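(* Let $T>0$ and let assumptions (i1)–(i5) listed in the context hold. Then the inverse problem has a unique solution $$(v,k)\in H^2(0,T;H_0^1(I)\cap H^2(I))\times H^1(0,T).$$ That is, there is exactly one pair $(v,k)$ in this space for which there exists $y\in H^3(0,T)$ such that $(v,k,y)$ satisfies the inverse problem (IP) of the context on $(0,T)$.
   Context: Fix $\ell>0$, $I=(0,\ell)$, $T>0$, and positive constants $\beta,p,q$. $H^m$ denotes the Sobolev space $W^{m,2}$ (real-valued on $I$ or $(0,T)$, or with values in a Banach space $X$ for $H^m(0,T;X)$). $H_0^1(I)=\{\varphi\in H^1(I):\varphi(0)=\varphi(\ell)=0\}$, $H_0^3(I)=\{\varphi\in H^3(I):\varphi,\varphi',\varphi''\text{ vanish at }0\text{ and }\ell\}$. Data and assumptions. Given functions $u_0,u_1,\varphi$ on $I$ and $f$ on $(0,T)$: (i1) $u_0,u_1\in H^4(I)$, $\varphi\in H_0^3(I)$. (i2) $u_2:=(1-\beta\frac{d^2}{dx^2})^{-1}u_0''$, i.e. $u_2$ is a fixed function with $u_2-\beta u_2''=u_0''$ on $I$; $v_0(x):=u_1(x)-u_1(\ell)\frac{x}{\ell}$, $v_1(x):=u_2(x)-u_2(\ell)\frac{x}{\ell}$, and $v_0,v_1\in H_0^1(I)\cap H^2(I)$. (i3) $\int_0^\ell\varphi'(x)u_0''(x)\,dx\neq0$; $\alpha$ denotes the reciprocal of this number. (i4) $f\in H^4(0,T)$, and for $j=0,1,2$: $\int_0^\ell(\varphi-\beta\varphi'')u_j'\,dx=f^{(j)}(0)$;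 moreover $\int_0^\ell(\varphi-\beta\varphi'')\,(1-\beta\frac{d^2}{dx^2})^{-1}[u_1'''-k(0)u_0''']\,dx=f'''(0)$, where $k(0)=\alpha\big(f'''(0)+\int_0^\ell v_0\varphi'''\,dx\big)$ (here $(1-\beta\frac{d^2}{dx^2})^{-1}h$ is a function $w$ with $w-\beta w''=h$; the integral does not depend on the choice of $w$ since $\varphi\in H^3_0(I)$). (i5) $\psi(x):=\int_0^x\varphi(\xi)\,d\xi-\beta\varphi'(x)$ satisfies $\psi(\ell)\ne0$, and $y''(0)=\frac1{\psi(\ell)}\big[f'(0)-k(0)f(0)+\int_0^\ell\psi(x)(u_1''(x)-k(0)u_0''(x))\,dx\big]$. The values $k(0)$ and $y''(0)$ given by the formulas in (i4), (i5) are the prescribed initial values of the unknowns $k$ and $y''$. Inverse problem (IP) on $(0,\tau)$, $0<\tau\le T$: find $v\in H^2(0,\tau;H_0^1(I)\cap H^2(I))$, $k\in H^1(0,\tau)$, $y\in H^3(0,\tau)$ (with the initial values $k(0)=\alpha\big(f'''(0)+\int_0^\ell v_0\varphi'''\,dx\big)$ and $y''(0)=\frac1{\psi(\ell)}\big[f'(0)-k(0)f(0)+\int_0^\ell\psi(x)(u_1''(x)-k(0)u_0''(x))\,dx\big]$) such that, with $z:=py'+qy$, $$v_{tt}-v_{xx}-\beta v_{xxtt}+k(t)u_0''(x)+\int_0^tk(t-s)v_{xx}(x,s)\,ds=z''(t)\frac{x}{\ell},\quad (x,t)\in I\times(0,\tau),$$ $$v|_{x=0}=v|_{x=\ell}=0,\qquad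 v|_{t=0}=v_0,\quad v_t|_{t=0}=v_1,$$ $$\Big[v_x-\int_0^tk(t-s)v_x(x,s)\,ds\Big]_{x=\ell}=y''(t)+k(t)u_0'(\ell)+\frac1\ell\Big(z(t)-\int_0^tk(t-s)z(s)\,ds\Big),\quad 0<t<\tau,$$ $$\int_0^\ell(\varphi(x)-\beta\varphi''(x))\Big[v_x(x,t)-\frac{z(t)}{\ell}\Big]dx=f'(t),\quad t\in(0,\tau).$$ The equations are understood for almost every $(x,t)$ or $t$. *)

theory Defs
  imports "HOL-Analysis.Analysis"
begin

section \<open>Sobolev spaces on a bounded interval (a,b)\<close>

text \<open>
  Elements of Lebesgue and Sobolev spaces are represented by functions on the whole real line;
  only their values on (a,b) matter, up to null sets.
\<close>

abbreviation leb :: "real \<Rightarrow> real \<Rightarrow> real measure" where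
  "leb a b \<equiv> lebesgue_on {a<..<b}"

definition L2 :: "real \<Rightarrow> real \<Rightarrow> (real \<Rightarrow> real) set" where
  "L2 a b = {f \<in> borel_measurable (leb a b). integrable (leb a b) (\<lambda>x. (f x)\<^sup>2)}"

definition L2_norm :: "real \<Rightarrow> real \<Rightarrow> (real \<Rightarrow> real) \<Rightarrow> real" where
  "L2_norm a b f = sqrt (LINT x|leb a b. (f x)\<^sup>2)"

definition locally_integrable :: "real \<Rightarrow> real \<Rightarrow> (real \<Rightarrow> real) \<Rightarrow> bool" where
  "locally_integrable a b f \<longleftrightarrow>
     (\<forall>c d. a < c \<longrightarrow> d < b \<longrightarrow> integrable (lebesgue_on {c..d}) f)"

text \<open>Smooth functions whose support is a compact subset of (a,b).\<close>

definition test_functions :: "real \<Rightarrow> real \<Rightarrow> (real \<Rightarrow> real) set" where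
  "test_functions a b =
     {\<eta>. (\<forall>n x. (deriv ^^ n) \<eta> field_differentiable at x) \<and>
          (\<exists>c d. a < c \<and> d < b \<and> (\<forall>x. x \<notin> {c..d} \<longrightarrow> \<eta> x = 0))}"

definition has_weak_deriv ::
    "real \<Rightarrow> real \<Rightarrow> nat \<Rightarrow> (real \<Rightarrow> real) \<Rightarrow> (real \<Rightarrow> real) \<Rightarrow> bool" where
  "has_weak_deriv a b n f g \<longleftrightarrow>
     locally_integrable a b f \<and> locally_integrable a b g \<and>
     (\<forall>\<eta>\<in>test_functions a b.
        (LINT x|leb a b. f x * (deriv ^^ n) \<eta> x) = (-1) ^ n * (LINT x|leb a b. g x * \<eta> x))"

text \<open>
  The weak derivative is unique up to null sets. Whenever it has a representative that is
  continuous on [a,b], that one is chosen; on [a,b] it is unique, so that boundary and initial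
  values may be read off pointwise.
\<close>

definition wderiv :: "real \<Rightarrow> real \<Rightarrow> nat \<Rightarrow> (real \<Rightarrow> real) \<Rightarrow> real \<Rightarrow> real" where
  "wderiv a b n f =
     (SOME g. has_weak_deriv a b n f g \<and>
        ((\<exists>h. has_weak_deriv a b n f h \<and> continuous_on {a..b} h) \<longrightarrow> continuous_on {a..b} g))"

text \<open>The continuous representative of a function itself is its weak derivative of order 0.\<close>

abbreviation crep :: "real \<Rightarrow> real \<Rightarrow> (real \<Rightarrow> real) \<Rightarrow> real \<Rightarrow> real" where
  "crep a b f \<equiv> wderiv a b 0 f"

definition sobolev :: "nat \<Rightarrow> real \<Rightarrow> real \<Rightarrow> (real \<Rightarrow> real) set" where
  "sobolev m a b = {f \<in> L2 a b. \<forall>i\<le>m. \<exists>g\<in>L2 a b. has_weak_deriv a b i f g}"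

definition sobolev_norm :: "nat \<Rightarrow> real \<Rightarrow> real \<Rightarrow> (real \<Rightarrow> real) \<Rightarrow> real" where
  "sobolev_norm m a b f = sqrt (\<Sum>i\<le>m. (L2_norm a b (wderiv a b i f))\<^sup>2)"

definition sobolev0 :: "nat \<Rightarrow> real \<Rightarrow> real \<Rightarrow> (real \<Rightarrow> real) set" where
  "sobolev0 m a b =
     {f \<in> sobolev m a b. \<forall>i<m. wderiv a b i f a = 0 \<and> wderiv a b i f b = 0}"


section \<open>Bochner--Sobolev spaces with values in a function space\<close>

text \<open>
  The value space is a set E of (representatives of) functions of x with a seminorm N, which
  becomes a Banach space after identifying functions at N-distance 0. An E-valued function of t
  is written in curried form, \<open>v t x\<close>. The notions below are those of the Bochner integral in
  the library, relative to such a pair (E, N).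
\<close>

definition bsimple ::
    "(real \<Rightarrow> real) set \<Rightarrow> real \<Rightarrow> real \<Rightarrow> (real \<Rightarrow> real \<Rightarrow> real) \<Rightarrow> bool" where
  "bsimple E a b s \<longleftrightarrow> simple_function (leb a b) s \<and> (\<forall>t\<in>{a<..<b}. s t \<in> E)"

definition bsimple_integral ::
    "real \<Rightarrow> real \<Rightarrow> (real \<Rightarrow> real \<Rightarrow> real) \<Rightarrow> real \<Rightarrow> real" where
  "bsimple_integral a b s =
     (\<lambda>x. \<Sum>e\<in>s ` {a<..<b}. measure lebesgue {t \<in> {a<..<b}. s t = e} * e x)"

definition bmeasurable ::
    "(real \<Rightarrow> real) set \<Rightarrow> ((real \<Rightarrow> real) \<Rightarrow> real) \<Rightarrow> real \<Rightarrow> real \<Rightarrow>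
     (real \<Rightarrow> real \<Rightarrow> real) \<Rightarrow> bool" where
  "bmeasurable E N a b v \<longleftrightarrow>
     (AE t in leb a b. v t \<in> E) \<and>
     (\<exists>s. (\<forall>n::nat. bsimple E a b (s n)) \<and>
          (AE t in leb a b. (\<lambda>n. N (\<lambda>x. v t x - s n t x)) \<longlonglongrightarrow> 0))"

definition has_bintegral ::
    "(real \<Rightarrow> real) set \<Rightarrow> ((real \<Rightarrow> real) \<Rightarrow> real) \<Rightarrow> real \<Rightarrow> real \<Rightarrow>
     (real \<Rightarrow> real \<Rightarrow> real) \<Rightarrow> (real \<Rightarrow> real) \<Rightarrow> bool" where
  "has_bintegral E N a b v J \<longleftrightarrow>
     bmeasurable E N a b v \<and> J \<in> E \<and>
     (\<exists>s. (\<forall>n::nat. bsimple E a b (s n)) \<and>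
          (\<lambda>n. \<integral>\<^sup>+ t. ennreal (N (\<lambda>x. v t x - s n t x)) \<partial>leb a b) \<longlonglongrightarrow> 0 \<and>
          (\<lambda>n. N (\<lambda>x. bsimple_integral a b (s n) x - J x)) \<longlonglongrightarrow> 0)"

definition bL2 ::
    "(real \<Rightarrow> real) set \<Rightarrow> ((real \<Rightarrow> real) \<Rightarrow> real) \<Rightarrow> real \<Rightarrow> real \<Rightarrow>
     (real \<Rightarrow> real \<Rightarrow> real) set" where
  "bL2 E N a b = {v. bmeasurable E N a b v \<and> integrable (leb a b) (\<lambda>t. (N (v t))\<^sup>2)}"

definition has_bweak_deriv ::
    "(real \<Rightarrow> real) set \<Rightarrow> ((real \<Rightarrow> real) \<Rightarrow> real) \<Rightarrow> real \<Rightarrow> real \<Rightarrow> nat \<Rightarrow>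
     (real \<Rightarrow> real \<Rightarrow> real) \<Rightarrow> (real \<Rightarrow> real \<Rightarrow> real) \<Rightarrow> bool" where
  "has_bweak_deriv E N a b n v w \<longleftrightarrow>
     (\<forall>\<eta>\<in>test_functions a b. \<exists>J.
        has_bintegral E N a b (\<lambda>t x. (deriv ^^ n) \<eta> t * v t x) J \<and>
        has_bintegral E N a b (\<lambda>t x. (-1) ^ n * \<eta> t * w t x) J)"

definition bcontinuous ::
    "(real \<Rightarrow> real) set \<Rightarrow> ((real \<Rightarrow> real) \<Rightarrow> real) \<Rightarrow> real \<Rightarrow> real \<Rightarrow>
     (real \<Rightarrow> real \<Rightarrow> real) \<Rightarrow> bool" where
  "bcontinuous E N a b w \<longleftrightarrow>
     (\<forall>t\<in>{a..b}. w t \<in> E \<and>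
        ((\<lambda>s. N (\<lambda>x. w s x - w t x)) \<longlongrightarrow> 0) (at t within {a..b}))"

text \<open>As for \<^const>\<open>wderiv\<close>, an E-continuous representative on [a,b] is chosen if there is one.\<close>

definition bwderiv ::
    "(real \<Rightarrow> real) set \<Rightarrow> ((real \<Rightarrow> real) \<Rightarrow> real) \<Rightarrow> real \<Rightarrow> real \<Rightarrow> nat \<Rightarrow>
     (real \<Rightarrow> real \<Rightarrow> real) \<Rightarrow> real \<Rightarrow> real \<Rightarrow> real" where
  "bwderiv E N a b n v =
     (SOME w. has_bweak_deriv E N a b n v w \<and>
        ((\<exists>h. has_bweak_deriv E N a b n v h \<and> bcontinuous E N a b h) \<longrightarrow> bcontinuous E N a b w))"

definition bsobolev ::
    "nat \<Rightarrow> (real \<Rightarrow> real) set \<Rightarrow> ((real \<Rightarrow> real) \<Rightarrow> real) \<Rightarrow> real \<Rightarrow> real \<Rightarrow>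
     (real \<Rightarrow> real \<Rightarrow> real) set" where
  "bsobolev m E N a b =
     {v \<in> bL2 E N a b. \<forall>i\<le>m. \<exists>w\<in>bL2 E N a b. has_bweak_deriv E N a b i v w}"


section \<open>The inverse problem\<close>

text \<open>The space \<open>H\<^sub>0\<^sup>1(I) \<inter> H\<^sup>2(I)\<close> with the \<open>H\<^sup>2\<close> norm, \<open>I = (0,L)\<close>.\<close>

definition X :: "real \<Rightarrow> (real \<Rightarrow> real) set" where
  "X L = sobolev0 1 0 L \<inter> sobolev 2 0 L"

abbreviation X_norm :: "real \<Rightarrow> (real \<Rightarrow> real) \<Rightarrow> real" where
  "X_norm L \<equiv> sobolev_norm 2 0 L"

text \<open>\<open>v\<^sub>0\<close> and \<open>v\<^sub>1\<close> are obtained from \<open>u\<^sub>1\<close> and \<open>u\<^sub>2\<close> in this way.\<close>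

definition lift :: "real \<Rightarrow> (real \<Rightarrow> real) \<Rightarrow> real \<Rightarrow> real" where
  "lift L u = (\<lambda>x. u x - crep 0 L u L * x / L)"

definition \<alpha> :: "real \<Rightarrow> (real \<Rightarrow> real) \<Rightarrow> (real \<Rightarrow> real) \<Rightarrow> real" where
  "\<alpha> L \<phi> u0 = 1 / (LINT x|leb 0 L. wderiv 0 L 1 \<phi> x * wderiv 0 L 2 u0 x)"

definition k_init ::
    "real \<Rightarrow> real \<Rightarrow> (real \<Rightarrow> real) \<Rightarrow> (real \<Rightarrow> real) \<Rightarrow> (real \<Rightarrow> real) \<Rightarrow> (real \<Rightarrow> real) \<Rightarrow> real" where
  "k_init L T \<phi> f u0 u1 =
     \<alpha> L \<phi> u0 * (wderiv 0 T 3 f 0 + (LINT x|leb 0 L. lift L u1 x * wderiv 0 L 3 \<phi> x))"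

definition \<psi> :: "real \<Rightarrow> real \<Rightarrow> (real \<Rightarrow> real) \<Rightarrow> real \<Rightarrow> real" where
  "\<psi> L \<beta> \<phi> x = (LINT \<xi>|leb 0 x. \<phi> \<xi>) - \<beta> * wderiv 0 L 1 \<phi> x"

definition ytt_init ::
    "real \<Rightarrow> real \<Rightarrow> real \<Rightarrow> (real \<Rightarrow> real) \<Rightarrow> (real \<Rightarrow> real) \<Rightarrow> (real \<Rightarrow> real) \<Rightarrow> (real \<Rightarrow> real) \<Rightarrow> real" where
  "ytt_init L T \<beta> \<phi> f u0 u1 =
     1 / \<psi> L \<beta> \<phi> L *
       (wderiv 0 T 1 f 0 - k_init L T \<phi> f u0 u1 * crep 0 T f 0 +
        (LINT x|leb 0 L. \<psi> L \<beta> \<phi> x *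
           (wderiv 0 L 2 u1 x - k_init L T \<phi> f u0 u1 * wderiv 0 L 2 u0 x)))"

text \<open>
  The problem on \<open>(0,\<tau>)\<close>, with \<open>k0\<close> and \<open>ytt0\<close> the prescribed values of k and y'' at 0.
  The equation of motion is an identity in \<open>L\<^sup>2(I)\<close> for almost every t, with the memory term
  (the function J) a Bochner integral in \<open>L\<^sup>2(I)\<close>: a convolution that is integrated pointwise in x
  would depend on how representatives of \<open>v\<^sub>x\<^sub>x(\<cdot>,s)\<close> are chosen for the individual s.
\<close>

definition IP ::
    "real \<Rightarrow> real \<Rightarrow> real \<Rightarrow> real \<Rightarrow> real \<Rightarrow> (real \<Rightarrow> real) \<Rightarrow> (real \<Rightarrow> real) \<Rightarrow> (real \<Rightarrow> real) \<Rightarrow>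
     (real \<Rightarrow> real) \<Rightarrow> (real \<Rightarrow> real) \<Rightarrow> real \<Rightarrow> real \<Rightarrow>
     (real \<Rightarrow> real \<Rightarrow> real) \<Rightarrow> (real \<Rightarrow> real) \<Rightarrow> (real \<Rightarrow> real) \<Rightarrow> bool" where
  "IP L \<tau> \<beta> p q \<phi> f u0 v0 v1 k0 ytt0 v k y \<longleftrightarrow>
     v \<in> bsobolev 2 (X L) (X_norm L) 0 \<tau> \<and> k \<in> sobolev 1 0 \<tau> \<and> y \<in> sobolev 3 0 \<tau> \<and>
     crep 0 \<tau> k 0 = k0 \<and> wderiv 0 \<tau> 2 y 0 = ytt0 \<and>
     (let z = (\<lambda>t. p * wderiv 0 \<tau> 1 y t + q * y t);
          v\<^sub>t = bwderiv (X L) (X_norm L) 0 \<tau> 1 v;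
          v\<^sub>t\<^sub>t = bwderiv (X L) (X_norm L) 0 \<tau> 2 v
      in
        (AE t in leb 0 \<tau>. \<exists>J.
           has_bintegral (L2 0 L) (L2_norm 0 L) 0 t (\<lambda>s x. k (t - s) * wderiv 0 L 2 (v s) x) J \<and>
           (AE x in leb 0 L.
              v\<^sub>t\<^sub>t t x - wderiv 0 L 2 (v t) x - \<beta> * wderiv 0 L 2 (v\<^sub>t\<^sub>t t) x
                + k t * wderiv 0 L 2 u0 x + J x
              = wderiv 0 \<tau> 2 z t * x / L)) \<and>
        (AE t in leb 0 \<tau>. crep 0 L (v t) 0 = 0 \<and> crep 0 L (v t) L = 0) \<and>
        (AE x in leb 0 L. bwderiv (X L) (X_norm L) 0 \<tau> 0 v 0 x = v0 x) \<and>
        (AE x in leb 0 L. v\<^sub>t 0 x = v1 x) \<and>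
        (AE t in leb 0 \<tau>.
           wderiv 0 L 1 (v t) L - (LINT s|leb 0 t. k (t - s) * wderiv 0 L 1 (v s) L)
           = wderiv 0 \<tau> 2 y t + k t * wderiv 0 L 1 u0 L
             + 1 / L * (z t - (LINT s|leb 0 t. k (t - s) * z s))) \<and>
        (AE t in leb 0 \<tau>.
           (LINT x|leb 0 L. (\<phi> x - \<beta> * wderiv 0 L 2 \<phi> x) * (wderiv 0 L 1 (v t) x - z t / L))
           = wderiv 0 \<tau> 1 f t))"

end

theory Submission
  imports Defs
begin

text \<open>
  Put \<open>\<gamma> = \<integral> \<phi>' u\<^sub>0''\<close>, which is not 0, and \<open>z = p y' + q y\<close>. Integration by parts gives
  \<open>\<integral> (\<phi> - \<beta> \<phi>'') v\<^sub>x = - \<integral> (v - \<beta> v\<^sub>x\<^sub>x) \<phi>'\<close> (lemma \<open>ell_\<phi>1\<close>). Hence the second time derivative of the overdetermination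
  condition can be evaluated by testing the equation of motion with \<open>\<phi>'\<close>. The terms with \<open>z''\<close> cancel, and what
  remains is an explicit equation for the kernel, with \<open>*\<close> for the convolution in time,
  \<open>\<gamma> k = f''' + \<integral> v\<^sub>x\<^sub>x \<phi>' - k * \<integral> v\<^sub>x\<^sub>x \<phi>'\<close>, while the boundary condition is an explicit equation for \<open>y''\<close>. The equation of
  motion determines \<open>v\<^sub>t\<^sub>t - \<beta> v\<^sub>x\<^sub>x\<^sub>t\<^sub>t\<close>, and \<open>1 - \<beta> d\<^sup>2/dx\<^sup>2\<close> has a bounded inverse from \<open>L\<^sup>2\<close> to X: there is no loss of
  derivatives, and the problem is an integral equation in time whose only nonlinearity is a convolution.

  Uniqueness (\<open>IP_imp_reduced\<close>, \<open>reduced_unique\<close>). A solution has continuous representatives of v, \<open>v\<^sub>t\<close>, k and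
  \<open>y''\<close>, so the equations can be stated for continuous functions of time and for functionals of them. The initial
  values of z and \<open>z'\<close> are determined since \<open>\<psi>(L) \<noteq> 0\<close>, and with \<open>y''(0)\<close> those of \<open>y'\<close> and y since \<open>q \<noteq> 0\<close>. The differences of \<open>v\<^sub>t\<close>, \<open>y''\<close> and k
  for two solutions are bounded by the time integral of their sum, and a Gronwall inequality makes them vanish.

  Existence (\<open>quadratic_Volterra_exists\<close>, \<open>Volterra_system\<close>, \<open>solves_IP\<close>). With \<open>m = v - \<beta> v\<^sub>x\<^sub>x\<close> as unknown, \<open>v\<^sub>x\<^sub>x\<close> is
  given by Green's function and is a bounded operator of m on continuous functions; the data enter through
  continuous functions because \<open>u\<^sub>0\<close> and \<open>u\<^sub>1\<close> are in \<open>H\<^sup>4\<close>. Differentiating the equations for k and \<open>y''\<close> once and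
  integrating everything in time gives a Volterra equation with a quadratic convolution term in a Banach space. It is solvable on all of \<open>[0, T]\<close>: in the norm with
  weight \<open>exp (- \<sigma> t)\<close> a time integral gains a factor \<open>1 / \<sigma>\<close> and convolution is bounded uniformly in \<open>\<sigma>\<close>. The prescribed
  values of \<open>k(0)\<close> and \<open>y''(0)\<close> are those that the undifferentiated equations have at time 0 (\<open>k0_eq\<close>, \<open>ytt0_eq\<close>), so
  these equations are recovered by integration, and so is the overdetermination condition.

  Weak derivatives are handled through primitives of integrable functions; weak derivatives in time of functions
  with values in \<open>L\<^sup>2\<close> or X are reduced to scalar ones by inner products (locale \<open>semi_hilbert\<close>).
\<close>

section \<open>Integrals over open intervals\<close>

lemma leb_integrable_iff:
  fixes f :: "real \<Rightarrow> real"
  shows "integrable (leb a b) f \<longleftrightarrow> integrable lebesgue (\<lambda>x. indicator {a<..<b} x * f x)"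
  by (simp add: integrable_restrict_space)

lemma leb_integral_eq:
  fixes f :: "real \<Rightarrow> real"
  shows "(LINT x|leb a b. f x) = (LINT x|lebesgue. indicator {a<..<b} x * f x)"
  by (simp add: integral_restrict_space)

lemma AE_leb_iff: "(AE x in leb a b. P x) \<longleftrightarrow> (AE x in lebesgue. a < x \<and> x < b \<longrightarrow> P x)"
  by (subst AE_restrict_space_iff) auto

lemma AE_eq_sym: "AE x in M. f x = g x \<Longrightarrow> AE x in M. g x = f x"
  by (erule AE_mp) simp

lemma leb_integrable_sub:
  fixes f :: "real \<Rightarrow> real"
  assumes "integrable (leb a b) f" "a \<le> c" "d \<le> b"
  shows "integrable (leb c d) f"
proof -
  have "integrable lebesgue (\<lambda>x. indicator {c<..<d} x *\<^sub>R (indicator {a<..<b} x * f x))"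
    using assms(1) by (intro integrable_mult_indicator) (auto simp: leb_integrable_iff)
  also have "(\<lambda>x. indicator {c<..<d} x *\<^sub>R (indicator {a<..<b} x * f x)) = (\<lambda>x. indicator {c<..<d} x * f x)"
    using assms by (auto simp: indicator_def fun_eq_iff)
  finally show ?thesis by (simp add: leb_integrable_iff)
qed

lemma AE_leb_sub: "AE x in leb a b. P x \<Longrightarrow> a \<le> c \<Longrightarrow> d \<le> b \<Longrightarrow> AE x in leb c d. P x"
  unfolding AE_leb_iff by (erule AE_mp) auto

lemma leb_Icc_integrable_iff:
  fixes f :: "real \<Rightarrow> real"
  shows "integrable (lebesgue_on {a..b}) f \<longleftrightarrow> integrable (leb a b) f"
proof -
  have "integrable (lebesgue_on {a..b}) f \<longleftrightarrow> f absolutely_integrable_on {a..b}"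
    by (simp add: integrable_restrict_space set_integrable_def)
  also have "\<dots> \<longleftrightarrow> f absolutely_integrable_on {a<..<b}"
    by (rule absolutely_integrable_on_Icc_iff_Ioo)
  also have "\<dots> \<longleftrightarrow> integrable (leb a b) f"
    by (simp add: integrable_restrict_space set_integrable_def)
  finally show ?thesis .
qed

lemma leb_eq_integral:
  fixes f :: "real \<Rightarrow> real"
  assumes "integrable (leb a b) f"
  shows "(LINT x|leb a b. f x) = integral {a..b} f"
  using assms lebesgue_integral_eq_integral[of "{a<..<b}" f]
  by (simp add: integral_open_interval_real)

lemma leb_has_integral:
  fixes f :: "real \<Rightarrow> real"
  assumes "integrable (leb a b) f"
  shows "(f has_integral (LINT x|leb a b. f x)) {a..b}"
  using leb_eq_integral[OF assms] assms leb_Icc_integrable_iff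
    integrable_on_lebesgue_on[of "{a..b}" f] by (auto intro: integrable_integral)

lemma leb_integral_combine:
  fixes f :: "real \<Rightarrow> real"
  assumes "integrable (leb a c) f" "a \<le> b" "b \<le> c"
  shows "(LINT x|leb a c. f x) = (LINT x|leb a b. f x) + (LINT x|leb b c. f x)"
proof -
  have "integrable (leb a b) f" "integrable (leb b c) f"
    using assms leb_integrable_sub by auto
  from has_integral_combine[OF assms(2,3) leb_has_integral[OF this(1)] leb_has_integral[OF this(2)]]
  show ?thesis using leb_has_integral[OF assms(1)] has_integral_unique by blast
qed

lemma leb_continuous_integrable:
  fixes f :: "real \<Rightarrow> real"
  assumes "continuous_on {a..b} f"
  shows "integrable (leb a b) f"
  using assms absolutely_integrable_continuous_real absolutely_integrable_imp_integrable
    leb_Icc_integrable_iff by (metis sets_completionI_sets sets_lborel atLeastAtMost_borel)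

lemma leb_continuous_measurable:
  fixes f :: "real \<Rightarrow> real"
  assumes "continuous_on {a..b} f"
  shows "f \<in> borel_measurable (leb a b)"
  using leb_continuous_integrable[OF assms] by auto

lemma finite_measure_leb: "finite_measure (leb a b)"
  by (rule finite_measure_lebesgue_on) auto

lemma leb_integrable_bounded:
  fixes f :: "real \<Rightarrow> real"
  assumes "f \<in> borel_measurable (leb a b)" "\<And>x. a < x \<Longrightarrow> x < b \<Longrightarrow> \<bar>f x\<bar> \<le> B"
  shows "integrable (leb a b) f"
proof (rule finite_measure.integrable_const_bound[OF finite_measure_leb])
  show "AE x in leb a b. norm (f x) \<le> B" using assms(2) by (auto simp: AE_leb_iff)
qed (fact assms(1))

lemma leb_measurable_cong_AE:
  fixes f g :: "real \<Rightarrow> real"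
  assumes "f \<in> borel_measurable (leb a b)" "AE x in leb a b. f x = g x"
  shows "g \<in> borel_measurable (leb a b)"
proof -
  have "(\<lambda>x. indicator {a<..<b} x *\<^sub>R f x) \<in> borel_measurable lebesgue"
    using assms(1) borel_measurable_restrict_space_iff[of "{a<..<b}" lebesgue f] by auto
  moreover have "AE x in lebesgue. indicator {a<..<b} x *\<^sub>R f x = indicator {a<..<b} x *\<^sub>R g x"
    using assms(2) unfolding AE_leb_iff by (erule_tac AE_mp) (auto simp: indicator_def)
  ultimately have "(\<lambda>x. indicator {a<..<b} x *\<^sub>R g x) \<in> borel_measurable lebesgue"
    by (rule borel_measurable_AE)
  thus ?thesis
    using borel_measurable_restrict_space_iff[of "{a<..<b}" lebesgue g] by auto
qed

lemma leb_integrable_cong_AE: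
  fixes f g :: "real \<Rightarrow> real"
  assumes "integrable (leb a b) f" "AE x in leb a b. f x = g x"
  shows "integrable (leb a b) g"
  using assms integrable_cong_AE_imp leb_measurable_cong_AE borel_measurable_integrable by blast

lemma leb_integral_cong_AE:
  fixes f g :: "real \<Rightarrow> real"
  assumes "AE x in leb a b. f x = g x"
  shows "(LINT x|leb a b. f x) = (LINT x|leb a b. g x)"
proof (cases "f \<in> borel_measurable (leb a b)")
  case True
  show ?thesis by (rule integral_cong_AE[OF True leb_measurable_cong_AE[OF True assms] assms])
next
  case False
  have "AE x in leb a b. g x = f x" by (rule AE_eq_sym[OF assms])
  hence "g \<notin> borel_measurable (leb a b)"
    using leb_measurable_cong_AE[of g a b f] False by blast
  thus ?thesis using False by (metis borel_measurable_integrable not_integrable_integral_eq)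
qed

lemma leb_integral_bound:
  fixes f :: "real \<Rightarrow> real"
  assumes "a \<le> b" "0 \<le> B" "\<And>x. a < x \<Longrightarrow> x < b \<Longrightarrow> \<bar>f x\<bar> \<le> B"
  shows "\<bar>LINT x|leb a b. f x\<bar> \<le> B * (b - a)"
proof (cases "integrable (leb a b) f")
  case True
  have c: "integrable (leb a b) (\<lambda>x. B)" by (simp add: leb_continuous_integrable)
  have "\<bar>LINT x|leb a b. f x\<bar> \<le> (LINT x|leb a b. \<bar>f x\<bar>)" by (rule integral_abs_bound)
  also have "\<dots> \<le> (LINT x|leb a b. B)"
    using True c assms by (intro integral_mono) auto
  also have "\<dots> = B * (b - a)"
    using leb_eq_integral[OF c] assms by (simp add: )
  finally show ?thesis .
qed (use assms in \<open>simp add: not_integrable_integral_eq\<close>)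

text \<open>A function is represented by a globally integrable Borel function, so that the
  product measure theory of \<open>lborel\<close> applies.\<close>

lemma leb_borel_representative:
  fixes f :: "real \<Rightarrow> real"
  assumes "integrable (leb a b) f"
  obtains g where "integrable lborel g" "AE x in leb a b. g x = f x" "\<And>x. x \<notin> {a<..<b} \<Longrightarrow> g x = 0"
proof -
  let ?f = "\<lambda>x. indicator {a<..<b} x * f x"
  have i: "integrable lebesgue ?f" using assms by (simp add: leb_integrable_iff)
  then obtain h where h: "h \<in> borel_measurable lborel" "AE x in lborel. ?f x = h x"
    using completion_ex_borel_measurable_real[of ?f lborel] by auto
  define g where "g = (\<lambda>x. indicator {a<..<b} x * h x)"
  have gm: "g \<in> borel_measurable lborel" using h(1) unfolding g_def by auto
  have "AE x in lborel. ?f x = g x"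
    using h(2) by (rule AE_mp) (auto simp: g_def indicator_def)
  hence ae': "AE x in lebesgue. ?f x = g x" by (rule AE_completion)
  have "integrable lebesgue g"
    using integrable_cong_AE_imp[OF i _ ae'] gm measurable_completion by blast
  hence "integrable lborel g" using gm integrable_completion by blast
  moreover have "AE x in leb a b. g x = f x"
    using ae' unfolding AE_leb_iff by (rule AE_mp) auto
  moreover have "\<And>x. x \<notin> {a<..<b} \<Longrightarrow> g x = 0" by (auto simp: g_def)
  ultimately show thesis using that by blast
qed

lemma leb_integral_lborel:
  fixes g :: "real \<Rightarrow> real"
  assumes "g \<in> borel_measurable lborel"
  shows "(LINT x|leb a b. g x) = (LINT x|lborel. indicator {a<..<b} x * g x)"
  using assms unfolding leb_integral_eq by (intro integral_completion) auto

text \<open>Half-lines generate the Borel sets, so the positive and the negative part of h define the same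
  measure.\<close>

lemma AE_zero_of_interval_integrals:
  fixes h :: "real \<Rightarrow> real"
  assumes h: "integrable (leb a b) h"
    and z: "\<And>c d. a < c \<Longrightarrow> c < d \<Longrightarrow> d < b \<Longrightarrow> (LINT x|leb c d. h x) = 0"
  shows "AE x in leb a b. h x = 0"
proof -
  obtain g where g: "integrable lborel g" "AE x in leb a b. g x = h x" "\<And>x. x \<notin> {a<..<b} \<Longrightarrow> g x = 0"
    using leb_borel_representative[OF h] by blast
  have gm[measurable]: "g \<in> borel_measurable borel" using g(1) by auto
  have gi: "integrable (leb a b) g"
    by (rule leb_integrable_cong_AE[OF h AE_eq_sym[OF g(2)]])
  have zg: "(LINT x|leb c d. g x) = 0" if "a < c" "c < d" "d < b" for c d
  proof -
    have "(LINT x|leb c d. g x) = (LINT x|leb c d. h x)"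
      by (rule leb_integral_cong_AE, rule AE_leb_sub[OF g(2)]) (use that in auto)
    thus ?thesis using z[OF that] by simp
  qed
  have ib: "integral {a..x} g = LINT s|leb a x. g s" if "x \<le> b" for x
    using that by (intro leb_eq_integral[symmetric] leb_integrable_sub[OF gi]) auto
  have cont: "continuous_on {a..b} (\<lambda>x. integral {a..x} g)"
    using gi leb_Icc_integrable_iff integrable_on_lebesgue_on[of "{a..b}" g]
    by (intro indefinite_integral_continuous_1) auto
  have z2: "integral {a..x} g = integral {a..c} g" if "a < c" "c < x" "x < b" for c x
    using zg[OF that] that leb_integral_combine[of a x g c] ib leb_integrable_sub[OF gi, of a x] by auto
  have z3: "integral {a..x} g = 0" if ab: "a \<le> x" "x \<le> b" "a < b" for x
  proof -
    have lim: "((\<lambda>c. integral {a..c} g) \<longlongrightarrow> integral {a..a} g) (at_right a)"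
      by (rule continuous_on_Icc_at_rightD[OF cont ab(3)])
    have e: "integral {a..x} g = 0" if "a < x" "x < b" for x
    proof -
      have "eventually (\<lambda>c. integral {a..c} g = integral {a..x} g) (at_right a)"
        by (rule eventually_at_rightI[where a=a and b=x]) (use z2 that in auto)
      hence "((\<lambda>c. integral {a..c} g) \<longlongrightarrow> integral {a..x} g) (at_right a)"
        by (simp add: tendsto_eventually)
      from tendsto_unique[OF _ this lim] show ?thesis by simp
    qed
    have "((\<lambda>c. integral {a..c} g) \<longlongrightarrow> integral {a..b} g) (at_left b)"
      by (rule continuous_on_Icc_at_leftD[OF cont ab(3)])
    moreover have "eventually (\<lambda>c. integral {a..c} g = 0) (at_left b)"
      by (rule eventually_at_leftI[where a=a and b=b]) (use e ab in auto)
    ultimately have "integral {a..b} g = 0"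
      using tendsto_unique[OF _ _ tendsto_eventually] trivial_limit_at_left_real by metis
    thus ?thesis using e[of x] ab by (cases "x = a \<or> x = b") auto
  qed
  have tail: "(LINT s|lborel. indicator {x<..} s * g s) = 0" for x
  proof (cases "a < b \<and> x < b")
    case True
    define x' where "x' = max x a"
    have x': "a \<le> x'" "x' < b" using True by (auto simp: x'_def)
    have "(LINT s|lborel. indicator {x<..} s * g s) = (LINT s|lborel. indicator {x'<..<b} s * g s)"
      using g(3) by (intro Bochner_Integration.integral_cong) (auto simp: x'_def indicator_def not_le)
    also have "\<dots> = (LINT s|leb x' b. g s)" by (simp add: leb_integral_lborel)
    also have "\<dots> = (LINT s|leb a b. g s) - (LINT s|leb a x'. g s)"
      using leb_integral_combine[OF gi, of x'] x' by auto
    also have "\<dots> = 0" using z3[of b] z3[of x'] x' True ib[of b] ib[of x'] by auto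
    finally show ?thesis .
  next
    case False
    have z: "indicator {x<..} s * g s = 0" for s using False g(3)[of s] by (auto simp: indicator_def)
    show ?thesis unfolding z by simp
  qed
  define p where "p = (\<lambda>x. ennreal (max 0 (g x)))"
  define n where "n = (\<lambda>x. ennreal (max 0 (- g x)))"
  have [measurable]: "p \<in> borel_measurable lborel" "n \<in> borel_measurable lborel"
    unfolding p_def n_def by auto
  have ip: "integrable lborel (\<lambda>x. max 0 (g x))" "integrable lborel (\<lambda>x. max 0 (- g x))"
    using g(1) by (auto intro!: integrable_max)
  have ipx: "integrable lborel (\<lambda>s. indicator {x<..} s * max 0 (g s))"
       "integrable lborel (\<lambda>s. indicator {x<..} s * max 0 (- g s))" for x
    using integrable_mult_indicator[OF _ ip(1), of "{x<..}"] integrable_mult_indicator[OF _ ip(2), of "{x<..}"] by auto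
  have em: "emeasure (density lborel p) {x<..} = ennreal (LINT s|lborel. indicator {x<..} s * max 0 (g s))"
    "emeasure (density lborel n) {x<..} = ennreal (LINT s|lborel. indicator {x<..} s * max 0 (- g s))" for x
  proof -
    have "emeasure (density lborel p) {x<..} = (\<integral>\<^sup>+s. ennreal (indicator {x<..} s * max 0 (g s)) \<partial>lborel)"
      by (subst emeasure_density) (auto simp: p_def indicator_def intro!: nn_integral_cong)
    also have "\<dots> = ennreal (LINT s|lborel. indicator {x<..} s * max 0 (g s))"
      by (rule nn_integral_eq_integral[OF ipx(1)]) (auto simp: indicator_def)
    finally show "emeasure (density lborel p) {x<..} = ennreal (LINT s|lborel. indicator {x<..} s * max 0 (g s))" .
    have "emeasure (density lborel n) {x<..} = (\<integral>\<^sup>+s. ennreal (indicator {x<..} s * max 0 (- g s)) \<partial>lborel)"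
      by (subst emeasure_density) (auto simp: n_def indicator_def intro!: nn_integral_cong)
    also have "\<dots> = ennreal (LINT s|lborel. indicator {x<..} s * max 0 (- g s))"
      by (rule nn_integral_eq_integral[OF ipx(2)]) (auto simp: indicator_def)
    finally show "emeasure (density lborel n) {x<..} = ennreal (LINT s|lborel. indicator {x<..} s * max 0 (- g s))" .
  qed
  have eq: "(LINT s|lborel. indicator {x<..} s * max 0 (g s)) = (LINT s|lborel. indicator {x<..} s * max 0 (- g s))" for x
  proof -
    have "(LINT s|lborel. indicator {x<..} s * max 0 (g s)) - (LINT s|lborel. indicator {x<..} s * max 0 (- g s))
      = (LINT s|lborel. indicator {x<..} s * max 0 (g s) - indicator {x<..} s * max 0 (- g s))"
      using ipx[of x] by simp
    also have "\<dots> = (LINT s|lborel. indicator {x<..} s * g s)"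
      by (intro Bochner_Integration.integral_cong) (auto simp: indicator_def)
    finally show ?thesis using tail[of x] by simp
  qed
  have "density lborel p = density lborel n"
    by (rule measure_eqI_lessThan) (auto simp: em eq)
  hence "AE x in lborel. p x = n x"
    by (intro sigma_finite_measure.density_unique[OF sigma_finite_lborel]) auto
  hence "AE x in lborel. g x = 0"
    by (rule AE_mp) (auto simp: p_def n_def max_def split: if_splits)
  hence "AE x in lebesgue. g x = 0" by (rule AE_completion)
  hence "AE x in leb a b. g x = 0" unfolding AE_leb_iff by (rule AE_mp) auto
  with g(2) show ?thesis by eventually_elim simp
qed

section \<open>Primitives\<close>

text \<open>Absolute continuity, in the form in which it is used: F is an indefinite integral of an integrable g.
  All one-dimensional weak derivatives are reduced to this relation.\<close>

definition primitive_on :: "real \<Rightarrow> real \<Rightarrow> (real \<Rightarrow> real) \<Rightarrow> (real \<Rightarrow> real) \<Rightarrow> bool" where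
  "primitive_on a b F g \<longleftrightarrow>
     integrable (leb a b) g \<and> (\<forall>x\<in>{a..b}. F x = F a + (LINT s|leb a x. g s))"

lemma primitive_onD:
  assumes "primitive_on a b F g"
  shows "integrable (leb a b) g" "\<And>x. a \<le> x \<Longrightarrow> x \<le> b \<Longrightarrow> F x = F a + (LINT s|leb a x. g s)"
  using assms unfolding primitive_on_def by (blast, meson atLeastAtMost_iff)

lemma primitive_on_diff:
  assumes "primitive_on a b F g" "a \<le> x" "x \<le> y" "y \<le> b"
  shows "F y - F x = (LINT s|leb x y. g s)"
  using primitive_onD(2)[OF assms(1), of x] primitive_onD(2)[OF assms(1), of y] assms
    leb_integral_combine[OF leb_integrable_sub[OF primitive_onD(1)[OF assms(1)], of a y], of x] by auto

lemma primitive_on_continuous: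
  assumes "primitive_on a b F g"
  shows "continuous_on {a..b} F"
proof -
  have i: "integrable (leb a b) g" by (rule primitive_onD(1)[OF assms])
  have "continuous_on {a..b} (\<lambda>x. F a + integral {a..x} g)"
    using i leb_Icc_integrable_iff integrable_on_lebesgue_on[of "{a..b}" g]
    by (intro continuous_intros indefinite_integral_continuous_1) auto
  moreover have "F a + integral {a..x} g = F x" if "x \<in> {a..b}" for x
    using that primitive_onD(2)[OF assms, of x] leb_eq_integral[OF leb_integrable_sub[OF i, of a x]] by auto
  ultimately show ?thesis by (rule continuous_on_eq)
qed

lemma primitive_on_cong:
  assumes "primitive_on a b F g" "\<And>x. a \<le> x \<Longrightarrow> x \<le> b \<Longrightarrow> F x = F' x" "AE x in leb a b. g x = g' x" "a \<le> b"
  shows "primitive_on a b F' g'"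
  unfolding primitive_on_def
proof (intro conjI ballI)
  show "integrable (leb a b) g'" by (rule leb_integrable_cong_AE[OF primitive_onD(1)[OF assms(1)] assms(3)])
  fix x assume x: "x \<in> {a..b}"
  have "(LINT s|leb a x. g s) = (LINT s|leb a x. g' s)"
    by (rule leb_integral_cong_AE, rule AE_leb_sub[OF assms(3)]) (use x in auto)
  thus "F' x = F' a + (LINT s|leb a x. g' s)"
    using primitive_onD(2)[OF assms(1), of x] assms(2)[of x] assms(2)[of a] assms(4) x by auto
qed

lemma primitive_onI:
  assumes "integrable (leb a b) g"
  shows "primitive_on a b (\<lambda>x. C + (LINT s|leb a x. g s)) g"
  using assms unfolding primitive_on_def by simp

lemma primitive_on_DERIV:
  assumes "\<And>x. a \<le> x \<Longrightarrow> x \<le> b \<Longrightarrow> (F has_real_derivative g x) (at x within {a..b})" "continuous_on {a..b} g"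
  shows "primitive_on a b F g"
  unfolding primitive_on_def
proof (intro conjI ballI)
  show i: "integrable (leb a b) g" by (rule leb_continuous_integrable[OF assms(2)])
  fix x assume x: "x \<in> {a..b}"
  have "(g has_integral (F x - F a)) {a..x}"
  proof (rule fundamental_theorem_of_calculus)
    fix y assume "y \<in> {a..x}"
    thus "(F has_vector_derivative g y) (at y within {a..x})"
      using x assms(1)[of y] has_field_derivative_subset[of F "g y" y "{a..b}" "{a..x}"]
      by (auto simp: has_real_derivative_iff_has_vector_derivative)
  qed (use x in auto)
  thus "F x = F a + (LINT s|leb a x. g s)"
    using leb_eq_integral[OF leb_integrable_sub[OF i, of a x]] x by (auto simp: integral_unique)
qed

lemma primitive_on_has_derivative:
  assumes "primitive_on a b F g" "continuous_on {a..b} g" "a \<le> x" "x \<le> b"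
  shows "(F has_real_derivative g x) (at x within {a..b})"
proof -
  have i: "integrable (leb a b) g" by (rule primitive_onD(1)[OF assms(1)])
  have "((\<lambda>u. integral {a..u} g) has_vector_derivative g x) (at x within {a..b})"
    using assms by (intro integral_has_vector_derivative) auto
  hence D: "((\<lambda>u. F a + integral {a..u} g) has_real_derivative g x) (at x within {a..b})"
    by (auto simp: has_real_derivative_iff_has_vector_derivative intro!: derivative_eq_intros)
  have e: "F u = F a + integral {a..u} g" if "u \<in> {a..b}" for u
    using that primitive_onD(2)[OF assms(1), of u] leb_eq_integral[OF leb_integrable_sub[OF i, of a u]] by auto
  show ?thesis
    by (rule has_field_derivative_transform_within[OF D, of 1]) (simp_all add: assms e[symmetric])
qed

lemma primitive_on_linear:
  assumes "primitive_on a b F f" "primitive_on a b G g"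
  shows "primitive_on a b (\<lambda>x. c * F x + d * G x) (\<lambda>x. c * f x + d * g x)"
  unfolding primitive_on_def
proof (intro conjI ballI)
  have i: "integrable (leb a b) f" "integrable (leb a b) g" using assms primitive_onD(1) by auto
  thus "integrable (leb a b) (\<lambda>x. c * f x + d * g x)" by auto
  fix x assume x: "x \<in> {a..b}"
  have "integrable (leb a x) f" "integrable (leb a x) g" using i leb_integrable_sub x by auto
  hence "(LINT s|leb a x. c * f s + d * g s) = c * (LINT s|leb a x. f s) + d * (LINT s|leb a x. g s)" by simp
  thus "c * F x + d * G x = c * F a + d * G a + (LINT s|leb a x. c * f s + d * g s)"
    using primitive_onD(2)[OF assms(1), of x] primitive_onD(2)[OF assms(2), of x] x
    by (simp add: algebra_simps)
qed

lemma primitive_on_unique: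
  assumes "primitive_on a b F f" "primitive_on a b F g"
  shows "AE x in leb a b. f x = g x"
proof -
  have i: "integrable (leb a b) f" "integrable (leb a b) g" using assms primitive_onD(1) by auto
  have "AE x in leb a b. f x - g x = 0"
  proof (rule AE_zero_of_interval_integrals)
    fix c d assume *: "a < c" "c < d" "d < b"
    have "integrable (leb c d) f" "integrable (leb c d) g" using i leb_integrable_sub * by auto
    thus "(LINT x|leb c d. f x - g x) = 0"
      using primitive_on_diff[OF assms(1), of c d] primitive_on_diff[OF assms(2), of c d] * by simp
  qed (use i in auto)
  thus ?thesis by (rule AE_mp) simp
qed

lemma bounded_mult_integrable:
  fixes h H :: "real \<Rightarrow> real"
  assumes "integrable (leb a b) h" "continuous_on {a..b} H"
  shows "integrable (leb a b) (\<lambda>x. h x * H x)"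
proof -
  have "bounded (H ` {a..b})" using assms(2) compact_continuous_image compact_imp_bounded by blast
  then obtain B where B: "\<And>x. x \<in> {a..b} \<Longrightarrow> norm (H x) \<le> B" unfolding bounded_iff by blast
  show ?thesis
  proof (rule Bochner_Integration.integrable_bound)
    show "integrable (leb a b) (\<lambda>x. B * h x)" using assms by simp
    show "(\<lambda>x. h x * H x) \<in> borel_measurable (leb a b)"
      using assms leb_continuous_measurable by auto
    have "norm (h x * H x) \<le> norm (B * h x)" if "x \<in> {a..b}" for x
    proof -
      have "\<bar>H x\<bar> \<le> \<bar>B\<bar>" using B[OF that] by simp
      thus ?thesis by (simp add: abs_mult mult.commute mult_right_mono)
    qed
    thus "AE x in leb a b. norm (h x * H x) \<le> norm (B * h x)" unfolding AE_leb_iff by auto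
  qed
qed

lemma triangle_Fubini:
  fixes f g :: "real \<Rightarrow> real"
  assumes f: "integrable lborel f" and g: "integrable lborel g"
  shows "(LINT s|lborel. f s * (LINT t|lborel. indicator {..s} t * g t)) +
         (LINT t|lborel. g t * (LINT s|lborel. indicator {..<t} s * f s)) =
         (LINT s|lborel. f s) * (LINT t|lborel. g t)"
    and "integrable lborel (\<lambda>s. f s * (LINT t|lborel. indicator {..s} t * g t))"
    and "integrable lborel (\<lambda>t. g t * (LINT s|lborel. indicator {..<t} s * f s))"
proof -
  have [measurable]: "f \<in> borel_measurable borel" "g \<in> borel_measurable borel" using f g by auto
  have i: "integrable (lborel \<Otimes>\<^sub>M lborel) (\<lambda>(s,t). f s * g t)"
  proof (rule lborel_pair.Fubini_integrable)
    show "integrable lborel (\<lambda>x. LINT y|lborel. norm (case (x, y) of (s, t) \<Rightarrow> f s * g t))"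
      using f by (simp add: abs_mult)
    show "AE x in lborel. integrable lborel (\<lambda>y. case (x, y) of (s, t) \<Rightarrow> f s * g t)"
      using g by simp
  qed simp
  have A[measurable]: "{p. snd p \<le> fst p} \<in> sets (lborel \<Otimes>\<^sub>M lborel :: (real \<times> real) measure)"
    by (simp only: lborel_prod sets_lborel) (intro borel_closed closed_Collect_le continuous_intros)
  have B[measurable]: "{p. fst p < snd p} \<in> sets (lborel \<Otimes>\<^sub>M lborel :: (real \<times> real) measure)"
    by (simp only: lborel_prod sets_lborel) (intro borel_open open_Collect_less continuous_intros)
  have i1: "integrable (lborel \<Otimes>\<^sub>M lborel) (\<lambda>(s,t). f s * (indicator {..s} t * g t))"
  proof (rule Bochner_Integration.integrable_cong[THEN iffD1, OF refl _ integrable_mult_indicator[OF A i]])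
    show "indicator {p. snd p \<le> fst p} x *\<^sub>R (case x of (s, t) \<Rightarrow> f s * g t) = (case x of (s, t) \<Rightarrow> f s * (indicator {..s} t * g t))"
      for x by (cases x) (auto simp: indicator_def)
  qed
  have i2: "integrable (lborel \<Otimes>\<^sub>M lborel) (\<lambda>(s,t). g t * (indicator {..<t} s * f s))"
  proof (rule Bochner_Integration.integrable_cong[THEN iffD1, OF refl _ integrable_mult_indicator[OF B i]])
    show "indicator {p. fst p < snd p} x *\<^sub>R (case x of (s, t) \<Rightarrow> f s * g t) = (case x of (s, t) \<Rightarrow> g t * (indicator {..<t} s * f s))"
      for x by (cases x) (auto simp: indicator_def)
  qed
  have e1: "(LINT s|lborel. f s * (LINT t|lborel. indicator {..s} t * g t)) =
      integral\<^sup>L (lborel \<Otimes>\<^sub>M lborel) (\<lambda>(s,t). f s * (indicator {..s} t * g t))"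
    using lborel_pair.integral_fst[OF i1] by simp
  have e2: "(LINT t|lborel. g t * (LINT s|lborel. indicator {..<t} s * f s)) =
      integral\<^sup>L (lborel \<Otimes>\<^sub>M lborel) (\<lambda>(s,t). g t * (indicator {..<t} s * f s))"
    using lborel_pair.integral_snd[OF i2] by simp
  have e3: "(LINT s|lborel. f s) * (LINT t|lborel. g t) = integral\<^sup>L (lborel \<Otimes>\<^sub>M lborel) (\<lambda>(s,t). f s * g t)"
    using lborel_pair.integral_fst[OF i] by simp
  show "(LINT s|lborel. f s * (LINT t|lborel. indicator {..s} t * g t)) +
         (LINT t|lborel. g t * (LINT s|lborel. indicator {..<t} s * f s)) =
         (LINT s|lborel. f s) * (LINT t|lborel. g t)"
    unfolding e1 e2 e3
    by (subst Bochner_Integration.integral_add[symmetric, OF i1 i2])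
       (auto intro!: Bochner_Integration.integral_cong simp: indicator_def)
  show "integrable lborel (\<lambda>s. f s * (LINT t|lborel. indicator {..s} t * g t))"
    using lborel_pair.integrable_fst[OF i1] by simp
  show "integrable lborel (\<lambda>t. g t * (LINT s|lborel. indicator {..<t} s * f s))"
    using lborel_pair.integrable_snd[OF i2] by simp
qed

text \<open>Integration by parts for primitives of integrable functions comes from Fubini's theorem on the
  two triangles into which the diagonal cuts a square.\<close>

lemma primitive_on_mult:
  assumes F: "primitive_on a b F f" and G: "primitive_on a b G g"
  shows "primitive_on a b (\<lambda>x. F x * G x) (\<lambda>x. f x * G x + F x * g x)"
  unfolding primitive_on_def
proof (intro conjI ballI)
  have i: "integrable (leb a b) (\<lambda>x. G x * f x)" "integrable (leb a b) (\<lambda>x. F x * g x)"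
    using bounded_mult_integrable[OF primitive_onD(1)[OF F] primitive_on_continuous[OF G]]
      bounded_mult_integrable[OF primitive_onD(1)[OF G] primitive_on_continuous[OF F]]
    by (simp_all add: mult.commute)
  thus "integrable (leb a b) (\<lambda>x. f x * G x + F x * g x)" by (simp add: mult.commute)
  fix x assume x: "x \<in> {a..b}"
  obtain f' where f': "integrable lborel f'" "AE s in leb a x. f' s = f s" "\<And>s. s \<notin> {a<..<x} \<Longrightarrow> f' s = 0"
    using leb_borel_representative[OF leb_integrable_sub[OF primitive_onD(1)[OF F], of a x]] x by auto
  obtain g' where g': "integrable lborel g'" "AE s in leb a x. g' s = g s" "\<And>s. s \<notin> {a<..<x} \<Longrightarrow> g' s = 0"
    using leb_borel_representative[OF leb_integrable_sub[OF primitive_onD(1)[OF G], of a x]] x by auto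
  have [measurable]: "f' \<in> borel_measurable borel" "g' \<in> borel_measurable borel" using f' g' by auto
  have prim: "H s - H a = (LINT t|lborel. indicator {..s} t * h' t)"
      "H s - H a = (LINT t|lborel. indicator {..<s} t * h' t)"
    if "primitive_on a b H h" "integrable lborel h'" "AE s in leb a x. h' s = h s"
       "\<And>s. s \<notin> {a<..<x} \<Longrightarrow> h' s = 0" "a \<le> s" "s \<le> x" for H h h' s
  proof -
    have [measurable]: "h' \<in> borel_measurable borel" using that by auto
    have "H s - H a = (LINT t|leb a s. h t)" using primitive_on_diff[OF that(1), of a s] that x by auto
    also have "\<dots> = (LINT t|leb a s. h' t)"
      by (rule leb_integral_cong_AE, rule AE_leb_sub[OF AE_eq_sym[OF that(3)]]) (use that in auto)
    also have "\<dots> = (LINT t|lborel. indicator {a<..<s} t * h' t)" by (simp add: leb_integral_lborel)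
    finally have e: "H s - H a = (LINT t|lborel. indicator {a<..<s} t * h' t)" .
    also have "\<dots> = (LINT t|lborel. indicator {..<s} t * h' t)"
      by (rule Bochner_Integration.integral_cong) (use that(4) in \<open>auto simp: indicator_def\<close>)
    finally show "H s - H a = (LINT t|lborel. indicator {..<s} t * h' t)" .
    also have "\<dots> = (LINT t|lborel. indicator {..s} t * h' t)"
    proof (rule integral_cong_AE)
      have "AE t in lborel. t \<noteq> s" by (rule AE_lborel_singleton)
      thus "AE t in lborel. indicator {..<s} t * h' t = indicator {..s} t * h' t"
        by (rule AE_mp) (auto simp: indicator_def)
    qed auto
    finally show "H s - H a = (LINT t|lborel. indicator {..s} t * h' t)" .
  qed
  note pG = prim(1)[OF G g'] and pF = prim(2)[OF F f']
  have t: "(LINT s|lborel. f' s) = F x - F a" "(LINT s|lborel. g' s) = G x - G a"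
  proof -
    have "(\<lambda>s. indicator {..x} s * f' s) = f'" "(\<lambda>s. indicator {..x} s * g' s) = g'"
      using f'(3) g'(3) by (auto simp: fun_eq_iff indicator_def)
    thus "(LINT s|lborel. f' s) = F x - F a" "(LINT s|lborel. g' s) = G x - G a"
      using prim(1)[OF F f', of x] prim(1)[OF G g', of x] x by auto
  qed
  note T = triangle_Fubini[OF f'(1) g'(1)]
  have e: "(LINT s|leb a x. f s * G s) = (LINT s|lborel. f' s * (G a + (LINT t|lborel. indicator {..s} t * g' t)))"
  proof -
    have [measurable]: "(\<lambda>s. f' s * (G a + (LINT t|lborel. indicator {..s} t * g' t))) \<in> borel_measurable borel"
      using T(2) f'(1) by (simp add: distrib_left)
    have "(LINT s|leb a x. f s * G s) = (LINT s|leb a x. f' s * (G a + (LINT t|lborel. indicator {..s} t * g' t)))"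
    proof (rule leb_integral_cong_AE)
      have "AE s in leb a x. a < s \<and> s < x" unfolding AE_leb_iff by simp
      with f'(2) show "AE s in leb a x. f s * G s = f' s * (G a + (LINT t|lborel. indicator {..s} t * g' t))"
      proof eventually_elim
        case (elim s)
        have "G s = G a + (LINT t|lborel. indicator {..s} t * g' t)" using pG[of s] elim by linarith
        thus ?case using elim by simp
      qed
    qed
    also have "\<dots> = (LINT s|lborel. f' s * (G a + (LINT t|lborel. indicator {..s} t * g' t)))"
      by (simp add: leb_integral_lborel, rule Bochner_Integration.integral_cong)
         (use f'(3) in \<open>auto simp: indicator_def\<close>)
    finally show ?thesis .
  qed
  have e': "(LINT s|leb a x. F s * g s) = (LINT s|lborel. g' s * (F a + (LINT t|lborel. indicator {..<s} t * f' t)))"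
  proof -
    have [measurable]: "(\<lambda>s. g' s * (F a + (LINT t|lborel. indicator {..<s} t * f' t))) \<in> borel_measurable borel"
      using T(3) g'(1) by (simp add: distrib_left)
    have "(LINT s|leb a x. F s * g s) = (LINT s|leb a x. g' s * (F a + (LINT t|lborel. indicator {..<s} t * f' t)))"
    proof (rule leb_integral_cong_AE)
      have "AE s in leb a x. a < s \<and> s < x" unfolding AE_leb_iff by simp
      with g'(2) show "AE s in leb a x. F s * g s = g' s * (F a + (LINT t|lborel. indicator {..<s} t * f' t))"
      proof eventually_elim
        case (elim s)
        have "F s = F a + (LINT t|lborel. indicator {..<s} t * f' t)" using pF[of s] elim by linarith
        thus ?case using elim by simp
      qed
    qed
    also have "\<dots> = (LINT s|lborel. g' s * (F a + (LINT t|lborel. indicator {..<s} t * f' t)))"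
      by (simp add: leb_integral_lborel, rule Bochner_Integration.integral_cong)
         (use g'(3) in \<open>auto simp: indicator_def\<close>)
    finally show ?thesis .
  qed
  have "(LINT s|leb a x. f s * G s + F s * g s) = (LINT s|leb a x. f s * G s) + (LINT s|leb a x. F s * g s)"
    using leb_integrable_sub[OF i(1), of a x] leb_integrable_sub[OF i(2), of a x] x
    by (simp add: mult.commute)
  also have "\<dots> = (F x - F a) * G a + (G x - G a) * F a + (F x - F a) * (G x - G a)"
    unfolding e e' using T f'(1) g'(1) by (simp add: distrib_left t)
  finally show "F x * G x = F a * G a + (LINT s|leb a x. f s * G s + F s * g s)"
    by (simp add: algebra_simps)
qed

lemma integral_by_parts_primitive:
  assumes F: "primitive_on a b F f" and G: "primitive_on a b G g" and "a \<le> b"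
  shows "(LINT x|leb a b. F x * g x) = F b * G b - F a * G a - (LINT x|leb a b. f x * G x)"
    and "integrable (leb a b) (\<lambda>x. f x * G x)" "integrable (leb a b) (\<lambda>x. F x * g x)"
proof -
  show i: "integrable (leb a b) (\<lambda>x. f x * G x)" "integrable (leb a b) (\<lambda>x. F x * g x)"
    using bounded_mult_integrable[OF primitive_onD(1)[OF F] primitive_on_continuous[OF G]]
      bounded_mult_integrable[OF primitive_onD(1)[OF G] primitive_on_continuous[OF F]]
    by (simp_all add: mult.commute)
  show "(LINT x|leb a b. F x * g x) = F b * G b - F a * G a - (LINT x|leb a b. f x * G x)"
    using primitive_onD(2)[OF primitive_on_mult[OF F G], of b] i assms(3) by simp
qed

section \<open>Test functions\<close>

definition smooth :: "(real \<Rightarrow> real) \<Rightarrow> bool" where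
  "smooth f \<longleftrightarrow> (\<forall>n x. (deriv ^^ n) f field_differentiable at x)"

text \<open>Smoothness by coinduction: it suffices to find a class of functions that is closed under taking
  derivatives.\<close>

lemma smooth_coinduct:
  assumes "f \<in> S" and step: "\<And>g. g \<in> S \<Longrightarrow> \<exists>g'\<in>S. \<forall>x. (g has_field_derivative g' x) (at x)"
  shows "smooth f"
proof -
  have S: "deriv g \<in> S" "g field_differentiable at x" if gS: "g \<in> S" for g x
  proof -
    obtain g' where g': "g' \<in> S" "\<forall>x. (g has_field_derivative g' x) (at x)" using step[OF gS] by blast
    hence "deriv g = g'" by (auto intro!: DERIV_imp_deriv)
    thus "deriv g \<in> S" "g field_differentiable at x" using g' field_differentiable_def by auto
  qed
  have "(deriv ^^ n) f \<in> S" for n using assms(1) S by (induction n) auto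
  thus ?thesis unfolding smooth_def using S by blast
qed

lemma test_functions_iff:
  "\<eta> \<in> test_functions a b \<longleftrightarrow> smooth \<eta> \<and> (\<exists>c d. a < c \<and> d < b \<and> (\<forall>x. x \<notin> {c..d} \<longrightarrow> \<eta> x = 0))"
  unfolding test_functions_def smooth_def by simp

lemma smooth_DERIV: "smooth f \<Longrightarrow> (f has_real_derivative deriv f x) (at x)"
  unfolding smooth_def using field_differentiable_derivI by (metis funpow_0)

lemma smooth_deriv: "smooth f \<Longrightarrow> smooth (deriv f)"
  unfolding smooth_def by (metis funpow_Suc_right o_apply)

lemma smooth_continuous: "smooth f \<Longrightarrow> continuous_on A f"
  by (intro continuous_at_imp_continuous_on ballI DERIV_isCont[OF smooth_DERIV])

lemma smooth_linear:
  assumes "smooth f" "smooth g"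
  shows "smooth (\<lambda>x. c * f x + d * g x)" "deriv (\<lambda>x. c * f x + d * g x) = (\<lambda>x. c * deriv f x + d * deriv g x)"
proof -
  have D: "((\<lambda>x. c * f x + d * g x) has_field_derivative c * deriv f x + d * deriv g x) (at x)"
    if "smooth f" "smooth g" for f g x
    using smooth_DERIV[OF that(1), of x] smooth_DERIV[OF that(2), of x] by (auto intro!: derivative_eq_intros)
  show "smooth (\<lambda>x. c * f x + d * g x)"
  proof (rule smooth_coinduct)
    show "(\<lambda>x. c * f x + d * g x) \<in> {\<lambda>x. c * f x + d * g x |f g. smooth f \<and> smooth g}" using assms by blast
    fix h assume "h \<in> {\<lambda>x. c * f x + d * g x |f g. smooth f \<and> smooth g}"
    then obtain f g where h: "h = (\<lambda>x. c * f x + d * g x)" "smooth f" "smooth g" by blast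
    show "\<exists>g'\<in>{\<lambda>x. c * f x + d * g x |f g. smooth f \<and> smooth g}. \<forall>x. (h has_field_derivative g' x) (at x)"
    proof (rule bexI[of _ "\<lambda>x. c * deriv f x + d * deriv g x"])
      show "\<forall>x. (h has_field_derivative c * deriv f x + d * deriv g x) (at x)"
        unfolding h(1) using D[OF h(2,3)] by blast
      show "(\<lambda>x. c * deriv f x + d * deriv g x) \<in> {\<lambda>x. c * f x + d * g x |f g. smooth f \<and> smooth g}"
        by (rule CollectI, intro exI[of _ "deriv f"] exI[of _ "deriv g"] conjI refl smooth_deriv h)
    qed
  qed
  show "deriv (\<lambda>x. c * f x + d * g x) = (\<lambda>x. c * deriv f x + d * deriv g x)"
    using D[OF assms] by (auto intro!: DERIV_imp_deriv)
qed

lemma smooth_of_DERIV: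
  assumes "\<And>x. (f has_real_derivative g x) (at x)" "smooth g"
  shows "smooth f" "deriv f = g"
proof -
  show e: "deriv f = g" using assms(1) by (auto intro!: DERIV_imp_deriv)
  show "smooth f"
    unfolding smooth_def
  proof (intro allI)
    fix n x show "(deriv ^^ n) f field_differentiable at x"
    proof (cases n)
      case 0 thus ?thesis using assms(1) field_differentiable_def by auto
    next
      case (Suc m) thus ?thesis using e assms(2) unfolding smooth_def
        by (metis funpow_Suc_right o_apply)
    qed
  qed
qed

lemma test_functions_smooth: "\<eta> \<in> test_functions a b \<Longrightarrow> smooth \<eta>"
  by (simp add: test_functions_iff)

lemma test_functions_zero: "\<eta> \<in> test_functions a b \<Longrightarrow> x \<le> a \<or> b \<le> x \<Longrightarrow> \<eta> x = 0"
  unfolding test_functions_iff by force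

lemma test_functions_deriv:
  assumes "\<eta> \<in> test_functions a b"
  shows "deriv \<eta> \<in> test_functions a b"
proof -
  obtain c d where cd: "a < c" "d < b" "\<forall>x. x \<notin> {c..d} \<longrightarrow> \<eta> x = 0" using assms test_functions_iff by blast
  have "deriv \<eta> x = 0" if "x \<notin> {c..d}" for x
  proof (rule DERIV_imp_deriv)
    have "((\<lambda>_. 0) has_real_derivative 0) (at x)" by simp
    moreover have "open (- {c..d})" by auto
    ultimately show "(\<eta> has_real_derivative 0) (at x)"
      using has_field_derivative_transform_within_open[of "\<lambda>_. 0" 0 x "- {c..d}" \<eta>] cd(3) that by auto
  qed
  thus ?thesis using assms cd smooth_deriv unfolding test_functions_iff by blast
qed

lemma test_functions_deriv_funpow: "\<eta> \<in> test_functions a b \<Longrightarrow> (deriv ^^ n) \<eta> \<in> test_functions a b"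
  by (induction n) (auto simp: test_functions_deriv)

lemma test_functions_linear:
  assumes "\<eta> \<in> test_functions a b" "\<zeta> \<in> test_functions a b"
  shows "(\<lambda>x. c * \<eta> x + d * \<zeta> x) \<in> test_functions a b"
proof -
  obtain c1 d1 where 1: "a < c1" "d1 < b" "\<forall>x. x \<notin> {c1..d1} \<longrightarrow> \<eta> x = 0" using assms test_functions_iff by blast
  obtain c2 d2 where 2: "a < c2" "d2 < b" "\<forall>x. x \<notin> {c2..d2} \<longrightarrow> \<zeta> x = 0" using assms test_functions_iff by blast
  show ?thesis unfolding test_functions_iff
    using smooth_linear(1) assms test_functions_smooth 1 2
    by (intro conjI exI[of _ "min c1 c2"] exI[of _ "max d1 d2"]) (auto simp: not_le)
qed

lemma test_functions_DERIV: "\<eta> \<in> test_functions a b \<Longrightarrow> (\<eta> has_real_derivative deriv \<eta> x) (at x)"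
  using smooth_DERIV test_functions_smooth by blast

lemma test_functions_continuous: "\<eta> \<in> test_functions a b \<Longrightarrow> continuous_on A \<eta>"
  using smooth_continuous test_functions_smooth by blast

lemma test_functions_primitive:
  assumes "\<eta> \<in> test_functions a b"
  shows "primitive_on c d \<eta> (deriv \<eta>)"
  using test_functions_DERIV[OF assms] test_functions_continuous[OF test_functions_deriv[OF assms]]
  by (intro primitive_on_DERIV) (auto intro: DERIV_subset)

text \<open>The integral from the left end vanishes to the right of the support because the total integral is 0.\<close>

lemma test_functions_antiderivative:
  assumes "\<eta> \<in> test_functions a b" "(LINT x|leb a b. \<eta> x) = 0" "a < b"
  shows "\<exists>\<zeta>\<in>test_functions a b. deriv \<zeta> = \<eta>"
proof -
  obtain c d where cd: "a < c" "d < b" "\<forall>x. x \<notin> {c..d} \<longrightarrow> \<eta> x = 0" using assms test_functions_iff by blast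
  define \<zeta> where "\<zeta> = (\<lambda>x. integral {a..x} \<eta>)"
  have cont: "continuous_on A \<eta>" for A using test_functions_continuous assms by blast
  have int: "\<eta> integrable_on {x..y}" for x y using cont integrable_continuous_real by blast
  have iz: "integral {x..y} \<eta> = 0" if "\<And>s. s \<in> {x..y} \<Longrightarrow> \<eta> s = 0" for x y
    using Henstock_Kurzweil_Integration.integral_cong[of "{x..y}" \<eta> "\<lambda>_. 0"] that by simp
  have z1: "\<zeta> x = 0" if "x < c" for x
    unfolding \<zeta>_def by (rule iz) (use cd that in auto)
  have "integral {a..b} \<eta> = 0"
    using leb_eq_integral[OF leb_continuous_integrable[OF cont]] assms(2) by metis
  have z2: "\<zeta> x = 0" if "d < x" for x
  proof (cases "x \<le> a")
    case True thus ?thesis using z1[of x] cd by auto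
  next
    case False
    show ?thesis
    proof (cases "x \<le> b")
      case True
      have "integral {a..x} \<eta> + integral {x..b} \<eta> = integral {a..b} \<eta>"
        using False True int by (intro Henstock_Kurzweil_Integration.integral_combine) auto
      moreover have "integral {x..b} \<eta> = 0" by (rule iz) (use cd that in auto)
      ultimately show ?thesis using \<open>integral {a..b} \<eta> = 0\<close> by (simp add: \<zeta>_def)
    next
      case False
      have "integral {a..b} \<eta> + integral {b..x} \<eta> = integral {a..x} \<eta>"
        using False assms(3) int by (intro Henstock_Kurzweil_Integration.integral_combine) auto
      moreover have "integral {b..x} \<eta> = 0" by (rule iz) (use cd that in auto)
      ultimately show ?thesis using \<open>integral {a..b} \<eta> = 0\<close> by (simp add: \<zeta>_def)
    qed
  qed
  have D: "(\<zeta> has_real_derivative \<eta> x) (at x)" for x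
  proof (cases "x < c")
    case True
    have "((\<lambda>_. 0) has_real_derivative 0) (at x)" by simp
    hence "(\<zeta> has_real_derivative 0) (at x)"
      using has_field_derivative_transform_within_open[of "\<lambda>_. 0" 0 x "{..<c}" \<zeta>] z1 True by auto
    thus ?thesis using cd True by auto
  next
    case False
    have "((\<lambda>u. integral {a..u} \<eta>) has_vector_derivative \<eta> x) (at x within {a..x+1})"
      by (rule integral_has_vector_derivative[OF cont]) (use False cd in auto)
    moreover have "at x within {a..x+1} = at x"
      by (rule at_within_interior) (use False cd in auto)
    ultimately show ?thesis unfolding \<zeta>_def by (simp add: has_real_derivative_iff_has_vector_derivative)
  qed
  have "\<zeta> \<in> test_functions a b" unfolding test_functions_iff
    using smooth_of_DERIV(1)[OF D test_functions_smooth[OF assms(1)]] cd z1 z2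
    by (intro conjI exI[of _ c] exI[of _ d]) (auto simp: not_le)
  moreover have "deriv \<zeta> = \<eta>" using smooth_of_DERIV(2)[OF D test_functions_smooth[OF assms(1)]] .
  ultimately show ?thesis by blast
qed

text \<open>The bump functions \<open>exp (-\<epsilon> / ((x - c) (d - x)))\<close> on \<open>(c, d)\<close>. Their derivatives stay in the
  span of the following monomials times the bump.\<close>

definition bump_monomial :: "real \<Rightarrow> real \<Rightarrow> real \<Rightarrow> nat \<Rightarrow> nat \<Rightarrow> real \<Rightarrow> real" where
  "bump_monomial c d \<epsilon> i j x = (if c < x \<and> x < d
     then x ^ i * (1 / ((x - c) * (d - x))) ^ j * exp (- \<epsilon> / ((x - c) * (d - x))) else 0)"

inductive_set bump_span :: "real \<Rightarrow> real \<Rightarrow> real \<Rightarrow> (real \<Rightarrow> real) set" for c d \<epsilon> where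
  mono: "bump_monomial c d \<epsilon> i j \<in> bump_span c d \<epsilon>"
| comb: "f \<in> bump_span c d \<epsilon> \<Longrightarrow> g \<in> bump_span c d \<epsilon> \<Longrightarrow> (\<lambda>x. r * f x + s * g x) \<in> bump_span c d \<epsilon>"

text \<open>The exponential decay of the bump at the ends of its interval beats every power of \<open>1 / ((x - c) (d - x))\<close>.\<close>

lemma pow_exp_bound:
  fixes \<epsilon> r :: real
  assumes "\<epsilon> > 0" "r \<ge> 0"
  shows "r ^ n * exp (- \<epsilon> * r) \<le> fact n / \<epsilon> ^ n"
proof -
  have "(\<epsilon> * r) ^ n / fact n \<le> exp (\<epsilon> * r)"
  proof -
    have "sum (\<lambda>k. (\<epsilon> * r) ^ k /\<^sub>R fact k) {n} \<le> (\<Sum>k. (\<epsilon> * r) ^ k /\<^sub>R fact k)"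
      using assms by (intro sum_le_suminf[OF sums_summable[OF exp_converges]]) auto
    also have "\<dots> = exp (\<epsilon> * r)" by (rule sums_unique[OF exp_converges, symmetric])
    finally show ?thesis by (simp add: divide_inverse mult.commute)
  qed
  hence "(\<epsilon> * r) ^ n \<le> fact n * exp (\<epsilon> * r)" by (simp add: field_simps)
  hence "(\<epsilon> * r) ^ n * exp (- (\<epsilon> * r)) \<le> fact n"
    by (simp add: exp_minus field_simps)
  thus ?thesis using assms by (simp add: power_mult_distrib field_simps)
qed

lemma bump_monomial_bound:
  assumes "\<epsilon> > 0" "c < d"
  shows "\<exists>K. \<forall>x. \<bar>bump_monomial c d \<epsilon> i j x\<bar> \<le> K * ((x - c)\<^sup>2 * (x - d)\<^sup>2)"
proof -
  define K where "K = (max \<bar>c\<bar> \<bar>d\<bar>) ^ i * (fact (j+2) / \<epsilon> ^ (j+2))"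
  have "\<bar>bump_monomial c d \<epsilon> i j x\<bar> \<le> K * ((x - c)\<^sup>2 * (x - d)\<^sup>2)" for x
  proof (cases "c < x \<and> x < d")
    case True
    define r where "r = 1 / ((x - c) * (d - x))"
    have r: "r > 0" using True by (simp add: r_def)
    have "\<bar>bump_monomial c d \<epsilon> i j x\<bar> = \<bar>x\<bar> ^ i * (r ^ j * exp (- \<epsilon> * r))"
      using True r by (simp add: bump_monomial_def r_def abs_mult power_abs)
    also have "\<dots> = \<bar>x\<bar> ^ i * ((r ^ (j+2) * exp (- \<epsilon> * r)) * (1 / r) ^ 2)"
      using r by (simp add: power_add field_simps power2_eq_square)
    also have "\<dots> \<le> (max \<bar>c\<bar> \<bar>d\<bar>) ^ i * ((fact (j+2) / \<epsilon> ^ (j+2)) * (1 / r) ^ 2)"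
      using pow_exp_bound[OF assms(1), of r "j+2"] r True
      by (intro mult_mono power_mono mult_right_mono) auto
    also have "(1 / r) ^ 2 = (x - c)\<^sup>2 * (x - d)\<^sup>2"
      by (simp add: r_def power_mult_distrib power2_commute)
    finally show ?thesis by (simp add: K_def mult.assoc)
  next
    case False
    have "0 \<le> K" using assms by (auto simp: K_def)
    thus ?thesis using False by (auto simp: bump_monomial_def)
  qed
  thus ?thesis by blast
qed

text \<open>The bumps vanish to second order at the ends of their support; this gives differentiability there.\<close>

lemma DERIV_zero_of_quadratic_bound:
  fixes f :: "real \<Rightarrow> real"
  assumes "\<And>y. \<bar>f y\<bar> \<le> K * ((y - x)\<^sup>2 * h y)" "isCont h x"
  shows "(f has_real_derivative 0) (at x)"
proof -
  have f0: "f x = 0" using assms(1)[of x] by simp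
  have "((\<lambda>y. \<bar>K\<bar> * (\<bar>y - x\<bar> * \<bar>h y\<bar>)) \<longlongrightarrow> \<bar>K\<bar> * (\<bar>x - x\<bar> * \<bar>h x\<bar>)) (at x)"
    using assms(2) by (intro tendsto_intros) (auto simp: isCont_def)
  hence lim: "((\<lambda>y. \<bar>K\<bar> * (\<bar>y - x\<bar> * \<bar>h y\<bar>)) \<longlongrightarrow> 0) (at x)" by simp
  have "((\<lambda>y. (f y - f x) / (y - x)) \<longlongrightarrow> 0) (at x)"
  proof (rule Lim_null_comparison[OF _ lim])
    have "norm ((f y - f x) / (y - x)) \<le> \<bar>K\<bar> * (\<bar>y - x\<bar> * \<bar>h y\<bar>)" if "y \<noteq> x" for y
    proof -
      have "\<bar>f y\<bar> \<le> \<bar>K * ((y - x)\<^sup>2 * h y)\<bar>" using assms(1)[of y] by linarith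
      also have "\<dots> = \<bar>K\<bar> * (\<bar>y - x\<bar> * \<bar>h y\<bar>) * \<bar>y - x\<bar>" by (simp add: abs_mult power2_eq_square)
      finally show ?thesis using that f0 by (simp add: field_simps)
    qed
    thus "eventually (\<lambda>y. norm ((f y - f x) / (y - x)) \<le> \<bar>K\<bar> * (\<bar>y - x\<bar> * \<bar>h y\<bar>)) (at x)"
      by (simp add: eventually_at_filter)
  qed
  thus ?thesis by (simp add: has_field_derivative_iff)
qed

lemma bump_span_DERIV:
  assumes "\<epsilon> > 0" "c < d" "f \<in> bump_span c d \<epsilon>"
  shows "\<exists>g\<in>bump_span c d \<epsilon>. \<forall>x. (f has_field_derivative g x) (at x)"
  using assms(3)
proof induction
  case (mono i j)
  let ?m = "bump_monomial c d \<epsilon>"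
  define g where "g = (\<lambda>x. 1 * (real i * ?m (i-1) j x + (- real j) * ((c+d) * ?m i (j+1) x + (-2) * ?m (i+1) (j+1) x))
        + \<epsilon> * ((c+d) * ?m i (j+2) x + (-2) * ?m (i+1) (j+2) x))"
  have "g \<in> bump_span c d \<epsilon>" unfolding g_def by (intro bump_span.intros)
  moreover have "(?m i j has_field_derivative g x) (at x)" for x
  proof -
    consider "c < x \<and> x < d" | "x = c" | "x = d" | "x < c \<or> d < x" by linarith
    thus ?thesis
    proof cases
      case 1
      define r where "r = (\<lambda>x. 1 / ((x - c) * (d - x)))"
      have nz: "(x - c) * (d - x) \<noteq> 0" using 1 by auto
      have r': "(r has_field_derivative - ((c + d - 2 * x) * (r x)\<^sup>2)) (at x)"
      proof -
        have "((\<lambda>x. (x - c) * (d - x)) has_field_derivative (c + d - 2 * x)) (at x)"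
          by (auto intro!: derivative_eq_intros simp: algebra_simps)
        from DERIV_inverse'[OF this nz] show ?thesis
          unfolding r_def by (simp add: divide_inverse power2_eq_square mult_ac)
      qed
      have "((\<lambda>x. x ^ i * r x ^ j * exp (- \<epsilon> * r x)) has_field_derivative g x) (at x)"
      proof -
        have "((\<lambda>x. x ^ i * r x ^ j * exp (- \<epsilon> * r x)) has_field_derivative
          (real i * x ^ (i-1)) * r x ^ j * exp (- \<epsilon> * r x) +
          x ^ i * (real j * r x ^ (j-1) * (- ((c + d - 2 * x) * (r x)\<^sup>2))) * exp (- \<epsilon> * r x)
          + x ^ i * r x ^ j * (exp (- \<epsilon> * r x) * (- \<epsilon> * (- ((c + d - 2 * x) * (r x)\<^sup>2))))) (at x)"
          by (rule derivative_eq_intros r' refl | simp add: algebra_simps)+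
        also have "(real i * x ^ (i-1)) * r x ^ j * exp (- \<epsilon> * r x) +
          x ^ i * (real j * r x ^ (j-1) * (- ((c + d - 2 * x) * (r x)\<^sup>2))) * exp (- \<epsilon> * r x)
          + x ^ i * r x ^ j * (exp (- \<epsilon> * r x) * (- \<epsilon> * (- ((c + d - 2 * x) * (r x)\<^sup>2)))) = g x"
        proof -
          have "real j * r x ^ (j-1) * (r x)\<^sup>2 = real j * r x ^ (j+1)"
            by (cases j) (auto simp: power2_eq_square)
          moreover have "x ^ i * (real j * r x ^ (j-1) * (- ((c + d - 2 * x) * (r x)\<^sup>2))) =
              x ^ i * (- (c + d - 2 * x)) * (real j * r x ^ (j-1) * (r x)\<^sup>2)"
            by (simp only: mult_minus_right mult_minus_left mult_ac)
          ultimately have *: "x ^ i * (real j * r x ^ (j-1) * (- ((c + d - 2 * x) * (r x)\<^sup>2))) =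
              x ^ i * (- (c + d - 2 * x)) * (real j * r x ^ (j+1))" by simp
          have m: "?m i' j' x = x ^ i' * r x ^ j' * exp (- \<epsilon> * r x)" for i' j'
            using 1 by (simp add: bump_monomial_def r_def)
          show ?thesis unfolding * g_def m by (simp add: power_add algebra_simps power2_eq_square)
        qed
        finally show ?thesis .
      qed
      thus ?thesis
        by (rule has_field_derivative_transform_within_open[of _ _ _ "{c<..<d}"])
           (use 1 in \<open>auto simp: bump_monomial_def r_def\<close>)
    next
      case 2
      obtain K where "\<forall>x. \<bar>?m i j x\<bar> \<le> K * ((x - c)\<^sup>2 * (x - d)\<^sup>2)" using bump_monomial_bound[OF assms(1,2)] by blast
      hence "(?m i j has_real_derivative 0) (at c)"
        by (intro DERIV_zero_of_quadratic_bound[where h="\<lambda>x. (x - d)\<^sup>2"]) auto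
      moreover have "g c = 0" by (simp add: g_def bump_monomial_def)
      ultimately show ?thesis using 2 by simp
    next
      case 3
      obtain K where "\<forall>x. \<bar>?m i j x\<bar> \<le> K * ((x - c)\<^sup>2 * (x - d)\<^sup>2)" using bump_monomial_bound[OF assms(1,2)] by blast
      hence "(?m i j has_real_derivative 0) (at d)"
        by (intro DERIV_zero_of_quadratic_bound[where h="\<lambda>x. (x - c)\<^sup>2" and K=K]) (auto simp: mult.commute)
      moreover have "g d = 0" by (simp add: g_def bump_monomial_def)
      ultimately show ?thesis using 3 by simp
    next
      case 4
      have "((\<lambda>_. 0) has_real_derivative 0) (at x)" by simp
      hence "(?m i j has_real_derivative 0) (at x)"
        by (rule has_field_derivative_transform_within_open[of _ _ _ "{..<c} \<union> {d<..}"])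
           (use 4 in \<open>auto simp: bump_monomial_def\<close>)
      moreover have "g x = 0" using 4 by (auto simp: g_def bump_monomial_def)
      ultimately show ?thesis by simp
    qed
  qed
  ultimately show ?case by blast
next
  case (comb f g r s)
  then obtain f' g' where fg: "f' \<in> bump_span c d \<epsilon>" "g' \<in> bump_span c d \<epsilon>"
    "\<forall>x. (f has_field_derivative f' x) (at x)" "\<forall>x. (g has_field_derivative g' x) (at x)" by blast
  show ?case
    using fg by (intro bexI[of _ "\<lambda>x. r * f' x + s * g' x"] allI bump_span.comb)
      (auto intro!: derivative_eq_intros)
qed

definition bump :: "real \<Rightarrow> real \<Rightarrow> real \<Rightarrow> real \<Rightarrow> real" where
  "bump c d \<epsilon> x = (if c < x \<and> x < d then exp (- \<epsilon> / ((x - c) * (d - x))) else 0)"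

lemma bump_test_function:
  assumes "a < c" "c < d" "d < b" "\<epsilon> > 0"
  shows "bump c d \<epsilon> \<in> test_functions a b"
proof -
  have e: "bump c d \<epsilon> = bump_monomial c d \<epsilon> 0 0" by (auto simp: bump_def bump_monomial_def)
  have "smooth (bump c d \<epsilon>)"
    unfolding e by (rule smooth_coinduct[OF bump_span.mono]) (use bump_span_DERIV assms in blast)
  thus ?thesis unfolding test_functions_iff using assms
    by (intro conjI exI[of _ c] exI[of _ d]) (auto simp: bump_def)
qed

lemma bump_bounds: "\<epsilon> > 0 \<Longrightarrow> 0 \<le> bump c d \<epsilon> x" "\<epsilon> > 0 \<Longrightarrow> bump c d \<epsilon> x \<le> 1"
  by (auto simp: bump_def divide_simps)

lemma bump_pos: "c < x \<Longrightarrow> x < d \<Longrightarrow> 0 < bump c d \<epsilon> x"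
  by (auto simp: bump_def)

text \<open>For the passage to the limit in the fundamental lemma.\<close>

lemma bump_limit: "(\<lambda>n. bump c d (1 / real (Suc n)) x) \<longlonglongrightarrow> indicator {c<..<d} x"
proof (cases "c < x \<and> x < d")
  case True
  have "(\<lambda>n. exp (- (1 / real (Suc n)) / ((x - c) * (d - x)))) \<longlonglongrightarrow> exp (- 0 / ((x - c) * (d - x)))"
    using True by (intro tendsto_intros LIMSEQ_Suc[OF lim_1_over_n]) auto
  thus ?thesis using True by (simp add: bump_def)
qed (auto simp: bump_def)

section \<open>The fundamental lemma of the calculus of variations\<close>

lemma locally_integrable_iff:
  "locally_integrable a b f \<longleftrightarrow> (\<forall>c d. a < c \<longrightarrow> d < b \<longrightarrow> integrable (leb c d) f)"
  unfolding locally_integrable_def leb_Icc_integrable_iff ..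

lemma integrable_imp_locally_integrable: "integrable (leb a b) f \<Longrightarrow> locally_integrable a b f"
  unfolding locally_integrable_iff by (auto intro: leb_integrable_sub)

lemma locally_integrable_linear:
  "locally_integrable a b f \<Longrightarrow> locally_integrable a b g \<Longrightarrow> locally_integrable a b (\<lambda>x. r * f x + s * g x)"
  unfolding locally_integrable_iff by auto

lemma locally_integrable_cong_AE:
  assumes "locally_integrable a b f" "AE x in leb a b. f x = g x"
  shows "locally_integrable a b g"
  unfolding locally_integrable_iff
proof (intro allI impI)
  fix c d assume cd: "a < c" "d < b"
  show "integrable (leb c d) g"
    by (rule leb_integrable_cong_AE[OF _ AE_leb_sub[OF assms(2)]])
       (use cd assms(1) in \<open>auto simp: locally_integrable_iff\<close>)
qed

lemma locally_integrable_mult_test: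
  assumes "locally_integrable a b f" "\<eta> \<in> test_functions a b"
  shows "integrable (leb a b) (\<lambda>x. f x * \<eta> x)"
proof -
  obtain c d where cd: "a < c" "d < b" "\<forall>x. x \<notin> {c..d} \<longrightarrow> \<eta> x = 0" using assms test_functions_iff by blast
  define c' d' where "c' = (a + c) / 2" and "d' = (d + b) / 2"
  have cd': "a < c'" "c' < c" "d < d'" "d' < b" using cd by (auto simp: c'_def d'_def)
  have "integrable (leb c' d') (\<lambda>x. f x * \<eta> x)"
    using assms(1) cd' by (intro bounded_mult_integrable test_functions_continuous[OF assms(2)])
       (auto simp: locally_integrable_iff)
  hence "integrable lebesgue (\<lambda>x. indicator {c'<..<d'} x * (f x * \<eta> x))" by (simp add: leb_integrable_iff)
  also have "(\<lambda>x. indicator {c'<..<d'} x * (f x * \<eta> x)) = (\<lambda>x. indicator {a<..<b} x * (f x * \<eta> x))"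
  proof
    fix x show "indicator {c'<..<d'} x * (f x * \<eta> x) = indicator {a<..<b} x * (f x * \<eta> x)"
    proof (cases "x \<in> {c..d}")
      case True thus ?thesis using cd cd' by (simp add: indicator_def)
    next
      case False thus ?thesis using cd(3) by simp
    qed
  qed
  finally show ?thesis by (simp add: leb_integrable_iff)
qed

text \<open>Testing with bumps and passing to the limit gives that h has integral 0 over every interval.\<close>

lemma fundamental_lemma:
  assumes h: "locally_integrable a b h"
    and z: "\<And>\<eta>. \<eta> \<in> test_functions a b \<Longrightarrow> (LINT x|leb a b. h x * \<eta> x) = 0"
  shows "AE x in leb a b. h x = 0"
proof -
  have A: "AE x in leb c d. h x = 0" if cd: "a < c" "d < b" for c d
  proof (rule AE_zero_of_interval_integrals)
    show hi: "integrable (leb c d) h" using h cd by (auto simp: locally_integrable_iff)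
    fix c' d' assume *: "c < c'" "c' < d'" "d' < d"
    have hi': "integrable (leb c' d') h" by (rule leb_integrable_sub[OF hi]) (use * in auto)
    let ?e = "\<lambda>n::nat. 1 / real (Suc n)"
    have t: "bump c' d' (?e n) \<in> test_functions a b" for n using * cd by (intro bump_test_function) auto
    have b0: "(LINT x|leb c' d'. h x * bump c' d' (?e n) x) = 0" for n
    proof -
      have "(LINT x|leb c' d'. h x * bump c' d' (?e n) x) = (LINT x|leb a b. h x * bump c' d' (?e n) x)"
        unfolding leb_integral_eq
        by (rule Bochner_Integration.integral_cong) (use * cd in \<open>auto simp: indicator_def bump_def\<close>)
      thus ?thesis using z[OF t] by simp
    qed
    have "(\<lambda>n. LINT x|leb c' d'. h x * bump c' d' (?e n) x) \<longlonglongrightarrow> (LINT x|leb c' d'. h x * indicator {c'<..<d'} x)"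
    proof (rule integral_dominated_convergence[where w="\<lambda>x. \<bar>h x\<bar>"])
      show "(\<lambda>x. h x * indicator {c'<..<d'} x) \<in> borel_measurable (leb c' d')"
      proof (rule leb_measurable_cong_AE)
        show "h \<in> borel_measurable (leb c' d')" using hi' by auto
        show "AE x in leb c' d'. h x = h x * indicator {c'<..<d'} x" unfolding AE_leb_iff by auto
      qed
      show "(\<lambda>x. h x * bump c' d' (?e n) x) \<in> borel_measurable (leb c' d')" for n
        using hi' leb_continuous_measurable[OF test_functions_continuous[OF t]] by auto
      show "integrable (leb c' d') (\<lambda>x. \<bar>h x\<bar>)" using hi' by simp
      show "AE x in leb c' d'. (\<lambda>n. h x * bump c' d' (?e n) x) \<longlonglongrightarrow> h x * indicator {c'<..<d'} x"
        by (intro AE_I2 tendsto_intros bump_limit)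
      show "AE x in leb c' d'. norm (h x * bump c' d' (?e n) x) \<le> \<bar>h x\<bar>" for n
      proof (rule AE_I2)
        fix x
        have "\<bar>bump c' d' (?e n) x\<bar> \<le> 1" using bump_bounds[of "?e n" c' d' x] by auto
        thus "norm (h x * bump c' d' (?e n) x) \<le> \<bar>h x\<bar>"
          using mult_left_mono[of "\<bar>bump c' d' (?e n) x\<bar>" 1 "\<bar>h x\<bar>"] by (simp add: abs_mult)
      qed
    qed
    hence "(LINT x|leb c' d'. h x * indicator {c'<..<d'} x) = 0"
      unfolding b0 by (simp add: LIMSEQ_const_iff)
    moreover have "(LINT x|leb c' d'. h x * indicator {c'<..<d'} x) = (LINT x|leb c' d'. h x)"
      by (rule Bochner_Integration.integral_cong) auto
    ultimately show "(LINT x|leb c' d'. h x) = 0" by simp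
  qed
  have "AE x in lebesgue. \<forall>n::nat. a + 1 / real (Suc n) < x \<and> x < b - 1 / real (Suc n) \<longrightarrow> h x = 0"
    unfolding AE_all_countable using A[unfolded AE_leb_iff] by auto
  thus ?thesis unfolding AE_leb_iff
  proof (rule AE_mp, intro AE_I2 impI)
    fix x assume *: "\<forall>n::nat. a + 1 / real (Suc n) < x \<and> x < b - 1 / real (Suc n) \<longrightarrow> h x = 0" and x: "a < x \<and> x < b"
    obtain n where "1 / real (Suc n) < min (x - a) (b - x)"
      using reals_Archimedean[of "min (x - a) (b - x)"] x by (auto simp: inverse_eq_divide)
    thus "h x = 0" using *[rule_format, of n] by auto
  qed
qed

lemma bump_normalised:
  assumes "a < b"
  shows "\<exists>\<theta>\<in>test_functions a b. (LINT x|leb a b. \<theta> x) = 1"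
proof -
  define c d where "c = (2 * a + b) / 3" and "d = (a + 2 * b) / 3"
  have cd: "a < c" "c < d" "d < b" using assms by (auto simp: c_def d_def)
  have t: "bump c d 1 \<in> test_functions a b" by (rule bump_test_function[OF cd]) simp
  have i: "integrable (leb a b) (bump c d 1)" by (rule leb_continuous_integrable[OF test_functions_continuous[OF t]])
  have "(LINT x|leb a b. bump c d 1 x) \<noteq> 0"
  proof
    assume "(LINT x|leb a b. bump c d 1 x) = 0"
    hence "AE x in leb a b. bump c d 1 x = 0"
      using integral_nonneg_eq_0_iff_AE[OF i] bump_bounds(1) by auto
    hence "AE x in lebesgue. x \<notin> {c<..<d}"
      unfolding AE_leb_iff by (rule AE_mp) (use cd in \<open>auto simp: bump_def\<close>)
    hence "{c<..<d} \<in> null_sets lebesgue" by (subst AE_iff_null_sets) auto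
    hence "negligible {c<..<d}" by (simp add: negligible_iff_null_sets)
    thus False using cd open_not_negligible[of "{c<..<d}"] by auto
  qed
  hence "(LINT x|leb a b. (1 / (LINT x|leb a b. bump c d 1 x)) * bump c d 1 x + 0 * bump c d 1 x) = 1" by simp
  thus ?thesis using test_functions_linear[OF t t] by blast
qed

text \<open>A test function \<open>\<zeta>\<close> minus \<open>(\<integral> \<zeta>) \<theta>\<close> has integral 0, so it is the derivative of a test function. Hence
  h minus the constant \<open>\<integral> h \<theta>\<close> is orthogonal to every \<open>\<zeta>\<close>.\<close>

lemma du_Bois_Reymond:
  assumes ab: "a < b" and h: "locally_integrable a b h"
    and z: "\<And>\<eta>. \<eta> \<in> test_functions a b \<Longrightarrow> (LINT x|leb a b. h x * deriv \<eta> x) = 0"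
    and \<theta>: "\<theta> \<in> test_functions a b" "(LINT x|leb a b. \<theta> x) = 1"
  shows "AE x in leb a b. h x = (LINT x|leb a b. h x * \<theta> x)"
proof -
  let ?c = "LINT x|leb a b. h x * \<theta> x"
  have "AE x in leb a b. 1 * h x + (- ?c) * 1 = 0"
  proof (rule fundamental_lemma)
    show "locally_integrable a b (\<lambda>x. 1 * h x + - ?c * 1)"
      by (intro locally_integrable_linear h integrable_imp_locally_integrable leb_continuous_integrable) auto
    fix \<zeta> assume \<zeta>: "\<zeta> \<in> test_functions a b"
    have it: "integrable (leb a b) \<xi>" if "\<xi> \<in> test_functions a b" for \<xi>
      by (rule leb_continuous_integrable[OF test_functions_continuous[OF that]])
    let ?s = "LINT x|leb a b. \<zeta> x"
    define \<xi> where "\<xi> = (\<lambda>x. 1 * \<zeta> x + (- ?s) * \<theta> x)"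
    have "\<xi> \<in> test_functions a b" unfolding \<xi>_def by (rule test_functions_linear[OF \<zeta> \<theta>(1)])
    moreover have "(LINT x|leb a b. \<xi> x) = 0"
      unfolding \<xi>_def using it[OF \<zeta>] it[OF \<theta>(1)] \<theta>(2) by simp
    ultimately obtain \<eta> where \<eta>: "\<eta> \<in> test_functions a b" "deriv \<eta> = \<xi>"
      using test_functions_antiderivative ab by blast
    have i: "integrable (leb a b) (\<lambda>x. h x * \<zeta> x)" "integrable (leb a b) (\<lambda>x. h x * \<theta> x)"
      using locally_integrable_mult_test h \<zeta> \<theta> by auto
    have "0 = (LINT x|leb a b. h x * \<zeta> x - ?s * (h x * \<theta> x))"
      using z[OF \<eta>(1)] unfolding \<eta>(2) \<xi>_def by (simp add: algebra_simps)
    also have "\<dots> = (LINT x|leb a b. h x * \<zeta> x) - ?s * ?c" using i by simp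
    finally have "(LINT x|leb a b. h x * \<zeta> x) = ?c * ?s" by simp
    moreover have "(LINT x|leb a b. (1 * h x + - ?c * 1) * \<zeta> x) = (LINT x|leb a b. h x * \<zeta> x - ?c * \<zeta> x)"
      by (simp add: algebra_simps)
    ultimately show "(LINT x|leb a b. (1 * h x + - ?c * 1) * \<zeta> x) = 0" using i it[OF \<zeta>] by simp
  qed
  thus ?thesis by (rule AE_mp) simp
qed

section \<open>Weak derivatives and Sobolev functions on an interval\<close>

lemma continuous_AE_eq:
  fixes f g :: "real \<Rightarrow> real"
  assumes "continuous_on {a..b} f" "continuous_on {a..b} g" "AE x in leb a b. f x = g x" "a < b" "x \<in> {a..b}"
  shows "f x = g x"
proof -
  define k where "k = (\<lambda>x. max a (min b x))"
  have k: "continuous_on UNIV k" "range k \<subseteq> {a..b}" "\<And>x. x \<in> {a..b} \<Longrightarrow> k x = x"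
    using assms(4) by (auto simp: k_def intro!: continuous_intros)
  define C where "C = {x. f (k x) = g (k x)}"
  have "continuous_on UNIV (\<lambda>x. f (k x))" "continuous_on UNIV (\<lambda>x. g (k x))"
    using continuous_on_compose2[OF assms(1) k(1,2)] continuous_on_compose2[OF assms(2) k(1,2)] by auto
  hence C: "closed C" unfolding C_def by (rule closed_Collect_eq)
  have "AE x\<in>{a<..<b} in lebesgue. x \<in> C"
    using assms(3) unfolding AE_leb_iff by (rule AE_mp) (auto simp: C_def k)
  note ae = this
  have "{a<..<b} \<subseteq> C"
  proof
    fix x assume "x \<in> {a<..<b}"
    thus "x \<in> C" by (rule mem_closed_if_AE_lebesgue_open[OF _ C ae, rotated]) auto
  qed
  hence "{a..b} \<subseteq> C" using closure_minimal[OF _ C, of "{a<..<b}"] assms(4) by simp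
  thus ?thesis using assms(5) k(3) by (auto simp: C_def)
qed

lemma has_weak_deriv_locally_integrable:
  assumes "has_weak_deriv a b n f g"
  shows "locally_integrable a b f" "locally_integrable a b g"
  using assms unfolding has_weak_deriv_def by blast+

lemma has_weak_deriv_test:
  assumes "has_weak_deriv a b n f g" "\<eta> \<in> test_functions a b"
  shows "(LINT x|leb a b. f x * (deriv ^^ n) \<eta> x) = (-1) ^ n * (LINT x|leb a b. g x * \<eta> x)"
  using assms unfolding has_weak_deriv_def by blast

lemma has_weak_deriv_cong_AE:
  assumes "has_weak_deriv a b n f g" "AE x in leb a b. f x = f' x" "AE x in leb a b. g x = g' x"
  shows "has_weak_deriv a b n f' g'"
  unfolding has_weak_deriv_def
proof (intro conjI ballI)
  show "locally_integrable a b f'" "locally_integrable a b g'"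
    by (rule locally_integrable_cong_AE[OF _ assms(2)] locally_integrable_cong_AE[OF _ assms(3)],
        rule has_weak_deriv_locally_integrable[OF assms(1)])+
  fix \<eta> assume \<eta>: "\<eta> \<in> test_functions a b"
  have "(LINT x|leb a b. f x * (deriv ^^ n) \<eta> x) = (LINT x|leb a b. f' x * (deriv ^^ n) \<eta> x)"
    by (rule leb_integral_cong_AE, rule AE_mp[OF assms(2)]) simp
  moreover have "(LINT x|leb a b. g x * \<eta> x) = (LINT x|leb a b. g' x * \<eta> x)"
    by (rule leb_integral_cong_AE, rule AE_mp[OF assms(3)]) simp
  ultimately show "(LINT x|leb a b. f' x * (deriv ^^ n) \<eta> x) = (-1) ^ n * (LINT x|leb a b. g' x * \<eta> x)"
    using has_weak_deriv_test[OF assms(1) \<eta>] by simp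
qed

lemma wderiv_cong_AE:
  assumes "AE x in leb a b. f x = f' x"
  shows "wderiv a b n f = wderiv a b n f'"
proof -
  have "has_weak_deriv a b n f = has_weak_deriv a b n f'"
    using has_weak_deriv_cong_AE[OF _ assms] has_weak_deriv_cong_AE[OF _ AE_eq_sym[OF assms]]
    by (intro ext iffI) blast+
  thus ?thesis unfolding wderiv_def by simp
qed

lemma has_weak_deriv_linear:
  assumes "has_weak_deriv a b n f g" "has_weak_deriv a b n f' g'"
  shows "has_weak_deriv a b n (\<lambda>x. r * f x + s * f' x) (\<lambda>x. r * g x + s * g' x)"
  unfolding has_weak_deriv_def
proof (intro conjI ballI)
  note li = has_weak_deriv_locally_integrable
  show "locally_integrable a b (\<lambda>x. r * f x + s * f' x)" "locally_integrable a b (\<lambda>x. r * g x + s * g' x)"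
    by (intro locally_integrable_linear li[OF assms(1)] li[OF assms(2)])+
  fix \<eta> assume \<eta>: "\<eta> \<in> test_functions a b"
  have \<eta>n: "(deriv ^^ n) \<eta> \<in> test_functions a b" by (rule test_functions_deriv_funpow[OF \<eta>])
  note [simp] = locally_integrable_mult_test[OF li(1)[OF assms(1)] \<eta>n] locally_integrable_mult_test[OF li(1)[OF assms(2)] \<eta>n]
    locally_integrable_mult_test[OF li(2)[OF assms(1)] \<eta>] locally_integrable_mult_test[OF li(2)[OF assms(2)] \<eta>]
  have "(LINT x|leb a b. (r * f x + s * f' x) * (deriv ^^ n) \<eta> x)
    = (LINT x|leb a b. r * (f x * (deriv ^^ n) \<eta> x) + s * (f' x * (deriv ^^ n) \<eta> x))"
    by (simp only: distrib_right mult.assoc)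
  also have "\<dots> = r * (LINT x|leb a b. f x * (deriv ^^ n) \<eta> x) + s * (LINT x|leb a b. f' x * (deriv ^^ n) \<eta> x)" by simp
  also have "\<dots> = (-1) ^ n * (r * (LINT x|leb a b. g x * \<eta> x) + s * (LINT x|leb a b. g' x * \<eta> x))"
    unfolding has_weak_deriv_test[OF assms(1) \<eta>] has_weak_deriv_test[OF assms(2) \<eta>] by (simp add: algebra_simps)
  also have "r * (LINT x|leb a b. g x * \<eta> x) + s * (LINT x|leb a b. g' x * \<eta> x) = (LINT x|leb a b. r * (g x * \<eta> x) + s * (g' x * \<eta> x))" by simp
  also have "\<dots> = (LINT x|leb a b. (r * g x + s * g' x) * \<eta> x)" by (simp only: distrib_right mult.assoc)
  finally show "(LINT x|leb a b. (r * f x + s * f' x) * (deriv ^^ n) \<eta> x) = (-1) ^ n * (LINT x|leb a b. (r * g x + s * g' x) * \<eta> x)" .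
qed

lemma has_weak_deriv_0: "locally_integrable a b f \<Longrightarrow> has_weak_deriv a b 0 f f"
  unfolding has_weak_deriv_def by simp

lemma has_weak_deriv_unique:
  assumes "has_weak_deriv a b n f g" "has_weak_deriv a b n f h"
  shows "AE x in leb a b. g x = h x"
proof -
  note li = has_weak_deriv_locally_integrable
  have "AE x in leb a b. 1 * g x + (-1) * h x = 0"
  proof (rule fundamental_lemma)
    show "locally_integrable a b (\<lambda>x. 1 * g x + (-1) * h x)"
      by (intro locally_integrable_linear li(2)[OF assms(1)] li(2)[OF assms(2)])
    fix \<eta> assume \<eta>: "\<eta> \<in> test_functions a b"
    have "(-1::real) ^ n * (LINT x|leb a b. g x * \<eta> x) = (-1) ^ n * (LINT x|leb a b. h x * \<eta> x)"
      using has_weak_deriv_test[OF assms(1) \<eta>] has_weak_deriv_test[OF assms(2) \<eta>] by simp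
    hence "(LINT x|leb a b. g x * \<eta> x) = (LINT x|leb a b. h x * \<eta> x)" by simp
    thus "(LINT x|leb a b. (1 * g x + (-1) * h x) * \<eta> x) = 0"
      using locally_integrable_mult_test[OF li(2)[OF assms(1)] \<eta>] locally_integrable_mult_test[OF li(2)[OF assms(2)] \<eta>]
      by (simp add: left_diff_distrib)
  qed
  thus ?thesis by (rule AE_mp) simp
qed

lemma has_weak_deriv_Suc_of_primitive:
  assumes "has_weak_deriv a b n f F" "primitive_on a b F g" "a < b"
  shows "has_weak_deriv a b (Suc n) f g"
  unfolding has_weak_deriv_def
proof (intro conjI ballI)
  show "locally_integrable a b f" by (rule has_weak_deriv_locally_integrable[OF assms(1)])
  show "locally_integrable a b g" by (rule integrable_imp_locally_integrable[OF primitive_onD(1)[OF assms(2)]])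
  fix \<eta> assume \<eta>: "\<eta> \<in> test_functions a b"
  have "(LINT x|leb a b. f x * (deriv ^^ Suc n) \<eta> x) = (LINT x|leb a b. f x * (deriv ^^ n) (deriv \<eta>) x)"
    by (simp only: funpow_Suc_right o_apply)
  also have "\<dots> = (-1) ^ n * (LINT x|leb a b. F x * deriv \<eta> x)"
    by (rule has_weak_deriv_test[OF assms(1) test_functions_deriv[OF \<eta>]])
  also have "(LINT x|leb a b. F x * deriv \<eta> x) = - (LINT x|leb a b. g x * \<eta> x)"
    using integral_by_parts_primitive(1)[OF assms(2) test_functions_primitive[OF \<eta>]] assms(3)
      test_functions_zero[OF \<eta>, of a] test_functions_zero[OF \<eta>, of b] by simp
  finally show "(LINT x|leb a b. f x * (deriv ^^ Suc n) \<eta> x) = (-1) ^ Suc n * (LINT x|leb a b. g x * \<eta> x)" by simp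
qed

text \<open>By du Bois-Reymond, a weak derivative differs from an indefinite integral of the next one by a constant.\<close>

lemma has_weak_deriv_primitive:
  assumes F: "has_weak_deriv a b n f F" and g: "has_weak_deriv a b (Suc n) f g" "integrable (leb a b) g" and ab: "a < b"
  obtains G where "primitive_on a b G g" "AE x in leb a b. F x = G x"
proof -
  define G0 where "G0 = (\<lambda>x. 0 + (LINT s|leb a x. g s))"
  have G0: "primitive_on a b G0 g" unfolding G0_def by (rule primitive_onI[OF g(2)])
  obtain \<theta> where \<theta>: "\<theta> \<in> test_functions a b" "(LINT x|leb a b. \<theta> x) = 1" using bump_normalised[OF ab] by blast
  define h where "h = (\<lambda>x. 1 * F x + (-1) * G0 x)"
  have liF: "locally_integrable a b F" by (rule has_weak_deriv_locally_integrable[OF F])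
  have liG: "locally_integrable a b G0"
    by (rule integrable_imp_locally_integrable, rule leb_continuous_integrable, rule primitive_on_continuous[OF G0])
  have "AE x in leb a b. h x = (LINT x|leb a b. h x * \<theta> x)"
  proof (rule du_Bois_Reymond[OF ab _ _ \<theta>])
    show "locally_integrable a b h" unfolding h_def by (rule locally_integrable_linear[OF liF liG])
    fix \<eta> assume \<eta>: "\<eta> \<in> test_functions a b"
    note \<eta>' = test_functions_deriv[OF \<eta>]
    have "(-1) ^ n * (LINT x|leb a b. F x * deriv \<eta> x) = (LINT x|leb a b. f x * (deriv ^^ n) (deriv \<eta>) x)"
      using has_weak_deriv_test[OF F \<eta>'] by simp
    also have "\<dots> = (LINT x|leb a b. f x * (deriv ^^ Suc n) \<eta> x)" by (simp only: funpow_Suc_right o_apply)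
    also have "\<dots> = (-1) ^ n * (- (LINT x|leb a b. g x * \<eta> x))" using has_weak_deriv_test[OF g(1) \<eta>] by simp
    finally have "(-1) ^ n * (LINT x|leb a b. F x * deriv \<eta> x) = (-1) ^ n * (- (LINT x|leb a b. g x * \<eta> x))" .
    hence 1: "(LINT x|leb a b. F x * deriv \<eta> x) = - (LINT x|leb a b. g x * \<eta> x)"
      by (subst (asm) mult_cancel_left) simp
    have 2: "(LINT x|leb a b. G0 x * deriv \<eta> x) = - (LINT x|leb a b. g x * \<eta> x)"
      using integral_by_parts_primitive(1)[OF G0 test_functions_primitive[OF \<eta>]] ab
        test_functions_zero[OF \<eta>, of a] test_functions_zero[OF \<eta>, of b] by simp
    show "(LINT x|leb a b. h x * deriv \<eta> x) = 0"
      using 1 2 locally_integrable_mult_test[OF liF \<eta>'] locally_integrable_mult_test[OF liG \<eta>']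
      by (simp add: h_def left_diff_distrib)
  qed
  hence ae: "AE x in leb a b. F x = (LINT x|leb a b. h x * \<theta> x) + G0 x" by (rule AE_mp) (simp add: h_def)
  have "primitive_on a b (\<lambda>x. (LINT x|leb a b. h x * \<theta> x) + G0 x) g"
    using primitive_onI[OF g(2), of "LINT x|leb a b. h x * \<theta> x"] by (simp add: G0_def)
  thus thesis using ae that by blast
qed

lemma wderiv_has_weak_deriv:
  assumes "has_weak_deriv a b n f g"
  shows "has_weak_deriv a b n f (wderiv a b n f)"
    and "continuous_on {a..b} g \<Longrightarrow> continuous_on {a..b} (wderiv a b n f)"
proof -
  let ?P = "\<lambda>g. has_weak_deriv a b n f g \<and>
        ((\<exists>h. has_weak_deriv a b n f h \<and> continuous_on {a..b} h) \<longrightarrow> continuous_on {a..b} g)"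
  have "\<exists>g. ?P g" using assms by blast
  hence "?P (wderiv a b n f)" unfolding wderiv_def by (rule someI_ex)
  thus "has_weak_deriv a b n f (wderiv a b n f)"
    "continuous_on {a..b} g \<Longrightarrow> continuous_on {a..b} (wderiv a b n f)" using assms by blast+
qed

lemma wderiv_AE_eq:
  assumes "has_weak_deriv a b n f g"
  shows "AE x in leb a b. wderiv a b n f x = g x"
  by (rule has_weak_deriv_unique[OF wderiv_has_weak_deriv(1)[OF assms] assms])

lemma wderiv_eq:
  assumes "has_weak_deriv a b n f g" "continuous_on {a..b} g" "a < b" "x \<in> {a..b}"
  shows "wderiv a b n f x = g x"
  by (rule continuous_AE_eq[OF wderiv_has_weak_deriv(2)[OF assms(1,2)] assms(2) wderiv_AE_eq[OF assms(1)] assms(3,4)])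

subsection \<open>Square integrable functions\<close>

lemma L2_measurable: "f \<in> L2 a b \<Longrightarrow> f \<in> borel_measurable (leb a b)"
  by (simp add: L2_def)

lemma L2_mult_integrable:
  assumes "f \<in> L2 a b" "g \<in> L2 a b"
  shows "integrable (leb a b) (\<lambda>x. f x * g x)"
proof (rule Bochner_Integration.integrable_bound)
  show "integrable (leb a b) (\<lambda>x. (f x)\<^sup>2 + (g x)\<^sup>2)" using assms by (simp add: L2_def)
  show "(\<lambda>x. f x * g x) \<in> borel_measurable (leb a b)" using assms L2_measurable by auto
  have "\<bar>f x * g x\<bar> \<le> (f x)\<^sup>2 + (g x)\<^sup>2" for x
  proof -
    have "0 \<le> (\<bar>f x\<bar> - \<bar>g x\<bar>)\<^sup>2" by simp
    hence "2 * (\<bar>f x\<bar> * \<bar>g x\<bar>) \<le> (f x)\<^sup>2 + (g x)\<^sup>2" by (simp add: power2_diff)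
    moreover have "0 \<le> \<bar>f x\<bar> * \<bar>g x\<bar>" by simp
    ultimately show ?thesis unfolding abs_mult by linarith
  qed
  thus "AE x in leb a b. norm (f x * g x) \<le> norm ((f x)\<^sup>2 + (g x)\<^sup>2)"
    by (intro AE_I2) (simp del: abs_mult)
qed

lemma L2_cong_AE:
  assumes "f \<in> L2 a b" "AE x in leb a b. f x = g x"
  shows "g \<in> L2 a b"
proof -
  have "AE x in leb a b. (f x)\<^sup>2 = (g x)\<^sup>2" using assms(2) by (rule AE_mp) simp
  from leb_integrable_cong_AE[OF _ this] show ?thesis
    using assms(1) leb_measurable_cong_AE[OF _ assms(2)] unfolding L2_def by simp
qed

lemma continuous_L2: "continuous_on {a..b} f \<Longrightarrow> f \<in> L2 a b"
  unfolding L2_def by (auto intro!: leb_continuous_measurable leb_continuous_integrable continuous_intros)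

lemma L2_integrable: "f \<in> L2 a b \<Longrightarrow> integrable (leb a b) f"
  using L2_mult_integrable[of f a b "\<lambda>_. 1"] continuous_L2[of a b "\<lambda>_. 1"] by simp

lemma L2_linear:
  assumes "f \<in> L2 a b" "g \<in> L2 a b"
  shows "(\<lambda>x. r * f x + s * g x) \<in> L2 a b"
proof -
  have "(\<lambda>x. (r * f x + s * g x)\<^sup>2) = (\<lambda>x. r\<^sup>2 * (f x)\<^sup>2 + s\<^sup>2 * (g x)\<^sup>2 + (2 * r * s) * (f x * g x))"
    by (auto simp: fun_eq_iff power2_eq_square algebra_simps)
  thus ?thesis using assms L2_mult_integrable[OF assms] unfolding L2_def by auto
qed

subsection \<open>Sobolev functions\<close>

lemma sobolevD:
  assumes "f \<in> sobolev m a b" "i \<le> m"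
  shows "has_weak_deriv a b i f (wderiv a b i f)" "wderiv a b i f \<in> L2 a b"
proof -
  obtain g where g: "g \<in> L2 a b" "has_weak_deriv a b i f g" using assms unfolding sobolev_def by blast
  show "has_weak_deriv a b i f (wderiv a b i f)" by (rule wderiv_has_weak_deriv(1)[OF g(2)])
  show "wderiv a b i f \<in> L2 a b" by (rule L2_cong_AE[OF g(1) AE_eq_sym[OF wderiv_AE_eq[OF g(2)]]])
qed

text \<open>The representative chosen by \<^const>\<open>wderiv\<close> below the top order is continuous, hence equal everywhere to the
  indefinite integral, and not only almost everywhere.\<close>

lemma sobolev_primitive:
  assumes "f \<in> sobolev m a b" "i < m" "a < b"
  shows "primitive_on a b (wderiv a b i f) (wderiv a b (Suc i) f)"
proof -
  have h: "has_weak_deriv a b i f (wderiv a b i f)" "has_weak_deriv a b (Suc i) f (wderiv a b (Suc i) f)"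
    "integrable (leb a b) (wderiv a b (Suc i) f)"
    using sobolevD[OF assms(1)] L2_integrable assms(2) by auto
  obtain G where G: "primitive_on a b G (wderiv a b (Suc i) f)" "AE x in leb a b. wderiv a b i f x = G x"
    using has_weak_deriv_primitive[OF h assms(3)] by blast
  have hG: "has_weak_deriv a b i f G" by (rule has_weak_deriv_cong_AE[OF h(1) _ G(2)]) simp
  show ?thesis
  proof (rule primitive_on_cong[OF G(1)])
    fix x assume "a \<le> x" "x \<le> b"
    thus "G x = wderiv a b i f x" using wderiv_eq[OF hG primitive_on_continuous[OF G(1)] assms(3), of x] by simp
  qed (use assms(3) in auto)
qed

lemma sobolev_mono: "m \<le> n \<Longrightarrow> sobolev n a b \<subseteq> sobolev m a b"
  unfolding sobolev_def by auto

lemma sobolev_L2: "f \<in> sobolev m a b \<Longrightarrow> f \<in> L2 a b"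
  unfolding sobolev_def by auto

lemma crep_AE: "f \<in> sobolev m a b \<Longrightarrow> AE x in leb a b. wderiv a b 0 f x = f x"
  by (rule wderiv_AE_eq, rule has_weak_deriv_0, rule integrable_imp_locally_integrable, rule L2_integrable, rule sobolev_L2)

lemma sobolev_linear:
  assumes "f \<in> sobolev m a b" "g \<in> sobolev m a b"
  shows "(\<lambda>x. r * f x + s * g x) \<in> sobolev m a b"
  unfolding sobolev_def
proof (intro CollectI conjI allI impI)
  show "(\<lambda>x. r * f x + s * g x) \<in> L2 a b" by (intro L2_linear sobolev_L2[OF assms(1)] sobolev_L2[OF assms(2)])
  fix i assume "i \<le> m"
  thus "\<exists>h\<in>L2 a b. has_weak_deriv a b i (\<lambda>x. r * f x + s * g x) h"
    using has_weak_deriv_linear[OF sobolevD(1)[OF assms(1)] sobolevD(1)[OF assms(2)], of i r s]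
      L2_linear[OF sobolevD(2)[OF assms(1)] sobolevD(2)[OF assms(2)], of i i r s] by blast
qed

lemma wderiv_linear_AE:
  assumes "f \<in> sobolev m a b" "g \<in> sobolev m a b" "i \<le> m"
  shows "AE x in leb a b. wderiv a b i (\<lambda>x. r * f x + s * g x) x = r * wderiv a b i f x + s * wderiv a b i g x"
  by (rule wderiv_AE_eq, rule has_weak_deriv_linear; rule sobolevD(1), fact+)

lemma wderiv_linear:
  assumes "f \<in> sobolev m a b" "g \<in> sobolev m a b" "i < m" "a < b" "x \<in> {a..b}"
  shows "wderiv a b i (\<lambda>x. r * f x + s * g x) x = r * wderiv a b i f x + s * wderiv a b i g x"
proof (rule wderiv_eq[OF _ _ assms(4,5)])
  show "has_weak_deriv a b i (\<lambda>x. r * f x + s * g x) (\<lambda>x. r * wderiv a b i f x + s * wderiv a b i g x)"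
    by (rule has_weak_deriv_linear; rule sobolevD(1)) (use assms in auto)
  show "continuous_on {a..b} (\<lambda>x. r * wderiv a b i f x + s * wderiv a b i g x)"
    using primitive_on_continuous[OF sobolev_primitive[OF assms(1,3,4)]] primitive_on_continuous[OF sobolev_primitive[OF assms(2,3,4)]]
    by (intro continuous_intros)
qed

text \<open>The converse of \<open>sobolev_primitive\<close>, and the way in which membership in Sobolev spaces is established.\<close>

lemma sobolev_of_primitives:
  assumes "a < b" "AE x in leb a b. f x = F 0 x" "F 0 \<in> L2 a b"
    and "\<And>i. i < m \<Longrightarrow> primitive_on a b (F i) (F (Suc i))" "\<And>i. i \<le> m \<Longrightarrow> F i \<in> L2 a b"
  shows "f \<in> sobolev m a b" "\<And>i. i \<le> m \<Longrightarrow> has_weak_deriv a b i f (F i)"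
    "\<And>i x. i < m \<Longrightarrow> x \<in> {a..b} \<Longrightarrow> wderiv a b i f x = F i x"
proof -
  have f: "f \<in> L2 a b" by (rule L2_cong_AE[OF assms(3) AE_eq_sym[OF assms(2)]])
  have "i \<le> m \<Longrightarrow> has_weak_deriv a b i f (F i)" for i
  proof (induction i)
    case 0
    show ?case
      by (rule has_weak_deriv_cong_AE[OF has_weak_deriv_0 _ assms(2)])
         (use f L2_integrable integrable_imp_locally_integrable in auto)
  next
    case (Suc i)
    show ?case by (rule has_weak_deriv_Suc_of_primitive[OF Suc.IH assms(4) assms(1)]) (use Suc.prems in auto)
  qed
  thus h: "\<And>i. i \<le> m \<Longrightarrow> has_weak_deriv a b i f (F i)" .
  show "f \<in> sobolev m a b" unfolding sobolev_def using f h assms(5) by blast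
  show "\<And>i x. i < m \<Longrightarrow> x \<in> {a..b} \<Longrightarrow> wderiv a b i f x = F i x"
    by (rule wderiv_eq[OF h primitive_on_continuous[OF assms(4)] assms(1)]) auto
qed

text \<open>The one-dimensional Sobolev embedding: compare \<open>F x\<close> with \<open>F y\<close> and average over y.\<close>

lemma primitive_on_bound:
  assumes "primitive_on a b F g" "x \<in> {a..b}" "a < b"
  shows "(b - a) * \<bar>F x\<bar> \<le> (LINT y|leb a b. \<bar>F y\<bar>) + (b - a) * (LINT y|leb a b. \<bar>g y\<bar>)"
proof -
  have gi: "integrable (leb a b) g" by (rule primitive_onD(1)[OF assms(1)])
  have Fi: "integrable (leb a b) F" by (rule leb_continuous_integrable[OF primitive_on_continuous[OF assms(1)]])
  have d: "\<bar>F z - F y\<bar> \<le> (LINT y|leb a b. \<bar>g y\<bar>)" if "a \<le> y" "y \<le> z" "z \<le> b" for y z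
  proof -
    have "\<bar>F z - F y\<bar> = \<bar>LINT s|leb y z. g s\<bar>" using primitive_on_diff[OF assms(1) that] by simp
    also have "\<dots> \<le> (LINT s|leb y z. \<bar>g s\<bar>)" by (rule integral_abs_bound)
    also have "\<dots> \<le> (LINT y|leb a b. \<bar>g y\<bar>)"
      unfolding leb_integral_eq
    proof (rule integral_mono)
      show "integrable lebesgue (\<lambda>x. indicator {y<..<z} x * \<bar>g x\<bar>)"
        using leb_integrable_sub[OF gi, of y z] that by (simp add: leb_integrable_iff[symmetric])
      show "integrable lebesgue (\<lambda>x. indicator {a<..<b} x * \<bar>g x\<bar>)"
        using gi by (simp add: leb_integrable_iff[symmetric])
    qed (use that in \<open>auto simp: indicator_def\<close>)
    finally show ?thesis .
  qed
  have c: "integrable (leb a b) (\<lambda>y. K)" "(LINT y|leb a b. K) = (b - a) * K" for K :: real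
  proof -
    show i: "integrable (leb a b) (\<lambda>y. K)" by (rule leb_continuous_integrable) simp
    show "(LINT y|leb a b. K) = (b - a) * K" using leb_eq_integral[OF i] assms(3) by simp
  qed
  have "(b - a) * \<bar>F x\<bar> = (LINT y|leb a b. \<bar>F x\<bar>)" by (rule c(2)[symmetric])
  also have "\<dots> \<le> (LINT y|leb a b. \<bar>F y\<bar> + (LINT y|leb a b. \<bar>g y\<bar>))"
  proof (rule integral_mono)
    fix y assume "y \<in> space (leb a b)"
    hence y: "a < y" "y < b" by auto
    show "\<bar>F x\<bar> \<le> \<bar>F y\<bar> + (LINT y|leb a b. \<bar>g y\<bar>)"
      using d[of x y] d[of y x] assms(2) y by (cases "x \<le> y") auto
  qed (use c Fi in auto)
  also have "\<dots> = (LINT y|leb a b. \<bar>F y\<bar>) + (b - a) * (LINT y|leb a b. \<bar>g y\<bar>)"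
    using c Fi by simp
  finally show ?thesis .
qed

section \<open>Bochner integrals in a semi-Hilbert space of functions\<close>

text \<open>Both value spaces of the problem, \<open>L\<^sup>2\<close> and X, carry an inner product. An element of norm 0 is
  recognised by its inner products, so that identities between Bochner integrals and between weak derivatives
  may be checked on scalar functions. Elements are functions, not classes, hence the seminorm.\<close>

locale semi_hilbert =
  fixes E :: "(real \<Rightarrow> real) set" and N :: "(real \<Rightarrow> real) \<Rightarrow> real"
    and ip :: "(real \<Rightarrow> real) \<Rightarrow> (real \<Rightarrow> real) \<Rightarrow> real"
  assumes zero_mem: "(\<lambda>_. 0) \<in> E"
    and lin_mem: "f \<in> E \<Longrightarrow> g \<in> E \<Longrightarrow> (\<lambda>x. r * f x + s * g x) \<in> E"
    and ip_sym: "f \<in> E \<Longrightarrow> g \<in> E \<Longrightarrow> ip f g = ip g f"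
    and ip_lin: "f \<in> E \<Longrightarrow> g \<in> E \<Longrightarrow> h \<in> E \<Longrightarrow> ip (\<lambda>x. r * f x + s * g x) h = r * ip f h + s * ip g h"
    and ip_nonneg: "f \<in> E \<Longrightarrow> 0 \<le> ip f f"
    and N_eq: "f \<in> E \<Longrightarrow> N f = sqrt (ip f f)"
    and complete: "\<And>\<sigma> :: nat \<Rightarrow> real \<Rightarrow> real. (\<And>n. \<sigma> n \<in> E) \<Longrightarrow>
        (\<And>e. e > 0 \<Longrightarrow> \<exists>M. \<forall>m\<ge>M. \<forall>n\<ge>M. N (\<lambda>x. \<sigma> m x - \<sigma> n x) < e) \<Longrightarrow>
        \<exists>l\<in>E. (\<lambda>n. N (\<lambda>x. \<sigma> n x - l x)) \<longlonglongrightarrow> 0"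
begin

lemma diff_mem: "f \<in> E \<Longrightarrow> g \<in> E \<Longrightarrow> (\<lambda>x. f x - g x) \<in> E"
  using lin_mem[of f g 1 "-1"] by simp

lemma add_mem: "f \<in> E \<Longrightarrow> g \<in> E \<Longrightarrow> (\<lambda>x. f x + g x) \<in> E"
  using lin_mem[of f g 1 1] by simp

lemma scale_mem: "f \<in> E \<Longrightarrow> (\<lambda>x. r * f x) \<in> E"
  using lin_mem[of f f r 0] by simp

lemma sum_mem: "finite A \<Longrightarrow> (\<And>e. e \<in> A \<Longrightarrow> h e \<in> E) \<Longrightarrow> (\<lambda>x. \<Sum>e\<in>A. c e * h e x) \<in> E"
  by (induction A rule: finite_induct) (auto intro!: zero_mem add_mem scale_mem)

lemma N_nonneg: "f \<in> E \<Longrightarrow> 0 \<le> N f"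
  by (simp add: N_eq ip_nonneg)

lemma N_sq: "f \<in> E \<Longrightarrow> N f * N f = ip f f"
  by (simp add: N_eq ip_nonneg)

definition bfunctional :: "((real \<Rightarrow> real) \<Rightarrow> real) \<Rightarrow> real \<Rightarrow> bool" where
  "bfunctional l C \<longleftrightarrow> 0 \<le> C \<and> (\<forall>f\<in>E. \<forall>g\<in>E. \<forall>r s. l (\<lambda>x. r * f x + s * g x) = r * l f + s * l g) \<and>
     (\<forall>f\<in>E. \<bar>l f\<bar> \<le> C * N f)"

lemma bfunctionalD:
  assumes "bfunctional l C"
  shows "0 \<le> C" "f \<in> E \<Longrightarrow> g \<in> E \<Longrightarrow> l (\<lambda>x. r * f x + s * g x) = r * l f + s * l g" "f \<in> E \<Longrightarrow> \<bar>l f\<bar> \<le> C * N f"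
    "f \<in> E \<Longrightarrow> g \<in> E \<Longrightarrow> l (\<lambda>x. f x - g x) = l f - l g" "f \<in> E \<Longrightarrow> l (\<lambda>x. r * f x) = r * l f"
    "f \<in> E \<Longrightarrow> g \<in> E \<Longrightarrow> l (\<lambda>x. f x + g x) = l f + l g"
proof -
  show *: "0 \<le> C" "\<And>r s. f \<in> E \<Longrightarrow> g \<in> E \<Longrightarrow> l (\<lambda>x. r * f x + s * g x) = r * l f + s * l g" "f \<in> E \<Longrightarrow> \<bar>l f\<bar> \<le> C * N f" for f g
    using assms unfolding bfunctional_def by blast+
  show "f \<in> E \<Longrightarrow> g \<in> E \<Longrightarrow> l (\<lambda>x. f x - g x) = l f - l g" using *(2)[of f g 1 "-1"] by simp
  show "f \<in> E \<Longrightarrow> g \<in> E \<Longrightarrow> l (\<lambda>x. f x + g x) = l f + l g" using *(2)[of f g 1 1] by simp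
  show "f \<in> E \<Longrightarrow> l (\<lambda>x. r * f x) = r * l f" using *(2)[of f f r 0] by simp
qed

lemma bfunctional_zero: "bfunctional l C \<Longrightarrow> l (\<lambda>x. 0) = 0"
  using bfunctionalD(5)[OF _ zero_mem, of l C 0] by simp

lemma bfunctional_sum:
  assumes "bfunctional l C" "finite A" "\<And>e. e \<in> A \<Longrightarrow> h e \<in> E"
  shows "l (\<lambda>x. \<Sum>e\<in>A. c e * h e x) = (\<Sum>e\<in>A. c e * l (h e))"
  using assms(2,3)
proof (induction A rule: finite_induct)
  case empty thus ?case using bfunctional_zero[OF assms(1)] by simp
next
  case (insert e A)
  have "l (\<lambda>x. c e * h e x + (\<Sum>e\<in>A. c e * h e x)) = l (\<lambda>x. c e * h e x) + l (\<lambda>x. \<Sum>e\<in>A. c e * h e x)"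
    using insert by (intro bfunctionalD(6)[OF assms(1)] scale_mem sum_mem) auto
  thus ?case using insert bfunctionalD(5)[OF assms(1), of "h e" "c e"] by simp
qed

lemma Cauchy_Schwarz:
  assumes "f \<in> E" "g \<in> E"
  shows "\<bar>ip f g\<bar> \<le> N f * N g"
proof -
  have q: "0 \<le> ip f f - 2 * t * ip f g + t * t * ip g g" for t
  proof -
    let ?h = "\<lambda>x. 1 * f x + (- t) * g x"
    have h: "?h \<in> E" by (rule lin_mem[OF assms])
    have "ip ?h ?h = ip f ?h - t * ip g ?h" using ip_lin[OF assms h, of 1 "-t"] by simp
    also have "ip f ?h = ip f f - t * ip f g"
      using ip_sym[OF assms(1) h] ip_lin[OF assms assms(1), of 1 "-t"] ip_sym[OF assms] by simp
    also have "ip g ?h = ip f g - t * ip g g"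
      using ip_sym[OF assms(2) h] ip_lin[OF assms assms(2), of 1 "-t"] by simp
    finally show ?thesis using ip_nonneg[OF h] by (simp add: algebra_simps)
  qed
  have "(ip f g)\<^sup>2 \<le> ip f f * ip g g"
  proof (cases "ip g g = 0")
    case True
    have "ip f g = 0"
    proof (rule ccontr)
      assume "ip f g \<noteq> 0"
      thus False using q[of "(ip f f + 1) / (2 * ip f g)"] True by simp
    qed
    thus ?thesis using True by simp
  next
    case False
    hence p: "ip g g > 0" using ip_nonneg[OF assms(2)] by simp
    have "0 \<le> ip f f - (ip f g)\<^sup>2 / ip g g"
      using q[of "ip f g / ip g g"] p by (simp add: power2_eq_square field_simps)
    thus ?thesis using p by (simp add: field_simps)
  qed
  hence "sqrt ((ip f g)\<^sup>2) \<le> sqrt (ip f f * ip g g)" by (rule real_sqrt_le_mono)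
  thus ?thesis using assms by (simp add: N_eq real_sqrt_mult)
qed

lemma bfunctional_ip:
  assumes "e \<in> E"
  shows "bfunctional (\<lambda>f. ip f e) (N e)"
  unfolding bfunctional_def
  using assms N_nonneg ip_lin Cauchy_Schwarz by (simp add: mult.commute)

lemma N_scale: "f \<in> E \<Longrightarrow> N (\<lambda>x. r * f x) = \<bar>r\<bar> * N f"
proof -
  assume f: "f \<in> E"
  have s: "(\<lambda>x. r * f x) \<in> E" by (rule scale_mem[OF f])
  have "ip (\<lambda>x. r * f x) (\<lambda>x. r * f x) = r * ip f (\<lambda>x. r * f x)" by (rule bfunctionalD(5)[OF bfunctional_ip[OF s] f])
  also have "ip f (\<lambda>x. r * f x) = r * ip f f"
    using ip_sym[OF f s] bfunctionalD(5)[OF bfunctional_ip[OF f] f, of r] by simp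
  finally have "ip (\<lambda>x. r * f x) (\<lambda>x. r * f x) = r\<^sup>2 * ip f f" by (simp add: power2_eq_square)
  thus ?thesis using f s by (simp add: N_eq real_sqrt_mult)
qed

lemma N_zero: "N (\<lambda>x. 0) = 0"
  using N_scale[OF zero_mem, of 0] by simp

lemma N_triangle:
  assumes "f \<in> E" "g \<in> E"
  shows "N (\<lambda>x. f x + g x) \<le> N f + N g"
proof -
  let ?h = "\<lambda>x. f x + g x"
  have h: "?h \<in> E" by (rule add_mem[OF assms])
  have "N ?h * N ?h = ip f ?h + ip g ?h" using N_sq[OF h] bfunctionalD(6)[OF bfunctional_ip[OF h] assms] by simp
  also have "\<dots> \<le> N f * N ?h + N g * N ?h"
    using Cauchy_Schwarz[OF assms(1) h] Cauchy_Schwarz[OF assms(2) h] by linarith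
  also have "\<dots> = (N f + N g) * N ?h" by (simp add: algebra_simps)
  finally have *: "N ?h * N ?h \<le> (N f + N g) * N ?h" .
  show ?thesis
  proof (cases "N ?h = 0")
    case True thus ?thesis using N_nonneg assms by (simp add: add_nonneg_nonneg)
  next
    case False
    hence "N ?h > 0" using N_nonneg[OF h] by simp
    thus ?thesis using * by simp
  qed
qed

lemma N_minus: "f \<in> E \<Longrightarrow> g \<in> E \<Longrightarrow> N (\<lambda>x. f x - g x) = N (\<lambda>x. g x - f x)"
  using N_scale[OF diff_mem, of g f "-1"] by simp

lemma N_triangle3:
  assumes "f \<in> E" "g \<in> E" "h \<in> E"
  shows "N (\<lambda>x. f x - h x) \<le> N (\<lambda>x. f x - g x) + N (\<lambda>x. g x - h x)"
  using N_triangle[OF diff_mem[OF assms(1,2)] diff_mem[OF assms(2,3)]] by simp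

lemma N_diff_le: "f \<in> E \<Longrightarrow> g \<in> E \<Longrightarrow> N (\<lambda>x. f x - g x) \<le> N f + N g"
  using N_triangle3[of f "\<lambda>x. 0" g] zero_mem N_minus[of "\<lambda>x. 0" g] by simp

lemma N_rev_triangle:
  assumes "f \<in> E" "g \<in> E"
  shows "\<bar>N f - N g\<bar> \<le> N (\<lambda>x. f x - g x)"
  using N_triangle[OF diff_mem[OF assms] assms(2)] N_triangle[OF diff_mem[OF assms(2,1)] assms(1)] N_minus[OF assms]
  by (simp add: abs_le_iff)

lemma N_zero_if_ip:
  assumes "f \<in> E" "\<And>e. e \<in> E \<Longrightarrow> ip f e = 0"
  shows "N f = 0"
  using N_eq[OF assms(1)] assms(2)[OF assms(1)] by simp

lemma N_zero_bfunctional: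
  assumes "bfunctional l C" "f \<in> E" "g \<in> E" "N (\<lambda>x. f x - g x) = 0"
  shows "l f = l g"
  using bfunctionalD(3)[OF assms(1) diff_mem[OF assms(2,3)]] bfunctionalD(4)[OF assms(1-3)] assms(4) by simp

lemma bfunctional_tendsto:
  assumes "bfunctional l C" "\<And>n. s n \<in> E" "f \<in> E" "((\<lambda>n. N (\<lambda>x. f x - s n x)) \<longlongrightarrow> 0) F"
  shows "((\<lambda>n. l (s n)) \<longlongrightarrow> l f) F"
proof -
  have "((\<lambda>n. C * N (\<lambda>x. f x - s n x)) \<longlongrightarrow> C * 0) F" by (intro tendsto_intros assms)
  hence lim: "((\<lambda>n. C * N (\<lambda>x. f x - s n x)) \<longlongrightarrow> 0) F" by simp
  have "((\<lambda>n. l f - l (s n)) \<longlongrightarrow> 0) F"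
  proof (rule Lim_null_comparison[OF _ lim], rule always_eventually, rule allI)
    fix n show "norm (l f - l (s n)) \<le> C * N (\<lambda>x. f x - s n x)"
      using bfunctionalD(3)[OF assms(1) diff_mem[OF assms(3,2)]] bfunctionalD(4)[OF assms(1,3,2)] by simp
  qed
  hence "((\<lambda>n. l f - (l f - l (s n))) \<longlongrightarrow> l f - 0) F" by (intro tendsto_intros)
  thus ?thesis by simp
qed

lemma N_tendsto:
  assumes "\<And>n. s n \<in> E" "f \<in> E" "((\<lambda>n. N (\<lambda>x. f x - s n x)) \<longlongrightarrow> 0) F"
  shows "((\<lambda>n. N (s n)) \<longlongrightarrow> N f) F"
proof -
  have "((\<lambda>n. N f - N (s n)) \<longlongrightarrow> 0) F"
    by (rule Lim_null_comparison[OF _ assms(3)], rule always_eventually, rule allI)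
       (use N_rev_triangle assms in auto)
  hence "((\<lambda>n. N f - (N f - N (s n))) \<longlongrightarrow> N f - 0) F" by (intro tendsto_intros)
  thus ?thesis by simp
qed

subsection \<open>Measurability\<close>

lemma bsimple_mem: "bsimple E a b s \<Longrightarrow> a < t \<Longrightarrow> t < b \<Longrightarrow> s t \<in> E"
  unfolding bsimple_def by simp

lemma bsimple_compose_measurable:
  fixes h :: "(real \<Rightarrow> real) \<Rightarrow> real"
  assumes "bsimple E a b s"
  shows "(\<lambda>t. h (s t)) \<in> borel_measurable (leb a b)"
  using assms borel_measurable_simple_function simple_function_compose1 unfolding bsimple_def by blast

lemma AE_interval: "AE t in leb a b. a < t \<and> t < b"
  unfolding AE_leb_iff by simp

lemma measurable_AE_limit:
  fixes f :: "nat \<Rightarrow> real \<Rightarrow> real"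
  assumes "\<And>n. f n \<in> borel_measurable (leb a b)" "AE t in leb a b. (\<lambda>n. f n t) \<longlonglongrightarrow> g t"
  shows "g \<in> borel_measurable (leb a b)"
proof (rule leb_measurable_cong_AE)
  show "(\<lambda>t. lim (\<lambda>n. f n t)) \<in> borel_measurable (leb a b)" using assms(1) by (rule borel_measurable_lim_metric)
  show "AE t in leb a b. lim (\<lambda>n. f n t) = g t" using assms(2) by (rule AE_mp) (auto intro!: limI)
qed

lemma bmeasurable_functional:
  assumes "bmeasurable E N a b v" "bfunctional l C"
  shows "(\<lambda>t. l (v t)) \<in> borel_measurable (leb a b)"
proof -
  obtain s where s: "\<And>n::nat. bsimple E a b (s n)" "AE t in leb a b. (\<lambda>n. N (\<lambda>x. v t x - s n t x)) \<longlonglongrightarrow> 0"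
    and v: "AE t in leb a b. v t \<in> E" using assms(1) unfolding bmeasurable_def by blast
  show ?thesis
  proof (rule measurable_AE_limit)
    show "(\<lambda>t. l (s n t)) \<in> borel_measurable (leb a b)" for n by (rule bsimple_compose_measurable[OF s(1)])
    from s(2) v AE_interval show "AE t in leb a b. (\<lambda>n. l (s n t)) \<longlonglongrightarrow> l (v t)"
    proof eventually_elim
      case (elim t)
      show ?case by (rule bfunctional_tendsto[OF assms(2) _ elim(2,1)]) (use elim bsimple_mem[OF s(1)] in blast)
    qed
  qed
qed

lemma bmeasurable_N:
  assumes "bmeasurable E N a b v"
  shows "(\<lambda>t. N (v t)) \<in> borel_measurable (leb a b)"
proof -
  obtain s where s: "\<And>n::nat. bsimple E a b (s n)" "AE t in leb a b. (\<lambda>n. N (\<lambda>x. v t x - s n t x)) \<longlonglongrightarrow> 0"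
    and v: "AE t in leb a b. v t \<in> E" using assms(1) unfolding bmeasurable_def by blast
  show ?thesis
  proof (rule measurable_AE_limit)
    show "(\<lambda>t. N (s n t)) \<in> borel_measurable (leb a b)" for n by (rule bsimple_compose_measurable[OF s(1)])
    from s(2) v AE_interval show "AE t in leb a b. (\<lambda>n. N (s n t)) \<longlonglongrightarrow> N (v t)"
    proof eventually_elim
      case (elim t)
      show ?case by (rule N_tendsto[OF _ elim(2,1)]) (use elim bsimple_mem[OF s(1)] in blast)
    qed
  qed
qed

lemma bmeasurable_mem: "bmeasurable E N a b v \<Longrightarrow> AE t in leb a b. v t \<in> E"
  unfolding bmeasurable_def by blast

lemma bmeasurable_linear:
  assumes "bmeasurable E N a b v" "bmeasurable E N a b w" "\<rho> \<in> borel_measurable (leb a b)" "\<sigma> \<in> borel_measurable (leb a b)"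
  shows "bmeasurable E N a b (\<lambda>t x. \<rho> t * v t x + \<sigma> t * w t x)"
proof -
  obtain s where s: "\<And>n::nat. bsimple E a b (s n)" "AE t in leb a b. (\<lambda>n. N (\<lambda>x. v t x - s n t x)) \<longlonglongrightarrow> 0"
    and v: "AE t in leb a b. v t \<in> E" using assms(1) unfolding bmeasurable_def by blast
  obtain s' where s': "\<And>n::nat. bsimple E a b (s' n)" "AE t in leb a b. (\<lambda>n. N (\<lambda>x. w t x - s' n t x)) \<longlonglongrightarrow> 0"
    and w: "AE t in leb a b. w t \<in> E" using assms(2) unfolding bmeasurable_def by blast
  obtain p where p: "\<And>n::nat. simple_function (leb a b) (p n)" "\<And>t. t \<in> space (leb a b) \<Longrightarrow> (\<lambda>n. p n t) \<longlonglongrightarrow> \<rho> t"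
    using borel_measurable_implies_sequence_metric[OF assms(3), of 0] by blast
  obtain q where q: "\<And>n::nat. simple_function (leb a b) (q n)" "\<And>t. t \<in> space (leb a b) \<Longrightarrow> (\<lambda>n. q n t) \<longlonglongrightarrow> \<sigma> t"
    using borel_measurable_implies_sequence_metric[OF assms(4), of 0] by blast
  define u where "u = (\<lambda>n t x. p n t * s n t x + q n t * s' n t x)"
  have bs: "bsimple E a b (u n)" for n
    unfolding bsimple_def
  proof (intro conjI ballI)
    have 1: "simple_function (leb a b) (\<lambda>t x. p n t * s n t x)"
      by (rule simple_function_compose2[where h="\<lambda>r f x. r * f x", OF p(1)]) (use s(1) in \<open>auto simp: bsimple_def\<close>)
    have 2: "simple_function (leb a b) (\<lambda>t x. q n t * s' n t x)"
      by (rule simple_function_compose2[where h="\<lambda>r f x. r * f x", OF q(1)]) (use s'(1) in \<open>auto simp: bsimple_def\<close>)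
    show "simple_function (leb a b) (u n)"
      unfolding u_def by (rule simple_function_compose2[where h="\<lambda>f g x. f x + g x", OF 1 2])
    fix t assume "t \<in> {a<..<b}"
    thus "u n t \<in> E" unfolding u_def using bsimple_mem[OF s(1)] bsimple_mem[OF s'(1)] by (intro lin_mem) auto
  qed
  from v w have "AE t in leb a b. (\<lambda>x. \<rho> t * v t x + \<sigma> t * w t x) \<in> E"
    by eventually_elim (rule lin_mem)
  moreover have "AE t in leb a b. (\<lambda>n. N (\<lambda>x. \<rho> t * v t x + \<sigma> t * w t x - u n t x)) \<longlonglongrightarrow> 0"
    using v w s(2) s'(2) AE_interval
  proof eventually_elim
    case (elim t)
    have sE: "s n t \<in> E" "s' n t \<in> E" for n using bsimple_mem[OF s(1)] bsimple_mem[OF s'(1)] elim by auto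
    have sp: "t \<in> space (leb a b)" using elim by simp
    have lim: "(\<lambda>n. (\<bar>\<rho> t - p n t\<bar> * N (v t) + \<bar>p n t\<bar> * N (\<lambda>x. v t x - s n t x)) +
            (\<bar>\<sigma> t - q n t\<bar> * N (w t) + \<bar>q n t\<bar> * N (\<lambda>x. w t x - s' n t x))) \<longlonglongrightarrow>
          (\<bar>\<rho> t - \<rho> t\<bar> * N (v t) + \<bar>\<rho> t\<bar> * 0) + (\<bar>\<sigma> t - \<sigma> t\<bar> * N (w t) + \<bar>\<sigma> t\<bar> * 0)"
      by (intro tendsto_intros p(2)[OF sp] q(2)[OF sp] elim)
    have d: "N (\<lambda>x. r * f x - r' * g x) \<le> \<bar>r - r'\<bar> * N f + \<bar>r'\<bar> * N (\<lambda>x. f x - g x)" if "f \<in> E" "g \<in> E" for r r' f g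
    proof -
      have "N (\<lambda>x. (r - r') * f x + r' * (f x - g x)) \<le> N (\<lambda>x. (r - r') * f x) + N (\<lambda>x. r' * (f x - g x))"
        by (rule N_triangle[OF scale_mem[OF that(1)] scale_mem[OF diff_mem[OF that]]])
      moreover have "(\<lambda>x. (r - r') * f x + r' * (f x - g x)) = (\<lambda>x. r * f x - r' * g x)" by (auto simp: algebra_simps)
      ultimately show ?thesis using N_scale[OF that(1), of "r - r'"] N_scale[OF diff_mem[OF that], of r'] by simp
    qed
    have mem: "(\<lambda>x. \<rho> t * v t x + \<sigma> t * w t x - u n t x) \<in> E" for n
      unfolding u_def by (intro diff_mem lin_mem elim sE)
    show ?case
    proof (rule Lim_null_comparison[OF always_eventually], rule allI)
      fix n
      have "N (\<lambda>x. (\<rho> t * v t x - p n t * s n t x) + (\<sigma> t * w t x - q n t * s' n t x))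
         \<le> N (\<lambda>x. \<rho> t * v t x - p n t * s n t x) + N (\<lambda>x. \<sigma> t * w t x - q n t * s' n t x)"
        by (intro N_triangle diff_mem scale_mem elim sE)
      moreover have "(\<lambda>x. (\<rho> t * v t x - p n t * s n t x) + (\<sigma> t * w t x - q n t * s' n t x)) =
        (\<lambda>x. \<rho> t * v t x + \<sigma> t * w t x - u n t x)" by (auto simp: u_def)
      ultimately show "norm (N (\<lambda>x. \<rho> t * v t x + \<sigma> t * w t x - u n t x)) \<le> (\<bar>\<rho> t - p n t\<bar> * N (v t) + \<bar>p n t\<bar> * N (\<lambda>x. v t x - s n t x)) +
            (\<bar>\<sigma> t - q n t\<bar> * N (w t) + \<bar>q n t\<bar> * N (\<lambda>x. w t x - s' n t x))"
        using d[OF elim(1) sE(1)[of n], of "\<rho> t" "p n t"] d[OF elim(2) sE(2)[of n], of "\<sigma> t" "q n t"] N_nonneg[OF mem[of n]] by simp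
      show "(\<lambda>n. (\<bar>\<rho> t - p n t\<bar> * N (v t) + \<bar>p n t\<bar> * N (\<lambda>x. v t x - s n t x)) +
            (\<bar>\<sigma> t - q n t\<bar> * N (w t) + \<bar>q n t\<bar> * N (\<lambda>x. w t x - s' n t x))) \<longlonglongrightarrow> 0" using lim by simp
    qed
  qed
  ultimately show ?thesis unfolding bmeasurable_def using bs by blast
qed

lemma bmeasurable_scale:
  assumes "bmeasurable E N a b v" "\<rho> \<in> borel_measurable (leb a b)"
  shows "bmeasurable E N a b (\<lambda>t x. \<rho> t * v t x)"
  using bmeasurable_linear[OF assms(1,1,2), of "\<lambda>_. 0"] by simp

lemma bmeasurable_diff:
  assumes "bmeasurable E N a b v" "bmeasurable E N a b w"
  shows "bmeasurable E N a b (\<lambda>t x. v t x - w t x)"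
  using bmeasurable_linear[OF assms, of "\<lambda>_. 1" "\<lambda>_. -1"] by simp

lemma bmeasurable_bsimple: "bsimple E a b s \<Longrightarrow> bmeasurable E N a b s"
  unfolding bmeasurable_def using bsimple_mem N_zero
  by (intro conjI exI[of _ "\<lambda>n. s"]) (auto simp: AE_leb_iff)

lemma bsimple_sub:
  assumes "bsimple E a b s" "a \<le> c" "d \<le> b"
  shows "bsimple E c d s"
  unfolding bsimple_def simple_function_def
proof (intro conjI ballI)
  have sub: "{c<..<d} \<subseteq> {a<..<b}" using assms by auto
  have f: "finite (s ` {a<..<b})" and m: "\<And>e. e \<in> s ` {a<..<b} \<Longrightarrow> s -` {e} \<inter> {a<..<b} \<in> sets (leb a b)"
    using assms(1) unfolding bsimple_def simple_function_def by auto
  show "finite (s ` space (leb c d))" using finite_subset[OF image_mono[OF sub] f] by simp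
  fix e assume e: "e \<in> s ` space (leb c d)"
  have "s -` {e} \<inter> {a<..<b} \<in> sets lebesgue" using m[of e] e sub sets_restrict_space_iff[of "{a<..<b}" lebesgue] by auto
  hence "(s -` {e} \<inter> {a<..<b}) \<inter> {c<..<d} \<in> sets lebesgue" by auto
  moreover have "(s -` {e} \<inter> {a<..<b}) \<inter> {c<..<d} = s -` {e} \<inter> space (leb c d)" using sub by auto
  ultimately show "s -` {e} \<inter> space (leb c d) \<in> sets (leb c d)" by (auto simp: sets_restrict_space)
next
  fix t assume "t \<in> {c<..<d}" thus "s t \<in> E" using bsimple_mem[OF assms(1)] assms by auto
qed

lemma bmeasurable_sub:
  assumes "bmeasurable E N a b v" "a \<le> c" "d \<le> b"
  shows "bmeasurable E N c d v"
proof -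
  obtain s where s: "\<And>n::nat. bsimple E a b (s n)" "AE t in leb a b. (\<lambda>n. N (\<lambda>x. v t x - s n t x)) \<longlonglongrightarrow> 0"
    and v: "AE t in leb a b. v t \<in> E" using assms(1) unfolding bmeasurable_def by blast
  show ?thesis unfolding bmeasurable_def
    using bsimple_sub[OF s(1) assms(2,3)] AE_leb_sub[OF s(2) assms(2,3)] AE_leb_sub[OF v assms(2,3)] by blast
qed

lemma bmeasurable_cong_AE:
  assumes "bmeasurable E N a b v" "AE t in leb a b. w t \<in> E \<and> N (\<lambda>x. v t x - w t x) = 0"
  shows "bmeasurable E N a b w"
proof -
  obtain s where s: "\<And>n::nat. bsimple E a b (s n)" "AE t in leb a b. (\<lambda>n. N (\<lambda>x. v t x - s n t x)) \<longlonglongrightarrow> 0"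
    and v: "AE t in leb a b. v t \<in> E" using assms(1) unfolding bmeasurable_def by blast
  have "AE t in leb a b. (\<lambda>n. N (\<lambda>x. w t x - s n t x)) \<longlonglongrightarrow> 0"
    using s(2) v assms(2) AE_interval
  proof eventually_elim
    case (elim t)
    have sE: "s n t \<in> E" for n using bsimple_mem[OF s(1)] elim by auto
    show ?case
    proof (rule Lim_null_comparison[OF always_eventually elim(1)], rule allI)
      fix n show "norm (N (\<lambda>x. w t x - s n t x)) \<le> N (\<lambda>x. v t x - s n t x)"
        using N_triangle3[of "w t" "v t" "s n t"] elim sE[of n] N_minus[of "w t" "v t"] N_nonneg[OF diff_mem[of "w t" "s n t"]] by auto
    qed
  qed
  moreover have "AE t in leb a b. w t \<in> E" using assms(2) by (rule AE_mp) simp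
  ultimately show ?thesis unfolding bmeasurable_def using s(1) by blast
qed

lemma bcontinuous_mem: "bcontinuous E N a b w \<Longrightarrow> a \<le> t \<Longrightarrow> t \<le> b \<Longrightarrow> w t \<in> E"
  unfolding bcontinuous_def by simp

lemma bcontinuous_N:
  assumes "bcontinuous E N a b w"
  shows "continuous_on {a..b} (\<lambda>t. N (w t))"
  unfolding continuous_on_def
proof
  fix t assume t: "t \<in> {a..b}"
  have lim: "((\<lambda>s. N (\<lambda>x. w s x - w t x)) \<longlongrightarrow> 0) (at t within {a..b})" using assms t unfolding bcontinuous_def by blast
  have "((\<lambda>s. N (w s) - N (w t)) \<longlongrightarrow> 0) (at t within {a..b})"
  proof (rule Lim_null_comparison[OF _ lim])
    have "norm (N (w s) - N (w t)) \<le> N (\<lambda>x. w s x - w t x)" if "s \<in> {a..b}" for s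
      using N_rev_triangle bcontinuous_mem[OF assms] that t by auto
    thus "eventually (\<lambda>s. norm (N (w s) - N (w t)) \<le> N (\<lambda>x. w s x - w t x)) (at t within {a..b})"
      by (auto simp: eventually_at_filter)
  qed
  thus "((\<lambda>s. N (w s)) \<longlongrightarrow> N (w t)) (at t within {a..b})" by (simp add: LIM_zero_iff)
qed

lemma bcontinuous_functional:
  assumes "bcontinuous E N a b w" "bfunctional l C"
  shows "continuous_on {a..b} (\<lambda>t. l (w t))"
  unfolding continuous_on_def
proof
  fix t assume t: "t \<in> {a..b}"
  have "((\<lambda>s. N (\<lambda>x. w s x - w t x)) \<longlongrightarrow> 0) (at t within {a..b})" using assms t unfolding bcontinuous_def by blast
  hence "((\<lambda>s. C * N (\<lambda>x. w s x - w t x)) \<longlongrightarrow> C * 0) (at t within {a..b})" by (intro tendsto_intros)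
  hence lim: "((\<lambda>s. C * N (\<lambda>x. w s x - w t x)) \<longlongrightarrow> 0) (at t within {a..b})" by simp
  have "((\<lambda>s. l (w s) - l (w t)) \<longlongrightarrow> 0) (at t within {a..b})"
  proof (rule Lim_null_comparison[OF _ lim])
    have "norm (l (w s) - l (w t)) \<le> C * N (\<lambda>x. w s x - w t x)" if "s \<in> {a..b}" for s
      using bfunctionalD(3)[OF assms(2) diff_mem] bfunctionalD(4)[OF assms(2)] bcontinuous_mem[OF assms(1)] that t
      by (metis atLeastAtMost_iff real_norm_def)
    thus "eventually (\<lambda>s. norm (l (w s) - l (w t)) \<le> C * N (\<lambda>x. w s x - w t x)) (at t within {a..b})"
      by (auto simp: eventually_at_filter)
  qed
  thus "((\<lambda>s. l (w s)) \<longlongrightarrow> l (w t)) (at t within {a..b})" by (simp add: LIM_zero_iff)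
qed

lemma bcontinuous_measurable:
  assumes "bcontinuous E N a b w" "a < b"
  shows "bmeasurable E N a b w"
proof -
  have "(\<lambda>t. t) \<in> borel_measurable (leb a b)" by (rule leb_continuous_measurable) simp
  then obtain p where p: "\<And>n::nat. simple_function (leb a b) (p n)" "\<And>t. t \<in> space (leb a b) \<Longrightarrow> (\<lambda>n. p n t) \<longlonglongrightarrow> t"
    using borel_measurable_implies_sequence_metric[of "\<lambda>t. t" "leb a b" 0] by blast
  define k where "k = (\<lambda>t. max a (min b t))"
  have k: "k t \<in> {a..b}" for t using assms(2) by (auto simp: k_def)
  have bs: "bsimple E a b (\<lambda>t. w (k (p n t)))" for n
    unfolding bsimple_def using k bcontinuous_mem[OF assms(1)]
    by (auto intro!: simple_function_compose1[OF p(1), where g="\<lambda>t. w (k t)", simplified])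
  have "AE t in leb a b. (\<lambda>n. N (\<lambda>x. w t x - w (k (p n t)) x)) \<longlonglongrightarrow> 0"
    using AE_interval
  proof eventually_elim
    case (elim t)
    hence t: "t \<in> {a..b}" by simp
    have "(\<lambda>n. k (p n t)) \<longlonglongrightarrow> k t" unfolding k_def using p(2)[of t] elim by (intro tendsto_intros) auto
    hence lk: "(\<lambda>n. k (p n t)) \<longlonglongrightarrow> t" using t by (auto simp: k_def)
    have "((\<lambda>s. N (\<lambda>x. w s x - w t x)) \<longlongrightarrow> 0) (at t within {a..b})" using assms t unfolding bcontinuous_def by blast
    hence "continuous (at t within {a..b}) (\<lambda>s. N (\<lambda>x. w s x - w t x))"
      unfolding continuous_within by (simp add: N_zero)
    hence "(\<lambda>n. N (\<lambda>x. w (k (p n t)) x - w t x)) \<longlonglongrightarrow> N (\<lambda>x. w t x - w t x)"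
      using continuous_within_tendsto_compose'[OF _ _ lk, of "{a..b}" "\<lambda>s. N (\<lambda>x. w s x - w t x)"] k by blast
    moreover have "N (\<lambda>x. w (k (p n t)) x - w t x) = N (\<lambda>x. w t x - w (k (p n t)) x)" for n
      using k[of "p n t"] t by (intro N_minus bcontinuous_mem[OF assms(1)]) auto
    ultimately show ?case by (simp add: N_zero)
  qed
  moreover have "AE t in leb a b. w t \<in> E"
    using AE_interval by eventually_elim (auto intro!: bcontinuous_mem[OF assms(1)])
  ultimately show ?thesis unfolding bmeasurable_def
    using bs by (intro conjI exI[of _ "\<lambda>n t. w (k (p n t))"]) auto
qed
end

context semi_hilbert begin

subsection \<open>The Bochner integral\<close>

lemma bsimple_integral_mem:
  assumes "bsimple E a b s"
  shows "bsimple_integral a b s \<in> E"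
proof -
  have "finite (s ` {a<..<b})" using assms unfolding bsimple_def simple_function_def by simp
  thus ?thesis unfolding bsimple_integral_def
    using assms by (intro sum_mem[where h="\<lambda>e. e"]) (auto simp: bsimple_def)
qed

lemma bsimple_integral_functional:
  assumes "bsimple E a b s" "bfunctional l C"
  shows "integrable (leb a b) (\<lambda>t. l (s t))" "(LINT t|leb a b. l (s t)) = l (bsimple_integral a b s)"
proof -
  let ?M = "leb a b"
  have sf: "simple_function ?M s" and f: "finite (s ` {a<..<b})"
    using assms unfolding bsimple_def simple_function_def by auto
  let ?A = "\<lambda>e. {t \<in> {a<..<b}. s t = e}"
  have A: "?A e \<in> sets ?M" if "e \<in> s ` {a<..<b}" for e
  proof -
    have "s -` {e} \<inter> space ?M \<in> sets ?M" using sf that unfolding simple_function_def by auto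
    moreover have "s -` {e} \<inter> space ?M = ?A e" by auto
    ultimately show ?thesis by simp
  qed
  have fin: "emeasure ?M (?A e) < \<infinity>" for e
    using finite_measure.emeasure_finite[OF finite_measure_leb] by (simp add: less_top[symmetric])
  have i: "integrable ?M (\<lambda>t. l e * indicator (?A e) t)" if "e \<in> s ` {a<..<b}" for e
    using A[OF that] fin by (intro integrable_mult_right integrable_real_indicator) auto
  have eq: "l (s t) = (\<Sum>e\<in>s ` {a<..<b}. l e * indicator (?A e) t)" if "t \<in> space ?M" for t
  proof -
    have "(\<Sum>e\<in>s ` {a<..<b}. l e * indicator (?A e) t) = (\<Sum>e\<in>s ` {a<..<b}. if e = s t then l e else 0)"
      using that by (intro sum.cong) (auto simp: indicator_def)
    also have "\<dots> = l (s t)" using f that by simp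
    finally show ?thesis by simp
  qed
  have ii: "integrable ?M (\<lambda>t. \<Sum>e\<in>s ` {a<..<b}. l e * indicator (?A e) t)"
    by (rule Bochner_Integration.integrable_sum) (rule i)
  show "integrable ?M (\<lambda>t. l (s t))"
    by (rule Bochner_Integration.integrable_cong[THEN iffD2, OF refl eq ii])
  have "(LINT t|?M. l (s t)) = (LINT t|?M. (\<Sum>e\<in>s ` {a<..<b}. l e * indicator (?A e) t))"
    by (rule Bochner_Integration.integral_cong[OF refl eq])
  also have "\<dots> = (\<Sum>e\<in>s ` {a<..<b}. (LINT t|?M. l e * indicator (?A e) t))"
    by (rule Bochner_Integration.integral_sum) (rule i)
  also have "\<dots> = (\<Sum>e\<in>s ` {a<..<b}. measure lebesgue (?A e) * l e)"
  proof (rule sum.cong[OF refl])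
    fix e assume e: "e \<in> s ` {a<..<b}"
    have "measure ?M (?A e) = measure lebesgue (?A e)" by (rule measure_restrict_space) auto
    thus "(LINT t|?M. l e * indicator (?A e) t) = measure lebesgue (?A e) * l e"
      using sets.sets_into_space[OF A[OF e]] by (simp add: Int_absorb2)
  qed
  also have "\<dots> = l (bsimple_integral a b s)"
    unfolding bsimple_integral_def
    by (rule bfunctional_sum[OF assms(2) f, where h="\<lambda>e. e", symmetric]) (use assms(1) in \<open>auto simp: bsimple_def\<close>)
  finally show "(LINT t|?M. l (s t)) = l (bsimple_integral a b s)" .
qed

lemma bmeasurable_integrable_functional:
  assumes "bmeasurable E N a b v" "integrable (leb a b) (\<lambda>t. N (v t))" "bfunctional l C"
  shows "integrable (leb a b) (\<lambda>t. l (v t))"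
proof (rule Bochner_Integration.integrable_bound)
  show "integrable (leb a b) (\<lambda>t. C * N (v t))" using assms(2) by simp
  show "(\<lambda>t. l (v t)) \<in> borel_measurable (leb a b)" by (rule bmeasurable_functional[OF assms(1,3)])
  show "AE t in leb a b. norm (l (v t)) \<le> norm (C * N (v t))"
    using bmeasurable_mem[OF assms(1)]
  proof eventually_elim
    case (elim t)
    have "\<bar>l (v t)\<bar> \<le> C * N (v t)" by (rule bfunctionalD(3)[OF assms(3) elim])
    also have "\<dots> \<le> \<bar>C * N (v t)\<bar>" by (rule abs_ge_self)
    finally show ?case by simp
  qed
qed

lemma bsimple_integrable_N:
  assumes "bsimple E a b s"
  shows "integrable (leb a b) (\<lambda>t. N (s t))"
proof -
  have f: "finite (s ` {a<..<b})" using assms unfolding bsimple_def simple_function_def by auto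
  show ?thesis
  proof (rule leb_integrable_bounded[OF bsimple_compose_measurable[OF assms]])
    fix t assume "a < t" "t < b"
    thus "\<bar>N (s t)\<bar> \<le> Max ((\<lambda>e. \<bar>N e\<bar>) ` s ` {a<..<b})" using f by (intro Max_ge) auto
  qed
qed

lemma has_bintegral_functional:
  assumes "has_bintegral E N a b v J" "bfunctional l C"
  shows "integrable (leb a b) (\<lambda>t. l (v t))" "(LINT t|leb a b. l (v t)) = l J"
    "integrable (leb a b) (\<lambda>t. N (v t))"
proof -
  obtain s where s: "\<And>n::nat. bsimple E a b (s n)"
    and lim: "(\<lambda>n. \<integral>\<^sup>+ t. ennreal (N (\<lambda>x. v t x - s n t x)) \<partial>leb a b) \<longlonglongrightarrow> 0"
      "(\<lambda>n. N (\<lambda>x. bsimple_integral a b (s n) x - J x)) \<longlonglongrightarrow> 0"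
    and v: "bmeasurable E N a b v" and J: "J \<in> E"
    using assms(1) unfolding has_bintegral_def by blast
  let ?d = "\<lambda>n t. N (\<lambda>x. v t x - s n t x)"
  have dm: "?d n \<in> borel_measurable (leb a b)" for n
    by (rule bmeasurable_N[OF bmeasurable_diff[OF v bmeasurable_bsimple[OF s]]])
  have mem: "AE t in leb a b. v t \<in> E \<and> (\<forall>n. s n t \<in> E)"
    using bmeasurable_mem[OF v] AE_interval by eventually_elim (use bsimple_mem[OF s] in blast)
  have dn: "AE t in leb a b. 0 \<le> ?d n t" for n
    using mem by eventually_elim (auto intro: N_nonneg diff_mem)
  have ev: "eventually (\<lambda>n. (\<integral>\<^sup>+ t. ennreal (?d n t) \<partial>leb a b) < \<infinity>) sequentially"
    using order_tendstoD(2)[OF lim(1), of 1] by (rule eventually_mono) (auto simp: ennreal_one_less_top order.strict_trans less_top[symmetric])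
  have di: "integrable (leb a b) (?d n)" if "(\<integral>\<^sup>+ t. ennreal (?d n t) \<partial>leb a b) < \<infinity>" for n
    by (rule integrableI_nonneg[OF dm dn that])
  obtain n0 where n0: "(\<integral>\<^sup>+ t. ennreal (?d n0 t) \<partial>leb a b) < \<infinity>"
    using eventually_happens[OF ev] by auto
  show Nv: "integrable (leb a b) (\<lambda>t. N (v t))"
  proof (rule Bochner_Integration.integrable_bound)
    show "integrable (leb a b) (\<lambda>t. N (s n0 t) + ?d n0 t)"
      by (rule Bochner_Integration.integrable_add[OF bsimple_integrable_N[OF s] di[OF n0]])
    show "(\<lambda>t. N (v t)) \<in> borel_measurable (leb a b)" by (rule bmeasurable_N[OF v])
    show "AE t in leb a b. norm (N (v t)) \<le> norm (N (s n0 t) + ?d n0 t)"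
      using mem
    proof eventually_elim
      case (elim t)
      have "N (v t) \<le> N (s n0 t) + ?d n0 t" using N_rev_triangle[of "v t" "s n0 t"] elim by auto
      moreover have "0 \<le> N (v t)" "0 \<le> N (s n0 t)" "0 \<le> ?d n0 t" using elim by (auto intro: N_nonneg diff_mem)
      ultimately show ?case by simp
    qed
  qed
  show lv: "integrable (leb a b) (\<lambda>t. l (v t))" by (rule bmeasurable_integrable_functional[OF v Nv assms(2)])
  have C: "0 \<le> C" by (rule bfunctionalD(1)[OF assms(2)])
  have bound: "ennreal (norm ((LINT t|leb a b. l (v t)) - l (bsimple_integral a b (s n)))) \<le>
      ennreal C * (\<integral>\<^sup>+ t. ennreal (?d n t) \<partial>leb a b)" for n
  proof -
    have ls: "integrable (leb a b) (\<lambda>t. l (s n t))" by (rule bsimple_integral_functional(1)[OF s assms(2)])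
    have "(LINT t|leb a b. l (v t)) - l (bsimple_integral a b (s n)) = (LINT t|leb a b. l (v t) - l (s n t))"
      using lv ls bsimple_integral_functional(2)[OF s assms(2)] by simp
    also have "ennreal (norm \<dots>) \<le> (\<integral>\<^sup>+ t. ennreal (norm (l (v t) - l (s n t))) \<partial>leb a b)"
      using lv ls by (intro integral_norm_bound_ennreal) auto
    also have "\<dots> \<le> (\<integral>\<^sup>+ t. ennreal C * ennreal (?d n t) \<partial>leb a b)"
    proof (rule nn_integral_mono_AE)
      show "AE t in leb a b. ennreal (norm (l (v t) - l (s n t))) \<le> ennreal C * ennreal (?d n t)"
        using mem
      proof eventually_elim
        case (elim t)
        have sE: "v t \<in> E" "s n t \<in> E" using elim by auto
        have "norm (l (v t) - l (s n t)) \<le> C * ?d n t"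
          using bfunctionalD(3)[OF assms(2) diff_mem[OF sE]] bfunctionalD(4)[OF assms(2) sE] by simp
        thus ?case using C N_nonneg[OF diff_mem[OF sE]] by (simp add: ennreal_mult[symmetric] ennreal_leI)
      qed
    qed
    also have "\<dots> = ennreal C * (\<integral>\<^sup>+ t. ennreal (?d n t) \<partial>leb a b)"
      using dm[of n] by (intro nn_integral_cmult) auto
    finally show ?thesis .
  qed
  have "(\<lambda>n. ennreal C * (\<integral>\<^sup>+ t. ennreal (?d n t) \<partial>leb a b)) \<longlonglongrightarrow> ennreal C * 0"
    by (rule ennreal_tendsto_cmult[OF _ lim(1)]) simp
  hence lim0: "(\<lambda>n. ennreal C * (\<integral>\<^sup>+ t. ennreal (?d n t) \<partial>leb a b)) \<longlonglongrightarrow> 0" by simp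
  have "(\<lambda>n. ennreal (norm ((LINT t|leb a b. l (v t)) - l (bsimple_integral a b (s n))))) \<longlonglongrightarrow> 0"
  proof (rule tendsto_sandwich[OF _ _ tendsto_const lim0])
    show "eventually (\<lambda>n. ennreal (norm ((LINT t|leb a b. l (v t)) - l (bsimple_integral a b (s n))))
        \<le> ennreal C * (\<integral>\<^sup>+ t. ennreal (?d n t) \<partial>leb a b)) sequentially"
      by (rule always_eventually, rule allI, rule bound)
  qed simp
  hence "(\<lambda>n. norm ((LINT t|leb a b. l (v t)) - l (bsimple_integral a b (s n)))) \<longlonglongrightarrow> 0"
    by (subst (asm) ennreal_tendsto_0_iff) auto
  hence "(\<lambda>n. (LINT t|leb a b. l (v t)) - l (bsimple_integral a b (s n))) \<longlonglongrightarrow> 0"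
    by (rule tendsto_norm_zero_cancel)
  hence 1: "(\<lambda>n. (LINT t|leb a b. l (v t)) - ((LINT t|leb a b. l (v t)) - l (bsimple_integral a b (s n)))) \<longlonglongrightarrow> (LINT t|leb a b. l (v t)) - 0"
    by (intro tendsto_intros)
  have "(\<lambda>n. N (\<lambda>x. J x - bsimple_integral a b (s n) x)) \<longlonglongrightarrow> 0"
    using lim(2) by (subst N_minus[OF J bsimple_integral_mem[OF s]])
  hence "(\<lambda>n. l (bsimple_integral a b (s n))) \<longlonglongrightarrow> l J"
    by (rule bfunctional_tendsto[OF assms(2) bsimple_integral_mem[OF s] J])
  with 1 show "(LINT t|leb a b. l (v t)) = l J" using LIMSEQ_unique by fastforce
qed

lemma has_bintegral_D:
  assumes "has_bintegral E N a b v J"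
  shows "bmeasurable E N a b v" "J \<in> E" "integrable (leb a b) (\<lambda>t. N (v t))"
  using assms has_bintegral_functional(3)[OF assms bfunctional_ip[OF zero_mem]] unfolding has_bintegral_def by blast+

text \<open>Truncating approximating simple functions where their norm exceeds twice that of \<open>v\<close> makes
  them dominated, and completeness of the space provides the limit of their integrals.\<close>

lemma has_bintegral_exists:
  assumes v: "bmeasurable E N a b v" and Nv: "integrable (leb a b) (\<lambda>t. N (v t))"
  shows "\<exists>J. has_bintegral E N a b v J"
proof -
  obtain s where s: "\<And>n::nat. bsimple E a b (s n)" "AE t in leb a b. (\<lambda>n. N (\<lambda>x. v t x - s n t x)) \<longlonglongrightarrow> 0"
    using v unfolding bmeasurable_def by blast
  define s' where "s' = (\<lambda>n t. if N (s n t) \<le> 2 * N (v t) then s n t else (\<lambda>_. 0))"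
  have bs: "bsimple E a b (s' n)" for n
    unfolding bsimple_def
  proof (intro conjI ballI)
    have m: "(\<lambda>t. 2 * N (v t) - N (s n t)) \<in> borel_measurable (leb a b)"
      using bmeasurable_N[OF v] bsimple_compose_measurable[OF s(1), of N n] by auto
    have "{t \<in> space (leb a b). 0 \<le> 2 * N (v t) - N (s n t)} \<in> sets (leb a b)"
      by (rule borel_measurable_le[OF borel_measurable_const m])
    thus "simple_function (leb a b) (s' n)"
      unfolding s'_def using s(1)[of n] by (intro simple_function_If) (auto simp: bsimple_def)
    fix t assume "t \<in> {a<..<b}"
    thus "s' n t \<in> E" unfolding s'_def using bsimple_mem[OF s(1)] zero_mem by auto
  qed
  let ?d = "\<lambda>n t. N (\<lambda>x. v t x - s' n t x)"
  have mem: "AE t in leb a b. v t \<in> E \<and> (\<forall>n. s' n t \<in> E \<and> s n t \<in> E)"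
    using bmeasurable_mem[OF v] AE_interval
    by eventually_elim (use bsimple_mem[OF bs] bsimple_mem[OF s(1)] in blast)
  have dm: "?d n \<in> borel_measurable (leb a b)" for n
    by (rule bmeasurable_N[OF bmeasurable_diff[OF v bmeasurable_bsimple[OF bs]]])
  have d3: "AE t in leb a b. \<forall>n. 0 \<le> ?d n t \<and> ?d n t \<le> 3 * N (v t)"
    using mem
  proof eventually_elim
    case (elim t)
    show ?case
    proof
      fix n
      have E: "v t \<in> E" "s' n t \<in> E" using elim by auto
      have "N (s' n t) \<le> 2 * N (v t)" using N_nonneg[OF E(1)] by (simp add: s'_def N_zero)
      thus "0 \<le> ?d n t \<and> ?d n t \<le> 3 * N (v t)" using N_diff_le[OF E] N_nonneg[OF diff_mem[OF E]] by simp
    qed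
  qed
  have d0: "AE t in leb a b. (\<lambda>n. ?d n t) \<longlonglongrightarrow> 0"
    using mem s(2)
  proof eventually_elim
    case (elim t)
    have vE: "v t \<in> E" and sE: "\<And>n. s n t \<in> E" using elim by auto
    show ?case
    proof (cases "N (v t) = 0")
      case True
      have "?d n t = 0" for n
      proof -
        have "?d n t \<le> N (v t) + N (s' n t)" using N_diff_le elim by blast
        moreover have "N (s' n t) \<le> 0" using True by (simp add: s'_def N_zero)
        moreover have "0 \<le> ?d n t" using elim N_nonneg diff_mem by blast
        ultimately show ?thesis using True by simp
      qed
      thus ?thesis by simp
    next
      case False
      hence p: "N (v t) > 0" using N_nonneg[OF vE] by simp
      have "(\<lambda>n. N (s n t)) \<longlonglongrightarrow> N (v t)" by (rule N_tendsto[OF sE vE elim(2)])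
      hence "eventually (\<lambda>n. N (s n t) < 2 * N (v t)) sequentially" by (rule order_tendstoD(2)) (use p in simp)
      hence "eventually (\<lambda>n. N (\<lambda>x. v t x - s n t x) = ?d n t) sequentially"
        by (rule eventually_mono) (simp add: s'_def)
      from tendsto_cong[OF this] elim(2) show ?thesis by simp
    qed
  qed
  have "(\<lambda>n. \<integral>\<^sup>+ t. ennreal (?d n t) \<partial>leb a b) \<longlonglongrightarrow> (\<integral>\<^sup>+ t. 0 \<partial>leb a b)"
  proof (rule nn_integral_dominated_convergence[where w="\<lambda>t. ennreal (3 * N (v t))"])
    show "(\<lambda>t. ennreal (?d n t)) \<in> borel_measurable (leb a b)" for n using dm[of n] by simp
    show "(\<lambda>t. ennreal (3 * N (v t))) \<in> borel_measurable (leb a b)" using bmeasurable_N[OF v] by simp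
    show "AE t in leb a b. ennreal (?d n t) \<le> ennreal (3 * N (v t))" for n
      using d3 by eventually_elim (auto intro: ennreal_leI)
    have "integrable (leb a b) (\<lambda>t. 3 * N (v t))" using Nv by simp
    from integrableD(2)[OF this] show "(\<integral>\<^sup>+ t. ennreal (3 * N (v t)) \<partial>leb a b) < \<infinity>"
      by (simp only: less_top infinity_ennreal_def)
    show "AE t in leb a b. (\<lambda>n. ennreal (?d n t)) \<longlonglongrightarrow> 0"
      using d0 by eventually_elim (auto dest: tendsto_ennrealI)
  qed simp_all
  hence lim1: "(\<lambda>n. \<integral>\<^sup>+ t. ennreal (?d n t) \<partial>leb a b) \<longlonglongrightarrow> 0" by simp
  have di: "integrable (leb a b) (?d n)" for n
  proof (rule Bochner_Integration.integrable_bound)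
    show "integrable (leb a b) (\<lambda>t. 3 * N (v t))" using Nv by simp
    show "AE t in leb a b. norm (?d n t) \<le> norm (3 * N (v t))"
      using d3
    proof eventually_elim
      case (elim t)
      from elim[rule_format, of n] show ?case by simp
    qed
  qed (rule dm)
  define r where "r = (\<lambda>n. LINT t|leb a b. ?d n t)"
  have r0: "r n \<ge> 0" for n unfolding r_def by (rule integral_nonneg_AE) (use d3 in \<open>eventually_elim, blast\<close>)
  have re: "ennreal (r n) = (\<integral>\<^sup>+ t. ennreal (?d n t) \<partial>leb a b)" for n
    unfolding r_def by (rule nn_integral_eq_integral[symmetric, OF di]) (use d3 in \<open>eventually_elim, blast\<close>)
  have "r \<longlonglongrightarrow> 0" using lim1 unfolding re[symmetric] by (subst (asm) ennreal_tendsto_0_iff[OF r0])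
  let ?I = "\<lambda>n. bsimple_integral a b (s' n)"
  have IE: "?I n \<in> E" for n by (rule bsimple_integral_mem[OF bs])
  have ID: "N (\<lambda>x. ?I m x - ?I n x) \<le> r m + r n" for m n
  proof -
    let ?D = "\<lambda>x. ?I m x - ?I n x"
    have D: "?D \<in> E" by (rule diff_mem[OF IE IE])
    note B = bfunctional_ip[OF D]
    note im = bsimple_integral_functional[OF bs[of m] B] and iN = bsimple_integral_functional[OF bs[of n] B]
    have "N ?D * N ?D = ip (?I m) ?D - ip (?I n) ?D"
      using N_sq[OF D] bfunctionalD(4)[OF B IE IE, of m n] by simp
    also have "\<dots> = (LINT t|leb a b. ip (s' m t) ?D - ip (s' n t) ?D)" using im iN by simp
    also have "\<dots> \<le> (LINT t|leb a b. N ?D * (?d m t + ?d n t))"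
    proof (rule integral_mono_AE)
      show "AE t in leb a b. ip (s' m t) ?D - ip (s' n t) ?D \<le> N ?D * (?d m t + ?d n t)"
        using mem
      proof eventually_elim
        case (elim t)
        have E: "v t \<in> E" "s' m t \<in> E" "s' n t \<in> E" using elim by auto
        have "ip (s' m t) ?D - ip (s' n t) ?D = ip (\<lambda>x. s' m t x - s' n t x) ?D"
          using bfunctionalD(4)[OF B E(2,3)] by simp
        also have "\<dots> \<le> N ?D * N (\<lambda>x. s' m t x - s' n t x)"
          using Cauchy_Schwarz[OF diff_mem[OF E(2,3)] D] by (simp add: mult.commute)
        also have "\<dots> \<le> N ?D * (?d m t + ?d n t)"
          using N_triangle3[OF E(2,1,3)] N_minus[OF E(2,1)] N_nonneg[OF D] by (intro mult_left_mono) auto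
        finally show ?case .
      qed
    qed (use im iN di in auto)
    also have "\<dots> = N ?D * (r m + r n)" unfolding r_def using di by simp
    finally have *: "N ?D * N ?D \<le> N ?D * (r m + r n)" .
    show ?thesis
    proof (cases "N ?D = 0")
      case True thus ?thesis using r0 by (simp add: add_nonneg_nonneg)
    next
      case False
      hence "N ?D > 0" using N_nonneg[OF D] by simp
      thus ?thesis using * by simp
    qed
  qed
  have "\<exists>l\<in>E. (\<lambda>n. N (\<lambda>x. ?I n x - l x)) \<longlonglongrightarrow> 0"
  proof (rule complete[OF IE])
    fix e :: real assume "e > 0"
    hence "eventually (\<lambda>n. r n < e / 2) sequentially" using order_tendstoD(2)[OF \<open>r \<longlonglongrightarrow> 0\<close>, of "e/2"] by simp
    then obtain M where M: "\<And>n. n \<ge> M \<Longrightarrow> r n < e / 2" unfolding eventually_sequentially by blast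
    have "N (\<lambda>x. ?I m x - ?I n x) < e" if "m \<ge> M" "n \<ge> M" for m n
      using ID[of m n] M[OF that(1)] M[OF that(2)] by linarith
    thus "\<exists>M. \<forall>m\<ge>M. \<forall>n\<ge>M. N (\<lambda>x. ?I m x - ?I n x) < e" by blast
  qed
  then obtain J where "J \<in> E" "(\<lambda>n. N (\<lambda>x. ?I n x - J x)) \<longlonglongrightarrow> 0" by blast
  thus ?thesis unfolding has_bintegral_def using v bs lim1 by blast
qed

text \<open>Some integral exists, and inner products identify it up to norm 0.\<close>

lemma has_bintegralI:
  assumes "bmeasurable E N a b v" "integrable (leb a b) (\<lambda>t. N (v t))" "J \<in> E"
    and "\<And>e. e \<in> E \<Longrightarrow> (LINT t|leb a b. ip (v t) e) = ip J e"
  shows "has_bintegral E N a b v J"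
proof -
  obtain J' where J': "has_bintegral E N a b v J'" using has_bintegral_exists[OF assms(1,2)] by blast
  then obtain s where s: "\<And>n::nat. bsimple E a b (s n)"
    and lim: "(\<lambda>n. \<integral>\<^sup>+ t. ennreal (N (\<lambda>x. v t x - s n t x)) \<partial>leb a b) \<longlonglongrightarrow> 0"
      "(\<lambda>n. N (\<lambda>x. bsimple_integral a b (s n) x - J' x)) \<longlonglongrightarrow> 0" and J'E: "J' \<in> E"
    unfolding has_bintegral_def by blast
  have z: "N (\<lambda>x. J' x - J x) = 0"
  proof (rule N_zero_if_ip[OF diff_mem[OF J'E assms(3)]])
    fix e assume e: "e \<in> E"
    show "ip (\<lambda>x. J' x - J x) e = 0"
      using bfunctionalD(4)[OF bfunctional_ip[OF e] J'E assms(3)] has_bintegral_functional(2)[OF J' bfunctional_ip[OF e]] assms(4)[OF e] by simp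
  qed
  have "(\<lambda>n. N (\<lambda>x. bsimple_integral a b (s n) x - J x)) \<longlonglongrightarrow> 0"
  proof (rule Lim_null_comparison[OF always_eventually lim(2)], rule allI)
    fix n
    have I: "bsimple_integral a b (s n) \<in> E" by (rule bsimple_integral_mem[OF s])
    show "norm (N (\<lambda>x. bsimple_integral a b (s n) x - J x)) \<le> N (\<lambda>x. bsimple_integral a b (s n) x - J' x)"
      using N_triangle3[OF I J'E assms(3)] z N_nonneg[OF diff_mem[OF I assms(3)]] by simp
  qed
  thus ?thesis unfolding has_bintegral_def using assms(1,3) s lim(1) by blast
qed

lemma has_bintegral_cong_AE:
  assumes "has_bintegral E N a b v J" "AE t in leb a b. w t \<in> E \<and> N (\<lambda>x. v t x - w t x) = 0"
  shows "has_bintegral E N a b w J"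
proof (rule has_bintegralI[OF bmeasurable_cong_AE[OF has_bintegral_D(1)[OF assms(1)] assms(2)] _ has_bintegral_D(2)[OF assms(1)]])
  have vE: "AE t in leb a b. v t \<in> E" by (rule bmeasurable_mem[OF has_bintegral_D(1)[OF assms(1)]])
  have l: "AE t in leb a b. l (v t) = l (w t)" if "bfunctional l C" for l C
    using vE assms(2) by eventually_elim (use N_zero_bfunctional[OF that] in blast)
  have Ne: "AE t in leb a b. N (v t) = N (w t)"
    using vE assms(2) by eventually_elim (use N_rev_triangle in force)
  show "integrable (leb a b) (\<lambda>t. N (w t))" by (rule leb_integrable_cong_AE[OF has_bintegral_D(3)[OF assms(1)] Ne])
  fix e assume e: "e \<in> E"
  have "(LINT t|leb a b. ip (w t) e) = (LINT t|leb a b. ip (v t) e)"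
    by (rule leb_integral_cong_AE[OF AE_eq_sym[OF l[OF bfunctional_ip[OF e]]]])
  also have "\<dots> = ip J e" by (rule has_bintegral_functional(2)[OF assms(1) bfunctional_ip[OF e]])
  finally show "(LINT t|leb a b. ip (w t) e) = ip J e" .
qed

lemma has_bintegral_bound:
  assumes "has_bintegral E N a b v J" "AE t in leb a b. N (v t) \<le> g t" "integrable (leb a b) g"
  shows "N J \<le> (LINT t|leb a b. g t)"
proof -
  have J: "J \<in> E" by (rule has_bintegral_D(2)[OF assms(1)])
  note B = bfunctional_ip[OF J]
  have vE: "AE t in leb a b. v t \<in> E" by (rule bmeasurable_mem[OF has_bintegral_D(1)[OF assms(1)]])
  have g0: "AE t in leb a b. 0 \<le> g t" using vE assms(2) by eventually_elim (use N_nonneg in fastforce)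
  have "N J * N J = (LINT t|leb a b. ip (v t) J)"
    using N_sq[OF J] has_bintegral_functional(2)[OF assms(1) B] by simp
  also have "\<dots> \<le> (LINT t|leb a b. N J * g t)"
  proof (rule integral_mono_AE[OF has_bintegral_functional(1)[OF assms(1) B]])
    show "integrable (leb a b) (\<lambda>t. N J * g t)" using assms(3) by simp
    show "AE t in leb a b. ip (v t) J \<le> N J * g t"
      using vE assms(2)
    proof eventually_elim
      case (elim t)
      have "ip (v t) J \<le> N J * N (v t)" using Cauchy_Schwarz[OF elim(1) J] by (simp add: mult.commute)
      also have "\<dots> \<le> N J * g t" using elim(2) N_nonneg[OF J] by (rule mult_left_mono)
      finally show ?case .
    qed
  qed
  also have "\<dots> = N J * (LINT t|leb a b. g t)" by simp
  finally have *: "N J * N J \<le> N J * (LINT t|leb a b. g t)" .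
  show ?thesis
  proof (cases "N J = 0")
    case True
    have "0 \<le> (LINT t|leb a b. g t)" by (rule integral_nonneg_AE[OF g0])
    thus ?thesis using True by simp
  next
    case False
    hence "N J > 0" using N_nonneg[OF J] by simp
    thus ?thesis using * by simp
  qed
qed

text \<open>The exceptional null sets depend on e. The approximating simple functions have countably many values in
  total, so one null set serves all e that matter, and u is a limit of such values.\<close>

lemma AE_N_zero:
  assumes "bmeasurable E N a b u" "\<And>e. e \<in> E \<Longrightarrow> AE t in leb a b. ip (u t) e = 0"
  shows "AE t in leb a b. N (u t) = 0"
proof -
  obtain s where s: "\<And>n::nat. bsimple E a b (s n)" "AE t in leb a b. (\<lambda>n. N (\<lambda>x. u t x - s n t x)) \<longlonglongrightarrow> 0"
    and uE: "AE t in leb a b. u t \<in> E" using assms(1) unfolding bmeasurable_def by blast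
  define D where "D = (\<Union>n. s n ` {a<..<b})"
  have "finite (s n ` {a<..<b})" for n using s(1)[of n] unfolding bsimple_def simple_function_def by simp
  hence cD: "countable D" unfolding D_def by (intro countable_UN) (auto intro: countable_finite)
  have DE: "D \<subseteq> E" unfolding D_def using bsimple_mem[OF s(1)] by auto
  have "AE t in leb a b. \<forall>e\<in>D. ip (u t) e = 0"
    using assms(2) DE cD by (intro AE_ball_countable') auto
  thus ?thesis using s(2) uE AE_interval
  proof eventually_elim
    case (elim t)
    have sD: "s n t \<in> D" for n unfolding D_def using elim by (intro UN_I[of n]) auto
    have "(\<lambda>n. ip (s n t) (u t)) \<longlonglongrightarrow> ip (u t) (u t)"
      by (rule bfunctional_tendsto[OF bfunctional_ip[OF elim(3)] _ elim(3,2)]) (use sD DE in blast)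
    moreover have "ip (s n t) (u t) = 0" for n using elim(1) sD[of n] ip_sym[OF elim(3), of "s n t"] DE by auto
    ultimately have "ip (u t) (u t) = 0" by (simp add: LIMSEQ_const_iff)
    thus ?case using N_eq[OF elim(3)] by simp
  qed
qed
end

lemma integral_mult_pull:
  fixes \<eta> h :: "'a \<Rightarrow> real"
  shows "(LINT t|M. c * \<eta> t * h t) = c * (LINT t|M. h t * \<eta> t)"
proof -
  have "(\<lambda>t. c * \<eta> t * h t) = (\<lambda>t. c * (h t * \<eta> t))" by (simp add: fun_eq_iff)
  thus ?thesis by simp
qed

context semi_hilbert begin

subsection \<open>Weak derivatives in time\<close>

lemma bL2_D:
  assumes "v \<in> bL2 E N a b"
  shows "bmeasurable E N a b v" "integrable (leb a b) (\<lambda>t. N (v t))"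
proof -
  show m: "bmeasurable E N a b v" using assms by (simp add: bL2_def)
  have "(\<lambda>t. N (v t)) \<in> L2 a b" unfolding L2_def using assms bmeasurable_N[OF m] by (simp add: bL2_def)
  thus "integrable (leb a b) (\<lambda>t. N (v t))" by (rule L2_integrable)
qed

lemma bcontinuous_integrable:
  assumes "bcontinuous E N a b v" "a < b"
  shows "bmeasurable E N a b v" "integrable (leb a b) (\<lambda>t. N (v t))" "v \<in> bL2 E N a b"
proof -
  show m: "bmeasurable E N a b v" by (rule bcontinuous_measurable[OF assms])
  show "integrable (leb a b) (\<lambda>t. N (v t))" by (rule leb_continuous_integrable[OF bcontinuous_N[OF assms(1)]])
  have "(\<lambda>t. N (v t)) \<in> L2 a b" by (rule continuous_L2[OF bcontinuous_N[OF assms(1)]])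
  thus "v \<in> bL2 E N a b" using m by (simp add: bL2_def L2_def)
qed

lemma integrable_N_scale:
  assumes "bmeasurable E N a b v" "integrable (leb a b) (\<lambda>t. N (v t))" "continuous_on {a..b} \<eta>"
  shows "bmeasurable E N a b (\<lambda>t x. \<eta> t * v t x)" "integrable (leb a b) (\<lambda>t. N (\<lambda>x. \<eta> t * v t x))"
proof -
  show "bmeasurable E N a b (\<lambda>t x. \<eta> t * v t x)"
    by (rule bmeasurable_scale[OF assms(1) leb_continuous_measurable[OF assms(3)]])
  have "integrable (leb a b) (\<lambda>t. N (v t) * \<bar>\<eta> t\<bar>)"
    by (rule bounded_mult_integrable[OF assms(2)]) (intro continuous_intros assms(3))
  moreover have "AE t in leb a b. N (v t) * \<bar>\<eta> t\<bar> = N (\<lambda>x. \<eta> t * v t x)"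
    using bmeasurable_mem[OF assms(1)] by eventually_elim (simp add: N_scale mult.commute)
  ultimately show "integrable (leb a b) (\<lambda>t. N (\<lambda>x. \<eta> t * v t x))" by (rule leb_integrable_cong_AE)
qed

lemma functional_scale_integral:
  assumes "bmeasurable E N a b v" "bfunctional l C"
  shows "(LINT t|leb a b. l (\<lambda>x. \<eta> t * v t x)) = (LINT t|leb a b. \<eta> t * l (v t))"
proof (rule leb_integral_cong_AE)
  show "AE t in leb a b. l (\<lambda>x. \<eta> t * v t x) = \<eta> t * l (v t)"
    using bmeasurable_mem[OF assms(1)] by eventually_elim (rule bfunctionalD(5)[OF assms(2)])
qed

lemma bweak_deriv_functional:
  assumes "has_bweak_deriv E N a b n v w" "bmeasurable E N a b v" "integrable (leb a b) (\<lambda>t. N (v t))"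
    "bmeasurable E N a b w" "integrable (leb a b) (\<lambda>t. N (w t))" "bfunctional l C"
  shows "has_weak_deriv a b n (\<lambda>t. l (v t)) (\<lambda>t. l (w t))"
  unfolding has_weak_deriv_def
proof (intro conjI ballI)
  show "locally_integrable a b (\<lambda>t. l (v t))" "locally_integrable a b (\<lambda>t. l (w t))"
    using bmeasurable_integrable_functional[OF _ _ assms(6)] assms integrable_imp_locally_integrable by blast+
  fix \<eta> assume \<eta>: "\<eta> \<in> test_functions a b"
  then obtain J where J: "has_bintegral E N a b (\<lambda>t x. (deriv ^^ n) \<eta> t * v t x) J"
      "has_bintegral E N a b (\<lambda>t x. (-1) ^ n * \<eta> t * w t x) J"
    using assms(1) unfolding has_bweak_deriv_def by blast
  have "(LINT t|leb a b. (deriv ^^ n) \<eta> t * l (v t)) = (LINT t|leb a b. (-1) ^ n * \<eta> t * l (w t))"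
    using has_bintegral_functional(2)[OF J(1) assms(6)] has_bintegral_functional(2)[OF J(2) assms(6)]
      functional_scale_integral[OF assms(2,6)] functional_scale_integral[OF assms(4,6), of "\<lambda>t. (-1) ^ n * \<eta> t"] by simp
  thus "(LINT t|leb a b. l (v t) * (deriv ^^ n) \<eta> t) = (-1) ^ n * (LINT t|leb a b. l (w t) * \<eta> t)"
    unfolding integral_mult_pull by (simp add: mult.commute)
qed

text \<open>The integrals in the definition exist by absolute integrability; they agree because all their inner
  products do.\<close>

lemma bweak_derivI:
  assumes "bmeasurable E N a b v" "integrable (leb a b) (\<lambda>t. N (v t))"
    "bmeasurable E N a b w" "integrable (leb a b) (\<lambda>t. N (w t))"
    and d: "\<And>e. e \<in> E \<Longrightarrow> has_weak_deriv a b n (\<lambda>t. ip (v t) e) (\<lambda>t. ip (w t) e)"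
  shows "has_bweak_deriv E N a b n v w"
  unfolding has_bweak_deriv_def
proof
  fix \<eta> assume \<eta>: "\<eta> \<in> test_functions a b"
  have c: "continuous_on {a..b} ((deriv ^^ n) \<eta>)" by (rule test_functions_continuous[OF test_functions_deriv_funpow[OF \<eta>]])
  have c': "continuous_on {a..b} (\<lambda>t. (-1) ^ n * \<eta> t)" by (intro continuous_intros test_functions_continuous[OF \<eta>])
  obtain J where J: "has_bintegral E N a b (\<lambda>t x. (deriv ^^ n) \<eta> t * v t x) J"
    using has_bintegral_exists[OF integrable_N_scale[OF assms(1,2) c]] by blast
  have "has_bintegral E N a b (\<lambda>t x. (-1) ^ n * \<eta> t * w t x) J"
  proof (rule has_bintegralI[OF integrable_N_scale[OF assms(3,4) c'] has_bintegral_D(2)[OF J]])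
    fix e assume e: "e \<in> E"
    note B = bfunctional_ip[OF e]
    have "(LINT t|leb a b. ip (\<lambda>x. (-1) ^ n * \<eta> t * w t x) e) = (-1) ^ n * (LINT t|leb a b. ip (w t) e * \<eta> t)"
      unfolding functional_scale_integral[OF assms(3) B] by (rule integral_mult_pull)
    also have "\<dots> = (LINT t|leb a b. ip (v t) e * (deriv ^^ n) \<eta> t)" using has_weak_deriv_test[OF d[OF e] \<eta>] by simp
    also have "\<dots> = ip J e"
      unfolding has_bintegral_functional(2)[OF J B, symmetric] functional_scale_integral[OF assms(1) B]
      by (simp only: mult.commute)
    finally show "(LINT t|leb a b. ip (\<lambda>x. (-1) ^ n * \<eta> t * w t x) e) = ip J e" .
  qed
  thus "\<exists>J. has_bintegral E N a b (\<lambda>t x. (deriv ^^ n) \<eta> t * v t x) J \<and>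
        has_bintegral E N a b (\<lambda>t x. (-1) ^ n * \<eta> t * w t x) J" using J by blast
qed

text \<open>The definition of a weak derivative speaks only of its products with test functions. Wherever a test
  function is bounded below, membership in the space and local integrability can be read off from them.\<close>

lemma bweak_deriv_local:
  assumes "has_bweak_deriv E N a b n v w" "bfunctional l C"
  shows "locally_integrable a b (\<lambda>t. l (w t))"
  unfolding locally_integrable_iff
proof (intro allI impI)
  fix c d assume cd: "a < c" "d < b"
  show "integrable (leb c d) (\<lambda>t. l (w t))"
  proof (cases "c < d")
    case True
    define c' d' where "c' = (a + c) / 2" and "d' = (d + b) / 2"
    have cd': "a < c'" "c' < c" "d < d'" "d' < b" using cd by (auto simp: c'_def d'_def)
    define \<eta> where "\<eta> = bump c' d' 1"
    have \<eta>: "\<eta> \<in> test_functions a b" unfolding \<eta>_def by (rule bump_test_function) (use cd' True in auto)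
    obtain J where J: "has_bintegral E N a b (\<lambda>t x. (-1) ^ n * \<eta> t * w t x) J"
      using assms(1) \<eta> unfolding has_bweak_deriv_def by blast
    have pos: "\<eta> t > 0" if "c \<le> t" "t \<le> d" for t unfolding \<eta>_def using bump_pos cd' that by auto
    have "integrable (leb c d) (\<lambda>t. l (\<lambda>x. (-1) ^ n * \<eta> t * w t x))"
      by (rule leb_integrable_sub[OF has_bintegral_functional(1)[OF J assms(2)]]) (use cd in auto)
    hence i: "integrable (leb c d) (\<lambda>t. l (\<lambda>x. (-1) ^ n * \<eta> t * w t x) * ((-1) ^ n / \<eta> t))"
    proof (rule bounded_mult_integrable)
      show "continuous_on {c..d} (\<lambda>t. (-1) ^ n / \<eta> t)"
        by (intro continuous_intros test_functions_continuous[OF \<eta>]) (use pos in force)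
    qed
    have "AE t in leb a b. (\<lambda>x. (-1) ^ n * \<eta> t * w t x) \<in> E" by (rule bmeasurable_mem[OF has_bintegral_D(1)[OF J]])
    hence "AE t in leb c d. (\<lambda>x. (-1) ^ n * \<eta> t * w t x) \<in> E" by (rule AE_leb_sub) (use cd in auto)
    hence "AE t in leb c d. l (\<lambda>x. (-1) ^ n * \<eta> t * w t x) * ((-1) ^ n / \<eta> t) = l (w t)"
      using AE_interval
    proof eventually_elim
      case (elim t)
      have p: "\<eta> t \<noteq> 0" using pos[of t] elim by auto
      have "w t = (\<lambda>x. (1 / ((-1) ^ n * \<eta> t)) * ((-1) ^ n * \<eta> t * w t x))" using p by (auto simp: fun_eq_iff)
      hence "l (w t) = (1 / ((-1) ^ n * \<eta> t)) * l (\<lambda>x. (-1) ^ n * \<eta> t * w t x)"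
        using bfunctionalD(5)[OF assms(2) elim(1), of "1 / ((-1) ^ n * \<eta> t)"] by simp
      also have "1 / ((-1) ^ n * \<eta> t) = (-1) ^ n / \<eta> t" by (cases "even n") auto
      finally show ?case by (simp add: mult.commute)
    qed
    thus ?thesis by (rule leb_integrable_cong_AE[OF i])
  qed (simp add: leb_continuous_integrable)
qed

text \<open>On each compact subinterval, multiplication by a bump that is positive there reduces the claim to
  scalar functions.\<close>

lemma bweak_deriv_unique:
  assumes "has_bweak_deriv E N a b n v w" "has_bweak_deriv E N a b n v w'"
  shows "AE t in leb a b. w t \<in> E \<and> w' t \<in> E \<and> N (\<lambda>x. w t x - w' t x) = 0"
proof -
  have main: "AE t in leb a b. c < t \<and> t < d \<longrightarrow> w t \<in> E \<and> w' t \<in> E \<and> N (\<lambda>x. w t x - w' t x) = 0"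
    if cd: "a < c" "c < d" "d < b" for c d
  proof -
    define \<eta> where "\<eta> = bump c d 1"
    have \<eta>: "\<eta> \<in> test_functions a b" unfolding \<eta>_def by (rule bump_test_function) (use cd in auto)
    obtain J where J: "has_bintegral E N a b (\<lambda>t x. (-1) ^ n * \<eta> t * w t x) J"
      using assms(1) \<eta> unfolding has_bweak_deriv_def by blast
    obtain J' where J': "has_bintegral E N a b (\<lambda>t x. (-1) ^ n * \<eta> t * w' t x) J'"
      using assms(2) \<eta> unfolding has_bweak_deriv_def by blast
    define u where "u = (\<lambda>t x. (-1) ^ n * \<eta> t * w t x - (-1) ^ n * \<eta> t * w' t x)"
    have um: "bmeasurable E N a b u"
      unfolding u_def by (rule bmeasurable_diff[OF has_bintegral_D(1)[OF J] has_bintegral_D(1)[OF J']])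
    have unscale: "f \<in> E" if "(\<lambda>x. (-1) ^ n * r * f x) \<in> E" "r \<noteq> 0" for f r
    proof -
      have "(\<lambda>x. (1 / ((-1) ^ n * r)) * ((-1) ^ n * r * f x)) = f" using that(2) by (auto simp: fun_eq_iff)
      thus ?thesis using scale_mem[OF that(1), of "1 / ((-1) ^ n * r)"] by simp
    qed
    note mJ = bmeasurable_mem[OF has_bintegral_D(1)[OF J]] and mJ' = bmeasurable_mem[OF has_bintegral_D(1)[OF J']]
    have ipeq: "AE t in leb a b. ip (w t) e = ip (w' t) e" if e: "e \<in> E" for e
    proof -
      note B = bfunctional_ip[OF e]
      note li = bweak_deriv_local[OF assms(1) B] bweak_deriv_local[OF assms(2) B]
      have "AE t in leb a b. 1 * ip (w t) e + (-1) * ip (w' t) e = 0"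
      proof (rule fundamental_lemma)
        show "locally_integrable a b (\<lambda>t. 1 * ip (w t) e + (-1) * ip (w' t) e)" by (rule locally_integrable_linear[OF li])
        fix \<zeta> assume \<zeta>: "\<zeta> \<in> test_functions a b"
        obtain K where K: "has_bintegral E N a b (\<lambda>t x. (deriv ^^ n) \<zeta> t * v t x) K" "has_bintegral E N a b (\<lambda>t x. (-1) ^ n * \<zeta> t * w t x) K"
          using assms(1) \<zeta> unfolding has_bweak_deriv_def by blast
        obtain K' where K': "has_bintegral E N a b (\<lambda>t x. (deriv ^^ n) \<zeta> t * v t x) K'" "has_bintegral E N a b (\<lambda>t x. (-1) ^ n * \<zeta> t * w' t x) K'"
          using assms(2) \<zeta> unfolding has_bweak_deriv_def by blast
        have sc: "(LINT t|leb a b. ip (\<lambda>x. (-1) ^ n * \<zeta> t * f t x) e) = (-1) ^ n * (LINT t|leb a b. ip (f t) e * \<zeta> t)"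
          if "has_bintegral E N a b (\<lambda>t x. (-1) ^ n * \<zeta> t * f t x) K0" for f K0
        proof -
          have "AE t in leb a b. ip (\<lambda>x. (-1) ^ n * \<zeta> t * f t x) e = (-1) ^ n * (ip (f t) e * \<zeta> t)"
            using bmeasurable_mem[OF has_bintegral_D(1)[OF that]]
          proof eventually_elim
            case (elim t)
            show ?case
            proof (cases "\<zeta> t = 0")
              case True thus ?thesis using bfunctional_zero[OF B] by simp
            next
              case False
              show ?thesis using bfunctionalD(5)[OF B unscale[OF elim False], of "(-1) ^ n * \<zeta> t"] by (simp add: mult_ac)
            qed
          qed
          from leb_integral_cong_AE[OF this] show ?thesis by simp
        qed
        have "ip K e = ip K' e"
          using has_bintegral_functional(2)[OF K(1) B] has_bintegral_functional(2)[OF K'(1) B] by simp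
        hence "(-1) ^ n * (LINT t|leb a b. ip (w t) e * \<zeta> t) = (-1) ^ n * (LINT t|leb a b. ip (w' t) e * \<zeta> t)"
          using has_bintegral_functional(2)[OF K(2) B] has_bintegral_functional(2)[OF K'(2) B] sc[OF K(2)] sc[OF K'(2)] by simp
        hence "(LINT t|leb a b. ip (w t) e * \<zeta> t) = (LINT t|leb a b. ip (w' t) e * \<zeta> t)" by simp
        thus "(LINT t|leb a b. (1 * ip (w t) e + (-1) * ip (w' t) e) * \<zeta> t) = 0"
          using locally_integrable_mult_test[OF li(1) \<zeta>] locally_integrable_mult_test[OF li(2) \<zeta>] by (simp add: left_diff_distrib)
      qed
      thus ?thesis by (rule AE_mp) simp
    qed
    have "AE t in leb a b. N (u t) = 0"
    proof (rule AE_N_zero[OF um])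
      fix e assume e: "e \<in> E"
      note B = bfunctional_ip[OF e]
      show "AE t in leb a b. ip (u t) e = 0"
        using mJ mJ' ipeq[OF e]
      proof eventually_elim
        case (elim t)
        have d: "ip (u t) e = ip (\<lambda>x. (-1) ^ n * \<eta> t * w t x) e - ip (\<lambda>x. (-1) ^ n * \<eta> t * w' t x) e"
          unfolding u_def by (rule bfunctionalD(4)[OF B elim(1,2)])
        show ?case
        proof (cases "\<eta> t = 0")
          case True thus ?thesis using d by simp
        next
          case False
          have "w t \<in> E" "w' t \<in> E" by (rule unscale[OF elim(1) False] unscale[OF elim(2) False])+
          thus ?thesis using d bfunctionalD(5)[OF B, of _ "(-1) ^ n * \<eta> t"] elim(3) by simp
        qed
      qed
    qed
    with mJ mJ' show ?thesis
    proof eventually_elim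
      case (elim t)
      show ?case
      proof
        assume t: "c < t \<and> t < d"
        hence p: "\<eta> t \<noteq> 0" using bump_pos[of c t d 1] by (simp add: \<eta>_def)
        have E: "w t \<in> E" "w' t \<in> E" by (rule unscale[OF elim(1) p] unscale[OF elim(2) p])+
        have "u t = (\<lambda>x. ((-1) ^ n * \<eta> t) * (w t x - w' t x))" by (auto simp: u_def right_diff_distrib)
        hence "\<bar>(-1) ^ n * \<eta> t\<bar> * N (\<lambda>x. w t x - w' t x) = 0" using N_scale[OF diff_mem[OF E]] elim(3) by simp
        thus "w t \<in> E \<and> w' t \<in> E \<and> N (\<lambda>x. w t x - w' t x) = 0" using E p by simp
      qed
    qed
  qed
  have "AE t in leb a b. \<forall>m::nat. a + 1 / real (Suc m) < t \<and> t < b - 1 / real (Suc m) \<longrightarrow>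
      w t \<in> E \<and> w' t \<in> E \<and> N (\<lambda>x. w t x - w' t x) = 0"
    unfolding AE_all_countable
  proof
    fix m :: nat
    show "AE t in leb a b. a + 1 / real (Suc m) < t \<and> t < b - 1 / real (Suc m) \<longrightarrow>
      w t \<in> E \<and> w' t \<in> E \<and> N (\<lambda>x. w t x - w' t x) = 0"
    proof (cases "a + 1 / real (Suc m) < b - 1 / real (Suc m)")
      case True thus ?thesis by (intro main) auto
    next
      case False
      show ?thesis by (rule AE_I2) (use False in linarith)
    qed
  qed
  thus ?thesis using AE_interval
  proof eventually_elim
    case (elim t)
    obtain m where "1 / real (Suc m) < min (t - a) (b - t)"
      using reals_Archimedean[of "min (t - a) (b - t)"] elim(2) by (auto simp: inverse_eq_divide)
    thus ?case using elim(1)[rule_format, of m] by auto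
  qed
qed

lemma has_bintegral_empty:
  assumes "b \<le> a"
  shows "bmeasurable E N a b v" "integrable (leb a b) (\<lambda>t. N (v t))"
proof -
  have e: "{a<..<b} = {}" using assms by simp
  show "integrable (leb a b) (\<lambda>t. N (v t))" unfolding e by simp
  have "AE t in leb a b. P t" for P unfolding AE_leb_iff
    by (intro AE_I2) (use assms in force)
  moreover have "bsimple E a b (\<lambda>t x. 0)" unfolding bsimple_def using zero_mem by simp
  ultimately show "bmeasurable E N a b v" unfolding bmeasurable_def
    by (intro conjI exI[of _ "\<lambda>n t x. 0"] allI)
qed

lemma bmeasurable_sub':
  assumes "bmeasurable E N a b w" "integrable (leb a b) (\<lambda>t. N (w t))" "a \<le> c" "d \<le> b"
  shows "bmeasurable E N c d w" "integrable (leb c d) (\<lambda>t. N (w t))"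
  using bmeasurable_sub[OF assms(1,3,4)] leb_integrable_sub[OF assms(2,3,4)] by auto

text \<open>The norm of an increment of the indefinite integral is at most the integral of the norm, which is
  small over short intervals.\<close>

lemma indefinite_bintegral:
  assumes w: "bmeasurable E N a b w" "integrable (leb a b) (\<lambda>t. N (w t))" and "a < b"
  obtains I where "\<And>t. a \<le> t \<Longrightarrow> t \<le> b \<Longrightarrow> has_bintegral E N a t w (I t)" "bcontinuous E N a b I"
proof -
  define I where "I = (\<lambda>t. SOME J. has_bintegral E N a t w J)"
  have I: "has_bintegral E N a t w (I t)" if t: "a \<le> t" "t \<le> b" for t
  proof -
    have "\<exists>J. has_bintegral E N a t w J" by (rule has_bintegral_exists[OF bmeasurable_sub'[OF w]]) (use t in auto)
    thus ?thesis unfolding I_def by (rule someI_ex)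
  qed
  have IE: "I t \<in> E" if "a \<le> t" "t \<le> b" for t by (rule has_bintegral_D(2)[OF I[OF that]])
  define g where "g = (\<lambda>t. 0 + (LINT s|leb a t. N (w s)))"
  have g: "primitive_on a b g (\<lambda>t. N (w t))" unfolding g_def by (rule primitive_onI[OF w(2)])
  have d: "N (\<lambda>x. I t x - I s x) \<le> g t - g s" if st: "a \<le> s" "s \<le> t" "t \<le> b" for s t
  proof -
    have "has_bintegral E N s t w (\<lambda>x. I t x - I s x)"
    proof (rule has_bintegralI)
      show "bmeasurable E N s t w" "integrable (leb s t) (\<lambda>t. N (w t))" using bmeasurable_sub'[OF w] st by auto
      show "(\<lambda>x. I t x - I s x) \<in> E" using IE st by (intro diff_mem) auto
      fix e assume e: "e \<in> E"
      note B = bfunctional_ip[OF e]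
      have "ip (I t) e = (LINT u|leb a t. ip (w u) e)" "ip (I s) e = (LINT u|leb a s. ip (w u) e)"
        using has_bintegral_functional(2)[OF I B] st by auto
      moreover have "(LINT u|leb a t. ip (w u) e) = (LINT u|leb a s. ip (w u) e) + (LINT u|leb s t. ip (w u) e)"
        using leb_integral_combine[OF has_bintegral_functional(1)[OF I B], of t s] st by auto
      ultimately show "(LINT u|leb s t. ip (w u) e) = ip (\<lambda>x. I t x - I s x) e"
        using bfunctionalD(4)[OF B IE IE, of t s] st by simp
    qed
    hence "N (\<lambda>x. I t x - I s x) \<le> (LINT u|leb s t. N (w u))"
      by (rule has_bintegral_bound) (use leb_integrable_sub[OF w(2)] st in auto)
    also have "\<dots> = g t - g s" using primitive_on_diff[OF g st] by simp
    finally show ?thesis .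
  qed
  have "bcontinuous E N a b I"
    unfolding bcontinuous_def
  proof
    fix t assume t: "t \<in> {a..b}"
    have "(g \<longlongrightarrow> g t) (at t within {a..b})" using primitive_on_continuous[OF g] t by (auto simp: continuous_on_def)
    hence "((\<lambda>s. \<bar>g s - g t\<bar>) \<longlongrightarrow> \<bar>g t - g t\<bar>) (at t within {a..b})" by (intro tendsto_intros)
    hence lim: "((\<lambda>s. \<bar>g s - g t\<bar>) \<longlongrightarrow> 0) (at t within {a..b})" by simp
    have "((\<lambda>s. N (\<lambda>x. I s x - I t x)) \<longlongrightarrow> 0) (at t within {a..b})"
    proof (rule Lim_null_comparison[OF _ lim])
      have "norm (N (\<lambda>x. I s x - I t x)) \<le> \<bar>g s - g t\<bar>" if "s \<in> {a..b}" for s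
        using d[of s t] d[of t s] N_minus[of "I s" "I t"] IE[of s] IE[of t] t that N_nonneg[OF diff_mem[of "I s" "I t"]]
        by (cases "s \<le> t") auto
      thus "eventually (\<lambda>s. norm (N (\<lambda>x. I s x - I t x)) \<le> \<bar>g s - g t\<bar>) (at t within {a..b})"
        by (auto simp: eventually_at_filter)
    qed
    thus "I t \<in> E \<and> ((\<lambda>s. N (\<lambda>x. I s x - I t x)) \<longlongrightarrow> 0) (at t within {a..b})" using IE t by auto
  qed
  thus thesis using that I by blast
qed

lemma bcontinuous_add_const:
  assumes "bcontinuous E N a b I" "J \<in> E"
  shows "bcontinuous E N a b (\<lambda>t x. J x + I t x)"
  using assms unfolding bcontinuous_def by (auto intro: add_mem)

text \<open>The candidate is an indefinite integral of the next derivative plus a constant in E; inner products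
  reduce the comparison to scalar functions.\<close>

lemma continuous_representative:
  assumes ab: "a < b" and d0: "has_bweak_deriv E N a b n v w0" and d1: "has_bweak_deriv E N a b (Suc n) v w1"
    and v: "v \<in> bL2 E N a b" and w0: "w0 \<in> bL2 E N a b" and w1: "w1 \<in> bL2 E N a b"
  obtains V where "bcontinuous E N a b V" "has_bweak_deriv E N a b n v V"
    "\<And>t. a \<le> t \<Longrightarrow> t \<le> b \<Longrightarrow> has_bintegral E N a t w1 (\<lambda>x. V t x - V a x)"
proof -
  note v' = bL2_D[OF v] and w0' = bL2_D[OF w0] and w1' = bL2_D[OF w1]
  obtain I where I: "\<And>t. a \<le> t \<Longrightarrow> t \<le> b \<Longrightarrow> has_bintegral E N a t w1 (I t)" "bcontinuous E N a b I"
    using indefinite_bintegral[OF w1' ab] by blast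
  have IE: "I t \<in> E" if "a \<le> t" "t \<le> b" for t by (rule bcontinuous_mem[OF I(2) that])
  note I' = bcontinuous_integrable[OF I(2) ab]
  obtain \<theta> where \<theta>: "\<theta> \<in> test_functions a b" "(LINT t|leb a b. \<theta> t) = 1" using bump_normalised[OF ab] by blast
  have c: "continuous_on {a..b} \<theta>" by (rule test_functions_continuous[OF \<theta>(1)])
  obtain J0 where J0: "has_bintegral E N a b (\<lambda>t x. \<theta> t * w0 t x) J0"
    using has_bintegral_exists[OF integrable_N_scale[OF w0' c]] by blast
  obtain J1 where J1: "has_bintegral E N a b (\<lambda>t x. \<theta> t * I t x) J1"
    using has_bintegral_exists[OF integrable_N_scale[OF I'(1,2) c]] by blast
  define J where "J = (\<lambda>x. J0 x - J1 x)"
  have JE: "J \<in> E" unfolding J_def by (rule diff_mem[OF has_bintegral_D(2)[OF J0] has_bintegral_D(2)[OF J1]])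
  define V where "V = (\<lambda>t x. J x + I t x)"
  have V: "bcontinuous E N a b V" unfolding V_def by (rule bcontinuous_add_const[OF I(2) JE])
  note V' = bcontinuous_integrable[OF V ab]
  have eq: "AE t in leb a b. ip (w0 t) e = ip (V t) e" if e: "e \<in> E" for e
  proof -
    note B = bfunctional_ip[OF e]
    have s: "has_weak_deriv a b n (\<lambda>t. ip (v t) e) (\<lambda>t. ip (w0 t) e)" "has_weak_deriv a b (Suc n) (\<lambda>t. ip (v t) e) (\<lambda>t. ip (w1 t) e)"
      by (rule bweak_deriv_functional[OF d0 v' w0' B] bweak_deriv_functional[OF d1 v' w1' B])+
    obtain G where G: "primitive_on a b G (\<lambda>t. ip (w1 t) e)" "AE t in leb a b. ip (w0 t) e = G t"
      using has_weak_deriv_primitive[OF s bmeasurable_integrable_functional[OF w1' B] ab] by blast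
    have GI: "G t = G a + ip (I t) e" if t: "a \<le> t" "t \<le> b" for t
      using primitive_onD(2)[OF G(1) t] has_bintegral_functional(2)[OF I(1)[OF t] B] by simp
    have "ip J e = (LINT t|leb a b. \<theta> t * ip (w0 t) e) - (LINT t|leb a b. \<theta> t * ip (I t) e)"
      unfolding J_def bfunctionalD(4)[OF B has_bintegral_D(2)[OF J0] has_bintegral_D(2)[OF J1]]
      using has_bintegral_functional(2)[OF J0 B] has_bintegral_functional(2)[OF J1 B]
        functional_scale_integral[OF w0'(1) B] functional_scale_integral[OF I'(1) B] by simp
    also have "(LINT t|leb a b. \<theta> t * ip (w0 t) e) = (LINT t|leb a b. G a * \<theta> t + \<theta> t * ip (I t) e)"
    proof (rule leb_integral_cong_AE)
      show "AE t in leb a b. \<theta> t * ip (w0 t) e = G a * \<theta> t + \<theta> t * ip (I t) e"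
        using G(2) AE_interval
      proof eventually_elim
        case (elim t)
        have "ip (w0 t) e = G a + ip (I t) e" using GI[of t] elim by linarith
        thus ?case by (simp add: algebra_simps)
      qed
    qed
    also have "\<dots> = G a + (LINT t|leb a b. \<theta> t * ip (I t) e)"
    proof -
      have "integrable (leb a b) \<theta>" by (rule leb_continuous_integrable[OF c])
      moreover have "integrable (leb a b) (\<lambda>t. \<theta> t * ip (I t) e)"
        using bounded_mult_integrable[OF bmeasurable_integrable_functional[OF I'(1,2) B] c] by (simp add: mult.commute)
      ultimately show ?thesis using \<theta>(2) by simp
    qed
    finally have Ga: "ip J e = G a" by simp
    show ?thesis using G(2) AE_interval
    proof eventually_elim
      case (elim t)
      have "ip (V t) e = ip J e + ip (I t) e" unfolding V_def by (rule bfunctionalD(6)[OF B JE IE]) (use elim in auto)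
      thus ?case using GI[of t] Ga elim by linarith
    qed
  qed
  have "AE t in leb a b. N (\<lambda>x. w0 t x - V t x) = 0"
  proof (rule AE_N_zero[OF bmeasurable_diff[OF w0'(1) V'(1)]])
    fix e assume e: "e \<in> E"
    show "AE t in leb a b. ip (\<lambda>x. w0 t x - V t x) e = 0"
      using eq[OF e] bmeasurable_mem[OF w0'(1)] bmeasurable_mem[OF V'(1)]
      by eventually_elim (simp add: bfunctionalD(4)[OF bfunctional_ip[OF e]])
  qed
  hence ae: "AE t in leb a b. w0 t \<in> E \<and> V t \<in> E \<and> N (\<lambda>x. w0 t x - V t x) = 0"
    using bmeasurable_mem[OF w0'(1)] bmeasurable_mem[OF V'(1)] by eventually_elim simp
  have "has_bweak_deriv E N a b n v V"
    unfolding has_bweak_deriv_def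
  proof
    fix \<eta> assume \<eta>: "\<eta> \<in> test_functions a b"
    then obtain K where K: "has_bintegral E N a b (\<lambda>t x. (deriv ^^ n) \<eta> t * v t x) K" "has_bintegral E N a b (\<lambda>t x. (-1) ^ n * \<eta> t * w0 t x) K"
      using d0 unfolding has_bweak_deriv_def by blast
    have "has_bintegral E N a b (\<lambda>t x. (-1) ^ n * \<eta> t * V t x) K"
    proof (rule has_bintegral_cong_AE[OF K(2)])
      show "AE t in leb a b. (\<lambda>x. (-1) ^ n * \<eta> t * V t x) \<in> E \<and> N (\<lambda>x. (-1) ^ n * \<eta> t * w0 t x - (-1) ^ n * \<eta> t * V t x) = 0"
        using ae
      proof eventually_elim
        case (elim t)
        have "N (\<lambda>x. ((-1) ^ n * \<eta> t) * (w0 t x - V t x)) = 0" using N_scale[OF diff_mem, of "w0 t" "V t"] elim by simp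
        moreover have "(\<lambda>x. ((-1) ^ n * \<eta> t) * (w0 t x - V t x)) = (\<lambda>x. (-1) ^ n * \<eta> t * w0 t x - (-1) ^ n * \<eta> t * V t x)"
          by (auto simp: right_diff_distrib)
        ultimately show ?case using elim scale_mem[of "V t" "(-1) ^ n * \<eta> t"] by simp
      qed
    qed
    thus "\<exists>J. has_bintegral E N a b (\<lambda>t x. (deriv ^^ n) \<eta> t * v t x) J \<and> has_bintegral E N a b (\<lambda>t x. (-1) ^ n * \<eta> t * V t x) J"
      using K(1) by blast
  qed
  moreover have "has_bintegral E N a t w1 (\<lambda>x. V t x - V a x)" if t: "a \<le> t" "t \<le> b" for t
  proof (rule has_bintegralI[OF has_bintegral_D(1,3)[OF I(1)[OF t]]])
    show "(\<lambda>x. V t x - V a x) \<in> E" using bcontinuous_mem[OF V] t ab by (intro diff_mem) auto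
    fix e assume e: "e \<in> E"
    note B = bfunctional_ip[OF e]
    have Ia: "ip (I a) e = 0" using has_bintegral_functional(2)[OF I(1)[of a] B] ab by simp
    have "(\<lambda>x. V t x - V a x) = (\<lambda>x. I t x - I a x)" by (auto simp: V_def)
    hence "ip (\<lambda>x. V t x - V a x) e = ip (I t) e - ip (I a) e"
      using bfunctionalD(4)[OF B IE[OF t] IE[of a]] ab by simp
    thus "(LINT s|leb a t. ip (w1 s) e) = ip (\<lambda>x. V t x - V a x) e"
      using Ia has_bintegral_functional(2)[OF I(1)[OF t] B] by simp
  qed
  ultimately show thesis using that V by blast
qed

lemma bcontinuous_AE_eq:
  assumes "bcontinuous E N a b V" "bcontinuous E N a b W" "AE t in leb a b. N (\<lambda>x. V t x - W t x) = 0" "a < b" "t \<in> {a..b}"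
  shows "N (\<lambda>x. V t x - W t x) = 0"
proof -
  have VE: "V s \<in> E" "W s \<in> E" if "s \<in> {a..b}" for s using bcontinuous_mem[OF assms(1)] bcontinuous_mem[OF assms(2)] that by auto
  show ?thesis
  proof (rule N_zero_if_ip)
    show "(\<lambda>x. V t x - W t x) \<in> E" using VE[OF assms(5)] by (intro diff_mem)
    fix e assume e: "e \<in> E"
    note B = bfunctional_ip[OF e]
    have "ip (V t) e = ip (W t) e"
    proof (rule continuous_AE_eq[OF bcontinuous_functional[OF assms(1) B] bcontinuous_functional[OF assms(2) B] _ assms(4,5)])
      show "AE t in leb a b. ip (V t) e = ip (W t) e"
        using assms(3) AE_interval
      proof eventually_elim
        case (elim s)
        show ?case by (rule N_zero_bfunctional[OF B VE(1) VE(2) elim(1)]) (use elim in auto)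
      qed
    qed
    thus "ip (\<lambda>x. V t x - W t x) e = 0" using bfunctionalD(4)[OF B VE[OF assms(5)]] by simp
  qed
qed

lemma bwderiv_has_bweak_deriv:
  assumes "has_bweak_deriv E N a b n v w"
  shows "has_bweak_deriv E N a b n v (bwderiv E N a b n v)"
    and "bcontinuous E N a b w \<Longrightarrow> bcontinuous E N a b (bwderiv E N a b n v)"
proof -
  let ?P = "\<lambda>w. has_bweak_deriv E N a b n v w \<and>
        ((\<exists>h. has_bweak_deriv E N a b n v h \<and> bcontinuous E N a b h) \<longrightarrow> bcontinuous E N a b w)"
  have "\<exists>w. ?P w" using assms by blast
  hence "?P (bwderiv E N a b n v)" unfolding bwderiv_def by (rule someI_ex)
  thus "has_bweak_deriv E N a b n v (bwderiv E N a b n v)"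
    "bcontinuous E N a b w \<Longrightarrow> bcontinuous E N a b (bwderiv E N a b n v)" using assms by blast+
qed

lemma has_bweak_deriv_0:
  assumes "v \<in> bL2 E N a b"
  shows "has_bweak_deriv E N a b 0 v v"
proof (rule bweak_derivI[OF bL2_D[OF assms] bL2_D[OF assms]])
  fix e assume e: "e \<in> E"
  show "has_weak_deriv a b 0 (\<lambda>t. ip (v t) e) (\<lambda>t. ip (v t) e)"
    by (rule has_weak_deriv_0[OF integrable_imp_locally_integrable[OF
          bmeasurable_integrable_functional[OF bL2_D[OF assms] bfunctional_ip[OF e]]]])
qed

lemma bwderiv_top:
  assumes "has_bweak_deriv E N a b n v w" "w \<in> bL2 E N a b"
  shows "bmeasurable E N a b (bwderiv E N a b n v)" "integrable (leb a b) (\<lambda>t. N (bwderiv E N a b n v t))"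
    "AE t in leb a b. w t \<in> E \<and> bwderiv E N a b n v t \<in> E \<and> N (\<lambda>x. w t x - bwderiv E N a b n v t x) = 0"
proof -
  show ae: "AE t in leb a b. w t \<in> E \<and> bwderiv E N a b n v t \<in> E \<and> N (\<lambda>x. w t x - bwderiv E N a b n v t x) = 0"
    by (rule bweak_deriv_unique[OF assms(1) bwderiv_has_bweak_deriv(1)[OF assms(1)]])
  show "bmeasurable E N a b (bwderiv E N a b n v)"
    by (rule bmeasurable_cong_AE[OF bL2_D(1)[OF assms(2)]]) (use ae in \<open>eventually_elim, blast\<close>)
  have "AE t in leb a b. N (w t) = N (bwderiv E N a b n v t)"
    using ae by eventually_elim (use N_rev_triangle in force)
  thus "integrable (leb a b) (\<lambda>t. N (bwderiv E N a b n v t))" by (rule leb_integrable_cong_AE[OF bL2_D(2)[OF assms(2)]])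
qed

text \<open>The form in which membership of \<open>H\<^sup>2(0, T; E)\<close> is used: v and its first derivative are continuous up to
  modification on null sets, and they are indefinite integrals.\<close>

lemma bsobolev_2_representation:
  assumes v: "v \<in> bsobolev 2 E N a b" and ab: "a < b"
  shows "bcontinuous E N a b (bwderiv E N a b 0 v)" "bcontinuous E N a b (bwderiv E N a b 1 v)"
    and "bmeasurable E N a b (bwderiv E N a b 2 v)" "integrable (leb a b) (\<lambda>t. N (bwderiv E N a b 2 v t))"
    and "AE t in leb a b. v t \<in> E \<and> N (\<lambda>x. v t x - bwderiv E N a b 0 v t x) = 0"
    and "\<And>t. a \<le> t \<Longrightarrow> t \<le> b \<Longrightarrow> has_bintegral E N a t (bwderiv E N a b 1 v) (\<lambda>x. bwderiv E N a b 0 v t x - bwderiv E N a b 0 v a x)"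
    and "\<And>t. a \<le> t \<Longrightarrow> t \<le> b \<Longrightarrow> has_bintegral E N a t (bwderiv E N a b 2 v) (\<lambda>x. bwderiv E N a b 1 v t x - bwderiv E N a b 1 v a x)"
proof -
  have vL: "v \<in> bL2 E N a b" using v by (simp add: bsobolev_def)
  have A0: "\<exists>w\<in>bL2 E N a b. has_bweak_deriv E N a b i v w" if "i \<le> 2" for i using v that by (simp add: bsobolev_def)
  obtain w1 where w1: "w1 \<in> bL2 E N a b" "has_bweak_deriv E N a b 1 v w1" using A0[of 1] by auto
  obtain w2 where w2: "w2 \<in> bL2 E N a b" "has_bweak_deriv E N a b 2 v w2" using A0[of 2] by auto
  let ?V = "bwderiv E N a b 0 v" and ?V1 = "bwderiv E N a b 1 v" and ?V2 = "bwderiv E N a b 2 v"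
  have w2': "has_bweak_deriv E N a b (Suc 1) v w2" using w2(2) by (simp add: numeral_2_eq_2)
  have w1': "has_bweak_deriv E N a b (Suc 0) v w1" using w1(2) by simp
  obtain A where A: "bcontinuous E N a b A" "has_bweak_deriv E N a b 0 v A"
    "\<And>t. a \<le> t \<Longrightarrow> t \<le> b \<Longrightarrow> has_bintegral E N a t w1 (\<lambda>x. A t x - A a x)"
    using continuous_representative[OF ab has_bweak_deriv_0[OF vL] w1' vL vL w1(1)] by blast
  obtain B where B: "bcontinuous E N a b B" "has_bweak_deriv E N a b 1 v B"
    "\<And>t. a \<le> t \<Longrightarrow> t \<le> b \<Longrightarrow> has_bintegral E N a t w2 (\<lambda>x. B t x - B a x)"
    using continuous_representative[OF ab w1(2) w2' vL w1(1) w2(1)] by blast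
  show V: "bcontinuous E N a b ?V" by (rule bwderiv_has_bweak_deriv(2)[OF A(2,1)])
  show V1: "bcontinuous E N a b ?V1" by (rule bwderiv_has_bweak_deriv(2)[OF B(2,1)])
  show "bmeasurable E N a b ?V2" "integrable (leb a b) (\<lambda>t. N (?V2 t))" using bwderiv_top[OF w2(2,1)] by auto
  have "AE t in leb a b. v t \<in> E \<and> ?V t \<in> E \<and> N (\<lambda>x. v t x - ?V t x) = 0"
    by (rule bweak_deriv_unique[OF has_bweak_deriv_0[OF vL] bwderiv_has_bweak_deriv(1)[OF A(2)]])
  thus "AE t in leb a b. v t \<in> E \<and> N (\<lambda>x. v t x - ?V t x) = 0" by eventually_elim simp
  have transfer: "has_bintegral E N a t u' (\<lambda>x. V t x - V a x)"
    if t: "a \<le> t" "t \<le> b" and V: "bcontinuous E N a b V" and A: "bcontinuous E N a b A"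
      and AV: "AE t in leb a b. N (\<lambda>x. A t x - V t x) = 0"
      and u: "AE t in leb a b. u' t \<in> E \<and> N (\<lambda>x. u t x - u' t x) = 0"
      and I: "has_bintegral E N a t u (\<lambda>x. A t x - A a x)" for A V u u' t
  proof -
    have I': "has_bintegral E N a t u' (\<lambda>x. A t x - A a x)"
      by (rule has_bintegral_cong_AE[OF I AE_leb_sub[OF u]]) (use t in auto)
    have m: "V s \<in> E" "A s \<in> E" if "s \<in> {a..b}" for s using bcontinuous_mem[OF V] bcontinuous_mem[OF A] that by auto
    show ?thesis
    proof (rule has_bintegralI[OF has_bintegral_D(1,3)[OF I']])
      show "(\<lambda>x. V t x - V a x) \<in> E" using m t ab by (intro diff_mem) auto
      fix e assume e: "e \<in> E"
      note Be = bfunctional_ip[OF e]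
      have eq: "ip (A s) e = ip (V s) e" if s: "s \<in> {a..b}" for s
        by (rule N_zero_bfunctional[OF Be m(2)[OF s] m(1)[OF s] bcontinuous_AE_eq[OF A V AV ab s]])
      have "(LINT s|leb a t. ip (u' s) e) = ip (\<lambda>x. A t x - A a x) e" by (rule has_bintegral_functional(2)[OF I' Be])
      also have "\<dots> = ip (A t) e - ip (A a) e" using m t ab by (intro bfunctionalD(4)[OF Be]) auto
      also have "\<dots> = ip (V t) e - ip (V a) e" using eq t ab by auto
      also have "\<dots> = ip (\<lambda>x. V t x - V a x) e" using m t ab by (intro bfunctionalD(4)[OF Be, symmetric]) auto
      finally show "(LINT s|leb a t. ip (u' s) e) = ip (\<lambda>x. V t x - V a x) e" .
    qed
  qed
  note AV = bweak_deriv_unique[OF A(2) bwderiv_has_bweak_deriv(1)[OF A(2)]]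
  note BV = bweak_deriv_unique[OF B(2) bwderiv_has_bweak_deriv(1)[OF B(2)]]
  note u1 = bweak_deriv_unique[OF w1(2) bwderiv_has_bweak_deriv(1)[OF w1(2)]]
  note u2 = bweak_deriv_unique[OF w2(2) bwderiv_has_bweak_deriv(1)[OF w2(2)]]
  show "has_bintegral E N a t ?V1 (\<lambda>x. ?V t x - ?V a x)" if t: "a \<le> t" "t \<le> b" for t
    by (rule transfer[OF t V A(1) _ _ A(3)[OF t]]) (use AV u1 in \<open>eventually_elim, blast\<close>)+
  show "has_bintegral E N a t ?V2 (\<lambda>x. ?V1 t x - ?V1 a x)" if t: "a \<le> t" "t \<le> b" for t
    by (rule transfer[OF t V1 B(1) _ _ B(3)[OF t]]) (use BV u2 in \<open>eventually_elim, blast\<close>)+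
qed
end

section \<open>The spaces \<open>L\<^sup>2\<close> and X\<close>

lemma L2_norm_sq: "(L2_norm a b f)\<^sup>2 = (LINT x|leb a b. (f x)\<^sup>2)"
  unfolding L2_norm_def by (rule real_sqrt_pow2) (rule integral_nonneg_AE, simp)

lemma L2_norm_nonneg: "0 \<le> L2_norm a b f"
  unfolding L2_norm_def by (rule real_sqrt_ge_zero) (rule integral_nonneg_AE, simp)

lemma L2_norm_cong_AE: "AE x in leb a b. f x = g x \<Longrightarrow> L2_norm a b f = L2_norm a b g"
proof -
  assume "AE x in leb a b. f x = g x"
  hence "AE x in leb a b. (f x)\<^sup>2 = (g x)\<^sup>2" by (rule AE_mp) simp
  thus ?thesis unfolding L2_norm_def using leb_integral_cong_AE by metis
qed

text \<open>Completeness in the style of Riesz and Fischer: a rapidly converging subsequence converges almost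
  everywhere, and Fatou's lemma identifies its limit as the limit in norm.\<close>

lemma L2_complete:
  fixes \<sigma> :: "nat \<Rightarrow> real \<Rightarrow> real"
  assumes \<sigma>: "\<And>n. \<sigma> n \<in> L2 a b"
    and C: "\<And>e. e > 0 \<Longrightarrow> \<exists>M. \<forall>m\<ge>M. \<forall>n\<ge>M. L2_norm a b (\<lambda>x. \<sigma> m x - \<sigma> n x) < e"
  shows "\<exists>l\<in>L2 a b. (\<lambda>n. L2_norm a b (\<lambda>x. \<sigma> n x - l x)) \<longlonglongrightarrow> 0"
proof -
  have "\<exists>M. \<forall>k. \<forall>m\<ge>M k. \<forall>n\<ge>M k. L2_norm a b (\<lambda>x. \<sigma> m x - \<sigma> n x) < (1/2::real) ^ k"
    by (rule choice) (use C in simp)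
  then obtain M where M: "\<And>k m n. m \<ge> M k \<Longrightarrow> n \<ge> M k \<Longrightarrow> L2_norm a b (\<lambda>x. \<sigma> m x - \<sigma> n x) < (1/2::real) ^ k" by blast
  define r where "r = (\<lambda>k. \<Sum>j\<le>k. M j)"
  have "k \<le> j \<Longrightarrow> M k \<le> r j" for k j
    unfolding r_def by (rule member_le_sum) auto
  hence r: "M k \<le> r k" "M k \<le> r (Suc k)" "k \<le> j \<Longrightarrow> M k \<le> r j" for k j by simp_all
  define f where "f = (\<lambda>k x. \<sigma> (r (Suc k)) x - \<sigma> (r k) x)"
  have L2d: "(\<lambda>x. \<sigma> m x - \<sigma> n x) \<in> L2 a b" for m n using L2_linear[OF \<sigma>[of m] \<sigma>[of n], of 1 "-1"] by simp
  have fL2: "f k \<in> L2 a b" for k unfolding f_def by (rule L2d)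
  have [measurable]: "\<sigma> n \<in> borel_measurable (leb a b)" "f n \<in> borel_measurable (leb a b)" for n
    using L2_measurable \<sigma> fL2 by auto
  have c1: "integrable (leb a b) (\<lambda>x. c::real)" for c by (rule leb_continuous_integrable) simp
  define B where "B = measure (leb a b) {a<..<b}"
  have B: "(LINT x|leb a b. c) = c * B" for c :: real by (simp add: B_def)
  have f1: "(LINT x|leb a b. \<bar>f k x\<bar>) \<le> (1/2) ^ k * (1 + B)" for k
  proof -
    have sq: "integrable (leb a b) (\<lambda>x. (f k x)\<^sup>2)" using fL2[of k] by (simp add: L2_def)
    have "(LINT x|leb a b. \<bar>f k x\<bar>) \<le> (LINT x|leb a b. 2 ^ k * (f k x)\<^sup>2 + (1/2) ^ k)"
    proof (rule integral_mono)
      show "integrable (leb a b) (\<lambda>x. \<bar>f k x\<bar>)" using L2_integrable[OF fL2] by simp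
      show "integrable (leb a b) (\<lambda>x. 2 ^ k * (f k x)\<^sup>2 + (1/2) ^ k)" using sq c1 by simp
      fix x
      have p: "(2::real) ^ k * (1/2) ^ k = 1" by (simp add: power_mult_distrib[symmetric])
      have "0 \<le> 2 ^ k * (\<bar>f k x\<bar> - (1/2) ^ k)\<^sup>2" by simp
      also have "\<dots> = 2 ^ k * (f k x)\<^sup>2 - 2 * \<bar>f k x\<bar> * (2 ^ k * (1/2) ^ k) + (2 ^ k * (1/2) ^ k) * (1/2) ^ k"
        by (simp add: power2_eq_square algebra_simps)
      finally have "2 * \<bar>f k x\<bar> \<le> 2 ^ k * (f k x)\<^sup>2 + (1/2) ^ k" unfolding p by simp
      thus "\<bar>f k x\<bar> \<le> 2 ^ k * (f k x)\<^sup>2 + (1/2) ^ k" by linarith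
    qed
    also have "\<dots> = 2 ^ k * (L2_norm a b (f k))\<^sup>2 + (1/2) ^ k * B" using sq c1 by (simp add: L2_norm_sq B_def)
    also have "(L2_norm a b (f k))\<^sup>2 \<le> ((1/2) ^ k)\<^sup>2"
      using power_mono[OF less_imp_le[OF M[OF r(2) r(1), of k]] L2_norm_nonneg, of 2] unfolding f_def by simp
    hence "2 ^ k * (L2_norm a b (f k))\<^sup>2 + (1/2) ^ k * B \<le> 2 ^ k * ((1/2) ^ k)\<^sup>2 + (1/2) ^ k * B" by simp
    also have "\<dots> = (1/2) ^ k * (1 + B)"
      by (simp add: power2_eq_square power_mult_distrib[symmetric] algebra_simps mult.assoc[symmetric])
    finally show ?thesis by simp
  qed
  have "(\<integral>\<^sup>+ x. (\<Sum>k. ennreal \<bar>f k x\<bar>) \<partial>leb a b) = (\<Sum>k. \<integral>\<^sup>+ x. ennreal \<bar>f k x\<bar> \<partial>leb a b)"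
    by (rule nn_integral_suminf) simp
  also have "\<dots> = (\<Sum>k. ennreal (LINT x|leb a b. \<bar>f k x\<bar>))"
    using L2_integrable[OF fL2] by (intro suminf_cong nn_integral_eq_integral) auto
  also have "\<dots> \<le> (\<Sum>k. ennreal ((1/2) ^ k * (1 + B)))"
    by (intro suminf_le) (auto intro!: ennreal_leI f1)
  also have "\<dots> < \<infinity>"
  proof -
    have "summable (\<lambda>k. (1/2::real) ^ k * (1 + B))" by (intro summable_mult2 summable_geometric) simp
    thus ?thesis by (subst suminf_ennreal2) (auto simp: B_def)
  qed
  finally have "(\<integral>\<^sup>+ x. (\<Sum>k. ennreal \<bar>f k x\<bar>) \<partial>leb a b) \<noteq> \<infinity>" by simp
  hence "AE x in leb a b. (\<Sum>k. ennreal \<bar>f k x\<bar>) \<noteq> \<infinity>"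
    by (intro nn_integral_PInf_AE) auto
  hence conv: "AE x in leb a b. convergent (\<lambda>k. \<sigma> (r k) x)"
  proof eventually_elim
    case (elim x)
    have "summable (\<lambda>k. \<bar>f k x\<bar>)" by (rule summable_suminf_not_top) (use elim in auto)
    hence "summable (\<lambda>k. f k x)" by (rule summable_rabs_cancel)
    hence "(\<lambda>n. \<Sum>k<n. f k x) \<longlonglongrightarrow> (\<Sum>k. f k x)" by (rule summable_LIMSEQ)
    moreover have "(\<Sum>k<n. f k x) = \<sigma> (r n) x - \<sigma> (r 0) x" for n
      unfolding f_def by (rule sum_lessThan_telescope)
    ultimately have "(\<lambda>n. (\<sigma> (r n) x - \<sigma> (r 0) x) + \<sigma> (r 0) x) \<longlonglongrightarrow> (\<Sum>k. f k x) + \<sigma> (r 0) x"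
      by (intro tendsto_intros) simp
    thus ?case by (auto simp: convergent_def)
  qed
  define l where "l = (\<lambda>x. lim (\<lambda>k. \<sigma> (r k) x))"
  have [measurable]: "l \<in> borel_measurable (leb a b)" unfolding l_def by (rule borel_measurable_lim_metric) simp
  have lim: "AE x in leb a b. (\<lambda>k. \<sigma> (r k) x) \<longlonglongrightarrow> l x"
    using conv by eventually_elim (simp add: l_def convergent_LIMSEQ_iff)
  have F: "(\<integral>\<^sup>+ x. ennreal ((\<sigma> m x - l x)\<^sup>2) \<partial>leb a b) \<le> ennreal (((1/2) ^ j)\<^sup>2)" if m: "m \<ge> M j" for m j
  proof -
    have "(\<integral>\<^sup>+ x. ennreal ((\<sigma> m x - l x)\<^sup>2) \<partial>leb a b) = (\<integral>\<^sup>+ x. liminf (\<lambda>k. ennreal ((\<sigma> m x - \<sigma> (r k) x)\<^sup>2)) \<partial>leb a b)"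
    proof (rule nn_integral_cong_AE)
      show "AE x in leb a b. ennreal ((\<sigma> m x - l x)\<^sup>2) = liminf (\<lambda>k. ennreal ((\<sigma> m x - \<sigma> (r k) x)\<^sup>2))"
        using lim
      proof eventually_elim
        case (elim x)
        have "(\<lambda>k. ennreal ((\<sigma> m x - \<sigma> (r k) x)\<^sup>2)) \<longlonglongrightarrow> ennreal ((\<sigma> m x - l x)\<^sup>2)"
          by (intro tendsto_ennrealI tendsto_intros elim)
        from lim_imp_Liminf[OF _ this] show ?case by simp
      qed
    qed
    also have "\<dots> \<le> liminf (\<lambda>k. \<integral>\<^sup>+ x. ennreal ((\<sigma> m x - \<sigma> (r k) x)\<^sup>2) \<partial>leb a b)"
      by (rule nn_integral_liminf) simp
    also have "\<dots> \<le> ennreal (((1/2) ^ j)\<^sup>2)"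
    proof (rule Liminf_le)
      have "(\<integral>\<^sup>+ x. ennreal ((\<sigma> m x - \<sigma> (r k) x)\<^sup>2) \<partial>leb a b) \<le> ennreal (((1/2) ^ j)\<^sup>2)" if "k \<ge> j" for k
      proof -
        have "(\<integral>\<^sup>+ x. ennreal ((\<sigma> m x - \<sigma> (r k) x)\<^sup>2) \<partial>leb a b) = ennreal ((L2_norm a b (\<lambda>x. \<sigma> m x - \<sigma> (r k) x))\<^sup>2)"
          unfolding L2_norm_sq using L2d[of m "r k"] by (intro nn_integral_eq_integral) (auto simp: L2_def)
        also have "\<dots> \<le> ennreal (((1/2) ^ j)\<^sup>2)"
          by (intro ennreal_leI power_mono[OF less_imp_le[OF M[OF m r(3)[OF that]]] L2_norm_nonneg])
        finally show ?thesis .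
      qed
      thus "eventually (\<lambda>k. (\<integral>\<^sup>+ x. ennreal ((\<sigma> m x - \<sigma> (r k) x)\<^sup>2) \<partial>leb a b) \<le> ennreal (((1/2) ^ j)\<^sup>2)) sequentially"
        unfolding eventually_sequentially by blast
    qed simp
    finally show ?thesis .
  qed
  have dL2: "(\<lambda>x. \<sigma> m x - l x) \<in> L2 a b" if "m \<ge> M 0" for m
    unfolding L2_def
  proof (intro CollectI conjI integrableI_nonneg)
    show "(\<integral>\<^sup>+ x. ennreal ((\<sigma> m x - l x)\<^sup>2) \<partial>leb a b) < \<infinity>"
      using F[OF that] by (rule order.strict_trans1) simp
  qed auto
  have lL2: "l \<in> L2 a b" using L2_linear[OF \<sigma>[of "M 0"] dL2[of "M 0"], of 1 "-1"] by simp
  have "(\<lambda>n. L2_norm a b (\<lambda>x. \<sigma> n x - l x)) \<longlonglongrightarrow> 0"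
  proof (rule LIMSEQ_I)
    fix e :: real assume "e > 0"
    then obtain j where j: "(1/2::real) ^ j < e" using real_arch_pow_inv[of e "1/2"] by auto
    have "norm (L2_norm a b (\<lambda>x. \<sigma> n x - l x) - 0) < e" if n: "n \<ge> M j" for n
    proof -
      have d: "(\<lambda>x. \<sigma> n x - l x) \<in> L2 a b" using L2_linear[OF \<sigma>[of n] lL2, of 1 "-1"] by simp
      have "ennreal ((L2_norm a b (\<lambda>x. \<sigma> n x - l x))\<^sup>2) = (\<integral>\<^sup>+ x. ennreal ((\<sigma> n x - l x)\<^sup>2) \<partial>leb a b)"
        unfolding L2_norm_sq using d by (intro nn_integral_eq_integral[symmetric]) (auto simp: L2_def)
      also have "\<dots> \<le> ennreal (((1/2) ^ j)\<^sup>2)" by (rule F[OF n])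
      finally have "(L2_norm a b (\<lambda>x. \<sigma> n x - l x))\<^sup>2 \<le> ((1/2) ^ j)\<^sup>2" by (subst (asm) ennreal_le_iff) auto
      hence "L2_norm a b (\<lambda>x. \<sigma> n x - l x) \<le> (1/2) ^ j" by (rule power2_le_imp_le) simp
      thus ?thesis using j L2_norm_nonneg[of a b "\<lambda>x. \<sigma> n x - l x"] by simp
    qed
    thus "\<exists>no. \<forall>n\<ge>no. norm (L2_norm a b (\<lambda>x. \<sigma> n x - l x) - 0) < e" by blast
  qed
  thus ?thesis using lL2 by blast
qed

definition L2_ip :: "real \<Rightarrow> real \<Rightarrow> (real \<Rightarrow> real) \<Rightarrow> (real \<Rightarrow> real) \<Rightarrow> real" where
  "L2_ip a b f g = (LINT x|leb a b. f x * g x)"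

lemma L2_ip_linear:
  assumes "f \<in> L2 a b" "g \<in> L2 a b" "h \<in> L2 a b"
  shows "L2_ip a b (\<lambda>x. r * f x + s * g x) h = r * L2_ip a b f h + s * L2_ip a b g h"
proof -
  have "L2_ip a b (\<lambda>x. r * f x + s * g x) h = (LINT x|leb a b. r * (f x * h x) + s * (g x * h x))"
    unfolding L2_ip_def by (simp only: distrib_right mult.assoc)
  also have "\<dots> = r * L2_ip a b f h + s * L2_ip a b g h"
    unfolding L2_ip_def using L2_mult_integrable[OF assms(1,3)] L2_mult_integrable[OF assms(2,3)] by simp
  finally show ?thesis .
qed

lemma L2_semi_hilbert: "semi_hilbert (L2 a b) (L2_norm a b) (L2_ip a b)"
proof
  show "(\<lambda>_. 0) \<in> L2 a b" by (rule continuous_L2) simp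
  show "\<And>f g r s. f \<in> L2 a b \<Longrightarrow> g \<in> L2 a b \<Longrightarrow> (\<lambda>x. r * f x + s * g x) \<in> L2 a b" by (rule L2_linear)
  show "\<And>f g. L2_ip a b f g = L2_ip a b g f" unfolding L2_ip_def by (simp add: mult.commute)
  show "\<And>f g h r s. f \<in> L2 a b \<Longrightarrow> g \<in> L2 a b \<Longrightarrow> h \<in> L2 a b \<Longrightarrow>
      L2_ip a b (\<lambda>x. r * f x + s * g x) h = r * L2_ip a b f h + s * L2_ip a b g h" by (rule L2_ip_linear)
  show "\<And>f. 0 \<le> L2_ip a b f f" unfolding L2_ip_def by (rule integral_nonneg_AE) simp
  show "\<And>f. L2_norm a b f = sqrt (L2_ip a b f f)" unfolding L2_norm_def L2_ip_def by (simp add: power2_eq_square)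
qed (rule L2_complete)

interpretation L2sp: semi_hilbert "L2 a b" "L2_norm a b" "L2_ip a b" for a b
  by (rule L2_semi_hilbert)

lemma L2_abs: "f \<in> L2 a b \<Longrightarrow> (\<lambda>x. \<bar>f x\<bar>) \<in> L2 a b"
  unfolding L2_def by auto

lemma L1_le_L2:
  assumes "f \<in> L2 a b"
  shows "(LINT x|leb a b. \<bar>f x\<bar>) \<le> L2_norm a b (\<lambda>_. 1) * L2_norm a b f"
proof -
  have "\<bar>L2_ip a b (\<lambda>x. \<bar>f x\<bar>) (\<lambda>_. 1)\<bar> \<le> L2_norm a b (\<lambda>x. \<bar>f x\<bar>) * L2_norm a b (\<lambda>_. 1)"
    by (rule L2sp.Cauchy_Schwarz[OF L2_abs[OF assms] continuous_L2]) simp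
  moreover have "L2_norm a b (\<lambda>x. \<bar>f x\<bar>) = L2_norm a b f" unfolding L2_norm_def by simp
  ultimately show ?thesis unfolding L2_ip_def by (simp add: mult.commute)
qed

lemma L2_norm_zero_AE:
  assumes "f \<in> L2 a b" "L2_norm a b f = 0"
  shows "AE x in leb a b. f x = 0"
proof -
  have "(LINT x|leb a b. (f x)\<^sup>2) = 0" using L2_norm_sq[of a b f] assms(2) by simp
  hence "AE x in leb a b. (f x)\<^sup>2 = 0"
    using integral_nonneg_eq_0_iff_AE[of "leb a b" "\<lambda>x. (f x)\<^sup>2"] assms(1) by (auto simp: L2_def)
  thus ?thesis by (rule AE_mp) simp
qed

subsection \<open>The space X\<close>

lemma X_D:
  assumes "e \<in> X L"
  shows "e \<in> sobolev 2 0 L" "wderiv 0 L 0 e 0 = 0" "wderiv 0 L 0 e L = 0"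
  using assms unfolding X_def sobolev0_def by auto

lemma X_I:
  assumes "e \<in> sobolev 2 0 L" "wderiv 0 L 0 e 0 = 0" "wderiv 0 L 0 e L = 0"
  shows "e \<in> X L"
  using assms sobolev_mono[of 1 2 0 L] unfolding X_def sobolev0_def by auto

lemma X_linear:
  assumes "L > 0" "f \<in> X L" "g \<in> X L"
  shows "(\<lambda>x. r * f x + s * g x) \<in> X L"
  using assms X_D[OF assms(2)] X_D[OF assms(3)]
    wderiv_linear[OF X_D(1)[OF assms(2)] X_D(1)[OF assms(3)], of 0 0 r s] wderiv_linear[OF X_D(1)[OF assms(2)] X_D(1)[OF assms(3)], of 0 L r s]
  by (intro X_I sobolev_linear) auto

definition X_ip :: "real \<Rightarrow> (real \<Rightarrow> real) \<Rightarrow> (real \<Rightarrow> real) \<Rightarrow> real" where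
  "X_ip L f g = (\<Sum>i\<le>2. L2_ip 0 L (wderiv 0 L i f) (wderiv 0 L i g))"

lemma X_wderiv_L2: "e \<in> X L \<Longrightarrow> i \<le> 2 \<Longrightarrow> wderiv 0 L i e \<in> L2 0 L"
  using sobolevD(2) X_D(1) by blast

lemma L2_ip_cong_AE:
  assumes "AE x in leb a b. f x = f' x" "AE x in leb a b. g x = g' x"
  shows "L2_ip a b f g = L2_ip a b f' g'"
  unfolding L2_ip_def by (rule leb_integral_cong_AE) (use assms in \<open>eventually_elim, simp\<close>)

lemma X_norm_eq: "X_norm L f = sqrt (X_ip L f f)"
  unfolding sobolev_norm_def X_ip_def L2_norm_sq L2_ip_def by (simp add: power2_eq_square)

lemma X_wderiv_norm: "i \<le> 2 \<Longrightarrow> L2_norm 0 L (wderiv 0 L i e) \<le> X_norm L e"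
proof -
  assume i: "i \<le> 2"
  have "(L2_norm 0 L (wderiv 0 L i e))\<^sup>2 \<le> (\<Sum>i\<le>2. (L2_norm 0 L (wderiv 0 L i e))\<^sup>2)"
    using i by (intro member_le_sum) auto
  hence "sqrt ((L2_norm 0 L (wderiv 0 L i e))\<^sup>2) \<le> X_norm L e" unfolding sobolev_norm_def by (rule real_sqrt_le_mono)
  thus ?thesis using L2_norm_nonneg by simp
qed

lemma X_wderiv_diff:
  assumes "f \<in> X L" "g \<in> X L" "i \<le> 2"
  shows "AE x in leb 0 L. wderiv 0 L i (\<lambda>x. f x - g x) x = wderiv 0 L i f x - wderiv 0 L i g x"
  using wderiv_linear_AE[OF X_D(1)[OF assms(1)] X_D(1)[OF assms(2)] assms(3), of 1 "-1"] by simp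

text \<open>Completeness of \<open>L\<^sup>2\<close> gives limits of all derivatives up to order 2. Weak derivatives pass to the limit by
  the Cauchy-Schwarz inequality, boundary values by the embedding into continuous functions.\<close>

lemma X_complete:
  fixes \<sigma> :: "nat \<Rightarrow> real \<Rightarrow> real"
  assumes L: "L > 0" and \<sigma>: "\<And>n. \<sigma> n \<in> X L"
    and C: "\<And>e. e > 0 \<Longrightarrow> \<exists>M. \<forall>m\<ge>M. \<forall>n\<ge>M. X_norm L (\<lambda>x. \<sigma> m x - \<sigma> n x) < e"
  shows "\<exists>l\<in>X L. (\<lambda>n. X_norm L (\<lambda>x. \<sigma> n x - l x)) \<longlonglongrightarrow> 0"
proof -
  have "\<exists>l\<in>L2 0 L. (\<lambda>n. L2_norm 0 L (\<lambda>x. wderiv 0 L i (\<sigma> n) x - l x)) \<longlonglongrightarrow> 0" if i: "i \<le> 2" for i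
  proof (rule L2_complete)
    show "wderiv 0 L i (\<sigma> n) \<in> L2 0 L" for n by (rule X_wderiv_L2[OF \<sigma> i])
    fix e :: real assume "e > 0"
    then obtain M where M: "\<forall>m\<ge>M. \<forall>n\<ge>M. X_norm L (\<lambda>x. \<sigma> m x - \<sigma> n x) < e" using C by blast
    have "L2_norm 0 L (\<lambda>x. wderiv 0 L i (\<sigma> m) x - wderiv 0 L i (\<sigma> n) x) \<le> X_norm L (\<lambda>x. \<sigma> m x - \<sigma> n x)" for m n
      using X_wderiv_norm[OF i, of L "\<lambda>x. \<sigma> m x - \<sigma> n x"] L2_norm_cong_AE[OF X_wderiv_diff[OF \<sigma> \<sigma> i]] by simp
    thus "\<exists>M. \<forall>m\<ge>M. \<forall>n\<ge>M. L2_norm 0 L (\<lambda>x. wderiv 0 L i (\<sigma> m) x - wderiv 0 L i (\<sigma> n) x) < e"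
      using M order.strict_trans1 by blast
  qed
  hence "\<forall>i. \<exists>l. i \<le> 2 \<longrightarrow> l \<in> L2 0 L \<and> (\<lambda>n. L2_norm 0 L (\<lambda>x. wderiv 0 L i (\<sigma> n) x - l x)) \<longlonglongrightarrow> 0" by blast
  then obtain g where g': "\<forall>i. i \<le> 2 \<longrightarrow> g i \<in> L2 0 L \<and> (\<lambda>n. L2_norm 0 L (\<lambda>x. wderiv 0 L i (\<sigma> n) x - g i x)) \<longlonglongrightarrow> 0"
    using choice[of "\<lambda>i l. i \<le> 2 \<longrightarrow> l \<in> L2 0 L \<and> (\<lambda>n. L2_norm 0 L (\<lambda>x. wderiv 0 L i (\<sigma> n) x - l x)) \<longlonglongrightarrow> 0"] by blast
  hence g: "\<And>i. i \<le> 2 \<Longrightarrow> g i \<in> L2 0 L" "\<And>i. i \<le> 2 \<Longrightarrow> (\<lambda>n. L2_norm 0 L (\<lambda>x. wderiv 0 L i (\<sigma> n) x - g i x)) \<longlonglongrightarrow> 0" by blast+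
  define l where "l = g 0"
  have s: "\<sigma> n \<in> sobolev 2 0 L" for n by (rule X_D(1)[OF \<sigma>])
  have lim: "(\<lambda>n. LINT x|leb 0 L. wderiv 0 L i (\<sigma> n) x * \<eta> x) \<longlonglongrightarrow> (LINT x|leb 0 L. g i x * \<eta> x)"
    if i: "i \<le> 2" and \<eta>: "continuous_on {0..L} \<eta>" for i \<eta>
  proof -
    have "(\<lambda>n. L2_ip 0 L (wderiv 0 L i (\<sigma> n)) \<eta>) \<longlonglongrightarrow> L2_ip 0 L (g i) \<eta>"
    proof (rule L2sp.bfunctional_tendsto[OF L2sp.bfunctional_ip[OF continuous_L2[OF \<eta>]]])
      show "wderiv 0 L i (\<sigma> n) \<in> L2 0 L" for n by (rule X_wderiv_L2[OF \<sigma> i])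
      show "g i \<in> L2 0 L" by (rule g(1)[OF i])
      show "(\<lambda>n. L2_norm 0 L (\<lambda>x. g i x - wderiv 0 L i (\<sigma> n) x)) \<longlonglongrightarrow> 0"
        using g(2)[OF i] by (subst L2sp.N_minus[OF g(1)[OF i] X_wderiv_L2[OF \<sigma> i]])
    qed
    thus ?thesis unfolding L2_ip_def .
  qed
  have wd: "has_weak_deriv 0 L i l (g i)" if i: "i \<le> 2" for i
    unfolding has_weak_deriv_def
  proof (intro conjI ballI)
    show "locally_integrable 0 L l" "locally_integrable 0 L (g i)"
      unfolding l_def by (rule integrable_imp_locally_integrable[OF L2_integrable[OF g(1)]], use i in simp)+
    fix \<eta> assume \<eta>: "\<eta> \<in> test_functions 0 L"
    have lim1: "(\<lambda>n. LINT x|leb 0 L. wderiv 0 L 0 (\<sigma> n) x * (deriv ^^ i) \<eta> x) \<longlonglongrightarrow> (LINT x|leb 0 L. l x * (deriv ^^ i) \<eta> x)"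
      unfolding l_def by (rule lim) (simp_all add: test_functions_continuous[OF test_functions_deriv_funpow[OF \<eta>]])
    have eq: "(LINT x|leb 0 L. wderiv 0 L 0 (\<sigma> n) x * (deriv ^^ i) \<eta> x) = (-1) ^ i * (LINT x|leb 0 L. wderiv 0 L i (\<sigma> n) x * \<eta> x)" for n
    proof -
      have "(LINT x|leb 0 L. wderiv 0 L 0 (\<sigma> n) x * (deriv ^^ i) \<eta> x) = (LINT x|leb 0 L. \<sigma> n x * (deriv ^^ i) \<eta> x)"
        by (rule leb_integral_cong_AE, rule AE_mp[OF crep_AE[OF s[of n]]]) simp
      thus ?thesis using has_weak_deriv_test[OF sobolevD(1)[OF s i] \<eta>] by simp
    qed
    have lim2: "(\<lambda>n. (-1) ^ i * (LINT x|leb 0 L. wderiv 0 L i (\<sigma> n) x * \<eta> x)) \<longlonglongrightarrow> (-1) ^ i * (LINT x|leb 0 L. g i x * \<eta> x)"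
      by (intro tendsto_intros lim i test_functions_continuous[OF \<eta>])
    show "(LINT x|leb 0 L. l x * (deriv ^^ i) \<eta> x) = (-1) ^ i * (LINT x|leb 0 L. g i x * \<eta> x)"
      by (rule LIMSEQ_unique[OF lim1[unfolded eq] lim2])
  qed
  have ls: "l \<in> sobolev 2 0 L" unfolding sobolev_def using wd g(1) by (auto simp: l_def)
  have wl: "AE x in leb 0 L. wderiv 0 L i l x = g i x" if "i \<le> 2" for i by (rule wderiv_AE_eq[OF wd[OF that]])
  have wdiff: "AE x in leb 0 L. wderiv 0 L i (\<lambda>x. \<sigma> n x - l x) x = wderiv 0 L i (\<sigma> n) x - g i x" if i: "i \<le> 2" for i n
    using wderiv_linear_AE[OF s[of n] ls i, of 1 "-1"] wl[OF i] by eventually_elim simp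
  have lim0: "(\<lambda>n. L2_norm 0 L (wderiv 0 L i (\<lambda>x. \<sigma> n x - l x))) \<longlonglongrightarrow> 0" if i: "i \<le> 2" for i
    using g(2)[OF i] L2_norm_cong_AE[OF wdiff[OF i]] by simp
  have ds: "(\<lambda>x. \<sigma> n x - l x) \<in> sobolev 2 0 L" for n using sobolev_linear[OF s[of n] ls, of 1 "-1"] by simp
  have bd: "wderiv 0 L 0 l y = 0" if y: "y \<in> {0, L}" for y
  proof -
    have y': "y \<in> {0..L}" using y L by auto
    have "wderiv 0 L 0 (\<lambda>x. \<sigma> n x - l x) y = - wderiv 0 L 0 l y" for n
      using wderiv_linear[OF s[of n] ls, of 0 y 1 "-1"] y' L y X_D(2,3)[OF \<sigma>[of n]] by auto
    hence ab: "\<bar>wderiv 0 L 0 (\<lambda>x. \<sigma> n x - l x) y\<bar> = \<bar>wderiv 0 L 0 l y\<bar>" for n by simp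
    have le: "L * \<bar>wderiv 0 L 0 l y\<bar> \<le> L2_norm 0 L (\<lambda>_. 1) * L2_norm 0 L (wderiv 0 L 0 (\<lambda>x. \<sigma> n x - l x))
        + L * (L2_norm 0 L (\<lambda>_. 1) * L2_norm 0 L (wderiv 0 L 1 (\<lambda>x. \<sigma> n x - l x)))" for n
    proof -
      let ?d = "\<lambda>x. \<sigma> n x - l x"
      have "primitive_on 0 L (wderiv 0 L 0 ?d) (wderiv 0 L 1 ?d)" using sobolev_primitive[OF ds[of n], of 0] L by simp
      from primitive_on_bound[OF this y'] have "L * \<bar>wderiv 0 L 0 l y\<bar> \<le>
        (LINT y|leb 0 L. \<bar>wderiv 0 L 0 ?d y\<bar>) + L * (LINT y|leb 0 L. \<bar>wderiv 0 L 1 ?d y\<bar>)"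
        using L ab[of n] by simp
      moreover have "(LINT y|leb 0 L. \<bar>wderiv 0 L 0 ?d y\<bar>) \<le> L2_norm 0 L (\<lambda>_. 1) * L2_norm 0 L (wderiv 0 L 0 ?d)"
        by (rule L1_le_L2[OF sobolevD(2)[OF ds]]) simp
      moreover have "L * (LINT y|leb 0 L. \<bar>wderiv 0 L 1 ?d y\<bar>) \<le> L * (L2_norm 0 L (\<lambda>_. 1) * L2_norm 0 L (wderiv 0 L 1 ?d))"
        using L by (intro mult_left_mono L1_le_L2[OF sobolevD(2)[OF ds]]) auto
      ultimately show ?thesis by linarith
    qed
    have "(\<lambda>n. L2_norm 0 L (\<lambda>_. 1) * L2_norm 0 L (wderiv 0 L 0 (\<lambda>x. \<sigma> n x - l x))
        + L * (L2_norm 0 L (\<lambda>_. 1) * L2_norm 0 L (wderiv 0 L 1 (\<lambda>x. \<sigma> n x - l x)))) \<longlonglongrightarrow>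
        L2_norm 0 L (\<lambda>_. 1) * 0 + L * (L2_norm 0 L (\<lambda>_. 1) * 0)"
      by (intro tendsto_intros lim0) auto
    hence "L * \<bar>wderiv 0 L 0 l y\<bar> \<le> 0" using LIMSEQ_le_const le by fastforce
    thus ?thesis using L by (simp add: mult_le_0_iff)
  qed
  have lX: "l \<in> X L" by (rule X_I[OF ls]) (use bd in auto)
  have "(\<lambda>n. sqrt (\<Sum>i\<le>2. (L2_norm 0 L (wderiv 0 L i (\<lambda>x. \<sigma> n x - l x)))\<^sup>2)) \<longlonglongrightarrow> sqrt (\<Sum>i\<le>(2::nat). 0\<^sup>2)"
    by (intro tendsto_intros lim0) auto
  hence "(\<lambda>n. X_norm L (\<lambda>x. \<sigma> n x - l x)) \<longlonglongrightarrow> 0" unfolding sobolev_norm_def by simp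
  thus ?thesis using lX by blast
qed

lemma X_semi_hilbert:
  assumes L: "L > 0"
  shows "semi_hilbert (X L) (X_norm L) (X_ip L)"
proof
  have z: "(\<lambda>x. 0) \<in> L2 0 L" by (rule continuous_L2) simp
  have wz: "has_weak_deriv 0 L i (\<lambda>x. 0) (\<lambda>x. 0)" for i
    unfolding has_weak_deriv_def using integrable_imp_locally_integrable[OF L2_integrable[OF z]] by simp
  have "(\<lambda>x. 0) \<in> sobolev 2 0 L" unfolding sobolev_def using wz z by blast
  thus "(\<lambda>_. 0) \<in> X L"
    using wderiv_eq[OF wz[of 0], of 0] wderiv_eq[OF wz[of 0], of L] L by (intro X_I) auto
  show "\<And>f g r s. f \<in> X L \<Longrightarrow> g \<in> X L \<Longrightarrow> (\<lambda>x. r * f x + s * g x) \<in> X L" by (rule X_linear[OF L])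
  show "\<And>f g. X_ip L f g = X_ip L g f" unfolding X_ip_def L2_ip_def by (simp add: mult.commute)
  show "X_ip L (\<lambda>x. r * f x + s * g x) h = r * X_ip L f h + s * X_ip L g h"
    if f: "f \<in> X L" and g: "g \<in> X L" and h: "h \<in> X L" for f g h r s
  proof -
    have "L2_ip 0 L (wderiv 0 L i (\<lambda>x. r * f x + s * g x)) (wderiv 0 L i h)
       = r * L2_ip 0 L (wderiv 0 L i f) (wderiv 0 L i h) + s * L2_ip 0 L (wderiv 0 L i g) (wderiv 0 L i h)" if i: "i \<le> 2" for i
      using L2_ip_cong_AE[OF wderiv_linear_AE[OF X_D(1)[OF f] X_D(1)[OF g] i, of r s], where g="wderiv 0 L i h" and g'="wderiv 0 L i h"]
        L2_ip_linear[OF X_wderiv_L2[OF f i] X_wderiv_L2[OF g i] X_wderiv_L2[OF h i]] by simp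
    thus ?thesis unfolding X_ip_def by (simp add: sum.distrib sum_distrib_left)
  qed
  show "\<And>f. 0 \<le> X_ip L f f" unfolding X_ip_def L2_ip_def by (intro sum_nonneg integral_nonneg_AE) simp
  show "\<And>f. X_norm L f = sqrt (X_ip L f f)" by (rule X_norm_eq)
qed (rule X_complete[OF L])

text \<open>Space derivatives enter the problem only through the following functionals.\<close>

lemma X_functional_wderiv:
  assumes L: "L > 0" and i: "i \<le> 2" and \<theta>: "\<theta> \<in> L2 0 L"
  shows "semi_hilbert.bfunctional (X L) (X_norm L) (\<lambda>e. L2_ip 0 L (wderiv 0 L i e) \<theta>) (L2_norm 0 L \<theta>)"
proof -
  interpret X: semi_hilbert "X L" "X_norm L" "X_ip L" by (rule X_semi_hilbert[OF L])
  show ?thesis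
    unfolding X.bfunctional_def
  proof (intro conjI ballI allI)
    show "0 \<le> L2_norm 0 L \<theta>" by (rule L2_norm_nonneg)
    fix f assume f: "f \<in> X L"
    have "\<bar>L2_ip 0 L (wderiv 0 L i f) \<theta>\<bar> \<le> L2_norm 0 L (wderiv 0 L i f) * L2_norm 0 L \<theta>"
      by (rule L2sp.Cauchy_Schwarz[OF X_wderiv_L2[OF f i] \<theta>])
    also have "\<dots> \<le> X_norm L f * L2_norm 0 L \<theta>" by (rule mult_right_mono[OF X_wderiv_norm[OF i] L2_norm_nonneg])
    finally show "\<bar>L2_ip 0 L (wderiv 0 L i f) \<theta>\<bar> \<le> L2_norm 0 L \<theta> * X_norm L f" by (simp add: mult.commute)
    fix g r s assume g: "g \<in> X L"
    show "L2_ip 0 L (wderiv 0 L i (\<lambda>x. r * f x + s * g x)) \<theta> = r * L2_ip 0 L (wderiv 0 L i f) \<theta> + s * L2_ip 0 L (wderiv 0 L i g) \<theta>"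
      using L2_ip_cong_AE[OF wderiv_linear_AE[OF X_D(1)[OF f] X_D(1)[OF g] i, of r s], where g=\<theta> and g'=\<theta>]
        L2_ip_linear[OF X_wderiv_L2[OF f i] X_wderiv_L2[OF g i] \<theta>] by simp
  qed
qed

text \<open>The embedding estimate, applied to the first derivative.\<close>

lemma X_functional_boundary_deriv:
  assumes L: "L > 0"
  shows "\<exists>C. semi_hilbert.bfunctional (X L) (X_norm L) (\<lambda>e. wderiv 0 L 1 e L) C"
proof -
  interpret X: semi_hilbert "X L" "X_norm L" "X_ip L" by (rule X_semi_hilbert[OF L])
  let ?k = "L2_norm 0 L (\<lambda>_. 1)"
  let ?C = "?k / L + ?k"
  have "X.bfunctional (\<lambda>e. wderiv 0 L 1 e L) ?C"
    unfolding X.bfunctional_def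
  proof (intro conjI ballI allI)
    show "0 \<le> ?C" using L2_norm_nonneg L by (simp add: add_nonneg_nonneg)
    fix f assume f: "f \<in> X L"
    have s: "f \<in> sobolev 2 0 L" by (rule X_D(1)[OF f])
    have p: "primitive_on 0 L (wderiv 0 L 1 f) (wderiv 0 L 2 f)"
      using sobolev_primitive[OF s, of 1] L by (simp add: numeral_2_eq_2)
    have "L * \<bar>wderiv 0 L 1 f L\<bar> \<le> (LINT y|leb 0 L. \<bar>wderiv 0 L 1 f y\<bar>) + L * (LINT y|leb 0 L. \<bar>wderiv 0 L 2 f y\<bar>)"
      using primitive_on_bound[OF p, of L] L by simp
    also have "\<dots> \<le> ?k * X_norm L f + L * (?k * X_norm L f)"
    proof (intro add_mono mult_left_mono)
      have *: "(LINT y|leb 0 L. \<bar>wderiv 0 L i f y\<bar>) \<le> ?k * X_norm L f" if i: "i \<le> 2" for i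
      proof -
        have "(LINT y|leb 0 L. \<bar>wderiv 0 L i f y\<bar>) \<le> ?k * L2_norm 0 L (wderiv 0 L i f)" by (rule L1_le_L2[OF X_wderiv_L2[OF f i]])
        also have "\<dots> \<le> ?k * X_norm L f" by (rule mult_left_mono[OF X_wderiv_norm[OF i] L2_norm_nonneg])
        finally show ?thesis .
      qed
      show "(LINT y|leb 0 L. \<bar>wderiv 0 L 1 f y\<bar>) \<le> ?k * X_norm L f" "(LINT y|leb 0 L. \<bar>wderiv 0 L 2 f y\<bar>) \<le> ?k * X_norm L f"
        by (rule *, simp)+
    qed (use L in auto)
    also have "\<dots> = L * (?C * X_norm L f)" using L by (simp add: field_simps)
    finally show "\<bar>wderiv 0 L 1 f L\<bar> \<le> ?C * X_norm L f" using L by simp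
    fix g r s' assume g: "g \<in> X L"
    show "wderiv 0 L 1 (\<lambda>x. r * f x + s' * g x) L = r * wderiv 0 L 1 f L + s' * wderiv 0 L 1 g L"
      using wderiv_linear[OF s X_D(1)[OF g], of 1 L r s'] L by simp
  qed
  thus ?thesis by blast
qed

section \<open>Convolutions and a Gronwall inequality\<close>

lemma AE_leb_reflect:
  assumes "AE s in leb 0 T. P s" "t \<le> T"
  shows "AE s in leb 0 t. P (t - s)"
proof -
  obtain S where S: "negligible S" "{s. \<not> (0 < s \<and> s < T \<longrightarrow> P s)} \<subseteq> S"
    using assms(1) unfolding AE_leb_iff eventually_ae_filter_negligible by blast
  have n: "negligible ((\<lambda>s. t - s) ` S)"
    by (rule negligible_differentiable_image_negligible[OF _ S(1)]) (auto intro!: derivative_intros)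
  have "{s. \<not> (0 < s \<and> s < t \<longrightarrow> P (t - s))} \<subseteq> (\<lambda>s. t - s) ` S"
  proof
    fix s assume "s \<in> {s. \<not> (0 < s \<and> s < t \<longrightarrow> P (t - s))}"
    hence "t - s \<in> S" using S(2) assms(2) by auto
    thus "s \<in> (\<lambda>s. t - s) ` S" by (rule rev_image_eqI) simp
  qed
  thus ?thesis unfolding AE_leb_iff eventually_ae_filter_negligible using n by blast
qed

lemma leb_integral_reflect: "(LINT s|leb 0 t. h (t - s)) = (LINT s|leb 0 t. h s :: real)"
proof -
  have "(LINT s|leb 0 t. h s) = (LINT s|lebesgue. indicator {0<..<t} (t + (-1) * s) * h (t + (-1) * s))"
    unfolding leb_integral_eq using lebesgue_integral_real_affine[of "-1" "\<lambda>s. indicator {0<..<t} s * h s" t] by simp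
  also have "\<dots> = (LINT s|leb 0 t. h (t - s))"
    unfolding leb_integral_eq by (rule Bochner_Integration.integral_cong) (auto simp: indicator_def)
  finally show ?thesis by simp
qed

definition conv :: "(real \<Rightarrow> real) \<Rightarrow> (real \<Rightarrow> real) \<Rightarrow> real \<Rightarrow> real" where
  "conv k h t = (LINT s|leb 0 t. k (t - s) * h s)"

lemma conv_cong_AE:
  assumes "AE s in leb 0 T. k s = k' s" "AE s in leb 0 T. h s = h' s" "t \<le> T"
  shows "conv k h t = conv k' h' t"
  unfolding conv_def
proof (rule leb_integral_cong_AE)
  have "AE s in leb 0 t. h s = h' s" by (rule AE_leb_sub[OF assms(2)]) (use assms(3) in auto)
  with AE_leb_reflect[OF assms(1,3)] show "AE s in leb 0 t. k (t - s) * h s = k' (t - s) * h' s" by eventually_elim simp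
qed

lemma continuous_reflect:
  fixes k :: "real \<Rightarrow> real"
  assumes "continuous_on {0..T} k" "t \<le> T"
  shows "continuous_on {0..t} (\<lambda>s. k (t - s))"
  by (rule continuous_on_compose2[OF assms(1)]) (use assms(2) in \<open>auto intro!: continuous_intros\<close>)

text \<open>Splitting \<open>k1 h1 - k2 h2 = (k1 - k2) h1 + k2 (h1 - h2)\<close> keeps the difference of the kernels under the integral, in
  the form that a linear Gronwall inequality can absorb.\<close>

lemma conv_diff_bound:
  assumes c: "continuous_on {0..T} k1" "continuous_on {0..T} k2" "continuous_on {0..T} h1" "continuous_on {0..T} h2" "continuous_on {0..T} D"
    and t: "0 \<le> t" "t \<le> T" and B: "0 \<le> B" and E: "0 \<le> E"
    and kd: "\<And>s. 0 \<le> s \<Longrightarrow> s \<le> t \<Longrightarrow> \<bar>k1 s - k2 s\<bar> \<le> D s" and h1: "\<And>s. 0 \<le> s \<Longrightarrow> s \<le> t \<Longrightarrow> \<bar>h1 s\<bar> \<le> A"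
    and k2: "\<And>s. 0 \<le> s \<Longrightarrow> s \<le> t \<Longrightarrow> \<bar>k2 s\<bar> \<le> B" and hd: "\<And>s. 0 \<le> s \<Longrightarrow> s \<le> t \<Longrightarrow> \<bar>h1 s - h2 s\<bar> \<le> E"
  shows "\<bar>conv k1 h1 t - conv k2 h2 t\<bar> \<le> A * (LINT s|leb 0 t. D s) + B * E * T"
proof -
  have sub: "continuous_on {0..t} g" if "continuous_on {0..T} g" for g :: "real \<Rightarrow> real"
    by (rule continuous_on_subset[OF that]) (use t in auto)
  note cr = continuous_reflect[OF _ t(2)]
  have i: "integrable (leb 0 t) (\<lambda>s. k1 (t - s) * h1 s)" "integrable (leb 0 t) (\<lambda>s. k2 (t - s) * h2 s)"
    by (intro leb_continuous_integrable continuous_intros cr sub c)+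
  have iD: "integrable (leb 0 t) (\<lambda>s. D (t - s))" by (intro leb_continuous_integrable cr c)
  have i1: "integrable (leb 0 t) (\<lambda>s. B * E)" by (rule leb_continuous_integrable) simp
  have "conv k1 h1 t - conv k2 h2 t = (LINT s|leb 0 t. k1 (t - s) * h1 s - k2 (t - s) * h2 s)"
    unfolding conv_def using i by simp
  also have "\<bar>\<dots>\<bar> \<le> (LINT s|leb 0 t. \<bar>k1 (t - s) * h1 s - k2 (t - s) * h2 s\<bar>)" by (rule integral_abs_bound)
  also have "\<dots> \<le> (LINT s|leb 0 t. A * D (t - s) + B * E)"
  proof (rule integral_mono)
    show "integrable (leb 0 t) (\<lambda>s. \<bar>k1 (t - s) * h1 s - k2 (t - s) * h2 s\<bar>)" using i by simp
    show "integrable (leb 0 t) (\<lambda>s. A * D (t - s) + B * E)" using iD i1 by simp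
    fix s assume "s \<in> space (leb 0 t)"
    hence s: "0 \<le> s" "s \<le> t" by auto
    have "k1 (t - s) * h1 s - k2 (t - s) * h2 s = (k1 (t - s) - k2 (t - s)) * h1 s + k2 (t - s) * (h1 s - h2 s)"
      by (simp add: algebra_simps)
    also have "\<bar>\<dots>\<bar> \<le> \<bar>k1 (t - s) - k2 (t - s)\<bar> * \<bar>h1 s\<bar> + \<bar>k2 (t - s)\<bar> * \<bar>h1 s - h2 s\<bar>"
      by (metis abs_mult abs_triangle_ineq)
    also have "\<dots> \<le> D (t - s) * A + B * E"
    proof (intro add_mono mult_mono)
      show "0 \<le> D (t - s)" using kd[of "t - s"] s by linarith
    qed (use kd[of "t - s"] h1[OF s] k2[of "t - s"] hd[OF s] s B in auto)
    finally show "\<bar>k1 (t - s) * h1 s - k2 (t - s) * h2 s\<bar> \<le> A * D (t - s) + B * E" by (simp add: mult.commute)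
  qed
  also have "\<dots> = A * (LINT s|leb 0 t. D s) + B * E * t"
    using iD i1 leb_integral_reflect[of t D] leb_eq_integral[OF i1] t by simp
  also have "\<dots> \<le> A * (LINT s|leb 0 t. D s) + B * E * T"
    using B E t by (intro add_left_mono mult_left_mono) auto
  finally show ?thesis .
qed

text \<open>By continuity the inequality holds everywhere, and then \<open>exp (- C t) \<integral> D\<close> is nonincreasing.\<close>

lemma Gronwall_AE:
  fixes D :: "real \<Rightarrow> real"
  assumes T: "T > 0" and D: "continuous_on {0..T} D" and nn: "\<And>t. t \<in> {0..T} \<Longrightarrow> 0 \<le> D t"
    and le: "AE t in leb 0 T. D t \<le> C * (LINT s|leb 0 t. D s)" and t: "t \<in> {0..T}"
  shows "D t = 0"
proof -
  define d where "d = (\<lambda>t. 0 + (LINT s|leb 0 t. D s))"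
  have dp: "primitive_on 0 T d D" unfolding d_def by (rule primitive_onI[OF leb_continuous_integrable[OF D]])
  have dc: "continuous_on {0..T} d" by (rule primitive_on_continuous[OF dp])
  have le': "D t \<le> C * d t" if "t \<in> {0..T}" for t
  proof -
    have "max 0 (D t - C * d t) = 0"
    proof (rule continuous_AE_eq[where g="\<lambda>_. 0", OF _ _ _ T that])
      show "AE t in leb 0 T. max 0 (D t - C * d t) = 0" using le by eventually_elim (simp add: d_def)
    qed (intro continuous_intros D dc)+
    thus ?thesis by linarith
  qed
  define E where "E = (\<lambda>t. exp (- C * t) * d t)"
  have "d t \<le> 0" if tt: "t \<in> {0..T}" for t
  proof -
    have "E t \<le> E 0"
    proof (rule DERIV_nonpos_imp_decreasing_open[where f=E and a=0 and b=t])
      fix x assume x: "0 < x" "x < t"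
      have "(d has_real_derivative D x) (at x within {0..T})"
        by (rule primitive_on_has_derivative[OF dp D]) (use x tt in auto)
      moreover have "at x within {0..T} = at x" by (rule at_within_interior) (use x tt in auto)
      ultimately have "(d has_real_derivative D x) (at x)" by simp
      hence "(E has_real_derivative exp (- C * x) * (D x - C * d x)) (at x)"
        unfolding E_def by (auto intro!: derivative_eq_intros simp: algebra_simps)
      moreover have "exp (- C * x) * (D x - C * d x) \<le> 0"
        using le'[of x] x tt by (intro mult_nonneg_nonpos) auto
      ultimately show "\<exists>y. (E has_real_derivative y) (at x) \<and> y \<le> 0" by blast
    next
      show "continuous_on {0..t} E" unfolding E_def
        using continuous_on_subset[OF dc, of "{0..t}"] tt by (intro continuous_intros) auto
    qed (use tt in auto)
    moreover have "E 0 = 0" by (simp add: E_def d_def)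
    ultimately show ?thesis unfolding E_def by (simp add: mult_le_0_iff)
  qed
  moreover have "0 \<le> d t" if "t \<in> {0..T}" for t
    unfolding d_def using nn that by (simp, intro integral_nonneg_AE) (auto simp: AE_leb_iff)
  ultimately have "d t = 0" using t by (simp add: order_antisym)
  thus ?thesis using le'[OF t] nn[OF t] by simp
qed

context semi_hilbert begin

lemma bfunctional_comb:
  assumes "bfunctional l C" "bfunctional l' C'"
  shows "bfunctional (\<lambda>e. r * l e + s * l' e) (\<bar>r\<bar> * C + \<bar>s\<bar> * C')"
  unfolding bfunctional_def
proof (intro conjI ballI allI)
  show "0 \<le> \<bar>r\<bar> * C + \<bar>s\<bar> * C'" using bfunctionalD(1) assms by (simp add: add_nonneg_nonneg)
  fix f assume f: "f \<in> E"
  have "\<bar>r * l f + s * l' f\<bar> \<le> \<bar>r\<bar> * \<bar>l f\<bar> + \<bar>s\<bar> * \<bar>l' f\<bar>" by (metis abs_mult abs_triangle_ineq)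
  also have "\<dots> \<le> \<bar>r\<bar> * (C * N f) + \<bar>s\<bar> * (C' * N f)"
    using bfunctionalD(3)[OF assms(1) f] bfunctionalD(3)[OF assms(2) f] by (intro add_mono mult_left_mono) auto
  finally show "\<bar>r * l f + s * l' f\<bar> \<le> (\<bar>r\<bar> * C + \<bar>s\<bar> * C') * N f" by (simp add: algebra_simps)
  fix g r' s' assume g: "g \<in> E"
  show "r * l (\<lambda>x. r' * f x + s' * g x) + s * l' (\<lambda>x. r' * f x + s' * g x) = r' * (r * l f + s * l' f) + s' * (r * l g + s * l' g)"
    using bfunctionalD(2)[OF assms(1) f g] bfunctionalD(2)[OF assms(2) f g] by (simp add: algebra_simps)
qed

lemma bfunctional_diff_bound:
  assumes "bfunctional l C" "f \<in> E" "g \<in> E"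
  shows "\<bar>l f - l g\<bar> \<le> C * N (\<lambda>x. f x - g x)"
  using bfunctionalD(3)[OF assms(1) diff_mem[OF assms(2,3)]] bfunctionalD(4)[OF assms] by simp

lemma bcontinuous_diff:
  assumes "bcontinuous E N a b V" "bcontinuous E N a b W"
  shows "bcontinuous E N a b (\<lambda>t x. V t x - W t x)"
  unfolding bcontinuous_def
proof
  fix t assume t: "t \<in> {a..b}"
  have V: "V s \<in> E" and W: "W s \<in> E" if "s \<in> {a..b}" for s
    using bcontinuous_mem[OF assms(1)] bcontinuous_mem[OF assms(2)] that by auto
  have "((\<lambda>s. N (\<lambda>x. V s x - V t x) + N (\<lambda>x. W s x - W t x)) \<longlongrightarrow> 0 + 0) (at t within {a..b})"
    using assms t unfolding bcontinuous_def by (intro tendsto_add) auto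
  hence lim: "((\<lambda>s. N (\<lambda>x. V s x - V t x) + N (\<lambda>x. W s x - W t x)) \<longlongrightarrow> 0) (at t within {a..b})" by simp
  have "((\<lambda>s. N (\<lambda>x. (V s x - W s x) - (V t x - W t x))) \<longlongrightarrow> 0) (at t within {a..b})"
  proof (rule Lim_null_comparison[OF _ lim])
    have "norm (N (\<lambda>x. (V s x - W s x) - (V t x - W t x))) \<le> N (\<lambda>x. V s x - V t x) + N (\<lambda>x. W s x - W t x)"
      if s: "s \<in> {a..b}" for s
    proof -
      have "(\<lambda>x. (V s x - W s x) - (V t x - W t x)) = (\<lambda>x. (V s x - V t x) - (W s x - W t x))" by auto
      thus ?thesis
        using N_diff_le[OF diff_mem[OF V[OF s] V[OF t]] diff_mem[OF W[OF s] W[OF t]]]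
          N_nonneg[OF diff_mem[OF diff_mem[OF V[OF s] V[OF t]] diff_mem[OF W[OF s] W[OF t]]]] by simp
    qed
    thus "eventually (\<lambda>s. norm (N (\<lambda>x. (V s x - W s x) - (V t x - W t x))) \<le> N (\<lambda>x. V s x - V t x) + N (\<lambda>x. W s x - W t x)) (at t within {a..b})"
      by (auto simp: eventually_at_filter)
  qed
  thus "(\<lambda>x. V t x - W t x) \<in> E \<and> ((\<lambda>s. N (\<lambda>x. (V s x - W s x) - (V t x - W t x))) \<longlongrightarrow> 0) (at t within {a..b})"
    using diff_mem[OF V[OF t] W[OF t]] by simp
qed

lemma has_bintegral_diff:
  assumes "has_bintegral E N a b v J" "has_bintegral E N a b w K"
  shows "has_bintegral E N a b (\<lambda>t x. v t x - w t x) (\<lambda>x. J x - K x)"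
proof (rule has_bintegralI)
  note D = has_bintegral_D[OF assms(1)] and D' = has_bintegral_D[OF assms(2)]
  show m: "bmeasurable E N a b (\<lambda>t x. v t x - w t x)" by (rule bmeasurable_diff[OF D(1) D'(1)])
  show "(\<lambda>x. J x - K x) \<in> E" by (rule diff_mem[OF D(2) D'(2)])
  show "integrable (leb a b) (\<lambda>t. N (\<lambda>x. v t x - w t x))"
  proof (rule Bochner_Integration.integrable_bound[OF Bochner_Integration.integrable_add[OF D(3) D'(3)] bmeasurable_N[OF m]])
    show "AE t in leb a b. norm (N (\<lambda>x. v t x - w t x)) \<le> norm (N (v t) + N (w t))"
      using bmeasurable_mem[OF D(1)] bmeasurable_mem[OF D'(1)]
    proof eventually_elim
      case (elim t)
      show ?case using N_diff_le[OF elim] N_nonneg[OF diff_mem[OF elim]] by simp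
    qed
  qed
  fix e assume e: "e \<in> E"
  note B = bfunctional_ip[OF e]
  have "(LINT t|leb a b. ip (\<lambda>x. v t x - w t x) e) = (LINT t|leb a b. ip (v t) e - ip (w t) e)"
  proof (rule leb_integral_cong_AE)
    show "AE t in leb a b. ip (\<lambda>x. v t x - w t x) e = ip (v t) e - ip (w t) e"
      using bmeasurable_mem[OF D(1)] bmeasurable_mem[OF D'(1)]
    proof eventually_elim
      case (elim t)
      show ?case by (rule bfunctionalD(4)[OF B elim])
    qed
  qed
  also have "\<dots> = ip J e - ip K e"
    using has_bintegral_functional[OF assms(1) B] has_bintegral_functional[OF assms(2) B] by simp
  finally show "(LINT t|leb a b. ip (\<lambda>x. v t x - w t x) e) = ip (\<lambda>x. J x - K x) e"
    using bfunctionalD(4)[OF B D(2) D'(2)] by simp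
qed
end

lemma X_norm_cong_AE:
  assumes "AE x in leb 0 L. e x = e' x"
  shows "X_norm L e = X_norm L e'"
  unfolding sobolev_norm_def using wderiv_cong_AE[OF assms] by simp

lemma AE_eq_zero_norm:
  assumes "L > 0" "e \<in> X L" "X_norm L e = 0"
  shows "AE x in leb 0 L. e x = 0"
proof -
  have "L2_norm 0 L (wderiv 0 L 0 e) = 0" using X_wderiv_norm[where i=0 and L=L and e=e] L2_norm_nonneg assms(3) by (simp add: order_antisym)
  hence "AE x in leb 0 L. wderiv 0 L 0 e x = 0" by (rule L2_norm_zero_AE[OF X_wderiv_L2[OF assms(2)], rotated]) simp
  thus ?thesis using crep_AE[OF X_D(1)[OF assms(2)]] by eventually_elim simp
qed

section \<open>Uniqueness\<close>

locale inverse_data =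
  fixes L T \<beta> p q :: real and u0 u1 u2 \<phi> f :: "real \<Rightarrow> real"
  assumes pos: "L > 0" "T > 0" "\<beta> > 0" "p > 0" "q > 0"
    and u0: "u0 \<in> sobolev 4 0 L" and u1: "u1 \<in> sobolev 4 0 L" and \<phi>: "\<phi> \<in> sobolev0 3 0 L"
    and u2: "u2 \<in> sobolev 2 0 L" "AE x in leb 0 L. u2 x - \<beta> * wderiv 0 L 2 u2 x = wderiv 0 L 2 u0 x"
    and v0: "lift L u1 \<in> X L" and v1: "lift L u2 \<in> X L"
    and \<gamma>_nz: "(LINT x|leb 0 L. wderiv 0 L 1 \<phi> x * wderiv 0 L 2 u0 x) \<noteq> 0"
    and f: "f \<in> sobolev 4 0 T"
    and f0: "(LINT x|leb 0 L. (\<phi> x - \<beta> * wderiv 0 L 2 \<phi> x) * wderiv 0 L 1 u0 x) = crep 0 T f 0"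
    and f1: "(LINT x|leb 0 L. (\<phi> x - \<beta> * wderiv 0 L 2 \<phi> x) * wderiv 0 L 1 u1 x) = wderiv 0 T 1 f 0"
    and f2: "(LINT x|leb 0 L. (\<phi> x - \<beta> * wderiv 0 L 2 \<phi> x) * wderiv 0 L 1 u2 x) = wderiv 0 T 2 f 0"
    and \<psi>_nz: "\<psi> L \<beta> \<phi> L \<noteq> 0"
begin

sublocale XX: semi_hilbert "X L" "X_norm L" "X_ip L"
  by (rule X_semi_hilbert[OF pos(1)])

abbreviation "\<phi>0 \<equiv> wderiv 0 L 0 \<phi>"
abbreviation "\<phi>1 \<equiv> wderiv 0 L 1 \<phi>"
abbreviation "\<phi>2 \<equiv> wderiv 0 L 2 \<phi>"
abbreviation "u02 \<equiv> wderiv 0 L 2 u0"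
abbreviation "w0 \<equiv> lift L u1"
abbreviation "w1 \<equiv> lift L u2"
abbreviation "k0 \<equiv> k_init L T \<phi> f u0 u1"
abbreviation "ytt0 \<equiv> ytt_init L T \<beta> \<phi> f u0 u1"
abbreviation "fd i \<equiv> wderiv 0 T i f"

definition "\<psi>L = \<psi> L \<beta> \<phi> L"
definition "\<gamma> = L2_ip 0 L u02 \<phi>1"
definition "\<mu> = (\<lambda>x. \<phi> x - \<beta> * \<phi>2 x)"
definition "xL = (\<lambda>x::real. x / L)"

lemma \<phi>_sob: "\<phi> \<in> sobolev 3 0 L" and \<phi>_bd: "i < 3 \<Longrightarrow> wderiv 0 L i \<phi> 0 = 0" "i < 3 \<Longrightarrow> wderiv 0 L i \<phi> L = 0"
  using \<phi> unfolding sobolev0_def by auto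

lemma \<phi>_prim: "primitive_on 0 L \<phi>0 \<phi>1" "primitive_on 0 L \<phi>1 \<phi>2" "primitive_on 0 L \<phi>2 (wderiv 0 L 3 \<phi>)"
  using sobolev_primitive[OF \<phi>_sob, of 0] sobolev_primitive[OF \<phi>_sob, of 1] sobolev_primitive[OF \<phi>_sob, of 2] pos(1)
  by (simp_all add: numeral_2_eq_2 numeral_3_eq_3)

lemma \<phi>_L2: "i \<le> 3 \<Longrightarrow> wderiv 0 L i \<phi> \<in> L2 0 L" and \<phi>_L2': "\<phi> \<in> L2 0 L"
  using sobolevD(2)[OF \<phi>_sob] sobolev_L2[OF \<phi>_sob] by auto

lemma \<gamma>_nz': "\<gamma> \<noteq> 0" and \<alpha>_eq: "\<alpha> L \<phi> u0 = 1 / \<gamma>"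
  using \<gamma>_nz unfolding \<gamma>_def L2_ip_def \<alpha>_def by (simp_all add: mult.commute)

lemma \<mu>_L2: "\<mu> \<in> L2 0 L"
  unfolding \<mu>_def using L2_linear[OF \<phi>_L2' \<phi>_L2[of 2], of 1 "-\<beta>"] by simp

lemma xL_L2: "xL \<in> L2 0 L" and xL_cont: "continuous_on A xL"
proof -
  show "continuous_on A xL" for A unfolding xL_def using pos(1) by (intro continuous_intros) auto
  thus "xL \<in> L2 0 L" by (rule continuous_L2)
qed

lemma \<psi>L_eq: "\<psi>L = (LINT x|leb 0 L. \<phi> x)" "\<psi>L \<noteq> 0"
  using \<psi>_nz \<phi>_bd(2)[of 1] unfolding \<psi>L_def \<psi>_def by auto

lemma \<mu>_int: "(LINT x|leb 0 L. \<mu> x) = \<psi>L"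
proof -
  have "(LINT x|leb 0 L. \<phi>2 x) = 0"
    using primitive_onD(2)[OF \<phi>_prim(2), of L] \<phi>_bd[of 1] pos(1) by simp
  thus ?thesis unfolding \<mu>_def \<psi>L_eq using L2_integrable[OF \<phi>_L2'] L2_integrable[OF \<phi>_L2[of 2]] by simp
qed

lemma xL_\<phi>1: "L2_ip 0 L xL \<phi>1 = - \<psi>L / L"
proof -
  have p: "primitive_on 0 L xL (\<lambda>_. 1 / L)"
    by (rule primitive_on_DERIV) (use pos(1) in \<open>auto simp: xL_def intro!: derivative_eq_intros\<close>)
  have "L2_ip 0 L xL \<phi>1 = - (LINT x|leb 0 L. 1 / L * \<phi>0 x)"
    unfolding L2_ip_def using integral_by_parts_primitive(1)[OF p \<phi>_prim(1)] pos(1) \<phi>_bd[of 0] by simp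
  also have "(LINT x|leb 0 L. 1 / L * \<phi>0 x) = 1 / L * (LINT x|leb 0 L. \<phi> x)"
    using leb_integral_cong_AE[OF crep_AE[OF \<phi>_sob]] by simp
  finally show ?thesis unfolding \<psi>L_eq by simp
qed

text \<open>The operator \<open>1 - \<beta> d\<^sup>2/dx\<^sup>2\<close>; the factor 1 makes it an instance of the linearity lemmas.\<close>

definition E :: "(real \<Rightarrow> real) \<Rightarrow> real \<Rightarrow> real" where
  "E e = (\<lambda>x. 1 * wderiv 0 L 0 e x + (- \<beta>) * wderiv 0 L 2 e x)"

text \<open>The functional \<open>e \<mapsto> \<integral> (E e) \<theta>\<close>, written as a combination of inner products whose boundedness is already known.\<close>

definition ell :: "(real \<Rightarrow> real) \<Rightarrow> (real \<Rightarrow> real) \<Rightarrow> real" where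
  "ell \<theta> e = 1 * L2_ip 0 L (wderiv 0 L 0 e) \<theta> + (- \<beta>) * L2_ip 0 L (wderiv 0 L 2 e) \<theta>"

definition \<Lambda> :: "(real \<Rightarrow> real) \<Rightarrow> real" where
  "\<Lambda> e = L2_ip 0 L (wderiv 0 L 1 e) \<mu>"

abbreviation "D e \<equiv> wderiv 0 L 1 e L"

lemma E_L2: "e \<in> X L \<Longrightarrow> E e \<in> L2 0 L"
  unfolding E_def by (intro L2_linear X_wderiv_L2) auto

lemma ell_E: "e \<in> X L \<Longrightarrow> \<theta> \<in> L2 0 L \<Longrightarrow> ell \<theta> e = L2_ip 0 L (E e) \<theta>"
  unfolding ell_def E_def using L2_ip_linear[OF X_wderiv_L2[of e L 0] X_wderiv_L2[of e L 2], of \<theta> 1 "-\<beta>"] by simp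

lemma ell_bfunctional: "\<theta> \<in> L2 0 L \<Longrightarrow> XX.bfunctional (ell \<theta>) (\<bar>1\<bar> * L2_norm 0 L \<theta> + \<bar>- \<beta>\<bar> * L2_norm 0 L \<theta>)"
  unfolding ell_def
  by (rule XX.bfunctional_comb[OF X_functional_wderiv[OF pos(1), of 0] X_functional_wderiv[OF pos(1), of 2]]) auto

lemma \<Lambda>_bfunctional: "XX.bfunctional \<Lambda> (L2_norm 0 L \<mu>)"
  unfolding \<Lambda>_def by (rule X_functional_wderiv[OF pos(1) _ \<mu>_L2]) simp

lemma X_prim: "e \<in> X L \<Longrightarrow> primitive_on 0 L (wderiv 0 L 0 e) (wderiv 0 L 1 e)"
  "e \<in> X L \<Longrightarrow> primitive_on 0 L (wderiv 0 L 1 e) (wderiv 0 L 2 e)"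
  using sobolev_primitive[OF X_D(1), of e L 0] sobolev_primitive[OF X_D(1), of e L 1] pos(1)
  by (simp_all add: numeral_2_eq_2)

text \<open>Testing with \<open>\<phi>'\<close> turns the operator into the functional of the overdetermination condition.\<close>

lemma ell_\<phi>1:
  assumes e: "e \<in> X L"
  shows "ell \<phi>1 e = - \<Lambda> e"
proof -
  have 1: "L2_ip 0 L (wderiv 0 L 0 e) \<phi>1 = - (LINT x|leb 0 L. wderiv 0 L 1 e x * \<phi>0 x)"
    unfolding L2_ip_def using integral_by_parts_primitive(1)[OF X_prim(1)[OF e] \<phi>_prim(1)] pos(1) \<phi>_bd[of 0] by simp
  have 2: "L2_ip 0 L (wderiv 0 L 2 e) \<phi>1 = - (LINT x|leb 0 L. wderiv 0 L 1 e x * \<phi>2 x)"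
    unfolding L2_ip_def using integral_by_parts_primitive(1)[OF X_prim(2)[OF e] \<phi>_prim(2)] pos(1) \<phi>_bd[of 1] by simp
  have i: "integrable (leb 0 L) (\<lambda>x. wderiv 0 L 1 e x * \<phi>0 x)" "integrable (leb 0 L) (\<lambda>x. wderiv 0 L 1 e x * \<phi>2 x)"
    using L2_mult_integrable[OF X_wderiv_L2[OF e, of 1] \<phi>_L2] by auto
  have "\<Lambda> e = (LINT x|leb 0 L. wderiv 0 L 1 e x * \<phi>0 x - \<beta> * (wderiv 0 L 1 e x * \<phi>2 x))"
    unfolding \<Lambda>_def L2_ip_def \<mu>_def
    by (rule leb_integral_cong_AE, rule AE_mp[OF crep_AE[OF \<phi>_sob]]) (simp add: algebra_simps)
  also have "\<dots> = (LINT x|leb 0 L. wderiv 0 L 1 e x * \<phi>0 x) - \<beta> * (LINT x|leb 0 L. wderiv 0 L 1 e x * \<phi>2 x)"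
    using i by simp
  finally show ?thesis unfolding ell_def 1 2 by simp
qed

text \<open>The a priori estimate of the elliptic problem: \<open>\<integral> (e - \<beta> e'')\<^sup>2 = \<integral> e\<^sup>2 + 2 \<beta> e'\<^sup>2 + \<beta>\<^sup>2 e''\<^sup>2\<close>.\<close>

definition "Kell = sqrt (1 / min 1 (min (2 * \<beta>) (\<beta>\<^sup>2)))"

lemma Kell_nonneg: "0 \<le> Kell"
  unfolding Kell_def using pos(3) by auto

lemma elliptic_estimate:
  assumes e: "e \<in> X L"
  shows "X_norm L e \<le> Kell * L2_norm 0 L (E e)"
proof -
  let ?e = "\<lambda>i. wderiv 0 L i e"
  have L2: "?e i \<in> L2 0 L" if "i \<le> 2" for i by (rule X_wderiv_L2[OF e that])
  have i: "integrable (leb 0 L) (\<lambda>x. (?e 0 x)\<^sup>2)" "integrable (leb 0 L) (\<lambda>x. (?e 2 x)\<^sup>2)" "integrable (leb 0 L) (\<lambda>x. ?e 0 x * ?e 2 x)"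
    using L2[of 0] L2[of 2] L2_mult_integrable[OF L2[of 0] L2[of 2]] by (auto simp: L2_def)
  have "(LINT x|leb 0 L. ?e 0 x * ?e 2 x) = - (LINT x|leb 0 L. ?e 1 x * ?e 1 x)"
    using integral_by_parts_primitive(1)[OF X_prim[OF e]] pos(1) X_D(2,3)[OF e] by simp
  hence c: "(LINT x|leb 0 L. ?e 0 x * ?e 2 x) = - (L2_norm 0 L (?e 1))\<^sup>2"
    unfolding L2_norm_sq by (simp add: power2_eq_square)
  have "(L2_norm 0 L (E e))\<^sup>2 = (LINT x|leb 0 L. (?e 0 x)\<^sup>2 - 2 * \<beta> * (?e 0 x * ?e 2 x) + \<beta>\<^sup>2 * (?e 2 x)\<^sup>2)"
    unfolding L2_norm_sq E_def by (rule Bochner_Integration.integral_cong) (auto simp: power2_eq_square algebra_simps)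
  also have "\<dots> = (L2_norm 0 L (?e 0))\<^sup>2 + 2 * \<beta> * (L2_norm 0 L (?e 1))\<^sup>2 + \<beta>\<^sup>2 * (L2_norm 0 L (?e 2))\<^sup>2"
    using i c by (simp add: L2_norm_sq)
  finally have eq: "(L2_norm 0 L (E e))\<^sup>2 = (L2_norm 0 L (?e 0))\<^sup>2 + 2 * \<beta> * (L2_norm 0 L (?e 1))\<^sup>2 + \<beta>\<^sup>2 * (L2_norm 0 L (?e 2))\<^sup>2" .
  define c where "c = min 1 (min (2 * \<beta>) (\<beta>\<^sup>2))"
  have c0: "c > 0" using pos(3) by (auto simp: c_def)
  have "c * (\<Sum>i\<le>2. (L2_norm 0 L (?e i))\<^sup>2) = c * (L2_norm 0 L (?e 0))\<^sup>2 + c * (L2_norm 0 L (?e 1))\<^sup>2 + c * (L2_norm 0 L (?e 2))\<^sup>2"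
    by (simp add: numeral_2_eq_2 algebra_simps)
  also have "\<dots> \<le> 1 * (L2_norm 0 L (?e 0))\<^sup>2 + 2 * \<beta> * (L2_norm 0 L (?e 1))\<^sup>2 + \<beta>\<^sup>2 * (L2_norm 0 L (?e 2))\<^sup>2"
    by (intro add_mono mult_right_mono) (auto simp: c_def)
  finally have "(\<Sum>i\<le>2. (L2_norm 0 L (?e i))\<^sup>2) \<le> 1 / c * (L2_norm 0 L (E e))\<^sup>2"
    using c0 eq by (simp add: field_simps)
  hence "X_norm L e \<le> sqrt (1 / c * (L2_norm 0 L (E e))\<^sup>2)" unfolding sobolev_norm_def by (rule real_sqrt_le_mono)
  also have "\<dots> = sqrt (1 / c) * sqrt ((L2_norm 0 L (E e))\<^sup>2)" by (rule real_sqrt_mult)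
  also have "\<dots> = Kell * L2_norm 0 L (E e)" using L2_norm_nonneg by (simp add: Kell_def c_def)
  finally show ?thesis .
qed

text \<open>The integral of \<open>\<phi> - \<beta> \<phi>''\<close> is \<open>\<psi>(L)\<close> because \<open>\<phi>'\<close> vanishes at both ends.\<close>

lemma overdetermination_functional:
  assumes "e \<in> X L"
  shows "(LINT x|leb 0 L. (\<phi> x - \<beta> * \<phi>2 x) * (wderiv 0 L 1 e x - c / L)) = \<Lambda> e - c * \<psi>L / L"
proof -
  have "(LINT x|leb 0 L. \<mu> x * (wderiv 0 L 1 e x - c / L)) = (LINT x|leb 0 L. wderiv 0 L 1 e x * \<mu> x - c / L * \<mu> x)"
    by (simp add: algebra_simps)
  also have "\<dots> = \<Lambda> e - c / L * \<psi>L"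
    unfolding \<Lambda>_def L2_ip_def \<mu>_int[symmetric]
    using L2_mult_integrable[OF X_wderiv_L2[of e L 1] \<mu>_L2] L2_integrable[OF \<mu>_L2] assms by simp
  finally show ?thesis by (simp add: \<mu>_def)
qed

definition memory :: "(real \<Rightarrow> real) \<Rightarrow> (real \<Rightarrow> real \<Rightarrow> real) \<Rightarrow> (real \<Rightarrow> real) \<Rightarrow> real \<Rightarrow> real" where
  "memory \<theta> V k s = L2_ip 0 L (wderiv 0 L 2 (V s)) \<theta> - k s * L2_ip 0 L u02 \<theta>
     - conv k (\<lambda>r. L2_ip 0 L (wderiv 0 L 2 (V r)) \<theta>) s"

text \<open>The initial values of \<open>z = p y' + q y\<close> and of \<open>z'\<close>. They are forced by the overdetermination condition
  and its time derivative at \<open>t = 0\<close>, where \<open>\<psi>(L) \<noteq> 0\<close> makes it possible to solve for them.\<close>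

definition "z0_init = - (L / \<psi>L) * (fd 1 0 - \<Lambda> w0)"
definition "z1_init = - (L / \<psi>L) * (fd 2 0 - \<Lambda> w1)"

text \<open>The form of the problem in which only continuous functions of time and functionals of them are
  left. The equation of motion is integrated in time and tested with square integrable functions.\<close>

definition reduced :: "(real \<Rightarrow> real \<Rightarrow> real) \<Rightarrow> (real \<Rightarrow> real \<Rightarrow> real) \<Rightarrow> (real \<Rightarrow> real) \<Rightarrow>
    (real \<Rightarrow> real) \<Rightarrow> (real \<Rightarrow> real) \<Rightarrow> (real \<Rightarrow> real) \<Rightarrow> bool" where
  "reduced V V1 k y0 y1 y2 \<longleftrightarrow>
     bcontinuous (X L) (X_norm L) 0 T V \<and> bcontinuous (X L) (X_norm L) 0 T V1 \<and>
     (\<forall>t\<in>{0..T}. has_bintegral (X L) (X_norm L) 0 t V1 (\<lambda>x. V t x - V 0 x)) \<and>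
     (AE x in leb 0 L. V 0 x = w0 x) \<and> (AE x in leb 0 L. V1 0 x = w1 x) \<and>
     continuous_on {0..T} k \<and> primitive_on 0 T y0 y1 \<and> primitive_on 0 T y1 y2 \<and> continuous_on {0..T} y2 \<and> y2 0 = ytt0 \<and>
     (\<forall>\<theta>\<in>L2 0 L. integrable (leb 0 T) (memory \<theta> V k) \<and>
       (\<forall>t\<in>{0..T}. ell \<theta> (V1 t) - ell \<theta> (V1 0) = (LINT s|leb 0 t. memory \<theta> V k s)
           + ((p * y2 t + q * y1 t) - (p * y2 0 + q * y1 0)) * L2_ip 0 L xL \<theta>)) \<and>
     (AE t in leb 0 T. \<gamma> * k t = fd 3 t + L2_ip 0 L (wderiv 0 L 2 (V t)) \<phi>1 - conv k (\<lambda>s. L2_ip 0 L (wderiv 0 L 2 (V s)) \<phi>1) t) \<and>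
     (AE t in leb 0 T. D (V t) - conv k (\<lambda>s. D (V s)) t = y2 t + k t * D u0
        + 1 / L * ((p * y1 t + q * y0 t) - conv k (\<lambda>s. p * y1 s + q * y0 s) t)) \<and>
     p * y1 0 + q * y0 0 = z0_init \<and> p * y2 0 + q * y1 0 = z1_init"

text \<open>Differentiating the overdetermination condition twice in time and inserting the equation of motion,
  tested with \<open>\<phi>'\<close>, makes k explicit: the term with \<open>z''\<close> cancels, and k appears with the factor \<open>\<gamma> \<noteq> 0\<close>.\<close>

lemma IP_imp_reduced:
  assumes IP: "IP L T \<beta> p q \<phi> f u0 w0 w1 k0 ytt0 v k y"
  shows "\<exists>V V1 y0 y1 y2. reduced V V1 (crep 0 T k) y0 y1 y2 \<and>
     (AE t in leb 0 T. v t \<in> X L \<and> X_norm L (\<lambda>x. v t x - V t x) = 0) \<and> (AE t in leb 0 T. crep 0 T k t = k t)"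
proof -
  define V where "V = bwderiv (X L) (X_norm L) 0 T 0 v"
  define V1 where "V1 = bwderiv (X L) (X_norm L) 0 T 1 v"
  define V2 where "V2 = bwderiv (X L) (X_norm L) 0 T 2 v"
  define yd where "yd = (\<lambda>i. wderiv 0 T i y)"
  define z where "z = (\<lambda>t. p * wderiv 0 T 1 y t + q * y t)"
  define kc where "kc = crep 0 T k"
  have bs: "v \<in> bsobolev 2 (X L) (X_norm L) 0 T" and ks: "k \<in> sobolev 1 0 T" and ys: "y \<in> sobolev 3 0 T"
    and i2: "yd 2 0 = ytt0"
    and pde: "AE t in leb 0 T. \<exists>J.
           has_bintegral (L2 0 L) (L2_norm 0 L) 0 t (\<lambda>s x. k (t - s) * wderiv 0 L 2 (v s) x) J \<and>
           (AE x in leb 0 L. V2 t x - wderiv 0 L 2 (v t) x - \<beta> * wderiv 0 L 2 (V2 t) x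
                + k t * wderiv 0 L 2 u0 x + J x = wderiv 0 T 2 z t * x / L)"
    and init: "AE x in leb 0 L. V 0 x = w0 x" "AE x in leb 0 L. V1 0 x = w1 x"
    and bc: "AE t in leb 0 T. wderiv 0 L 1 (v t) L - (LINT s|leb 0 t. k (t - s) * wderiv 0 L 1 (v s) L)
           = yd 2 t + k t * wderiv 0 L 1 u0 L + 1 / L * (z t - (LINT s|leb 0 t. k (t - s) * z s))"
    and od: "AE t in leb 0 T. (LINT x|leb 0 L. (\<phi> x - \<beta> * wderiv 0 L 2 \<phi> x) * (wderiv 0 L 1 (v t) x - z t / L)) = wderiv 0 T 1 f t"
    using IP unfolding IP_def Let_def V_def V1_def V2_def yd_def z_def by blast+
  note rep = XX.bsobolev_2_representation[OF bs pos(2), folded V_def V1_def V2_def]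
  have prim: "primitive_on 0 T (yd 0) (yd 1)" "primitive_on 0 T (yd 1) (yd 2)" "primitive_on 0 T (yd 2) (yd 3)"
    unfolding yd_def using sobolev_primitive[OF ys, of 0] sobolev_primitive[OF ys, of 1] sobolev_primitive[OF ys, of 2] pos(2)
    by (simp_all add: numeral_2_eq_2 numeral_3_eq_3)
  have kprim: "primitive_on 0 T kc (wderiv 0 T 1 k)" unfolding kc_def using sobolev_primitive[OF ks, of 0] pos(2) by simp
  have kc: "continuous_on {0..T} kc" by (rule primitive_on_continuous[OF kprim])
  have kae: "AE t in leb 0 T. k t = kc t" unfolding kc_def by (rule AE_eq_sym[OF crep_AE[OF ks]])
  define zz where "zz = (\<lambda>i t. p * yd (Suc i) t + q * yd i t)"
  have zprim: "primitive_on 0 T (zz 0) (zz 1)" "primitive_on 0 T (zz 1) (zz 2)"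
    unfolding zz_def using primitive_on_linear[OF prim(2,1), of p q] primitive_on_linear[OF prim(3,2), of p q]
    by (simp_all add: numeral_2_eq_2 numeral_3_eq_3)
  have zL2: "zz i \<in> L2 0 T" if "i \<le> 2" for i
    unfolding zz_def yd_def by (intro L2_linear sobolevD(2)[OF ys]) (use that in auto)
  have zae: "AE t in leb 0 T. z t = zz 0 t"
    using crep_AE[OF ys] by eventually_elim (simp add: z_def zz_def yd_def)
  have "has_weak_deriv 0 T 2 z (zz 2)"
  proof (rule sobolev_of_primitives(2)[where m=2 and F=zz, OF pos(2) zae])
    show "primitive_on 0 T (zz i) (zz (Suc i))" if "i < 2" for i
      using that zprim by (cases i) (auto simp: numeral_2_eq_2)
  qed (use zL2 in auto)
  hence z2ae: "AE t in leb 0 T. wderiv 0 T 2 z t = zz 2 t" by (rule wderiv_AE_eq)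
  define a where "a = (\<lambda>\<theta> s. L2_ip 0 L (wderiv 0 L 2 (V s)) \<theta>)"
  have vV: "AE t in leb 0 T. l (v t) = l (V t)" if "XX.bfunctional l C" for l C
    using rep(5) XX.AE_interval
  proof eventually_elim
    case (elim t)
    have "V t \<in> X L" by (rule XX.bcontinuous_mem[OF rep(1)]) (use elim in auto)
    thus ?case using XX.N_zero_bfunctional[OF that] elim by blast
  qed
  have V2E: "AE t in leb 0 T. V2 t \<in> X L" by (rule XX.bmeasurable_mem[OF rep(3)])
  have step: "AE t in leb 0 T. ell \<theta> (V2 t) = memory \<theta> V kc t + zz 2 t * L2_ip 0 L xL \<theta>" if \<theta>: "\<theta> \<in> L2 0 L" for \<theta>
    using pde V2E kae z2ae rep(5) vV[OF X_functional_wderiv[OF pos(1) _ \<theta>, of 2, simplified]] XX.AE_interval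
  proof eventually_elim
    case (elim t)
    then obtain J where J: "has_bintegral (L2 0 L) (L2_norm 0 L) 0 t (\<lambda>s x. k (t - s) * wderiv 0 L 2 (v s) x) J"
      and eq: "AE x in leb 0 L. V2 t x - wderiv 0 L 2 (v t) x - \<beta> * wderiv 0 L 2 (V2 t) x
                + k t * wderiv 0 L 2 u0 x + J x = wderiv 0 T 2 z t * x / L" by blast
    have t: "0 < t" "t < T" using elim by auto
    have u02L: "u02 \<in> L2 0 L" by (rule sobolevD(2)[OF u0]) simp
    have JL: "J \<in> L2 0 L" by (rule L2sp.has_bintegral_D(2)[OF J])
    have L2s: "wderiv 0 L 2 (v t) \<in> L2 0 L" "wderiv 0 L 2 (V2 t) \<in> L2 0 L" "wderiv 0 L 0 (V2 t) \<in> L2 0 L"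
      using X_wderiv_L2 elim(2,5) by auto
    have "AE x in leb 0 L. E (V2 t) x = wderiv 0 L 2 (v t) x + (- k t) * u02 x + (-1) * J x + zz 2 t * xL x"
      using eq crep_AE[OF X_D(1)[OF elim(2)]]
      by eventually_elim (simp add: E_def xL_def elim(4))
    hence "L2_ip 0 L (E (V2 t)) \<theta> = L2_ip 0 L (\<lambda>x. wderiv 0 L 2 (v t) x + (- k t) * u02 x + (-1) * J x + zz 2 t * xL x) \<theta>"
      by (rule L2_ip_cong_AE) simp
    also have "\<dots> = L2_ip 0 L (wderiv 0 L 2 (v t)) \<theta> + (- k t) * L2_ip 0 L u02 \<theta> - L2_ip 0 L J \<theta> + zz 2 t * L2_ip 0 L xL \<theta>"
    proof -
      have 1: "(\<lambda>x. 1 * wderiv 0 L 2 (v t) x + (- k t) * u02 x) \<in> L2 0 L" by (rule L2_linear[OF L2s(1) u02L])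
      have 2: "(\<lambda>x. (-1) * J x + zz 2 t * xL x) \<in> L2 0 L" by (rule L2_linear[OF JL xL_L2])
      show ?thesis
        using L2_ip_linear[OF 1 2 \<theta>, of 1 1] L2_ip_linear[OF L2s(1) u02L \<theta>, of 1 "- k t"] L2_ip_linear[OF JL xL_L2 \<theta>, of "-1" "zz 2 t"]
        by (simp add: algebra_simps)
    qed
    also have "L2_ip 0 L J \<theta> = conv kc (a \<theta>) t"
    proof -
      have "L2_ip 0 L J \<theta> = (LINT s|leb 0 t. L2_ip 0 L (\<lambda>x. k (t - s) * wderiv 0 L 2 (v s) x) \<theta>)"
        by (rule L2sp.has_bintegral_functional(2)[OF J L2sp.bfunctional_ip[OF \<theta>], symmetric])
      also have "\<dots> = conv k (\<lambda>s. L2_ip 0 L (wderiv 0 L 2 (v s)) \<theta>) t"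
        unfolding conv_def L2_ip_def by (simp add: mult.assoc)
      also have "\<dots> = conv kc (a \<theta>) t"
        unfolding a_def by (rule conv_cong_AE[OF kae vV[OF X_functional_wderiv[OF pos(1) _ \<theta>, of 2]]]) (use t in auto)
      finally show ?thesis .
    qed
    finally show ?case using ell_E[OF elim(2) \<theta>] elim(3,6) by (simp add: memory_def a_def)
  qed
  have mem: "integrable (leb 0 T) (memory \<theta> V kc)"
    "t \<in> {0..T} \<Longrightarrow> ell \<theta> (V1 t) - ell \<theta> (V1 0) = (LINT s|leb 0 t. memory \<theta> V kc s) + (zz 1 t - zz 1 0) * L2_ip 0 L xL \<theta>"
    if \<theta>: "\<theta> \<in> L2 0 L" for \<theta> t
  proof -
    note B = ell_bfunctional[OF \<theta>]
    have iz: "integrable (leb 0 T) (\<lambda>t. zz 2 t * L2_ip 0 L xL \<theta>)" using L2_integrable[OF zL2[of 2]] by simp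
    have "integrable (leb 0 T) (\<lambda>t. ell \<theta> (V2 t))" by (rule XX.bmeasurable_integrable_functional[OF rep(3,4) B])
    hence i: "integrable (leb 0 T) (\<lambda>t. ell \<theta> (V2 t) - zz 2 t * L2_ip 0 L xL \<theta>)" using iz by simp
    show im: "integrable (leb 0 T) (memory \<theta> V kc)"
      by (rule leb_integrable_cong_AE[OF i]) (use step[OF \<theta>] in \<open>eventually_elim, simp\<close>)
    assume t: "t \<in> {0..T}"
    have m: "V1 t \<in> X L" "V1 0 \<in> X L" using XX.bcontinuous_mem[OF rep(2)] t pos(2) by auto
    have "ell \<theta> (V1 t) - ell \<theta> (V1 0) = (LINT s|leb 0 t. ell \<theta> (V2 s))"
      using XX.has_bintegral_functional(2)[OF rep(7) B, of t] XX.bfunctionalD(4)[OF B m] t by simp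
    also have "\<dots> = (LINT s|leb 0 t. memory \<theta> V kc s + zz 2 s * L2_ip 0 L xL \<theta>)"
      by (rule leb_integral_cong_AE, rule AE_leb_sub[OF step[OF \<theta>]]) (use t in auto)
    also have "\<dots> = (LINT s|leb 0 t. memory \<theta> V kc s) + (LINT s|leb 0 t. zz 2 s) * L2_ip 0 L xL \<theta>"
      using leb_integrable_sub[OF im, of 0 t] leb_integrable_sub[OF primitive_onD(1)[OF zprim(2)], of 0 t] t by simp
    also have "(LINT s|leb 0 t. zz 2 s) = zz 1 t - zz 1 0" using primitive_on_diff[OF zprim(2), of 0 t] t by simp
    finally show "ell \<theta> (V1 t) - ell \<theta> (V1 0) = (LINT s|leb 0 t. memory \<theta> V kc s) + (zz 1 t - zz 1 0) * L2_ip 0 L xL \<theta>" .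
  qed
  have fprim: "primitive_on 0 T (fd 1) (fd 2)" "primitive_on 0 T (fd 2) (fd 3)"
    using sobolev_primitive[OF f, of 1] sobolev_primitive[OF f, of 2] pos(2)
    by (simp_all add: numeral_2_eq_2 numeral_3_eq_3)
  \<comment> \<open>the overdetermination condition and its first two time derivatives\<close>
  have od0: "\<Lambda> (V t) - zz 0 t * \<psi>L / L = fd 1 t" if t: "t \<in> {0..T}" for t
  proof (rule continuous_AE_eq[OF _ _ _ pos(2) t])
    show "continuous_on {0..T} (\<lambda>t. \<Lambda> (V t) - zz 0 t * \<psi>L / L)"
      by (intro continuous_intros XX.bcontinuous_functional[OF rep(1) \<Lambda>_bfunctional] primitive_on_continuous[OF zprim(1)]) (use pos(1) in auto)
    show "continuous_on {0..T} (fd 1)" by (rule primitive_on_continuous[OF fprim(1)])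
    show "AE t in leb 0 T. \<Lambda> (V t) - zz 0 t * \<psi>L / L = fd 1 t"
      using od vV[OF \<Lambda>_bfunctional] zae rep(5)
    proof eventually_elim
      case (elim t)
      thus ?case using overdetermination_functional[of "v t" "z t"] by simp
    qed
  qed
  have Vp: "primitive_on 0 T (\<lambda>t. \<Lambda> (V t)) (\<lambda>t. \<Lambda> (V1 t))"
    unfolding primitive_on_def
  proof (intro conjI ballI)
    show "integrable (leb 0 T) (\<lambda>t. \<Lambda> (V1 t))" by (rule leb_continuous_integrable[OF XX.bcontinuous_functional[OF rep(2) \<Lambda>_bfunctional]])
    fix t assume t: "t \<in> {0..T}"
    have m: "V t \<in> X L" "V 0 \<in> X L" using XX.bcontinuous_mem[OF rep(1)] t pos(2) by auto
    show "\<Lambda> (V t) = \<Lambda> (V 0) + (LINT s|leb 0 t. \<Lambda> (V1 s))"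
      using XX.has_bintegral_functional(2)[OF rep(6) \<Lambda>_bfunctional, of t] XX.bfunctionalD(4)[OF \<Lambda>_bfunctional m] t by simp
  qed
  have od1: "\<Lambda> (V1 t) - zz 1 t * \<psi>L / L = fd 2 t" if t: "t \<in> {0..T}" for t
  proof (rule continuous_AE_eq[OF _ _ _ pos(2) t])
    show "continuous_on {0..T} (\<lambda>t. \<Lambda> (V1 t) - zz 1 t * \<psi>L / L)"
      by (intro continuous_intros XX.bcontinuous_functional[OF rep(2) \<Lambda>_bfunctional] primitive_on_continuous[OF zprim(2)]) (use pos(1) in auto)
    show "continuous_on {0..T} (fd 2)" by (rule primitive_on_continuous[OF fprim(2)])
    have "primitive_on 0 T (fd 1) (\<lambda>t. 1 * \<Lambda> (V1 t) + (- \<psi>L / L) * zz 1 t)"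
      by (rule primitive_on_cong[OF primitive_on_linear[OF Vp zprim(1), of 1 "- \<psi>L / L"]]) (use od0 pos(2) in \<open>auto simp: mult.commute\<close>)
    from primitive_on_unique[OF this fprim(1)] show "AE t in leb 0 T. \<Lambda> (V1 t) - zz 1 t * \<psi>L / L = fd 2 t"
      by eventually_elim (simp add: mult.commute)
  qed
  have k_eq: "AE t in leb 0 T. \<gamma> * kc t = fd 3 t + a \<phi>1 t - conv kc (a \<phi>1) t"
  proof -
    have th: "\<phi>1 \<in> L2 0 L" by (rule \<phi>_L2) simp
    have "primitive_on 0 T (fd 2) (\<lambda>t. - memory \<phi>1 V kc t)"
      unfolding primitive_on_def
    proof (intro conjI ballI)
      show "integrable (leb 0 T) (\<lambda>t. - memory \<phi>1 V kc t)" using mem(1)[OF th] by simp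
      fix t assume t: "t \<in> {0..T}"
      have m: "V1 t \<in> X L" "V1 0 \<in> X L" using XX.bcontinuous_mem[OF rep(2)] t pos(2) by auto
      show "fd 2 t = fd 2 0 + (LINT s|leb 0 t. - memory \<phi>1 V kc s)"
      proof -
        have "ell \<phi>1 (V1 t) - ell \<phi>1 (V1 0) = (LINT s|leb 0 t. memory \<phi>1 V kc s) + (zz 1 t - zz 1 0) * (- \<psi>L / L)"
          using mem(2)[OF th t] unfolding xL_\<phi>1 .
        moreover have "(zz 1 t - zz 1 0) * (- \<psi>L / L) = - (zz 1 t * \<psi>L / L) + zz 1 0 * \<psi>L / L"
          using pos(1) by (simp add: field_simps)
        moreover have "(LINT s|leb 0 t. - memory \<phi>1 V kc s) = - (LINT s|leb 0 t. memory \<phi>1 V kc s)" by simp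
        moreover have "0 \<in> {0..T}" using pos(2) by simp
        note od1[OF this]
        ultimately show ?thesis using ell_\<phi>1[OF m(1)] ell_\<phi>1[OF m(2)] od1[OF t] by linarith
      qed
    qed
    from primitive_on_unique[OF this fprim(2)] show ?thesis
    proof eventually_elim
      case (elim t)
      have "memory \<phi>1 V kc t = a \<phi>1 t - \<gamma> * kc t - conv kc (a \<phi>1) t"
        by (simp only: memory_def a_def \<gamma>_def mult.commute)
      thus ?case using elim by linarith
    qed
  qed
  have bc': "AE t in leb 0 T. D (V t) - conv kc (\<lambda>s. D (V s)) t = yd 2 t + kc t * D u0 + 1 / L * (zz 0 t - conv kc (zz 0) t)"
  proof -
    obtain C where C: "XX.bfunctional (\<lambda>e. D e) C" using X_functional_boundary_deriv[OF pos(1)] by blast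
    show ?thesis using bc vV[OF C] kae zae XX.AE_interval
    proof eventually_elim
      case (elim t)
      have 1: "conv k (\<lambda>s. D (v s)) t = conv kc (\<lambda>s. D (V s)) t" by (rule conv_cong_AE[OF kae vV[OF C]]) (use elim in auto)
      have 2: "conv k z t = conv kc (zz 0) t" by (rule conv_cong_AE[OF kae zae]) (use elim in auto)
      show ?case using elim(1-4) unfolding 1[symmetric] 2[symmetric] by (simp add: conv_def)
    qed
  qed
  have \<Lambda>i: "\<Lambda> (V 0) = \<Lambda> w0" "\<Lambda> (V1 0) = \<Lambda> w1"
    unfolding \<Lambda>_def using wderiv_cong_AE[OF init(1)] wderiv_cong_AE[OF init(2)] by simp_all
  have zi: "zz 0 0 = z0_init" "zz 1 0 = z1_init"
    using od0[of 0] od1[of 0] pos(1,2) \<psi>L_eq(2) unfolding \<Lambda>i z0_init_def z1_init_def by (auto simp: field_simps)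
  have "reduced V V1 kc (yd 0) (yd 1) (yd 2)"
    unfolding reduced_def
    using rep(1,2,6) init kc prim(1,2) primitive_on_continuous[OF prim(3)] i2 mem k_eq bc' zi
    by (auto simp: zz_def a_def numeral_2_eq_2)
  thus ?thesis using rep(5) AE_eq_sym[OF kae] unfolding kc_def by blast
qed
end

lemma continuous_bound_Icc:
  fixes g :: "real \<Rightarrow> real"
  assumes "continuous_on {0..T} g"
  shows "\<exists>M\<ge>0. \<forall>s\<in>{0..T}. \<bar>g s\<bar> \<le> M"
proof -
  have "bounded (g ` {0..T})" using assms compact_continuous_image compact_imp_bounded by blast
  then obtain B where B: "\<forall>x\<in>g ` {0..T}. norm x \<le> B" unfolding bounded_iff by blast
  show ?thesis by (rule exI[of _ "max 0 B"]) (use B in \<open>auto simp: le_max_iff_disj\<close>)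
qed

context inverse_data begin

lemma reducedD:
  assumes "reduced V V1 k y0 y1 y2"
  shows "bcontinuous (X L) (X_norm L) 0 T V" "bcontinuous (X L) (X_norm L) 0 T V1"
    "\<And>t. t \<in> {0..T} \<Longrightarrow> has_bintegral (X L) (X_norm L) 0 t V1 (\<lambda>x. V t x - V 0 x)"
    "AE x in leb 0 L. V 0 x = w0 x" "AE x in leb 0 L. V1 0 x = w1 x"
    "continuous_on {0..T} k" "primitive_on 0 T y0 y1" "primitive_on 0 T y1 y2" "continuous_on {0..T} y2" "y2 0 = ytt0"
    "\<And>\<theta>. \<theta> \<in> L2 0 L \<Longrightarrow> integrable (leb 0 T) (memory \<theta> V k)"
    "\<And>\<theta> t. \<theta> \<in> L2 0 L \<Longrightarrow> t \<in> {0..T} \<Longrightarrow> ell \<theta> (V1 t) - ell \<theta> (V1 0) = (LINT s|leb 0 t. memory \<theta> V k s)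
           + ((p * y2 t + q * y1 t) - (p * y2 0 + q * y1 0)) * L2_ip 0 L xL \<theta>"
    "AE t in leb 0 T. \<gamma> * k t = fd 3 t + L2_ip 0 L (wderiv 0 L 2 (V t)) \<phi>1 - conv k (\<lambda>s. L2_ip 0 L (wderiv 0 L 2 (V s)) \<phi>1) t"
    "AE t in leb 0 T. D (V t) - conv k (\<lambda>s. D (V s)) t = y2 t + k t * D u0
        + 1 / L * ((p * y1 t + q * y0 t) - conv k (\<lambda>s. p * y1 s + q * y0 s) t)"
    "p * y1 0 + q * y0 0 = z0_init" "p * y2 0 + q * y1 0 = z1_init"
  using assms unfolding reduced_def by blast+

text \<open>Let G be the sum of the differences of \<open>v\<^sub>t\<close>, \<open>y''\<close> and k. The differences of v, \<open>y'\<close> and y are integrals of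
  it. The formula for k, then the boundary condition, then the elliptic estimate for the tested equation of motion
  bound each summand of \<open>G t\<close> by a multiple of \<open>\<integral> G\<close> over \<open>(0, t)\<close>.\<close>

lemma reduced_unique:
  assumes A: "reduced V V1 k y0 y1 y2" and B: "reduced V' V1' k' y0' y1' y2'" and t: "t \<in> {0..T}"
  shows "X_norm L (\<lambda>x. V t x - V' t x) = 0" "k t = k' t"
proof -
  note A = reducedD[OF A] and B = reducedD[OF B]
  define Vd where "Vd = (\<lambda>t x. V t x - V' t x)"
  define Wd where "Wd = (\<lambda>t x. V1 t x - V1' t x)"
  have mem: "V s \<in> X L" "V' s \<in> X L" "V1 s \<in> X L" "V1' s \<in> X L" if "s \<in> {0..T}" for s
    using XX.bcontinuous_mem[OF A(1)] XX.bcontinuous_mem[OF A(2)] XX.bcontinuous_mem[OF B(1)] XX.bcontinuous_mem[OF B(2)] that by auto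
  have memd: "Vd s \<in> X L" "Wd s \<in> X L" if "s \<in> {0..T}" for s
    unfolding Vd_def Wd_def using mem[OF that] by (auto intro: XX.diff_mem)
  have z0: "0 \<in> {0..T}" using pos(2) by simp
  define G where "G = (\<lambda>t. X_norm L (Wd t) + \<bar>y2 t - y2' t\<bar> + \<bar>k t - k' t\<bar>)"
  have Wc: "bcontinuous (X L) (X_norm L) 0 T Wd" unfolding Wd_def by (rule XX.bcontinuous_diff[OF A(2) B(2)])
  have Gc: "continuous_on {0..T} G"
    unfolding G_def by (intro continuous_intros XX.bcontinuous_N[OF Wc] A(6,9) B(6,9))
  have Gp: "X_norm L (Wd s) \<le> G s" "\<bar>y2 s - y2' s\<bar> \<le> G s" "\<bar>k s - k' s\<bar> \<le> G s" "0 \<le> G s" if "s \<in> {0..T}" for s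
    using XX.N_nonneg[OF memd(2)[OF that]] by (auto simp: G_def)
  have Gi: "integrable (leb 0 T) G" by (rule leb_continuous_integrable[OF Gc])
  define \<delta> where "\<delta> = (\<lambda>t. LINT s|leb 0 t. G s)"
  have \<delta>mono: "0 \<le> \<delta> s" "\<delta> s \<le> \<delta> t" if "0 \<le> s" "s \<le> t" "t \<le> T" for s t
  proof -
    have nn: "0 \<le> (LINT r|leb a b. G r)" if "0 \<le> a" "b \<le> T" for a b
      by (rule integral_nonneg_AE) (use that Gp(4) in \<open>auto simp: AE_leb_iff\<close>)
    show "0 \<le> \<delta> s" unfolding \<delta>_def by (rule nn) (use that in auto)
    have "\<delta> t = \<delta> s + (LINT r|leb s t. G r)" unfolding \<delta>_def
      by (rule leb_integral_combine[OF leb_integrable_sub[OF Gi]]) (use that in auto)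
    thus "\<delta> s \<le> \<delta> t" using nn[of s t] that by simp
  qed
  have int_le: "\<bar>LINT s|leb 0 t. g s\<bar> \<le> \<delta> t" if "t \<in> {0..T}" "integrable (leb 0 T) g" "\<And>s. s \<in> {0..T} \<Longrightarrow> \<bar>g s\<bar> \<le> G s" for g t
  proof -
    have "\<bar>LINT s|leb 0 t. g s\<bar> \<le> (LINT s|leb 0 t. \<bar>g s\<bar>)" by (rule integral_abs_bound)
    also have "\<dots> \<le> \<delta> t" unfolding \<delta>_def
      by (rule integral_mono) (use that leb_integrable_sub[OF that(2), of 0 t] leb_integrable_sub[OF Gi, of 0 t] in auto)
    finally show ?thesis .
  qed
  have bd: "\<bar>LINT s|leb 0 t. g s\<bar> \<le> c * T" if "t \<in> {0..T}" "0 \<le> c" "\<And>s. 0 < s \<Longrightarrow> s < t \<Longrightarrow> \<bar>g s\<bar> \<le> c" for g t c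
  proof -
    have "\<bar>LINT s|leb 0 t. g s\<bar> \<le> c * (t - 0)" by (rule leb_integral_bound) (use that in auto)
    also have "\<dots> \<le> c * T" using that by (intro mult_left_mono) auto
    finally show ?thesis .
  qed
  \<comment> \<open>the initial values coincide, those of \<open>y'\<close> and \<open>y\<close> because q is not zero\<close>
  have zero: "X_norm L (\<lambda>x. a x - b x) = 0" if "AE x in leb 0 L. a x = w x" "AE x in leb 0 L. b x = w x" for a b w
  proof -
    have "AE x in leb 0 L. a x - b x = 0" using that by eventually_elim simp
    from X_norm_cong_AE[OF this] show ?thesis using XX.N_zero by simp
  qed
  have V0: "X_norm L (Vd 0) = 0" "X_norm L (Wd 0) = 0"
    unfolding Vd_def Wd_def using zero A(4,5) B(4,5) by blast+
  have y20: "y2 0 = y2' 0" using A(10) B(10) by simp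
  have "q * y1 0 = q * y1' 0" using A(16) B(16)[folded y20] by linarith
  hence y10: "y1 0 = y1' 0" using pos(5) by simp
  have "q * y0 0 = q * y0' 0" using A(15) B(15)[folded y10] by linarith
  hence y00: "y0 0 = y0' 0" using pos(5) by simp
  have eV: "X_norm L (Vd s) \<le> \<delta> s" if s: "s \<in> {0..T}" for s
  proof -
    have J: "has_bintegral (X L) (X_norm L) 0 s (\<lambda>t x. V1 t x - V1' t x) (\<lambda>x. (V s x - V 0 x) - (V' s x - V' 0 x))"
      by (rule XX.has_bintegral_diff[OF A(3)[OF s] B(3)[OF s]])
    have "X_norm L (\<lambda>x. (V s x - V 0 x) - (V' s x - V' 0 x)) \<le> \<delta> s"
      unfolding \<delta>_def
    proof (rule XX.has_bintegral_bound[OF J])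
      show "AE t in leb 0 s. X_norm L (\<lambda>x. V1 t x - V1' t x) \<le> G t"
        unfolding AE_leb_iff using Gp(1) s by (auto simp: Wd_def)
      show "integrable (leb 0 s) G" by (rule leb_integrable_sub[OF Gi]) (use s in auto)
    qed
    moreover have "X_norm L (\<lambda>x. ((V s x - V 0 x) - (V' s x - V' 0 x)) + Vd 0 x) \<le>
        X_norm L (\<lambda>x. (V s x - V 0 x) - (V' s x - V' 0 x)) + X_norm L (Vd 0)"
      by (rule XX.N_triangle[OF XX.has_bintegral_D(2)[OF J] memd(1)[OF z0]])
    moreover have "(\<lambda>x. ((V s x - V 0 x) - (V' s x - V' 0 x)) + Vd 0 x) = Vd s" by (auto simp: Vd_def)
    ultimately show ?thesis using V0 by simp
  qed
  have ey1: "\<bar>y1 s - y1' s\<bar> \<le> \<delta> s" if s: "s \<in> {0..T}" for s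
  proof -
    have "primitive_on 0 T (\<lambda>t. 1 * y1 t + (-1) * y1' t) (\<lambda>t. 1 * y2 t + (-1) * y2' t)" by (rule primitive_on_linear[OF A(8) B(8)])
    from primitive_on_diff[OF this, of 0 s] have "y1 s - y1' s = (LINT r|leb 0 s. y2 r - y2' r)" using s y10 by simp
    moreover have "integrable (leb 0 T) (\<lambda>r. y2 r - y2' r)" by (intro leb_continuous_integrable continuous_intros A(9) B(9))
    ultimately show ?thesis using int_le[OF s, of "\<lambda>r. y2 r - y2' r"] Gp(2) by simp
  qed
  have ey0: "\<bar>y0 s - y0' s\<bar> \<le> T * \<delta> s" if s: "s \<in> {0..T}" for s
  proof -
    have "primitive_on 0 T (\<lambda>t. 1 * y0 t + (-1) * y0' t) (\<lambda>t. 1 * y1 t + (-1) * y1' t)" by (rule primitive_on_linear[OF A(7) B(7)])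
    from primitive_on_diff[OF this, of 0 s] have "y0 s - y0' s = (LINT r|leb 0 s. y1 r - y1' r)" using s y00 by simp
    moreover have "\<bar>LINT r|leb 0 s. y1 r - y1' r\<bar> \<le> \<delta> s * T"
    proof (rule bd[OF s])
      fix r assume r: "0 < r" "r < s"
      show "\<bar>y1 r - y1' r\<bar> \<le> \<delta> s" using ey1[of r] \<delta>mono(2)[of r s] r s by auto
    qed (use \<delta>mono(1)[of s s] s in auto)
    ultimately show ?thesis by (simp add: mult.commute)
  qed
  define zc where "zc = p + q * T"
  have zc: "0 \<le> zc" using pos by (simp add: zc_def)
  have ez: "\<bar>(p * y1 s + q * y0 s) - (p * y1' s + q * y0' s)\<bar> \<le> zc * \<delta> s" if s: "s \<in> {0..T}" for s
  proof -
    have "(p * y1 s + q * y0 s) - (p * y1' s + q * y0' s) = p * (y1 s - y1' s) + q * (y0 s - y0' s)" by (simp add: algebra_simps)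
    also have "\<bar>\<dots>\<bar> \<le> \<bar>p * (y1 s - y1' s)\<bar> + \<bar>q * (y0 s - y0' s)\<bar>" by (rule abs_triangle_ineq)
    also have "\<dots> = p * \<bar>y1 s - y1' s\<bar> + q * \<bar>y0 s - y0' s\<bar>" using pos by (simp add: abs_mult)
    also have "\<dots> \<le> p * \<delta> s + q * (T * \<delta> s)" using ey1[OF s] ey0[OF s] pos by (intro add_mono mult_left_mono) auto
    finally show ?thesis by (simp add: zc_def algebra_simps)
  qed
  obtain CD where CD: "XX.bfunctional (\<lambda>e. D e) CD" using X_functional_boundary_deriv[OF pos(1)] by blast
  have CD0: "0 \<le> CD" by (rule XX.bfunctionalD(1)[OF CD])
  let ?a = "\<lambda>\<theta> V s. L2_ip 0 L (wderiv 0 L 2 (V s)) \<theta>"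
  note BF = X_functional_wderiv[OF pos(1) order_refl]
  define c\<phi> where "c\<phi> = L2_norm 0 L \<phi>1"
  have c\<phi>: "0 \<le> c\<phi>" unfolding c\<phi>_def by (rule L2_norm_nonneg)
  have \<phi>1L: "\<phi>1 \<in> L2 0 L" by (rule \<phi>_L2) simp
  have ac: "continuous_on {0..T} (?a \<theta> V)" "continuous_on {0..T} (?a \<theta> V')" if "\<theta> \<in> L2 0 L" for \<theta>
    by (rule XX.bcontinuous_functional[OF A(1) BF[OF that]] XX.bcontinuous_functional[OF B(1) BF[OF that]])+
  have Dc: "continuous_on {0..T} (\<lambda>s. D (V s))" "continuous_on {0..T} (\<lambda>s. D (V' s))"
    by (rule XX.bcontinuous_functional[OF A(1) CD] XX.bcontinuous_functional[OF B(1) CD])+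
  have zcont: "continuous_on {0..T} (\<lambda>s. p * y1 s + q * y0 s)" "continuous_on {0..T} (\<lambda>s. p * y1' s + q * y0' s)"
    by (intro continuous_intros primitive_on_continuous[OF A(7)] primitive_on_continuous[OF A(8)]
        primitive_on_continuous[OF B(7)] primitive_on_continuous[OF B(8)])+
  have ea: "\<bar>?a \<theta> V s - ?a \<theta> V' s\<bar> \<le> L2_norm 0 L \<theta> * \<delta> s" if "\<theta> \<in> L2 0 L" and s: "s \<in> {0..T}" for \<theta> s
  proof -
    have "\<bar>?a \<theta> V s - ?a \<theta> V' s\<bar> \<le> L2_norm 0 L \<theta> * X_norm L (Vd s)"
      unfolding Vd_def by (rule XX.bfunctional_diff_bound[OF BF[OF that(1)] mem(1,2)[OF s]])
    also have "\<dots> \<le> L2_norm 0 L \<theta> * \<delta> s" by (rule mult_left_mono[OF eV[OF s] L2_norm_nonneg])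
    finally show ?thesis .
  qed
  have eD: "\<bar>D (V s) - D (V' s)\<bar> \<le> CD * \<delta> s" if s: "s \<in> {0..T}" for s
  proof -
    have "\<bar>D (V s) - D (V' s)\<bar> \<le> CD * X_norm L (Vd s)"
      unfolding Vd_def by (rule XX.bfunctional_diff_bound[OF CD mem(1,2)[OF s]])
    also have "\<dots> \<le> CD * \<delta> s" by (rule mult_left_mono[OF eV[OF s] CD0])
    finally show ?thesis .
  qed
  obtain M1 where M1: "M1 \<ge> 0" "\<forall>s\<in>{0..T}. \<bar>k' s\<bar> \<le> M1" using continuous_bound_Icc[OF B(6)] by blast
  obtain M2 where M2: "M2 \<ge> 0" "\<forall>s\<in>{0..T}. \<bar>X_norm L (V s)\<bar> \<le> M2" using continuous_bound_Icc[OF XX.bcontinuous_N[OF A(1)]] by blast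
  obtain M3 where M3: "M3 \<ge> 0" "\<forall>s\<in>{0..T}. \<bar>D (V s)\<bar> \<le> M3" using continuous_bound_Icc[OF Dc(1)] by blast
  obtain M4 where M4: "M4 \<ge> 0" "\<forall>s\<in>{0..T}. \<bar>p * y1 s + q * y0 s\<bar> \<le> M4" using continuous_bound_Icc[OF zcont(1)] by blast
  have aM: "\<bar>?a \<theta> V s\<bar> \<le> L2_norm 0 L \<theta> * M2" if "\<theta> \<in> L2 0 L" and s: "s \<in> {0..T}" for \<theta> s
  proof -
    have "\<bar>?a \<theta> V s\<bar> \<le> L2_norm 0 L \<theta> * X_norm L (V s)" by (rule XX.bfunctionalD(3)[OF BF[OF that(1)] mem(1)[OF s]])
    also have "\<dots> \<le> L2_norm 0 L \<theta> * M2"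
      by (rule mult_left_mono[OF abs_le_D1[OF bspec[OF M2(2) s]] L2_norm_nonneg])
    finally show ?thesis .
  qed
  have cv: "\<bar>conv k h t - conv k' h' t\<bar> \<le> (A + M1 * C * T) * \<delta> t"
    if c: "continuous_on {0..T} h" "continuous_on {0..T} h'" and t: "t \<in> {0..T}" and C: "0 \<le> C"
      and h: "\<And>s. s \<in> {0..T} \<Longrightarrow> \<bar>h s\<bar> \<le> A" and hd: "\<And>s. s \<in> {0..T} \<Longrightarrow> \<bar>h s - h' s\<bar> \<le> C * \<delta> s" for h h' A C t
  proof -
    have "\<bar>conv k h t - conv k' h' t\<bar> \<le> A * (LINT s|leb 0 t. G s) + M1 * (C * \<delta> t) * T"
    proof (rule conv_diff_bound[OF A(6) B(6) c Gc _ _ M1(1)])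
      show "0 \<le> C * \<delta> t" using C \<delta>mono(1)[of t t] t by simp
      fix s assume s: "0 \<le> s" "s \<le> t"
      have sT: "s \<in> {0..T}" using s t by auto
      show "\<bar>k s - k' s\<bar> \<le> G s" by (rule Gp(3)[OF sT])
      show "\<bar>h s\<bar> \<le> A" by (rule h[OF sT])
      show "\<bar>k' s\<bar> \<le> M1" using M1(2) sT by blast
      have "\<bar>h s - h' s\<bar> \<le> C * \<delta> s" by (rule hd[OF sT])
      also have "\<dots> \<le> C * \<delta> t" using \<delta>mono(2)[of s t] s t C by (intro mult_left_mono) auto
      finally show "\<bar>h s - h' s\<bar> \<le> C * \<delta> t" .
    qed (use t in auto)
    thus ?thesis unfolding \<delta>_def by (simp add: algebra_simps)
  qed
  define Ck where "Ck = (c\<phi> + (c\<phi> * M2 + M1 * c\<phi> * T)) / \<bar>\<gamma>\<bar>"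
  have ek: "AE t in leb 0 T. \<bar>k t - k' t\<bar> \<le> Ck * \<delta> t"
    using A(13) B(13) XX.AE_interval
  proof eventually_elim
    case (elim t)
    have t: "t \<in> {0..T}" using elim(3) by auto
    have "\<gamma> * (k t - k' t) = (?a \<phi>1 V t - ?a \<phi>1 V' t) - (conv k (?a \<phi>1 V) t - conv k' (?a \<phi>1 V') t)"
      using elim(1,2) by (simp add: right_diff_distrib)
    hence "\<bar>\<gamma>\<bar> * \<bar>k t - k' t\<bar> = \<bar>(?a \<phi>1 V t - ?a \<phi>1 V' t) - (conv k (?a \<phi>1 V) t - conv k' (?a \<phi>1 V') t)\<bar>" by (metis abs_mult)
    also have "\<dots> \<le> \<bar>?a \<phi>1 V t - ?a \<phi>1 V' t\<bar> + \<bar>conv k (?a \<phi>1 V) t - conv k' (?a \<phi>1 V') t\<bar>" by (rule abs_triangle_ineq4)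
    also have "\<dots> \<le> c\<phi> * \<delta> t + (c\<phi> * M2 + M1 * c\<phi> * T) * \<delta> t"
      using ea[OF \<phi>1L t] cv[OF ac[OF \<phi>1L] t c\<phi>, of "c\<phi> * M2"] aM[OF \<phi>1L] ea[OF \<phi>1L] unfolding c\<phi>_def by (intro add_mono) auto
    finally have "\<bar>\<gamma>\<bar> * \<bar>k t - k' t\<bar> \<le> (c\<phi> + (c\<phi> * M2 + M1 * c\<phi> * T)) * \<delta> t" by (simp add: algebra_simps)
    thus ?case unfolding Ck_def using \<gamma>_nz' by (simp add: field_simps)
  qed
  define Cy where "Cy = CD + (M3 + M1 * CD * T) + \<bar>D u0\<bar> * Ck + (zc + (M4 + M1 * zc * T)) / L"
  have ey2: "AE t in leb 0 T. \<bar>y2 t - y2' t\<bar> \<le> Cy * \<delta> t"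
    using A(14) B(14) ek XX.AE_interval
  proof eventually_elim
    case (elim t)
    have t: "t \<in> {0..T}" using elim(4) by auto
    let ?z = "\<lambda>s. p * y1 s + q * y0 s" and ?z' = "\<lambda>s. p * y1' s + q * y0' s"
    let ?cD = "conv k (\<lambda>s. D (V s)) t - conv k' (\<lambda>s. D (V' s)) t" and ?cz = "conv k ?z t - conv k' ?z' t"
    have "y2 t - y2' t = (D (V t) - D (V' t)) - ?cD - (k t - k' t) * D u0 - 1 / L * ((?z t - ?z' t) - ?cz)"
      using elim(1,2) by (simp add: algebra_simps)
    hence "\<bar>y2 t - y2' t\<bar> \<le> \<bar>D (V t) - D (V' t)\<bar> + \<bar>?cD\<bar> + \<bar>(k t - k' t) * D u0\<bar> + \<bar>1 / L * ((?z t - ?z' t) - ?cz)\<bar>" by linarith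
    also have "\<dots> \<le> CD * \<delta> t + (M3 + M1 * CD * T) * \<delta> t + (\<bar>D u0\<bar> * Ck) * \<delta> t + 1 / L * (zc * \<delta> t + (M4 + M1 * zc * T) * \<delta> t)"
    proof (intro add_mono)
      show "\<bar>D (V t) - D (V' t)\<bar> \<le> CD * \<delta> t" by (rule eD[OF t])
      show "\<bar>?cD\<bar> \<le> (M3 + M1 * CD * T) * \<delta> t" by (rule cv[OF Dc t CD0]) (use M3(2) eD in auto)
      show "\<bar>(k t - k' t) * D u0\<bar> \<le> (\<bar>D u0\<bar> * Ck) * \<delta> t"
        using mult_left_mono[OF elim(3), of "\<bar>D u0\<bar>"] by (simp add: abs_mult mult_ac)
      have "\<bar>?cz\<bar> \<le> (M4 + M1 * zc * T) * \<delta> t" by (rule cv[OF zcont t zc]) (use M4(2) ez in auto)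
      hence "\<bar>(?z t - ?z' t) - ?cz\<bar> \<le> zc * \<delta> t + (M4 + M1 * zc * T) * \<delta> t" using ez[OF t] by linarith
      thus "\<bar>1 / L * ((?z t - ?z' t) - ?cz)\<bar> \<le> 1 / L * (zc * \<delta> t + (M4 + M1 * zc * T) * \<delta> t)"
        using pos(1) by (simp add: abs_mult divide_right_mono)
    qed
    also have "\<dots> = Cy * \<delta> t" unfolding Cy_def by (simp add: algebra_simps add_divide_distrib)
    finally show ?case .
  qed
  define cu where "cu = L2_norm 0 L u02"
  define cx where "cx = L2_norm 0 L xL"
  have u02L: "u02 \<in> L2 0 L" by (rule sobolevD(2)[OF u0]) simp
  define Cm where "Cm = T + cu + (M2 + M1 * T) * T"
  define CW where "CW = Cm + (p * Cy + q) * cx"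
  have eW: "AE t in leb 0 T. X_norm L (Wd t) \<le> Kell * CW * \<delta> t"
    using ey2 XX.AE_interval
  proof eventually_elim
    case (elim t)
    have t: "t \<in> {0..T}" using elim(2) by auto
    have \<delta>0: "0 \<le> \<delta> t" using \<delta>mono(1)[of t t] t by auto
    \<comment> \<open>the tested equation, with the test function that makes the left-hand side the squared norm\<close>
    define \<theta> where "\<theta> = E (Wd t)"
    have \<theta>: "\<theta> \<in> L2 0 L" unfolding \<theta>_def by (rule E_L2[OF memd(2)[OF t]])
    let ?n = "L2_norm 0 L \<theta>"
    have n0: "0 \<le> ?n" by (rule L2_norm_nonneg)
    note Bl = ell_bfunctional[OF \<theta>]
    have W0: "ell \<theta> (V1 0) = ell \<theta> (V1' 0)"
      by (rule XX.N_zero_bfunctional[OF Bl mem(3,4)[OF z0]]) (use V0(2) in \<open>simp add: Wd_def\<close>)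
    have mi: "integrable (leb 0 t) (memory \<theta> V k)" "integrable (leb 0 t) (memory \<theta> V' k')"
      using leb_integrable_sub[OF A(11)[OF \<theta>], of 0 t] leb_integrable_sub[OF B(11)[OF \<theta>], of 0 t] t by auto
    have "?n * ?n = L2_ip 0 L \<theta> \<theta>" by (rule L2sp.N_sq[OF \<theta>])
    also have "\<dots> = ell \<theta> (Wd t)" using ell_E[OF memd(2)[OF t] \<theta>] by (simp add: \<theta>_def)
    also have "\<dots> = ell \<theta> (V1 t) - ell \<theta> (V1' t)" unfolding Wd_def by (rule XX.bfunctionalD(4)[OF Bl mem(3,4)[OF t]])
    also have "\<dots> = (LINT s|leb 0 t. memory \<theta> V k s - memory \<theta> V' k' s)
        + (p * (y2 t - y2' t) + q * (y1 t - y1' t)) * L2_ip 0 L xL \<theta>"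
      using A(12)[OF \<theta> t] B(12)[OF \<theta> t] A(16) B(16) W0 mi by (simp add: algebra_simps)
    also have "\<dots> \<le> ?n * (Cm * \<delta> t) + (p * Cy + q) * \<delta> t * (cx * ?n)"
    proof (intro add_mono)
      have md: "\<bar>memory \<theta> V k s - memory \<theta> V' k' s\<bar> \<le> ?n * (\<delta> t + cu * G s + (M2 + M1 * T) * \<delta> t)" if s: "0 < s" "s < t" for s
      proof -
        have sT: "s \<in> {0..T}" using s t by auto
        have \<delta>s: "\<delta> s \<le> \<delta> t" using \<delta>mono(2)[of s t] s t by auto
        let ?c = "conv k (?a \<theta> V) s - conv k' (?a \<theta> V') s"
        have "memory \<theta> V k s - memory \<theta> V' k' s = (?a \<theta> V s - ?a \<theta> V' s) - (k s - k' s) * L2_ip 0 L u02 \<theta> - ?c"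
          unfolding memory_def by (simp add: algebra_simps)
        hence "\<bar>memory \<theta> V k s - memory \<theta> V' k' s\<bar> \<le> \<bar>?a \<theta> V s - ?a \<theta> V' s\<bar> + \<bar>(k s - k' s) * L2_ip 0 L u02 \<theta>\<bar> + \<bar>?c\<bar>" by linarith
        also have "\<dots> \<le> ?n * \<delta> t + G s * (cu * ?n) + (?n * M2 + M1 * ?n * T) * \<delta> t"
        proof (intro add_mono)
          show "\<bar>?a \<theta> V s - ?a \<theta> V' s\<bar> \<le> ?n * \<delta> t" using ea[OF \<theta> sT] mult_left_mono[OF \<delta>s n0] by linarith
          show "\<bar>(k s - k' s) * L2_ip 0 L u02 \<theta>\<bar> \<le> G s * (cu * ?n)"
            unfolding abs_mult cu_def by (intro mult_mono Gp(3)[OF sT] L2sp.Cauchy_Schwarz[OF u02L \<theta>] Gp(4)[OF sT]) auto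
          have "\<bar>?c\<bar> \<le> (?n * M2 + M1 * ?n * T) * \<delta> s"
            by (rule cv[OF ac[OF \<theta>] sT n0]) (use aM[OF \<theta>] ea[OF \<theta>] in auto)
          also have "\<dots> \<le> (?n * M2 + M1 * ?n * T) * \<delta> t"
            using n0 M1(1) M2(1) pos(2) by (intro mult_left_mono[OF \<delta>s]) auto
          finally show "\<bar>?c\<bar> \<le> (?n * M2 + M1 * ?n * T) * \<delta> t" .
        qed
        finally show ?thesis by (simp add: algebra_simps)
      qed
      have Gt: "integrable (leb 0 t) G" by (rule leb_integrable_sub[OF Gi]) (use t in auto)
      have ci: "integrable (leb 0 t) (\<lambda>s. c::real)" for c by (rule leb_continuous_integrable) simp
      have "(LINT s|leb 0 t. memory \<theta> V k s - memory \<theta> V' k' s) \<le> (LINT s|leb 0 t. ?n * cu * G s + ?n * (\<delta> t + (M2 + M1 * T) * \<delta> t))"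
      proof (rule integral_mono)
        show "integrable (leb 0 t) (\<lambda>s. memory \<theta> V k s - memory \<theta> V' k' s)" using mi by simp
        show "integrable (leb 0 t) (\<lambda>s. ?n * cu * G s + ?n * (\<delta> t + (M2 + M1 * T) * \<delta> t))"
          by (intro Bochner_Integration.integrable_add integrable_mult_right Gt ci)
        fix s assume "s \<in> space (leb 0 t)"
        hence "0 < s" "s < t" by auto
        from md[OF this] show "memory \<theta> V k s - memory \<theta> V' k' s \<le> ?n * cu * G s + ?n * (\<delta> t + (M2 + M1 * T) * \<delta> t)"
          by (simp add: algebra_simps)
      qed
      also have "\<dots> = ?n * cu * \<delta> t + ?n * (\<delta> t + (M2 + M1 * T) * \<delta> t) * t"
        using Gt ci leb_eq_integral[OF ci[of "?n * (\<delta> t + (M2 + M1 * T) * \<delta> t)"]] t unfolding \<delta>_def by simp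
      also have "\<dots> \<le> ?n * cu * \<delta> t + ?n * (\<delta> t + (M2 + M1 * T) * \<delta> t) * T"
        using n0 \<delta>0 M1(1) M2(1) pos(2) t by (intro add_left_mono mult_left_mono) auto
      also have "\<dots> = ?n * (Cm * \<delta> t)" unfolding Cm_def by (simp add: algebra_simps)
      finally show "(LINT s|leb 0 t. memory \<theta> V k s - memory \<theta> V' k' s) \<le> ?n * (Cm * \<delta> t)" .
      have zb: "\<bar>p * (y2 t - y2' t) + q * (y1 t - y1' t)\<bar> \<le> (p * Cy + q) * \<delta> t"
      proof -
        have "\<bar>p * (y2 t - y2' t) + q * (y1 t - y1' t)\<bar> \<le> \<bar>p * (y2 t - y2' t)\<bar> + \<bar>q * (y1 t - y1' t)\<bar>" by (rule abs_triangle_ineq)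
        also have "\<dots> = p * \<bar>y2 t - y2' t\<bar> + q * \<bar>y1 t - y1' t\<bar>" using pos by (simp add: abs_mult)
        also have "\<dots> \<le> p * (Cy * \<delta> t) + q * \<delta> t" using elim(1) ey1[OF t] pos by (intro add_mono mult_left_mono) auto
        finally show ?thesis by (simp add: algebra_simps)
      qed
      have "(p * (y2 t - y2' t) + q * (y1 t - y1' t)) * L2_ip 0 L xL \<theta> \<le> \<bar>p * (y2 t - y2' t) + q * (y1 t - y1' t)\<bar> * \<bar>L2_ip 0 L xL \<theta>\<bar>"
        by (metis abs_ge_self abs_mult)
      also have "\<dots> \<le> (p * Cy + q) * \<delta> t * (cx * ?n)"
        unfolding cx_def using zb L2sp.Cauchy_Schwarz[OF xL_L2 \<theta>] by (intro mult_mono) auto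
      finally show "(p * (y2 t - y2' t) + q * (y1 t - y1' t)) * L2_ip 0 L xL \<theta> \<le> (p * Cy + q) * \<delta> t * (cx * ?n)" .
    qed
    also have "\<dots> = ?n * (CW * \<delta> t)" unfolding CW_def by (simp add: algebra_simps)
    finally have le: "?n * ?n \<le> ?n * (CW * \<delta> t)" .
    have "X_norm L (Wd t) \<le> Kell * ?n" unfolding \<theta>_def by (rule elliptic_estimate[OF memd(2)[OF t]])
    show ?case
    proof (cases "?n = 0")
      case True
      \<comment> \<open>here the claim reduces to the nonnegativity of its right-hand side\<close>
      have "0 \<le> CW * \<delta> t"
      proof -
        have "0 \<le> Ck" unfolding Ck_def using c\<phi> M1(1) M2(1) pos(2) by (intro divide_nonneg_nonneg) auto
        hence "0 \<le> Cy" unfolding Cy_def using CD0 M1(1) M3(1) M4(1) zc pos by (auto intro!: add_nonneg_nonneg)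
        hence "0 \<le> CW" unfolding CW_def Cm_def cu_def cx_def using M1(1) M2(1) pos L2_norm_nonneg
          by (auto intro!: add_nonneg_nonneg)
        thus ?thesis using \<delta>0 by simp
      qed
      hence "0 \<le> Kell * (CW * \<delta> t)" using Kell_nonneg by simp
      thus ?thesis using \<open>X_norm L (Wd t) \<le> Kell * ?n\<close> True by (simp add: mult.assoc)
    next
      case False
      hence "?n \<le> CW * \<delta> t" using le n0 by simp
      hence "Kell * ?n \<le> Kell * (CW * \<delta> t)" using Kell_nonneg by (rule mult_left_mono)
      thus ?thesis using \<open>X_norm L (Wd t) \<le> Kell * ?n\<close> by (simp add: mult.assoc)
    qed
  qed
  have le: "AE t in leb 0 T. G t \<le> (Kell * CW + Cy + Ck) * (LINT s|leb 0 t. G s)"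
    using ek ey2 eW by eventually_elim (simp add: G_def[abs_def] \<delta>_def algebra_simps)
  have G0: "G s = 0" if "s \<in> {0..T}" for s
    by (rule Gronwall_AE[OF pos(2) Gc _ le that]) (rule Gp(4))
  have "\<delta> t = 0" unfolding \<delta>_def
    using bd[OF t, of 0 G] G0 t by auto
  thus "X_norm L (\<lambda>x. V t x - V' t x) = 0"
    using eV[OF t] XX.N_nonneg[OF memd(1)[OF t]] by (simp add: Vd_def)
  show "k t = k' t" using Gp(3)[OF t] G0[OF t] by simp
qed

lemma IP_unique:
  assumes "IP L T \<beta> p q \<phi> f u0 w0 w1 k0 ytt0 v k y" "IP L T \<beta> p q \<phi> f u0 w0 w1 k0 ytt0 v' k' y'"
  shows "AE t in leb 0 T. AE x in leb 0 L. v' t x = v t x" "AE t in leb 0 T. k' t = k t"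
proof -
  obtain V V1 y0 y1 y2 where A: "reduced V V1 (crep 0 T k) y0 y1 y2"
     "AE t in leb 0 T. v t \<in> X L \<and> X_norm L (\<lambda>x. v t x - V t x) = 0" "AE t in leb 0 T. crep 0 T k t = k t"
    using IP_imp_reduced[OF assms(1)] by blast
  obtain V' V1' y0' y1' y2' where B: "reduced V' V1' (crep 0 T k') y0' y1' y2'"
     "AE t in leb 0 T. v' t \<in> X L \<and> X_norm L (\<lambda>x. v' t x - V' t x) = 0" "AE t in leb 0 T. crep 0 T k' t = k' t"
    using IP_imp_reduced[OF assms(2)] by blast
  show "AE t in leb 0 T. k' t = k t"
    using A(3) B(3) XX.AE_interval
  proof eventually_elim
    case (elim t)
    show ?case using reduced_unique(2)[OF A(1) B(1), of t] elim by auto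
  qed
  show "AE t in leb 0 T. AE x in leb 0 L. v' t x = v t x"
    using A(2) B(2) XX.AE_interval
  proof eventually_elim
    case (elim t)
    have t: "t \<in> {0..T}" using elim(3) by auto
    have m: "V t \<in> X L" "V' t \<in> X L"
      using XX.bcontinuous_mem[OF reducedD(1)[OF A(1)]] XX.bcontinuous_mem[OF reducedD(1)[OF B(1)]] t by auto
    have "X_norm L (\<lambda>x. v' t x - v t x) \<le> X_norm L (\<lambda>x. v' t x - V' t x) + (X_norm L (\<lambda>x. V' t x - V t x) + X_norm L (\<lambda>x. V t x - v t x))"
      using XX.N_triangle3[of "v' t" "V' t" "v t"] XX.N_triangle3[of "V' t" "V t" "v t"] m elim by auto
    also have "\<dots> = 0" using XX.N_minus[OF m] XX.N_minus[of "V t" "v t"] reduced_unique(1)[OF A(1) B(1) t] elim m by simp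
    finally have "X_norm L (\<lambda>x. v' t x - v t x) = 0" using XX.N_nonneg[OF XX.diff_mem] elim by (simp add: order_antisym)
    from AE_eq_zero_norm[OF pos(1) XX.diff_mem this] have "AE x in leb 0 L. v' t x - v t x = 0" using elim by simp
    thus ?case by eventually_elim simp
  qed
qed
end

section \<open>Quadratic Volterra equations in a Banach space\<close>

text \<open>The memory term of the equation. It is written with the integration variable rescaled to the unit
  interval, which makes its continuity a case of continuous dependence on a parameter.\<close>

definition bconv :: "(real \<Rightarrow> real) \<Rightarrow> (real \<Rightarrow> 'a::banach) \<Rightarrow> real \<Rightarrow> 'a" where
  "bconv k g t = integral {0..t} (\<lambda>r. k (t - r) *\<^sub>R g r)"

lemma bconv_integrable:
  fixes k :: "real \<Rightarrow> real" and g :: "real \<Rightarrow> 'a::banach"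
  assumes "continuous_on {0..T} k" "continuous_on {0..T} g" "t \<le> T"
  shows "continuous_on {0..t} (\<lambda>r. k (t - r) *\<^sub>R g r)"
  by (intro continuous_on_scaleR continuous_reflect[OF assms(1,3)] continuous_on_subset[OF assms(2)]) (use assms(3) in auto)

lemma bconv_rescale:
  assumes "continuous_on {0..T} k" "continuous_on {0..T} g" "0 \<le> t" "t \<le> T"
  shows "bconv k g t = t *\<^sub>R integral {0..1} (\<lambda>\<sigma>. k (t * (1 - \<sigma>)) *\<^sub>R g (t * \<sigma>))"
proof (cases "t = 0")
  case False
  hence t: "t > 0" using assms(3) by simp
  have "((\<lambda>r. k (t - r) *\<^sub>R g r) has_integral bconv k g t) (cbox 0 t)"
    unfolding bconv_def using integrable_continuous_real[OF bconv_integrable[OF assms(1,2,4)]] by (simp add: integrable_integral)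
  from has_integral_affinity[OF this, of t 0] t
  have "((\<lambda>\<sigma>. k (t - t * \<sigma>) *\<^sub>R g (t * \<sigma>)) has_integral (1 / t) *\<^sub>R bconv k g t) {0..1}"
    by simp
  hence "integral {0..1} (\<lambda>\<sigma>. k (t * (1 - \<sigma>)) *\<^sub>R g (t * \<sigma>)) = (1 / t) *\<^sub>R bconv k g t"
    by (simp add: integral_unique right_diff_distrib)
  thus ?thesis using t by simp
qed (simp add: bconv_def)

lemma bconv_continuous:
  assumes "continuous_on {0..T} k" "continuous_on {0..T} g"
  shows "continuous_on {0..T} (bconv k g)"
proof -
  have "continuous_on {0..T} (\<lambda>t. integral (cbox 0 1) (\<lambda>\<sigma>. k (t * (1 - \<sigma>)) *\<^sub>R g (t * \<sigma>)))"
  proof (rule integral_continuous_on_param)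
    show "continuous_on ({0..T} \<times> cbox 0 1) (\<lambda>(t, \<sigma>). k (t * (1 - \<sigma>)) *\<^sub>R g (t * \<sigma>))"
      unfolding case_prod_beta
    proof (intro continuous_on_scaleR)
      show "continuous_on ({0..T} \<times> cbox 0 1) (\<lambda>p. k (fst p * (1 - snd p)))"
      proof (rule continuous_on_compose2[OF assms(1)])
        show "continuous_on ({0..T} \<times> cbox 0 1) (\<lambda>p. fst p * (1 - snd p))" by (intro continuous_intros)
        have "0 \<le> t * (1 - \<sigma>)" "t * (1 - \<sigma>) \<le> T" if "0 \<le> t" "t \<le> T" "0 \<le> \<sigma>" "\<sigma> \<le> 1" for t \<sigma> :: real
          using that mult_left_le[of "1 - \<sigma>" t] by auto
        thus "(\<lambda>p. fst p * (1 - snd p)) ` ({0..T} \<times> cbox 0 1) \<subseteq> {0..T}" by auto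
      qed
      show "continuous_on ({0..T} \<times> cbox 0 1) (\<lambda>p. g (fst p * snd p))"
      proof (rule continuous_on_compose2[OF assms(2)])
        show "continuous_on ({0..T} \<times> cbox 0 1) (\<lambda>p. fst p * snd p :: real)" by (intro continuous_intros)
        have "0 \<le> t * \<sigma>" "t * \<sigma> \<le> T" if "0 \<le> t" "t \<le> T" "0 \<le> \<sigma>" "\<sigma> \<le> 1" for t \<sigma> :: real
          using that mult_left_le[of \<sigma> t] by auto
        thus "(\<lambda>p. fst p * snd p) ` ({0..T} \<times> cbox 0 1) \<subseteq> {0..T}" by auto
      qed
    qed
  qed
  hence "continuous_on {0..T} (\<lambda>t. t *\<^sub>R integral {0..1} (\<lambda>\<sigma>. k (t * (1 - \<sigma>)) *\<^sub>R g (t * \<sigma>)))"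
    by (intro continuous_intros) simp
  thus ?thesis by (rule continuous_on_eq) (use bconv_rescale[OF assms] in auto)
qed

lemma integral_exp_bound:
  fixes g :: "real \<Rightarrow> 'a::banach"
  assumes "continuous_on {0..t} g" "0 \<le> t" "\<sigma> > 0" "0 \<le> C" "\<And>s. 0 \<le> s \<Longrightarrow> s \<le> t \<Longrightarrow> norm (g s) \<le> C * exp (\<sigma> * s)"
  shows "norm (integral {0..t} g) \<le> C / \<sigma> * exp (\<sigma> * t)"
proof -
  have "((\<lambda>s. C * exp (\<sigma> * s)) has_integral (C / \<sigma> * exp (\<sigma> * t) - C / \<sigma> * exp (\<sigma> * 0))) {0..t}"
    using assms(2,3) by (intro fundamental_theorem_of_calculus)
      (auto intro!: derivative_eq_intros simp: has_real_derivative_iff_has_vector_derivative[symmetric])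
  note I = this
  have "norm (integral {0..t} g) \<le> integral {0..t} (\<lambda>s. C * exp (\<sigma> * s))"
    by (rule integral_norm_bound_integral[OF integrable_continuous_real[OF assms(1)]])
       (use I assms(5) in \<open>auto simp: integrable_on_def\<close>)
  also have "\<dots> = C / \<sigma> * exp (\<sigma> * t) - C / \<sigma>" using integral_unique[OF I] by simp
  also have "\<dots> \<le> C / \<sigma> * exp (\<sigma> * t)" using assms by simp
  finally show ?thesis .
qed

text \<open>In the norm \<open>sup e\<^bsup>-\<sigma>t\<^esup> |W t|\<close> the outer time integration gains a factor \<open>1 / \<sigma>\<close>, and convolution is
  bounded uniformly in \<open>\<sigma>\<close>. For large \<open>\<sigma>\<close> the equation is therefore a contraction on a ball whose radius
  does not depend on \<open>\<sigma>\<close>, so that the quadratic term does not limit the length of the time interval.\<close>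

lemma quadratic_Volterra_exists:
  fixes c :: "real \<Rightarrow> 'a::banach" and A \<Lambda> :: "'a \<Rightarrow> 'a" and \<kappa> :: "'a \<Rightarrow> real"
  assumes T: "T > 0" and c: "continuous_on {0..T} c" and A: "bounded_linear A" and \<Lambda>: "bounded_linear \<Lambda>" and \<kappa>: "bounded_linear \<kappa>"
  shows "\<exists>W. continuous_on {0..T} W \<and>
    (\<forall>t\<in>{0..T}. W t = c t + integral {0..t} (\<lambda>s. A (W s) + bconv (\<lambda>s. \<kappa> (W s)) (\<lambda>s. \<Lambda> (W s)) s))"
proof -
  obtain KA where KA: "KA > 0" "\<And>x. norm (A x) \<le> norm x * KA" using bounded_linear.pos_bounded[OF A] by blast
  obtain K1 where K1: "K1 > 0" "\<And>x. norm (\<Lambda> x) \<le> norm x * K1" using bounded_linear.pos_bounded[OF \<Lambda>] by blast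
  obtain K2 where K2: "K2 > 0" "\<And>x. norm (\<kappa> x) \<le> norm x * K2" using bounded_linear.pos_bounded[OF \<kappa>] by blast
  have "bounded (c ` {0..T})" using c compact_continuous_image compact_imp_bounded by blast
  then obtain B where B: "\<forall>x\<in>c ` {0..T}. norm x \<le> B" unfolding bounded_iff by blast
  define Mc where "Mc = max 0 B"
  have Mc: "0 \<le> Mc" "\<And>t. t \<in> {0..T} \<Longrightarrow> norm (c t) \<le> Mc" using B by (auto simp: Mc_def le_max_iff_disj)
  define R where "R = 2 * Mc + 1"
  have R: "R > 0" using Mc by (simp add: R_def)
  define K where "K = K1 * K2"
  have K: "K > 0" using K1 K2 by (simp add: K_def)
  define Q where "Q = KA + 2 * K * R * T"
  have Q: "Q > 0" using KA K R T by (simp add: Q_def add_pos_nonneg)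
  define \<sigma> where "\<sigma> = 2 * Q"
  have \<sigma>: "\<sigma> > 0" using Q by (simp add: \<sigma>_def)
  define rhs where "rhs = (\<lambda>W s. A (W s) + bconv (\<lambda>s. \<kappa> (W s)) (\<lambda>s. \<Lambda> (W s)) s)"
  define \<Phi> where "\<Phi> = (\<lambda>W t. c t + integral {0..t} (rhs W))"
  have cl: "continuous_on {0..T} (\<lambda>s. A (W s))" "continuous_on {0..T} (\<lambda>s. \<Lambda> (W s))" "continuous_on {0..T} (\<lambda>s. \<kappa> (W s))"
    if "continuous_on {0..T} W" for W
    using that by (auto intro: bounded_linear.continuous_on[OF A] bounded_linear.continuous_on[OF \<Lambda>] bounded_linear.continuous_on[OF \<kappa>])
  have crhs: "continuous_on {0..T} (rhs W)" if "continuous_on {0..T} W" for W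
    unfolding rhs_def by (intro continuous_on_add cl bconv_continuous that)
  have c\<Phi>: "continuous_on {0..T} (\<Phi> W)" if "continuous_on {0..T} W" for W
    unfolding \<Phi>_def by (intro continuous_on_add c indefinite_integral_continuous_1 integrable_continuous_real crhs that)
  have diff: "norm (rhs W s - rhs W' s) \<le> Q * d * exp (\<sigma> * s)"
    if W: "continuous_on {0..T} W" "continuous_on {0..T} W'" and s: "s \<in> {0..T}" and d: "0 \<le> d"
      and b: "\<And>r. r \<in> {0..T} \<Longrightarrow> norm (W r) \<le> R * exp (\<sigma> * r)" "\<And>r. r \<in> {0..T} \<Longrightarrow> norm (W' r) \<le> R * exp (\<sigma> * r)"
      and dd: "\<And>r. r \<in> {0..T} \<Longrightarrow> norm (W r - W' r) \<le> d * exp (\<sigma> * r)" for W W' d s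
  proof -
    let ?i = "\<lambda>W r. \<kappa> (W (s - r)) *\<^sub>R \<Lambda> (W r)"
    have ci: "continuous_on {0..s} (?i W)" if "continuous_on {0..T} W" for W
      using bconv_integrable[OF cl(3,2)[OF that], of s] s by simp
    have "norm (bconv (\<lambda>s. \<kappa> (W s)) (\<lambda>s. \<Lambda> (W s)) s - bconv (\<lambda>s. \<kappa> (W' s)) (\<lambda>s. \<Lambda> (W' s)) s)
        = norm (integral {0..s} (\<lambda>r. ?i W r - ?i W' r))"
      unfolding bconv_def
      by (subst Henstock_Kurzweil_Integration.integral_diff[OF integrable_continuous_real[OF ci[OF W(1)]] integrable_continuous_real[OF ci[OF W(2)]]]) simp
    also have "\<dots> \<le> (2 * K * R * d * exp (\<sigma> * s)) * (s - 0)"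
    proof (rule integral_bound)
      show "continuous_on {0..s} (\<lambda>r. ?i W r - ?i W' r)" by (intro continuous_on_diff ci W)
      fix r assume r: "r \<in> {0..s}"
      have rT: "r \<in> {0..T}" "s - r \<in> {0..T}" using r s by auto
      have "?i W r - ?i W' r = \<kappa> (W (s - r) - W' (s - r)) *\<^sub>R \<Lambda> (W r) + \<kappa> (W' (s - r)) *\<^sub>R \<Lambda> (W r - W' r)"
        using bounded_linear.linear[OF \<kappa>] bounded_linear.linear[OF \<Lambda>] by (simp add: linear_diff algebra_simps)
      also have "norm \<dots> \<le> norm (\<kappa> (W (s - r) - W' (s - r))) * norm (\<Lambda> (W r)) + norm (\<kappa> (W' (s - r))) * norm (\<Lambda> (W r - W' r))"
        by (rule order_trans[OF norm_triangle_ineq]) simp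
      also have "\<dots> \<le> (d * exp (\<sigma> * (s - r)) * K2) * (R * exp (\<sigma> * r) * K1) + (R * exp (\<sigma> * (s - r)) * K2) * (d * exp (\<sigma> * r) * K1)"
      proof -
        have 1: "norm (\<kappa> x) \<le> u * K2" if "norm x \<le> u" for x u
          using order_trans[OF K2(2)[of x] mult_right_mono[OF that, of K2]] K2(1) by simp
        have 2: "norm (\<Lambda> x) \<le> u * K1" if "norm x \<le> u" for x u
          using order_trans[OF K1(2)[of x] mult_right_mono[OF that, of K1]] K1(1) by simp
        show ?thesis
          using d R K2(1) K1(1) by (intro add_mono mult_mono 1 2 dd b rT) auto
      qed
      also have "\<dots> = 2 * K * R * d * (exp (\<sigma> * (s - r)) * exp (\<sigma> * r))" by (simp add: K_def algebra_simps)
      also have "exp (\<sigma> * (s - r)) * exp (\<sigma> * r) = exp (\<sigma> * s)" by (simp add: exp_add[symmetric] algebra_simps)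
      finally show "norm (?i W r - ?i W' r) \<le> 2 * K * R * d * exp (\<sigma> * s)" .
    qed (use s in auto)
    also have "\<dots> \<le> (2 * K * R * d * exp (\<sigma> * s)) * T" using s K R d by (intro mult_left_mono) auto
    finally have 1: "norm (bconv (\<lambda>s. \<kappa> (W s)) (\<lambda>s. \<Lambda> (W s)) s - bconv (\<lambda>s. \<kappa> (W' s)) (\<lambda>s. \<Lambda> (W' s)) s) \<le> 2 * K * R * d * exp (\<sigma> * s) * T" .
    have 2: "norm (A (W s) - A (W' s)) \<le> d * exp (\<sigma> * s) * KA"
      using order_trans[OF KA(2)[of "W s - W' s"] mult_right_mono[OF dd[OF s], of KA]] KA(1) bounded_linear.linear[OF A]
      by (simp add: linear_diff)
    have "rhs W s - rhs W' s = (A (W s) - A (W' s)) + (bconv (\<lambda>s. \<kappa> (W s)) (\<lambda>s. \<Lambda> (W s)) s - bconv (\<lambda>s. \<kappa> (W' s)) (\<lambda>s. \<Lambda> (W' s)) s)"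
      unfolding rhs_def by simp
    also have "norm \<dots> \<le> d * exp (\<sigma> * s) * KA + 2 * K * R * d * exp (\<sigma> * s) * T"
      using norm_triangle_mono[OF 2 1] .
    finally show ?thesis by (simp add: Q_def algebra_simps)
  qed
  have rhs0: "rhs (\<lambda>_. 0) s = 0" for s
    unfolding rhs_def bconv_def using bounded_linear.linear[OF A] bounded_linear.linear[OF \<Lambda>] by (simp add: linear_0)
  have \<Phi>diff: "norm (\<Phi> W t - \<Phi> W' t) \<le> d / 2 * exp (\<sigma> * t)"
    if W: "continuous_on {0..T} W" "continuous_on {0..T} W'" and t: "t \<in> {0..T}" and d: "0 \<le> d"
      and b: "\<And>r. r \<in> {0..T} \<Longrightarrow> norm (W r) \<le> R * exp (\<sigma> * r)" "\<And>r. r \<in> {0..T} \<Longrightarrow> norm (W' r) \<le> R * exp (\<sigma> * r)"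
      and dd: "\<And>r. r \<in> {0..T} \<Longrightarrow> norm (W r - W' r) \<le> d * exp (\<sigma> * r)" for W W' d t
  proof -
    have cs: "continuous_on {0..t} (rhs W)" "continuous_on {0..t} (rhs W')"
      by (rule continuous_on_subset[OF crhs[OF W(1)]] continuous_on_subset[OF crhs[OF W(2)]], use t in auto)+
    have "\<Phi> W t - \<Phi> W' t = integral {0..t} (\<lambda>s. rhs W s - rhs W' s)"
      unfolding \<Phi>_def
      by (subst Henstock_Kurzweil_Integration.integral_diff[OF integrable_continuous_real[OF cs(1)] integrable_continuous_real[OF cs(2)]]) simp
    also have "norm \<dots> \<le> (Q * d) / \<sigma> * exp (\<sigma> * t)"
    proof (rule integral_exp_bound[OF continuous_on_diff[OF cs] _ \<sigma>])
      fix s assume "0 \<le> s" "s \<le> t"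
      thus "norm (rhs W s - rhs W' s) \<le> Q * d * exp (\<sigma> * s)" using t by (intro diff[OF W _ d b dd]) auto
    qed (use t Q d in auto)
    also have "(Q * d) / \<sigma> = d / 2" using Q by (simp add: \<sigma>_def)
    finally show ?thesis .
  qed
  \<comment> \<open>the weighted space, realised as bounded continuous functions \<open>Z\<close> with \<open>W t = e\<^bsup>\<sigma>t\<^esup> Z t\<close>\<close>
  define kl where "kl = (\<lambda>t. max 0 (min T t))"
  have kl: "kl t \<in> {0..T}" "t \<in> {0..T} \<Longrightarrow> kl t = t" for t using T by (auto simp: kl_def)
  have klc: "continuous_on UNIV kl" unfolding kl_def by (intro continuous_intros)
  define W where "W = (\<lambda>(Z :: real \<Rightarrow>\<^sub>C 'a) t. exp (\<sigma> * t) *\<^sub>R apply_bcontfun Z t)"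
  have Wc: "continuous_on {0..T} (W Z)" for Z
    unfolding W_def by (intro continuous_intros) auto
  have WZ: "norm (W Z r) \<le> norm Z * exp (\<sigma> * r)" for Z r
    unfolding W_def using norm_bounded[of Z r] by (simp add: mult.commute)
  have WZd: "norm (W Z r - W Z' r) \<le> dist Z Z' * exp (\<sigma> * r)" for Z Z' r
  proof -
    have "W Z r - W Z' r = exp (\<sigma> * r) *\<^sub>R (apply_bcontfun Z r - apply_bcontfun Z' r)" by (simp add: W_def scaleR_diff_right)
    thus ?thesis using dist_bounded[of Z r Z'] by (simp add: dist_norm mult.commute)
  qed
  define FF where "FF = (\<lambda>Z t. exp (- \<sigma> * kl t) *\<^sub>R \<Phi> (W Z) (kl t))"
  have FFc: "FF Z \<in> bcontfun" for Z
  proof -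
    have 1: "continuous_on UNIV (FF Z)"
      unfolding FF_def using klc kl by (intro continuous_intros continuous_on_compose2[OF c\<Phi>[OF Wc]]) auto
    have "compact ((\<lambda>t. exp (- \<sigma> * t) *\<^sub>R \<Phi> (W Z) t) ` {0..T})"
      by (intro compact_continuous_image continuous_intros c\<Phi> Wc) auto
    moreover have "range (FF Z) \<subseteq> (\<lambda>t. exp (- \<sigma> * t) *\<^sub>R \<Phi> (W Z) t) ` {0..T}" unfolding FF_def using kl(1) by auto
    ultimately have "bounded (range (FF Z))" using compact_imp_bounded bounded_subset by blast
    thus ?thesis unfolding bcontfun_def using 1 by simp
  qed
  define F where "F = (\<lambda>Z. Bcontfun (FF Z))"
  have Fa: "apply_bcontfun (F Z) t = FF Z t" for Z t unfolding F_def using Bcontfun_inverse[OF FFc] by simp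
  have lip: "dist (F Z) (F Z') \<le> 1 / 2 * dist Z Z'" if Z: "Z \<in> cball 0 R" "Z' \<in> cball 0 R" for Z Z'
  proof (rule dist_bound)
    fix t
    let ?t = "kl t"
    have "norm (\<Phi> (W Z) ?t - \<Phi> (W Z') ?t) \<le> dist Z Z' / 2 * exp (\<sigma> * ?t)"
    proof (rule \<Phi>diff[OF Wc Wc kl(1) zero_le_dist _ _ WZd])
      show "norm (W Z r) \<le> R * exp (\<sigma> * r)" "norm (W Z' r) \<le> R * exp (\<sigma> * r)" for r
        using order_trans[OF WZ mult_right_mono[of _ R]] Z by auto
    qed
    hence "exp (- \<sigma> * ?t) * norm (\<Phi> (W Z) ?t - \<Phi> (W Z') ?t) \<le> exp (- \<sigma> * ?t) * (dist Z Z' / 2 * exp (\<sigma> * ?t))"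
      by (rule mult_left_mono) simp
    also have "\<dots> = 1 / 2 * dist Z Z'" by (simp add: exp_minus field_simps)
    finally show "dist (apply_bcontfun (F Z) t) (apply_bcontfun (F Z') t) \<le> 1 / 2 * dist Z Z'"
      unfolding Fa FF_def by (simp add: dist_norm scaleR_diff_right[symmetric])
  qed
  have ball: "F Z \<in> cball 0 R" if Z: "Z \<in> cball 0 R" for Z
  proof -
    have F0: "norm (apply_bcontfun (F 0) t) \<le> Mc" for t
    proof -
      have "W 0 = (\<lambda>_. 0)" by (auto simp: W_def)
      hence "\<Phi> (W 0) (kl t) = c (kl t)" unfolding \<Phi>_def using rhs0 by (simp add: integral_0[symmetric] cong: Henstock_Kurzweil_Integration.integral_cong)
      hence "norm (apply_bcontfun (F 0) t) = exp (- (\<sigma> * kl t)) * norm (c (kl t))" unfolding Fa FF_def by simp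
      also have "\<dots> \<le> 1 * Mc" using kl(1)[of t] \<sigma> Mc by (intro mult_mono) auto
      finally show ?thesis by simp
    qed
    have "dist (F 0) 0 \<le> Mc" by (rule dist_bound) (use F0 in auto)
    moreover have "dist (F Z) (F 0) \<le> 1 / 2 * dist Z 0" using lip[OF Z, of 0] R by simp
    moreover have "dist Z 0 \<le> R" using Z by simp
    ultimately have "dist (F Z) 0 \<le> Mc + R / 2" using dist_triangle[of "F Z" 0 "F 0"] by linarith
    moreover have "R = 2 * Mc + 1" by (rule R_def)
    ultimately have "dist (F Z) 0 \<le> R" by linarith
    thus ?thesis by simp
  qed
  have "\<exists>!Z\<in>cball 0 R. F Z = Z"
  proof (rule Banach_fix[where c="1/2"])
    show "complete (cball 0 R :: (real \<Rightarrow>\<^sub>C 'a) set)" by (simp add: complete_eq_closed)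
    show "(cball 0 R :: (real \<Rightarrow>\<^sub>C 'a) set) \<noteq> {}" using R by auto
    show "F ` cball 0 R \<subseteq> cball 0 R" using ball by blast
  qed (use lip in auto)
  then obtain Z where Z: "F Z = Z" by blast
  have "W Z t = \<Phi> (W Z) t" if t: "t \<in> {0..T}" for t
  proof -
    have "apply_bcontfun Z t = exp (- \<sigma> * t) *\<^sub>R \<Phi> (W Z) t" using Fa[of Z t] kl(2)[OF t] unfolding Z FF_def by simp
    thus ?thesis by (simp add: W_def exp_minus)
  qed
  thus ?thesis using Wc unfolding \<Phi>_def rhs_def by blast
qed

text \<open>Convolution commutes with integration: both orders of integration over the triangle
  \<open>0 \<le> s \<le> r \<le> t\<close> agree.\<close>

lemma conv_integral:
  assumes k: "continuous_on {0..T} k" and h: "continuous_on {0..T} h" and t: "0 \<le> t" "t \<le> T"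
  shows "conv k (\<lambda>s. LINT r|leb 0 s. h r) t = (LINT r|leb 0 t. conv k h r)"
proof -
  \<comment> \<open>k and h are extended by constants, so that Fubini's theorem applies on the plane\<close>
  define cl where "cl = (\<lambda>x. max 0 (min T x))"
  have cl: "cl x \<in> {0..T}" "x \<in> {0..T} \<Longrightarrow> cl x = x" for x using t by (auto simp: cl_def)
  have clc: "continuous_on UNIV cl" unfolding cl_def by (intro continuous_intros)
  define kk where "kk = (\<lambda>x. k (cl x))"
  define hh where "hh = (\<lambda>x. h (cl x))"
  have kc: "continuous_on UNIV kk" unfolding kk_def by (rule continuous_on_compose2[OF k clc]) (use cl in auto)
  have hc: "continuous_on UNIV hh" unfolding hh_def by (rule continuous_on_compose2[OF h clc]) (use cl in auto)
  have [measurable]: "kk \<in> borel_measurable borel" "hh \<in> borel_measurable borel"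
    using kc hc borel_measurable_continuous_onI by auto
  obtain Bk where Bk: "Bk \<ge> 0" "\<And>x. \<bar>kk x\<bar> \<le> Bk"
  proof -
    have "bounded (k ` {0..T})" using k compact_continuous_image compact_imp_bounded by blast
    then obtain B where "\<forall>x\<in>k ` {0..T}. norm x \<le> B" unfolding bounded_iff by blast
    thus thesis using that[of "max 0 B"] cl(1) by (auto simp: kk_def le_max_iff_disj)
  qed
  obtain Bh where Bh: "Bh \<ge> 0" "\<And>x. \<bar>hh x\<bar> \<le> Bh"
  proof -
    have "bounded (h ` {0..T})" using h compact_continuous_image compact_imp_bounded by blast
    then obtain B where "\<forall>x\<in>h ` {0..T}. norm x \<le> B" unfolding bounded_iff by blast
    thus thesis using that[of "max 0 B"] cl(1) by (auto simp: hh_def le_max_iff_disj)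
  qed
  define \<Phi> where "\<Phi> = (\<lambda>r s. if 0 < s \<and> s < r \<and> r < t then kk (r - s) * hh s else 0)"
  have \<Phi>m: "(\<lambda>(r, s). \<Phi> r s) \<in> borel_measurable (lborel \<Otimes>\<^sub>M lborel)" unfolding \<Phi>_def by measurable
  have \<Phi>i: "integrable (lborel \<Otimes>\<^sub>M lborel) (\<lambda>(r, s). \<Phi> r s)"
  proof (rule Bochner_Integration.integrable_bound[OF _ \<Phi>m])
    have "integrable lborel (indicator (cbox (0, 0) (t, t)) :: real \<times> real \<Rightarrow> real)"
      by (rule integrable_real_indicator) (auto simp: emeasure_lborel_cbox_eq)
    thus "integrable (lborel \<Otimes>\<^sub>M lborel) (\<lambda>x. Bk * Bh * indicator (cbox (0, 0) (t, t)) x)"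
      unfolding lborel_prod by simp
    show "AE x in lborel \<Otimes>\<^sub>M lborel. norm (case x of (r, s) \<Rightarrow> \<Phi> r s) \<le> norm (Bk * Bh * indicator (cbox (0, 0) (t, t)) x)"
    proof (rule AE_I2)
      fix x :: "real \<times> real"
      obtain r s where x: "x = (r, s)" by (cases x)
      show "norm (case x of (r, s) \<Rightarrow> \<Phi> r s) \<le> norm (Bk * Bh * indicator (cbox (0, 0) (t, t)) x)"
      proof (cases "0 < s \<and> s < r \<and> r < t")
        case True
        have "\<bar>kk (r - s)\<bar> * \<bar>hh s\<bar> \<le> Bk * Bh" using Bk Bh by (intro mult_mono) auto
        thus ?thesis using True Bk(1) Bh(1) by (simp add: x \<Phi>_def abs_mult cbox_Pair_eq indicator_def)
      next
        case False
        hence "\<Phi> r s = 0" by (auto simp: \<Phi>_def)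
        thus ?thesis by (simp add: x)
      qed
    qed
  qed
  have swap: "(LINT r|lborel. (LINT s|lborel. \<Phi> r s)) = (LINT s|lborel. (LINT r|lborel. \<Phi> r s))"
    using lborel_pair.integral_fst[OF \<Phi>i] lborel_pair.integral_snd[OF \<Phi>i] by simp
  define K where "K = (\<lambda>x. LINT r|leb 0 x. kk r)"
  have Kp: "primitive_on 0 a K kk" for a
    using primitive_onI[OF leb_continuous_integrable[OF continuous_on_subset[OF kc]], of 0 a 0] by (simp add: K_def)
  have K0: "K 0 = 0" by (simp add: K_def)
  have L1: "(LINT s|lborel. \<Phi> r s) = indicator {0<..<t} r * conv k h r" for r
  proof (cases "0 < r \<and> r < t")
    case True
    have "(LINT s|lborel. \<Phi> r s) = (LINT s|lborel. indicator {0<..<r} s * (kk (r - s) * hh s))"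
      by (rule Bochner_Integration.integral_cong) (use True in \<open>auto simp: \<Phi>_def indicator_def\<close>)
    also have "\<dots> = (LINT s|leb 0 r. kk (r - s) * hh s)" by (rule leb_integral_lborel[symmetric]) measurable
    also have "\<dots> = conv k h r" unfolding conv_def
      by (rule Bochner_Integration.integral_cong) (use True t in \<open>auto simp: kk_def hh_def cl(2)\<close>)
    finally show ?thesis using True by simp
  next
    case False
    hence "\<Phi> r = (\<lambda>s. 0)" by (auto simp: \<Phi>_def fun_eq_iff)
    thus ?thesis using False by simp
  qed
  have L2: "(LINT r|lborel. \<Phi> r s) = indicator {0<..<t} s * (K (t - s) * hh s)" for s
  proof (cases "0 < s \<and> s < t")
    case True
    have "(LINT r|lborel. \<Phi> r s) = (LINT r|lborel. indicator {s<..<t} r * (kk (r - s) * hh s))"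
      by (rule Bochner_Integration.integral_cong) (use True in \<open>auto simp: \<Phi>_def indicator_def\<close>)
    also have "\<dots> = (LINT r|leb s t. kk (r - s) * hh s)" by (rule leb_integral_lborel[symmetric]) measurable
    also have "\<dots> = (LINT r|leb s t. kk (r - s)) * hh s" by simp
    also have "(LINT r|leb s t. kk (r - s)) = K (t - s)"
    proof -
      have "primitive_on s t (\<lambda>r. K (r - s)) (\<lambda>r. kk (r - s))"
      proof (rule primitive_on_DERIV)
        show "continuous_on {s..t} (\<lambda>r. kk (r - s))"
          by (rule continuous_on_compose2[OF kc]) (auto intro!: continuous_intros)
        fix r assume r: "s \<le> r" "r \<le> t"
        have "(K has_real_derivative kk (r - s)) (at (r - s) within {0..t - s})"
          by (rule primitive_on_has_derivative[OF Kp continuous_on_subset[OF kc]]) (use r in auto)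
        hence "(K has_real_derivative kk (r - s)) (at (r - s) within (\<lambda>r. r - s) ` {s..t})" by simp
        moreover have "((\<lambda>r. r - s) has_real_derivative 1) (at r within {s..t})" by (auto intro!: derivative_eq_intros)
        ultimately have "(K \<circ> (\<lambda>r. r - s) has_real_derivative kk (r - s) * 1) (at r within {s..t})" by (rule DERIV_image_chain)
        thus "((\<lambda>r. K (r - s)) has_real_derivative kk (r - s)) (at r within {s..t})" by (simp add: o_def)
      qed
      from primitive_on_diff[OF this, of s t] show ?thesis using True K0 by simp
    qed
    finally show ?thesis using True by simp
  next
    case False
    have "(\<lambda>r. \<Phi> r s) = (\<lambda>r. 0)" using False by (auto simp: \<Phi>_def fun_eq_iff)
    thus ?thesis using False by (simp add: indicator_def)
  qed
  define H where "H = (\<lambda>s. LINT r|leb 0 s. hh r)"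
  have Hp: "primitive_on 0 t H hh"
    using primitive_onI[OF leb_continuous_integrable[OF continuous_on_subset[OF hc]], of 0 t 0] by (simp add: H_def)
  have Kr: "primitive_on 0 t (\<lambda>s. K (t - s)) (\<lambda>s. - kk (t - s))"
  proof (rule primitive_on_DERIV)
    show "continuous_on {0..t} (\<lambda>s. - kk (t - s))"
      by (intro continuous_intros continuous_on_compose2[OF kc]) auto
    fix s assume s: "0 \<le> s" "s \<le> t"
    have "(K has_real_derivative kk (t - s)) (at (t - s) within {0..t})"
      by (rule primitive_on_has_derivative[OF Kp continuous_on_subset[OF kc]]) (use s in auto)
    hence "(K has_real_derivative kk (t - s)) (at (t - s) within (\<lambda>s. t - s) ` {0..t})"
      by (simp add: image_diff_atLeastAtMost)
    moreover have "((\<lambda>s. t - s) has_real_derivative - 1) (at s within {0..t})" by (auto intro!: derivative_eq_intros)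
    ultimately have "(K \<circ> (\<lambda>s. t - s) has_real_derivative kk (t - s) * - 1) (at s within {0..t})" by (rule DERIV_image_chain)
    thus "((\<lambda>s. K (t - s)) has_real_derivative - kk (t - s)) (at s within {0..t})" by (simp add: o_def)
  qed
  have Kc: "continuous_on {0..t} (\<lambda>s. K (t - s))" by (rule primitive_on_continuous[OF Kr])
  have Bm: "(LINT s|lborel. indicator {0<..<t} s * (K (t - s) * hh s)) = (LINT s|leb 0 t. K (t - s) * hh s)"
  proof -
    have "integrable lebesgue (\<lambda>s. indicator {0<..<t} s * (K (t - s) * hh s))"
      using leb_continuous_integrable[OF continuous_on_mult[OF Kc continuous_on_subset[OF hc]]] by (simp add: leb_integrable_iff)
    have "(\<lambda>s. LINT r|lborel. \<Phi> r s) \<in> borel_measurable lborel"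
      using borel_measurable_integrable[OF lborel_pair.integrable_snd[OF \<Phi>i]] by simp
    hence "(\<lambda>s. indicator {0<..<t} s * (K (t - s) * hh s)) \<in> borel_measurable lborel" unfolding L2 .
    from integral_completion[OF this] show ?thesis unfolding leb_integral_eq by simp
  qed
  have Bm': "(LINT r|lborel. indicator {0<..<t} r * conv k h r) = (LINT r|leb 0 t. conv k h r)"
  proof -
    have "(\<lambda>r. LINT s|lborel. \<Phi> r s) \<in> borel_measurable lborel"
      using borel_measurable_integrable[OF lborel_pair.integrable_fst[OF \<Phi>i]] by simp
    hence "(\<lambda>r. indicator {0<..<t} r * conv k h r) \<in> borel_measurable lborel" unfolding L1 .
    from integral_completion[OF this] show ?thesis unfolding leb_integral_eq by simp
  qed
  have "(LINT s|leb 0 t. K (t - s) * hh s) = (LINT s|leb 0 t. kk (t - s) * H s)"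
    using integral_by_parts_primitive(1)[OF Kr Hp t(1)] K0 by (simp add: H_def)
  also have "\<dots> = conv k (\<lambda>s. LINT r|leb 0 s. h r) t"
    unfolding conv_def
  proof (rule Bochner_Integration.integral_cong[OF refl])
    fix s assume "s \<in> space (leb 0 t)"
    hence s: "0 < s" "s < t" by auto
    have "H s = (LINT r|leb 0 s. h r)" unfolding H_def
      by (rule Bochner_Integration.integral_cong) (use s t in \<open>auto simp: hh_def cl(2)\<close>)
    thus "kk (t - s) * H s = k (t - s) * (LINT r|leb 0 s. h r)" using s t by (simp add: kk_def cl(2))
  qed
  finally show ?thesis using swap unfolding L1 L2 Bm Bm' by simp
qed

text \<open>With \<open>H = H 0 + \<integral> h\<close>, the time derivative of \<open>k * H\<close> is \<open>H 0 k + k * h\<close>; all derivatives fall on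
  H, and a continuous kernel suffices.\<close>

lemma conv_primitive:
  assumes k: "continuous_on {0..T} k" and H: "primitive_on 0 T H h" and h: "continuous_on {0..T} h"
    and c: "continuous_on {0..T} (conv k h)" and t: "t \<in> {0..T}"
  shows "conv k H t = (LINT s|leb 0 t. H 0 * k s + conv k h s)"
proof -
  have sub: "continuous_on {0..t} g" if "continuous_on {0..T} g" for g :: "real \<Rightarrow> real"
    by (rule continuous_on_subset[OF that]) (use t in auto)
  have kr: "continuous_on {0..t} (\<lambda>s. k (t - s))" by (rule continuous_reflect[OF k]) (use t in auto)
  have Hc: "continuous_on {0..t} (\<lambda>s. LINT r|leb 0 s. h r)"
    using primitive_on_continuous[OF primitive_onI[OF leb_continuous_integrable[OF sub[OF h]], of 0]] by simp
  have "conv k H t = (LINT s|leb 0 t. H 0 * k (t - s) + k (t - s) * (LINT r|leb 0 s. h r))"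
    unfolding conv_def
  proof (rule Bochner_Integration.integral_cong[OF refl])
    fix s assume "s \<in> space (leb 0 t)"
    hence "H s = H 0 + (LINT r|leb 0 s. h r)" using t by (intro primitive_onD(2)[OF H]) auto
    thus "k (t - s) * H s = H 0 * k (t - s) + k (t - s) * (LINT r|leb 0 s. h r)" by (simp add: algebra_simps)
  qed
  also have "\<dots> = H 0 * (LINT s|leb 0 t. k (t - s)) + conv k (\<lambda>s. LINT r|leb 0 s. h r) t"
    unfolding conv_def using leb_continuous_integrable[OF kr] leb_continuous_integrable[OF continuous_on_mult[OF kr Hc]] by simp
  also have "\<dots> = H 0 * (LINT s|leb 0 t. k s) + (LINT r|leb 0 t. conv k h r)"
    using conv_integral[OF k h, of t] t leb_integral_reflect[of t k] by simp
  also have "\<dots> = (LINT s|leb 0 t. H 0 * k s + conv k h s)"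
    using leb_continuous_integrable[OF sub[OF k]] leb_continuous_integrable[OF sub[OF c]] by simp
  finally show ?thesis .
qed

section \<open>The elliptic operator on continuous functions\<close>

context inverse_data begin

definition "\<omega> = 1 / sqrt \<beta>"

lemma \<omega>: "\<omega> > 0" "\<omega> * \<omega> = 1 / \<beta>" "sinh (\<omega> * L) \<noteq> 0"
  using pos by (auto simp: \<omega>_def)

definition GP :: "(real \<Rightarrow> real) \<Rightarrow> real \<Rightarrow> real" where
  "GP m x = (LINT \<xi>|leb 0 x. sinh (\<omega> * \<xi>) * m \<xi>)"
definition GQ :: "(real \<Rightarrow> real) \<Rightarrow> real \<Rightarrow> real" where
  "GQ m x = (LINT \<xi>|leb x L. sinh (\<omega> * (L - \<xi>)) * m \<xi>)"

text \<open>Green's function of \<open>1 - \<beta> d\<^sup>2/dx\<^sup>2\<close> with Dirichlet boundary conditions.\<close>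

definition Gr :: "(real \<Rightarrow> real) \<Rightarrow> real \<Rightarrow> real" where
  "Gr m x = \<omega> / sinh (\<omega> * L) * (sinh (\<omega> * (L - x)) * GP m x + sinh (\<omega> * x) * GQ m x)"

text \<open>Differentiating \<open>Gr m\<close>, the terms with m cancel the first time and leave a Wronskian the second time,
  which the addition theorem for sinh evaluates.\<close>

lemma Gr_primitives:
  assumes m: "continuous_on {0..L} m"
  shows "\<exists>g. primitive_on 0 L (Gr m) g \<and> primitive_on 0 L g (\<lambda>x. (Gr m x - m x) / \<beta>)"
proof -
  let ?c = "\<omega> / sinh (\<omega> * L)"
  let ?S = "\<lambda>x. sinh (\<omega> * x)" and ?S' = "\<lambda>x. sinh (\<omega> * (L - x))"
  let ?C = "\<lambda>x. cosh (\<omega> * x)" and ?C' = "\<lambda>x. cosh (\<omega> * (L - x))"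
  have cP: "continuous_on {0..L} (\<lambda>x. ?S x * m x)" by (intro continuous_intros m)
  have cQ: "continuous_on {0..L} (\<lambda>x. ?S' x * m x)" by (intro continuous_intros m)
  have P: "primitive_on 0 L (GP m) (\<lambda>x. ?S x * m x)"
    using primitive_onI[OF leb_continuous_integrable[OF cP], of 0] by (simp add: GP_def[abs_def])
  have Q: "primitive_on 0 L (GQ m) (\<lambda>x. - (?S' x * m x))"
    unfolding primitive_on_def
  proof (intro conjI ballI)
    show "integrable (leb 0 L) (\<lambda>x. - (?S' x * m x))" using leb_continuous_integrable[OF cQ] by simp
    fix x assume x: "x \<in> {0..L}"
    have "GQ m 0 = (LINT \<xi>|leb 0 x. ?S' \<xi> * m \<xi>) + GQ m x"
      unfolding GQ_def by (rule leb_integral_combine[OF leb_continuous_integrable[OF cQ]]) (use x in auto)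
    thus "GQ m x = GQ m 0 + (LINT s|leb 0 x. - (?S' s * m s))" by simp
  qed
  have S: "primitive_on 0 L ?S (\<lambda>x. \<omega> * ?C x)" "primitive_on 0 L ?C (\<lambda>x. \<omega> * ?S x)"
      "primitive_on 0 L ?S' (\<lambda>x. - \<omega> * ?C' x)" "primitive_on 0 L ?C' (\<lambda>x. - \<omega> * ?S' x)"
    by (rule primitive_on_DERIV; auto intro!: derivative_eq_intros continuous_intros simp: algebra_simps)+
  define g where "g = (\<lambda>x. (- ?c * \<omega>) * (?C' x * GP m x) + (?c * \<omega>) * (?C x * GQ m x))"
  have "primitive_on 0 L (\<lambda>x. ?c * (?S' x * GP m x) + ?c * (?S x * GQ m x))
     (\<lambda>x. ?c * (- \<omega> * ?C' x * GP m x + ?S' x * (?S x * m x)) + ?c * (\<omega> * ?C x * GQ m x + ?S x * - (?S' x * m x)))"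
    by (intro primitive_on_linear primitive_on_mult S P Q)
  hence 1: "primitive_on 0 L (Gr m) g"
    by (rule primitive_on_cong) (use pos in \<open>auto simp: Gr_def g_def algebra_simps\<close>)
  have "primitive_on 0 L g
     (\<lambda>x. (- ?c * \<omega>) * (- \<omega> * ?S' x * GP m x + ?C' x * (?S x * m x)) + (?c * \<omega>) * (\<omega> * ?S x * GQ m x + ?C x * - (?S' x * m x)))"
    unfolding g_def by (intro primitive_on_linear primitive_on_mult S P Q)
  hence 2: "primitive_on 0 L g (\<lambda>x. (Gr m x - m x) / \<beta>)"
  proof (rule primitive_on_cong)
    have "(- ?c * \<omega>) * (- \<omega> * ?S' x * GP m x + ?C' x * (?S x * m x)) + (?c * \<omega>) * (\<omega> * ?S x * GQ m x + ?C x * - (?S' x * m x))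
      = (Gr m x - m x) / \<beta>" for x
    proof -
      have "sinh (\<omega> * L) = sinh (\<omega> * x + \<omega> * (L - x))" by (simp add: algebra_simps)
      also have "\<dots> = ?S x * ?C' x + ?C x * ?S' x" by (rule sinh_add)
      finally have s: "?S x * ?C' x + ?C x * ?S' x = sinh (\<omega> * L)" by simp
      have "(- ?c * \<omega>) * (- \<omega> * ?S' x * GP m x + ?C' x * (?S x * m x)) + (?c * \<omega>) * (\<omega> * ?S x * GQ m x + ?C x * - (?S' x * m x))
        = (\<omega> * \<omega>) * Gr m x - ?c * \<omega> * (?S x * ?C' x + ?C x * ?S' x) * m x"
        by (simp add: Gr_def algebra_simps)
      also have "?c * \<omega> * (?S x * ?C' x + ?C x * ?S' x) = \<omega> * \<omega>" unfolding s using \<omega>(3) by simp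
      finally show ?thesis using \<omega>(2) by (simp add: diff_divide_distrib)
    qed
    thus "AE x in leb 0 L. (- ?c * \<omega>) * (- \<omega> * ?S' x * GP m x + ?C' x * (?S x * m x)) + (?c * \<omega>) * (\<omega> * ?S x * GQ m x + ?C x * - (?S' x * m x))
      = (Gr m x - m x) / \<beta>" by simp
  qed (use pos in auto)
  show ?thesis using 1 2 by blast
qed

lemma Gr_X:
  assumes m: "continuous_on {0..L} m"
  shows "Gr m \<in> X L" "\<And>x. x \<in> {0..L} \<Longrightarrow> wderiv 0 L 0 (Gr m) x = Gr m x"
    "\<And>x. x \<in> {0..L} \<Longrightarrow> wderiv 0 L 2 (Gr m) x = (Gr m x - m x) / \<beta>"
    "\<And>x. x \<in> {0..L} \<Longrightarrow> E (Gr m) x = m x"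
proof -
  obtain g where g: "primitive_on 0 L (Gr m) g" "primitive_on 0 L g (\<lambda>x. (Gr m x - m x) / \<beta>)"
    using Gr_primitives[OF m] by blast
  define F where "F = (\<lambda>i::nat. if i = 0 then Gr m else if i = 1 then g else (\<lambda>x. (Gr m x - m x) / \<beta>))"
  have c2: "continuous_on {0..L} (\<lambda>x. (Gr m x - m x) / \<beta>)"
    by (intro continuous_intros primitive_on_continuous[OF g(1)] m) (use pos in auto)
  have Fc: "continuous_on {0..L} (F i)" for i
    unfolding F_def using primitive_on_continuous[OF g(1)] primitive_on_continuous[OF g(2)] c2 by auto
  have Fp: "primitive_on 0 L (F i) (F (Suc i))" if "i < 2" for i
    using that g by (cases i) (auto simp: F_def)
  have F0: "F 0 = Gr m" by (simp add: F_def)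
  have ae0: "AE x in leb 0 L. Gr m x = F 0 x" by (simp add: F0)
  note S = sobolev_of_primitives[of 0 L "Gr m" F 2, OF pos(1) ae0 continuous_L2[OF Fc] Fp continuous_L2[OF Fc]]
  show w0: "wderiv 0 L 0 (Gr m) x = Gr m x" if "x \<in> {0..L}" for x using S(3)[of 0 x] that by (simp add: F0)
  show w2: "wderiv 0 L 2 (Gr m) x = (Gr m x - m x) / \<beta>" if "x \<in> {0..L}" for x
  proof -
    have "has_weak_deriv 0 L 2 (Gr m) (\<lambda>x. (Gr m x - m x) / \<beta>)" using S(2)[of 2] by (simp add: F_def)
    from wderiv_eq[OF this c2 pos(1) that] show ?thesis .
  qed
  have "Gr m 0 = 0" "Gr m L = 0" by (auto simp: Gr_def GP_def GQ_def)
  thus "Gr m \<in> X L" using S(1) w0[of 0] w0[of L] pos(1) by (intro X_I) auto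
  show "E (Gr m) x = m x" if "x \<in> {0..L}" for x
    unfolding E_def using w0[OF that] w2[OF that] pos(3) by (simp add: field_simps)
qed

text \<open>Functions on \<open>[0, L]\<close> are extended to the line as constants, which embeds their space into the
  Banach space of bounded continuous functions.\<close>

definition ext :: "(real \<Rightarrow> real) \<Rightarrow> real \<Rightarrow>\<^sub>C real" where
  "ext g = Bcontfun (\<lambda>x. g (max 0 (min L x)))"

lemma ext_apply:
  assumes "continuous_on {0..L} g"
  shows "apply_bcontfun (ext g) x = g (max 0 (min L x))" "x \<in> {0..L} \<Longrightarrow> apply_bcontfun (ext g) x = g x"
proof -
  have r: "max 0 (min L x) \<in> {0..L}" for x using pos(1) by auto
  have "continuous_on UNIV (\<lambda>x. g (max 0 (min L x)))"
    by (rule continuous_on_compose2[OF assms]) (use r in \<open>auto intro!: continuous_intros\<close>)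
  moreover have "bounded (range (\<lambda>x. g (max 0 (min L x))))"
  proof (rule bounded_subset[of "g ` {0..L}"])
    show "bounded (g ` {0..L})" using assms compact_continuous_image compact_imp_bounded by blast
    show "range (\<lambda>x. g (max 0 (min L x))) \<subseteq> g ` {0..L}" using r by blast
  qed
  ultimately have "(\<lambda>x. g (max 0 (min L x))) \<in> bcontfun" unfolding bcontfun_def by simp
  thus "apply_bcontfun (ext g) x = g (max 0 (min L x))" unfolding ext_def by (simp add: Bcontfun_inverse)
  thus "x \<in> {0..L} \<Longrightarrow> apply_bcontfun (ext g) x = g x" by (auto simp: max_def min_def)
qed

abbreviation ap :: "(real \<Rightarrow>\<^sub>C real) \<Rightarrow> real \<Rightarrow> real" where "ap \<equiv> apply_bcontfun"

lemma ap_continuous: "continuous_on A (ap m)"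
  using apply_bcontfun[of m] continuous_on_subset unfolding bcontfun_def by blast

lemma ap_L2: "ap m \<in> L2 0 L"
  by (rule continuous_L2[OF ap_continuous])

definition jX :: "(real \<Rightarrow>\<^sub>C real) \<Rightarrow> real \<Rightarrow> real" where "jX m = Gr (ap m)"

lemmas jX_X = Gr_X[OF ap_continuous, folded jX_def]

lemma jX_linear: "jX (a *\<^sub>R m + b *\<^sub>R n) = (\<lambda>x. a * jX m x + b * jX n x)"
proof
  fix x
  have i: "integrable (leb c d) (\<lambda>\<xi>. sinh (\<omega> * \<xi>) * ap m \<xi>)" "integrable (leb c d) (\<lambda>\<xi>. sinh (\<omega> * (L - \<xi>)) * ap m \<xi>)" for c d m
    by (intro leb_continuous_integrable continuous_intros ap_continuous)+
  have P: "GP (ap (a *\<^sub>R m + b *\<^sub>R n)) x = a * GP (ap m) x + b * GP (ap n) x"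
  proof -
    have "GP (ap (a *\<^sub>R m + b *\<^sub>R n)) x = (LINT \<xi>|leb 0 x. a * (sinh (\<omega> * \<xi>) * ap m \<xi>) + b * (sinh (\<omega> * \<xi>) * ap n \<xi>))"
      unfolding GP_def by (simp add: algebra_simps)
    thus ?thesis unfolding GP_def using i by simp
  qed
  have Q: "GQ (ap (a *\<^sub>R m + b *\<^sub>R n)) x = a * GQ (ap m) x + b * GQ (ap n) x"
  proof -
    have "GQ (ap (a *\<^sub>R m + b *\<^sub>R n)) x = (LINT \<xi>|leb x L. a * (sinh (\<omega> * (L - \<xi>)) * ap m \<xi>) + b * (sinh (\<omega> * (L - \<xi>)) * ap n \<xi>))"
      unfolding GQ_def by (simp add: algebra_simps)
    thus ?thesis unfolding GQ_def using i by simp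
  qed
  show "jX (a *\<^sub>R m + b *\<^sub>R n) x = a * jX m x + b * jX n x"
    unfolding jX_def Gr_def P Q by (simp add: algebra_simps)
qed

lemma jX_diff: "jX (m - n) = (\<lambda>x. jX m x - jX n x)"
  using jX_linear[of 1 m "-1" n] by simp

lemma L2_norm_ap: "L2_norm 0 L (ap m) \<le> L2_norm 0 L (\<lambda>_. 1) * norm m"
proof -
  have "(LINT x|leb 0 L. (ap m x)\<^sup>2) \<le> (LINT x|leb 0 L. (norm m)\<^sup>2 * 1\<^sup>2)"
  proof (rule integral_mono)
    show "integrable (leb 0 L) (\<lambda>x. (ap m x)\<^sup>2)" using ap_L2[of m] by (simp add: L2_def)
    show "integrable (leb 0 L) (\<lambda>x. (norm m)\<^sup>2 * 1\<^sup>2)" by (rule leb_continuous_integrable) simp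
    show "(ap m x)\<^sup>2 \<le> (norm m)\<^sup>2 * 1\<^sup>2" for x using norm_bounded[of m x] by (simp add: abs_le_square_iff[symmetric])
  qed
  hence "(L2_norm 0 L (ap m))\<^sup>2 \<le> (norm m)\<^sup>2 * (L2_norm 0 L (\<lambda>_. 1))\<^sup>2" unfolding L2_norm_sq by (simp add: mult.commute)
  hence "(L2_norm 0 L (ap m))\<^sup>2 \<le> (L2_norm 0 L (\<lambda>_. 1) * norm m)\<^sup>2" by (simp add: power_mult_distrib mult.commute)
  thus ?thesis by (rule power2_le_imp_le) (simp add: L2_norm_nonneg)
qed

definition "KX = Kell * L2_norm 0 L (\<lambda>_. 1)"

text \<open>The bound in the \<open>H\<^sup>2\<close> norm is the a priori estimate of the elliptic problem.\<close>

lemma jX_bound: "X_norm L (jX m) \<le> KX * norm m"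
proof -
  have "AE x in leb 0 L. E (jX m) x = ap m x" unfolding AE_leb_iff using jX_X(4) by auto
  hence "L2_norm 0 L (E (jX m)) = L2_norm 0 L (ap m)" by (rule L2_norm_cong_AE)
  hence "X_norm L (jX m) \<le> Kell * L2_norm 0 L (ap m)" using elliptic_estimate[OF jX_X(1)[of m]] by simp
  also have "\<dots> \<le> Kell * (L2_norm 0 L (\<lambda>_. 1) * norm m)" by (rule mult_left_mono[OF L2_norm_ap Kell_nonneg])
  finally show ?thesis by (simp add: KX_def mult.assoc)
qed

lemma jX_functional:
  assumes "XX.bfunctional l C"
  shows "bounded_linear (\<lambda>m. l (jX m))"
proof (rule bounded_linear_intro[where K="C * KX"])
  show "l (jX (m + n)) = l (jX m) + l (jX n)" for m n
    using jX_linear[of 1 m 1 n] XX.bfunctionalD(6)[OF assms jX_X(1)[of m] jX_X(1)[of n]] by simp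
  show "l (jX (r *\<^sub>R m)) = r *\<^sub>R l (jX m)" for r m
    using jX_linear[of r m 0 m] XX.bfunctionalD(5)[OF assms jX_X(1)[of m], of r] by simp
  show "norm (l (jX m)) \<le> norm m * (C * KX)" for m
  proof -
    have "\<bar>l (jX m)\<bar> \<le> C * X_norm L (jX m)" by (rule XX.bfunctionalD(3)[OF assms jX_X(1)])
    also have "\<dots> \<le> C * (KX * norm m)" by (rule mult_left_mono[OF jX_bound XX.bfunctionalD(1)[OF assms]])
    finally show ?thesis by (simp add: mult_ac)
  qed
qed

lemma L2_functional:
  assumes \<theta>: "\<theta> \<in> L2 0 L"
  shows "bounded_linear (\<lambda>m. L2_ip 0 L (ap m) \<theta>)"
proof (rule bounded_linear_intro[where K="L2_norm 0 L (\<lambda>_. 1) * L2_norm 0 L \<theta>"])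
  show "L2_ip 0 L (ap (m + n)) \<theta> = L2_ip 0 L (ap m) \<theta> + L2_ip 0 L (ap n) \<theta>" for m n
    using L2_ip_linear[OF ap_L2 ap_L2 \<theta>, of 1 m 1 n] by (simp add: plus_bcontfun.rep_eq)
  show "L2_ip 0 L (ap (r *\<^sub>R m)) \<theta> = r *\<^sub>R L2_ip 0 L (ap m) \<theta>" for r m
    unfolding L2_ip_def by (simp add: mult.assoc)
  show "norm (L2_ip 0 L (ap m) \<theta>) \<le> norm m * (L2_norm 0 L (\<lambda>_. 1) * L2_norm 0 L \<theta>)" for m
  proof -
    have "\<bar>L2_ip 0 L (ap m) \<theta>\<bar> \<le> L2_norm 0 L (ap m) * L2_norm 0 L \<theta>" by (rule L2sp.Cauchy_Schwarz[OF ap_L2 \<theta>])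
    also have "\<dots> \<le> (L2_norm 0 L (\<lambda>_. 1) * norm m) * L2_norm 0 L \<theta>" by (rule mult_right_mono[OF L2_norm_ap L2_norm_nonneg])
    finally show ?thesis by (simp add: mult_ac)
  qed
qed

text \<open>If \<open>m = v - \<beta> v''\<close>, then \<open>v'' = (v - m) / \<beta>\<close>: in the variable m, the space derivatives of the equation of
  motion form a bounded operator.\<close>

definition Gb :: "(real \<Rightarrow>\<^sub>C real) \<Rightarrow> real \<Rightarrow>\<^sub>C real" where "Gb m = ext (jX m)"
definition Bop :: "(real \<Rightarrow>\<^sub>C real) \<Rightarrow> real \<Rightarrow>\<^sub>C real" where "Bop m = (1 / \<beta>) *\<^sub>R (Gb m - m)"

lemma jX_continuous: "continuous_on {0..L} (jX m)"
  by (rule continuous_on_eq[OF primitive_on_continuous[OF X_prim(1)[OF jX_X(1)]] jX_X(2)])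

text \<open>The supremum norm is controlled by the \<open>H\<^sup>2\<close> norm through the embedding estimate.\<close>

lemma Gb_bounded_linear: "bounded_linear Gb"
proof -
  have a: "ap (Gb m) x = jX m (max 0 (min L x))" for m x unfolding Gb_def by (rule ext_apply(1)[OF jX_continuous])
  let ?k = "L2_norm 0 L (\<lambda>_. 1)"
  let ?C = "(?k / L + ?k) * KX"
  have sup: "\<bar>jX m y\<bar> \<le> norm m * ?C" if y: "y \<in> {0..L}" for m y
  proof -
    have f: "jX m \<in> X L" by (rule jX_X(1))
    have *: "(LINT y|leb 0 L. \<bar>wderiv 0 L i (jX m) y\<bar>) \<le> ?k * X_norm L (jX m)" if i: "i \<le> 2" for i
    proof -
      have "(LINT y|leb 0 L. \<bar>wderiv 0 L i (jX m) y\<bar>) \<le> ?k * L2_norm 0 L (wderiv 0 L i (jX m))" by (rule L1_le_L2[OF X_wderiv_L2[OF f i]])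
      also have "\<dots> \<le> ?k * X_norm L (jX m)" by (rule mult_left_mono[OF X_wderiv_norm[OF i] L2_norm_nonneg])
      finally show ?thesis .
    qed
    have "L * \<bar>jX m y\<bar> \<le> (LINT y|leb 0 L. \<bar>wderiv 0 L 0 (jX m) y\<bar>) + L * (LINT y|leb 0 L. \<bar>wderiv 0 L 1 (jX m) y\<bar>)"
      using primitive_on_bound[OF X_prim(1)[OF f] y pos(1)] jX_X(2)[OF y] by simp
    also have "\<dots> \<le> ?k * X_norm L (jX m) + L * (?k * X_norm L (jX m))"
      using *[of 0] *[of 1] pos(1) by (intro add_mono mult_left_mono) auto
    also have "\<dots> = L * ((?k / L + ?k) * X_norm L (jX m))" using pos(1) by (simp add: field_simps)
    finally have "\<bar>jX m y\<bar> \<le> (?k / L + ?k) * X_norm L (jX m)" using pos(1) by simp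
    also have "\<dots> \<le> (?k / L + ?k) * (KX * norm m)"
      using L2_norm_nonneg pos(1) by (intro mult_left_mono[OF jX_bound]) (auto intro!: add_nonneg_nonneg)
    finally show ?thesis by (simp add: mult_ac)
  qed
  show ?thesis
  proof (rule bounded_linear_intro[where K="?C"])
    show "Gb (m + n) = Gb m + Gb n" for m n
      by (rule bcontfun_eqI) (use jX_linear[of 1 m 1 n] in \<open>simp add: a plus_bcontfun.rep_eq\<close>)
    show "Gb (r *\<^sub>R m) = r *\<^sub>R Gb m" for r m
      by (rule bcontfun_eqI) (use jX_linear[of r m 0 m] in \<open>simp add: a\<close>)
    show "norm (Gb m) \<le> norm m * ?C" for m
    proof (rule norm_bound)
      fix x
      have "max 0 (min L x) \<in> {0..L}" using pos(1) by auto
      thus "norm (ap (Gb m) x) \<le> norm m * ?C" unfolding a using sup by simp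
    qed
  qed
qed

lemma Bop_bounded_linear: "bounded_linear Bop"
  unfolding Bop_def
  by (intro bounded_linear_compose[OF bounded_linear_scaleR_right] bounded_linear_sub Gb_bounded_linear bounded_linear_ident)

lemma Bop_apply: "x \<in> {0..L} \<Longrightarrow> ap (Bop m) x = wderiv 0 L 2 (jX m) x"
  unfolding Bop_def Gb_def using jX_X(3)[of x m] ext_apply(2)[OF jX_continuous, of x m] by (simp add: minus_bcontfun.rep_eq)

lemma L2_ip_Bop: "L2_ip 0 L (wderiv 0 L 2 (jX m)) \<theta> = L2_ip 0 L (ap (Bop m)) \<theta>"
  unfolding L2_ip_def by (rule Bochner_Integration.integral_cong) (auto simp: Bop_apply)
end

section \<open>Existence\<close>

text \<open>The unknown of the Volterra system takes values in this space.\<close>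

instance bcontfun :: (metric_space, banach) banach ..

lemma continuous_LINT:
  fixes g :: "real \<Rightarrow> real"
  assumes "continuous_on {0..T} g" "t \<in> {0..T}"
  shows "(LINT s|leb 0 t. g s) = integral {0..t} g"
  by (rule leb_eq_integral[OF leb_continuous_integrable[OF continuous_on_subset[OF assms(1)]]]) (use assms(2) in auto)

lemma bconv_real:
  assumes "continuous_on {0..T} k" "continuous_on {0..T} h" "t \<in> {0..T}"
  shows "bconv k h t = conv k h t"
  unfolding bconv_def conv_def
  using leb_eq_integral[OF leb_continuous_integrable[OF bconv_integrable[OF assms(1,2)]]] assms(3) by simp

lemma conv_continuous:
  assumes "continuous_on {0..T} k" "continuous_on {0..T} h"
  shows "continuous_on {0..T} (conv k h)"
  by (rule continuous_on_eq[OF bconv_continuous[OF assms]]) (rule bconv_real[OF assms])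

text \<open>A bounded linear map may be applied under the integrals of a Volterra equation.\<close>

lemma bounded_linear_integral:
  fixes g :: "real \<Rightarrow> 'a::banach" and P :: "'a \<Rightarrow> 'b::banach"
  assumes "bounded_linear P" "continuous_on {a..b} g"
  shows "P (integral {a..b} g) = integral {a..b} (\<lambda>s. P (g s))"
  using integral_linear[OF integrable_continuous_real[OF assms(2)] assms(1)] by (simp add: o_def)

lemma bounded_linear_bconv:
  fixes g :: "real \<Rightarrow> 'a::banach" and P :: "'a \<Rightarrow> 'b::banach"
  assumes "bounded_linear P" "continuous_on {0..T} k" "continuous_on {0..T} g" "t \<in> {0..T}"
  shows "P (bconv k g t) = bconv k (\<lambda>s. P (g s)) t"
  unfolding bconv_def
  using bounded_linear_integral[OF assms(1) bconv_integrable[OF assms(2,3)], of t] assms(4)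
  by (simp add: linear_scale[OF bounded_linear.linear[OF assms(1)]])

lemma bounded_linear_Volterra:
  fixes g h :: "real \<Rightarrow> 'a::banach" and P :: "'a \<Rightarrow> 'b::banach"
  assumes P: "bounded_linear P" and k: "continuous_on {0..T} k" and g: "continuous_on {0..T} g" and h: "continuous_on {0..T} h"
    and t: "t \<in> {0..T}" and W: "W = c + integral {0..t} (\<lambda>s. g s + bconv k h s)"
  shows "P W = P c + integral {0..t} (\<lambda>s. P (g s) + bconv k (\<lambda>s. P (h s)) s)"
proof -
  have cc: "continuous_on {0..t} (\<lambda>s. g s + bconv k h s)"
    by (rule continuous_on_subset[OF continuous_on_add[OF g bconv_continuous[OF k h]]]) (use t in auto)
  have "P W = P c + integral {0..t} (\<lambda>s. P (g s + bconv k h s))"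
    unfolding W using bounded_linear_integral[OF P cc] by (simp add: linear_add[OF bounded_linear.linear[OF P]])
  also have "integral {0..t} (\<lambda>s. P (g s + bconv k h s)) = integral {0..t} (\<lambda>s. P (g s) + bconv k (\<lambda>s. P (h s)) s)"
    by (rule Henstock_Kurzweil_Integration.integral_cong)
       (use t bounded_linear_bconv[OF P k h] in \<open>auto simp: linear_add[OF bounded_linear.linear[OF P]]\<close>)
  finally show ?thesis .
qed

lemma id_sobolev: "a < b \<Longrightarrow> (\<lambda>x. x) \<in> sobolev m a b"
  and id_weak_deriv_2: "a < b \<Longrightarrow> has_weak_deriv a b 2 (\<lambda>x. x) (\<lambda>_. 0)"
  and id_weak_deriv_1: "a < b \<Longrightarrow> has_weak_deriv a b 1 (\<lambda>x. x) (\<lambda>_. 1)"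
  and id_weak_deriv_0: "a < b \<Longrightarrow> has_weak_deriv a b 0 (\<lambda>x. x) (\<lambda>x. x)"
proof -
  assume ab: "a < b"
  define F where "F = (\<lambda>i::nat. if i = 0 then (\<lambda>x::real. x) else if i = 1 then (\<lambda>_. 1) else (\<lambda>_. 0))"
  have p: "primitive_on a b (F i) (F (Suc i))" for i
    by (rule primitive_on_DERIV) (auto simp: F_def intro!: derivative_eq_intros)
  have L: "F i \<in> L2 a b" for i by (rule continuous_L2) (auto simp: F_def intro!: continuous_intros)
  have ae: "AE x in leb a b. x = F 0 x" by (simp add: F_def)
  note S = sobolev_of_primitives[of a b "\<lambda>x. x" F, OF ab ae L p L]
  show "(\<lambda>x. x) \<in> sobolev m a b" by (rule S(1))
  show "has_weak_deriv a b 2 (\<lambda>x. x) (\<lambda>_. 0)" "has_weak_deriv a b 1 (\<lambda>x. x) (\<lambda>_. 1)" "has_weak_deriv a b 0 (\<lambda>x. x) (\<lambda>x. x)"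
    using S(2)[of 2 2] S(2)[of 1 2] S(2)[of 0 2] by (auto simp: F_def)
qed

context inverse_data begin

lemma id_wderiv: "x \<in> {0..L} \<Longrightarrow> wderiv 0 L 0 (\<lambda>x. x) x = x" "x \<in> {0..L} \<Longrightarrow> wderiv 0 L 1 (\<lambda>x. x) x = 1" "x \<in> {0..L} \<Longrightarrow> wderiv 0 L 2 (\<lambda>x. x) x = 0"
  using wderiv_eq[OF id_weak_deriv_0[OF pos(1)] _ pos(1)] wderiv_eq[OF id_weak_deriv_1[OF pos(1)] _ pos(1)]
    wderiv_eq[OF id_weak_deriv_2[OF pos(1)] _ pos(1)] by auto

lemma lift_eq: "lift L u = (\<lambda>x. 1 * u x + (- crep 0 L u L / L) * x)"
  unfolding lift_def by auto

lemma lift_sobolev: "u \<in> sobolev m 0 L \<Longrightarrow> lift L u \<in> sobolev m 0 L"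
  unfolding lift_eq by (rule sobolev_linear[OF _ id_sobolev[OF pos(1)]])

lemma lift_wderiv_AE:
  assumes "u \<in> sobolev m 0 L" "i \<le> m"
  shows "AE x in leb 0 L. wderiv 0 L i (lift L u) x = wderiv 0 L i u x - crep 0 L u L / L * wderiv 0 L i (\<lambda>x. x) x"
  unfolding lift_eq
  using wderiv_linear_AE[OF assms(1) id_sobolev[OF pos(1)] assms(2), of 1 "- crep 0 L u L / L"] by simp

lemma lift_wderiv:
  assumes "u \<in> sobolev m 0 L" "i < m" "x \<in> {0..L}"
  shows "wderiv 0 L i (lift L u) x = wderiv 0 L i u x - crep 0 L u L / L * wderiv 0 L i (\<lambda>x. x) x"
  unfolding lift_eq
  using wderiv_linear[OF assms(1) id_sobolev[OF pos(1)] assms(2) pos(1) assms(3), of 1 "- crep 0 L u L / L"] by simp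

lemma \<Lambda>_lift:
  assumes "u \<in> sobolev 2 0 L"
  shows "\<Lambda> (lift L u) = (LINT x|leb 0 L. (\<phi> x - \<beta> * wderiv 0 L 2 \<phi> x) * wderiv 0 L 1 u x) - crep 0 L u L / L * \<psi>L"
proof -
  have "\<Lambda> (lift L u) = (LINT x|leb 0 L. \<mu> x * wderiv 0 L 1 u x - crep 0 L u L / L * \<mu> x)"
    unfolding \<Lambda>_def L2_ip_def
    by (rule Bochner_Integration.integral_cong) (auto simp: lift_wderiv[OF assms, of 1, simplified] id_wderiv(2)[simplified] algebra_simps)
  also have "\<dots> = (LINT x|leb 0 L. \<mu> x * wderiv 0 L 1 u x) - crep 0 L u L / L * \<psi>L"
    unfolding \<mu>_int[symmetric]
    using L2_mult_integrable[OF \<mu>_L2 sobolevD(2)[OF assms, of 1]] L2_integrable[OF \<mu>_L2] by simp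
  finally show ?thesis by (simp add: \<mu>_def)
qed

lemma u1_sob2: "u1 \<in> sobolev 2 0 L"
  using u1 sobolev_mono[of 2 4 0 L] by auto

text \<open>The lifts \<open>v\<^sub>0\<close> and \<open>v\<^sub>1\<close> subtract a multiple of x; the compatibility conditions on f turn the subtracted boundary
  values into the initial values of z and \<open>z'\<close>.\<close>

lemma z_init: "z0_init = - crep 0 L u1 L" "z1_init = - crep 0 L u2 L"
  unfolding z0_init_def z1_init_def \<Lambda>_lift[OF u1_sob2] \<Lambda>_lift[OF u2(1)] f1 f2 using \<psi>L_eq(2) pos(1) by simp_all

lemma u0_prim: "primitive_on 0 L (wderiv 0 L 1 u0) u02" and u1_prim: "primitive_on 0 L (wderiv 0 L 1 u1) (wderiv 0 L 2 u1)"
  and u02_cont: "continuous_on {0..L} u02"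
proof -
  show "primitive_on 0 L (wderiv 0 L 1 u0) u02" "primitive_on 0 L (wderiv 0 L 1 u1) (wderiv 0 L 2 u1)"
    using sobolev_primitive[OF u0, of 1] sobolev_primitive[OF u1, of 1] pos(1) by (simp_all add: numeral_2_eq_2)
  show "continuous_on {0..L} u02"
    by (rule primitive_on_continuous[OF sobolev_primitive[OF u0 _ pos(1)]]) simp
qed

text \<open>The prescribed initial value of \<open>y''\<close> is the one that the boundary condition requires.\<close>

lemma ytt0_eq: "ytt0 = D u1 - k0 * D u0"
proof -
  have \<psi>p: "primitive_on 0 L (\<psi> L \<beta> \<phi>) (\<lambda>x. 1 * \<phi> x + (- \<beta>) * \<phi>2 x)"
  proof -
    have "primitive_on 0 L (\<lambda>x. 0 + (LINT s|leb 0 x. \<phi> s)) \<phi>" by (rule primitive_onI[OF L2_integrable[OF \<phi>_L2']])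
    from primitive_on_linear[OF this \<phi>_prim(2), of 1 "-\<beta>"] show ?thesis
      by (simp add: \<psi>_def[abs_def])
  qed
  have \<psi>0: "\<psi> L \<beta> \<phi> 0 = 0" unfolding \<psi>_def using \<phi>_bd(1)[of 1] by simp
  have ibp: "(LINT x|leb 0 L. \<psi> L \<beta> \<phi> x * wderiv 0 L 2 u x) = \<psi>L * D u - (LINT x|leb 0 L. (\<phi> x - \<beta> * wderiv 0 L 2 \<phi> x) * wderiv 0 L 1 u x)"
    "integrable (leb 0 L) (\<lambda>x. \<psi> L \<beta> \<phi> x * wderiv 0 L 2 u x)"
    if "primitive_on 0 L (wderiv 0 L 1 u) (wderiv 0 L 2 u)" for u
    using integral_by_parts_primitive[OF \<psi>p that] \<psi>0 pos(1) by (simp_all add: \<psi>L_def)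
  have "(LINT x|leb 0 L. \<psi> L \<beta> \<phi> x * (wderiv 0 L 2 u1 x - k0 * wderiv 0 L 2 u0 x))
     = (LINT x|leb 0 L. \<psi> L \<beta> \<phi> x * wderiv 0 L 2 u1 x - k0 * (\<psi> L \<beta> \<phi> x * u02 x))"
    by (simp add: algebra_simps)
  also have "\<dots> = (\<psi>L * D u1 - wderiv 0 T 1 f 0) - k0 * (\<psi>L * D u0 - crep 0 T f 0)"
    using ibp[OF u1_prim] ibp[OF u0_prim] f0 f1 by simp
  finally have "ytt0 = 1 / \<psi>L * (wderiv 0 T 1 f 0 - k0 * crep 0 T f 0
      + ((\<psi>L * D u1 - wderiv 0 T 1 f 0) - k0 * (\<psi>L * D u0 - crep 0 T f 0)))"
    unfolding ytt_init_def \<psi>L_def[symmetric] by (simp only:)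
  also have "\<dots> = 1 / \<psi>L * (\<psi>L * (D u1 - k0 * D u0))" by (simp add: algebra_simps)
  finally show ?thesis using \<psi>L_eq(2) by simp
qed

subsection \<open>The Volterra system\<close>

definition "\<gamma>f m = L2_ip 0 L (wderiv 0 L 2 (jX m)) \<phi>1"
definition "\<delta>f m = D (jX m)"

lemma \<gamma>f_bl: "bounded_linear \<gamma>f"
  unfolding \<gamma>f_def[abs_def] by (rule jX_functional[OF X_functional_wderiv[OF pos(1) order_refl \<phi>_L2]]) simp

lemma \<delta>f_bl: "bounded_linear \<delta>f"
proof -
  obtain C where C: "XX.bfunctional (\<lambda>e. D e) C" using X_functional_boundary_deriv[OF pos(1)] by blast
  show ?thesis unfolding \<delta>f_def[abs_def] by (rule jX_functional[OF C])
qed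

definition "cu02 = ext u02"
definition "cxL = ext xL"
definition "cm0 = ext (E w0)"

lemma ext_data:
  "x \<in> {0..L} \<Longrightarrow> ap cu02 x = u02 x" "x \<in> {0..L} \<Longrightarrow> ap cxL x = xL x" "x \<in> {0..L} \<Longrightarrow> ap cm0 x = E w0 x"
proof -
  have "w0 \<in> sobolev 4 0 L" by (rule lift_sobolev[OF u1])
  from sobolev_primitive[OF this _ pos(1)] have "continuous_on {0..L} (wderiv 0 L i w0)" if "i < 4" for i
    using primitive_on_continuous that by blast
  hence "continuous_on {0..L} (E w0)" unfolding E_def by (intro continuous_intros) auto
  thus "x \<in> {0..L} \<Longrightarrow> ap cm0 x = E w0 x" unfolding cm0_def by (rule ext_apply(2))
  show "x \<in> {0..L} \<Longrightarrow> ap cu02 x = u02 x" unfolding cu02_def by (rule ext_apply(2)[OF u02_cont])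
  show "x \<in> {0..L} \<Longrightarrow> ap cxL x = xL x" unfolding cxL_def by (rule ext_apply(2)[OF xL_cont])
qed

text \<open>Elements of X are determined by \<open>e - \<beta> e''\<close>.\<close>

lemma jX_inverse:
  assumes "e \<in> X L" "AE x in leb 0 L. E e x = ap m x"
  shows "X_norm L (\<lambda>x. jX m x - e x) = 0"
proof -
  have d: "(\<lambda>x. jX m x - e x) \<in> X L" by (rule XX.diff_mem[OF jX_X(1) assms(1)])
  note w = X_wderiv_diff[OF jX_X(1)[of m] assms(1)]
  have "AE x in leb 0 L. E (\<lambda>x. jX m x - e x) x = 0"
    using w[OF le0] w[OF order_refl] assms(2) XX.AE_interval
  proof eventually_elim
    case (elim x)
    have "E (\<lambda>x. jX m x - e x) x = E (jX m) x - E e x" unfolding E_def elim(1) elim(2) by (simp add: algebra_simps)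
    thus ?case using elim(3,4) jX_X(4)[of x m] by simp
  qed
  hence "L2_norm 0 L (E (\<lambda>x. jX m x - e x)) = L2_norm 0 L (\<lambda>x. 0)" by (rule L2_norm_cong_AE)
  hence "X_norm L (\<lambda>x. jX m x - e x) \<le> 0" using elliptic_estimate[OF d] L2sp.N_zero by simp
  thus ?thesis using XX.N_nonneg[OF d] by simp
qed

lemma jX_w0: "X_norm L (\<lambda>x. jX cm0 x - w0 x) = 0"
  by (rule jX_inverse[OF v0]) (auto simp: AE_leb_iff ext_data)

lemma jX_w1: "X_norm L (\<lambda>x. jX (cu02 + z1_init *\<^sub>R cxL) x - w1 x) = 0"
proof (rule jX_inverse[OF v1])
  show "AE x in leb 0 L. E w1 x = ap (cu02 + z1_init *\<^sub>R cxL) x"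
    using lift_wderiv_AE[OF u2(1) le0] lift_wderiv_AE[OF u2(1) order_refl] u2(2) crep_AE[OF u2(1)] XX.AE_interval
  proof eventually_elim
    case (elim x)
    hence x: "x \<in> {0..L}" by simp
    have "E w1 x = u2 x - crep 0 L u2 L / L * x - \<beta> * wderiv 0 L 2 u2 x"
      unfolding E_def using elim id_wderiv(1,3)[OF x] by simp
    also have "\<dots> = u02 x + z1_init * (x / L)" using elim(3) unfolding z_init by simp
    finally show ?case using ext_data(1,2)[OF x] by (simp add: plus_bcontfun.rep_eq xL_def)
  qed
qed

lemma \<delta>f_cm0: "\<delta>f cm0 = D u1 + z0_init / L"
proof -
  obtain C where C: "XX.bfunctional (\<lambda>e. D e) C" using X_functional_boundary_deriv[OF pos(1)] by blast
  have "\<delta>f cm0 = D w0" unfolding \<delta>f_def by (rule XX.N_zero_bfunctional[OF C jX_X(1) v0 jX_w0])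
  also have "\<dots> = D u1 - crep 0 L u1 L / L"
    using lift_wderiv[OF u1, of 1 L] id_wderiv(2)[of L] pos(1) by simp
  finally show ?thesis unfolding z_init by simp
qed

text \<open>The prescribed initial value of k is the one that the equation for k requires.\<close>

lemma k0_eq: "k0 = (fd 3 0 + \<gamma>f cm0) / \<gamma>"
proof -
  have "\<gamma>f cm0 = L2_ip 0 L (wderiv 0 L 2 w0) \<phi>1"
    unfolding \<gamma>f_def
    by (rule XX.N_zero_bfunctional[OF X_functional_wderiv[OF pos(1) order_refl \<phi>_L2] jX_X(1) v0 jX_w0]) simp
  also have "\<dots> = (LINT x|leb 0 L. \<phi>1 x * wderiv 0 L 2 w0 x)" unfolding L2_ip_def by (simp add: mult.commute)
  also have "\<dots> = - (LINT x|leb 0 L. \<phi>2 x * wderiv 0 L 1 w0 x)"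
    using integral_by_parts_primitive(1)[OF \<phi>_prim(2) X_prim(2)[OF v0]] pos(1) \<phi>_bd[of 1] by simp
  also have "(LINT x|leb 0 L. \<phi>2 x * wderiv 0 L 1 w0 x) = - (LINT x|leb 0 L. wderiv 0 L 3 \<phi> x * wderiv 0 L 0 w0 x)"
    using integral_by_parts_primitive(1)[OF \<phi>_prim(3) X_prim(1)[OF v0]] pos(1) \<phi>_bd[of 2] by simp
  also have "(LINT x|leb 0 L. wderiv 0 L 3 \<phi> x * wderiv 0 L 0 w0 x) = (LINT x|leb 0 L. w0 x * wderiv 0 L 3 \<phi> x)"
    by (rule leb_integral_cong_AE, rule AE_mp[OF crep_AE[OF X_D(1)[OF v0]]]) simp
  finally show ?thesis unfolding k_init_def \<alpha>_eq by simp
qed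

text \<open>The inhomogeneities of the system, and the initial values of \<open>y'\<close> and y that give z and \<open>z'\<close> theirs.\<close>

definition "ck t = (fd 3 t + \<gamma>f cm0) / \<gamma>"
definition "cy2 t = - D u0 * ck t + \<delta>f cm0 - z0_init / L"
definition "y10 = (z1_init - p * ytt0) / q"
definition "y00 = (z0_init - p * y10) / q"

lemma y_init: "p * ytt0 + q * y10 = z1_init" "p * y10 + q * y00 = z0_init"
  unfolding y10_def y00_def using pos(5) by simp_all

lemma fd_prim: "i < 4 \<Longrightarrow> primitive_on 0 T (fd i) (fd (Suc i))"
  by (rule sobolev_primitive[OF f _ pos(2)])

lemma fd3_cont: "continuous_on {0..T} (fd 3)"
  by (rule primitive_on_continuous[OF fd_prim]) simp

text \<open>The time-integrated system with the unknowns \<open>m = v - \<beta> v''\<close>, \<open>M = m'\<close>, k, \<open>y''\<close>, \<open>y'\<close> and y. The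
  conditions that determine k and \<open>y''\<close> have been differentiated in time once.\<close>

lemma Volterra_system:
  obtains m M :: "real \<Rightarrow> real \<Rightarrow>\<^sub>C real" and k y2 y1 y0 :: "real \<Rightarrow> real"
  where "continuous_on {0..T} m" "continuous_on {0..T} M" "continuous_on {0..T} k"
      "continuous_on {0..T} y2" "continuous_on {0..T} y1" "continuous_on {0..T} y0"
    and "\<And>t. t \<in> {0..T} \<Longrightarrow> m t = cm0 + integral {0..t} M"
    and "\<And>t. t \<in> {0..T} \<Longrightarrow> y1 t = y10 + integral {0..t} y2"
    and "\<And>t. t \<in> {0..T} \<Longrightarrow> y0 t = y00 + integral {0..t} y1"
    and "\<And>t. t \<in> {0..T} \<Longrightarrow> k t = ck t + integral {0..t} (\<lambda>s. (\<gamma>f (M s) - \<gamma>f cm0 * k s) / \<gamma> + bconv k (\<lambda>s. - \<gamma>f (M s) / \<gamma>) s)"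
    and "\<And>t. t \<in> {0..T} \<Longrightarrow> y2 t + D u0 * k t = \<delta>f cm0 - z0_init / L +
        integral {0..t} (\<lambda>s. \<delta>f (M s) - \<delta>f cm0 * k s - ((p * y2 s + q * y1 s) - z0_init * k s) / L
           + bconv k (\<lambda>s. - \<delta>f (M s) + (p * y2 s + q * y1 s) / L) s)"
    and "\<And>t. t \<in> {0..T} \<Longrightarrow> M t - (p * y2 t + q * y1 t) *\<^sub>R cxL =
        cu02 + integral {0..t} (\<lambda>s. Bop (m s) - k s *\<^sub>R cu02 + bconv k (\<lambda>s. - Bop (m s)) s)"
proof -
  define pm :: "(real \<Rightarrow>\<^sub>C real) \<times> (real \<Rightarrow>\<^sub>C real) \<times> real \<times> real \<times> real \<times> real \<Rightarrow> real \<Rightarrow>\<^sub>C real" where "pm = fst"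
  define pM :: "(real \<Rightarrow>\<^sub>C real) \<times> (real \<Rightarrow>\<^sub>C real) \<times> real \<times> real \<times> real \<times> real \<Rightarrow> real \<Rightarrow>\<^sub>C real" where "pM = (\<lambda>W. fst (snd W))"
  define pk :: "(real \<Rightarrow>\<^sub>C real) \<times> (real \<Rightarrow>\<^sub>C real) \<times> real \<times> real \<times> real \<times> real \<Rightarrow> real" where "pk = (\<lambda>W. fst (snd (snd W)))"
  define p2 :: "(real \<Rightarrow>\<^sub>C real) \<times> (real \<Rightarrow>\<^sub>C real) \<times> real \<times> real \<times> real \<times> real \<Rightarrow> real" where "p2 = (\<lambda>W. fst (snd (snd (snd W))))"
  define p1 :: "(real \<Rightarrow>\<^sub>C real) \<times> (real \<Rightarrow>\<^sub>C real) \<times> real \<times> real \<times> real \<times> real \<Rightarrow> real" where "p1 = (\<lambda>W. fst (snd (snd (snd (snd W)))))"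
  define p0 :: "(real \<Rightarrow>\<^sub>C real) \<times> (real \<Rightarrow>\<^sub>C real) \<times> real \<times> real \<times> real \<times> real \<Rightarrow> real" where "p0 = (\<lambda>W. snd (snd (snd (snd (snd W)))))"
  note bs = bounded_linear_compose[OF bounded_linear_fst] bounded_linear_compose[OF bounded_linear_snd]
  have bl: "bounded_linear pm" "bounded_linear pM" "bounded_linear pk" "bounded_linear p2" "bounded_linear p1" "bounded_linear p0"
    unfolding pm_def pM_def pk_def p2_def p1_def p0_def by (intro bs bounded_linear_fst bounded_linear_snd)+
  define rk where "rk = (\<lambda>W. (\<gamma>f (pM W) - \<gamma>f cm0 * pk W) / \<gamma>)"
  define lk where "lk = (\<lambda>W. - \<gamma>f (pM W) / \<gamma>)"
  define zf where "zf = (\<lambda>W. p * p2 W + q * p1 W)"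
  \<comment> \<open>the equation for \<open>y2 + D u0 * k\<close> is solved for \<open>y2\<close> with the help of that for k, and then the one for M in
    the same way\<close>
  define r2 where "r2 = (\<lambda>W. \<delta>f (pM W) - \<delta>f cm0 * pk W - (zf W - z0_init * pk W) / L - D u0 * rk W)"
  define l2 where "l2 = (\<lambda>W. - \<delta>f (pM W) + zf W / L - D u0 * lk W)"
  define rM where "rM = (\<lambda>W. Bop (pm W) - pk W *\<^sub>R cu02 + (p * r2 W + q * p2 W) *\<^sub>R cxL)"
  define lM where "lM = (\<lambda>W. - Bop (pm W) + (p * l2 W) *\<^sub>R cxL)"
  define A where "A = (\<lambda>W. (pM W, rM W, rk W, r2 W, p2 W, p1 W))"
  define \<Lambda>' where "\<Lambda>' = (\<lambda>W. (0 :: real \<Rightarrow>\<^sub>C real, lM W, lk W, l2 W, 0 :: real, 0 :: real))"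
  have cm: "bounded_linear (\<lambda>W. a * g W)" if "bounded_linear g" for a and g :: "_ \<Rightarrow> real"
    by (rule bounded_linear_compose[OF bounded_linear_mult_right that])
  have cd: "bounded_linear (\<lambda>W. g W / a)" if "bounded_linear g" for a and g :: "_ \<Rightarrow> real"
    by (rule bounded_linear_compose[OF bounded_linear_divide that])
  have cs: "bounded_linear (\<lambda>W. g W *\<^sub>R x)" if "bounded_linear g" for x :: "real \<Rightarrow>\<^sub>C real" and g :: "_ \<Rightarrow> real"
    by (rule bounded_linear_compose[OF bounded_linear_scaleR_left that])
  note blc = bl bounded_linear_compose[OF \<gamma>f_bl bl(2)] bounded_linear_compose[OF \<delta>f_bl bl(2)] bounded_linear_compose[OF Bop_bounded_linear bl(1)]
  have bzf: "bounded_linear zf" unfolding zf_def by (intro bounded_linear_add cm bl)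
  have brk: "bounded_linear rk" unfolding rk_def by (intro cd bounded_linear_sub cm blc)
  have blk: "bounded_linear lk" unfolding lk_def by (intro cd bounded_linear_minus blc)
  have br2: "bounded_linear r2" unfolding r2_def by (intro cd bounded_linear_sub cm blc bzf brk)
  have bl2: "bounded_linear l2" unfolding l2_def by (intro cd bounded_linear_sub bounded_linear_add bounded_linear_minus cm blc bzf blk)
  have brM: "bounded_linear rM" unfolding rM_def by (intro cs bounded_linear_sub bounded_linear_add cm blc br2)
  have blM: "bounded_linear lM" unfolding lM_def by (intro cs bounded_linear_add bounded_linear_minus cm blc bl2)
  have bA: "bounded_linear A" unfolding A_def by (intro bounded_linear_Pair blc brM brk br2)
  have b\<Lambda>: "bounded_linear \<Lambda>'" unfolding \<Lambda>'_def by (intro bounded_linear_Pair bounded_linear_zero blM blk bl2)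
  define c where "c = (\<lambda>t. (cm0, cu02 + (p * cy2 t + q * y10) *\<^sub>R cxL, ck t, cy2 t, y10, y00))"
  have cc: "continuous_on {0..T} c"
    unfolding c_def cy2_def ck_def by (intro continuous_intros fd3_cont) (use \<gamma>_nz' in auto)
  obtain W where Wc: "continuous_on {0..T} W" and W: "\<And>t. t \<in> {0..T} \<Longrightarrow>
      W t = c t + integral {0..t} (\<lambda>s. A (W s) + bconv (\<lambda>s. pk (W s)) (\<lambda>s. \<Lambda>' (W s)) s)"
    using quadratic_Volterra_exists[OF pos(2) cc bA b\<Lambda> bl(3)] by blast
  have cW: "continuous_on {0..T} (\<lambda>t. P (W t))" if "bounded_linear P" for P :: "_ \<Rightarrow> 'z::real_normed_vector"
    by (rule bounded_linear.continuous_on[OF that Wc])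
  have PW: "P (W t) = P (c t) + integral {0..t} (\<lambda>s. P (A (W s)) + bconv (\<lambda>s. pk (W s)) (\<lambda>s. P (\<Lambda>' (W s))) s)"
    if "bounded_linear P" "t \<in> {0..T}" for P :: "_ \<Rightarrow> 'z::banach" and t
    by (rule bounded_linear_Volterra[OF that(1) cW[OF bl(3)] cW[OF bA] cW[OF b\<Lambda>] that(2) W[OF that(2)]])
  have bz: "bconv k (\<lambda>s. 0) t = 0" for k and t by (simp add: bconv_def)
  note [simp] = bz
  have pc: "pm (c t) = cm0" "pM (c t) = cu02 + (p * cy2 t + q * y10) *\<^sub>R cxL" "pk (c t) = ck t" "p2 (c t) = cy2 t" "p1 (c t) = y10" "p0 (c t) = y00" for t
    by (simp_all add: c_def pm_def pM_def pk_def p2_def p1_def p0_def)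
  have pA: "pm (A V) = pM V" "pM (A V) = rM V" "pk (A V) = rk V" "p2 (A V) = r2 V" "p1 (A V) = p2 V" "p0 (A V) = p1 V" for V
    by (simp_all add: A_def pm_def pM_def pk_def p2_def p1_def p0_def)
  have p\<Lambda>: "pm (\<Lambda>' V) = 0" "pM (\<Lambda>' V) = lM V" "pk (\<Lambda>' V) = lk V" "p2 (\<Lambda>' V) = l2 V" "p1 (\<Lambda>' V) = 0" "p0 (\<Lambda>' V) = 0" for V
    by (simp_all add: \<Lambda>'_def pm_def pM_def pk_def p2_def p1_def p0_def)
  \<comment> \<open>the projections that undo this elimination\<close>
  define P2 where "P2 = (\<lambda>W. p2 W + D u0 * pk W)"
  define PM where "PM = (\<lambda>W. pM W - (p * p2 W + q * p1 W) *\<^sub>R cxL)"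
  have bP2: "bounded_linear P2" unfolding P2_def by (intro bounded_linear_add cm bl)
  have bPM: "bounded_linear PM" unfolding PM_def by (intro bounded_linear_add bounded_linear_sub cs cm bl)
  have P2v: "P2 (c t) = \<delta>f cm0 - z0_init / L" "P2 (A V) = \<delta>f (pM V) - \<delta>f cm0 * pk V - (zf V - z0_init * pk V) / L"
     "P2 (\<Lambda>' V) = - \<delta>f (pM V) + zf V / L" for t V
    unfolding P2_def pc pA p\<Lambda> by (simp_all add: cy2_def r2_def l2_def)
  have PMv: "PM (c t) = cu02" "PM (A V) = Bop (pm V) - pk V *\<^sub>R cu02" "PM (\<Lambda>' V) = - Bop (pm V)" for t V
    unfolding PM_def pc pA p\<Lambda> by (simp_all add: rM_def lM_def)
  show thesis
  proof (rule that[of "\<lambda>t. pm (W t)" "\<lambda>t. pM (W t)" "\<lambda>t. pk (W t)" "\<lambda>t. p2 (W t)" "\<lambda>t. p1 (W t)" "\<lambda>t. p0 (W t)"])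
    show "continuous_on {0..T} (\<lambda>t. pm (W t))" "continuous_on {0..T} (\<lambda>t. pM (W t))" "continuous_on {0..T} (\<lambda>t. pk (W t))"
      "continuous_on {0..T} (\<lambda>t. p2 (W t))" "continuous_on {0..T} (\<lambda>t. p1 (W t))" "continuous_on {0..T} (\<lambda>t. p0 (W t))"
      by (rule cW, rule bl)+
    fix t assume t: "t \<in> {0..T}"
    show "pm (W t) = cm0 + integral {0..t} (\<lambda>t. pM (W t))" using PW[OF bl(1) t] by (simp add: pc pA p\<Lambda>)
    show "p1 (W t) = y10 + integral {0..t} (\<lambda>t. p2 (W t))" using PW[OF bl(5) t] by (simp add: pc pA p\<Lambda>)
    show "p0 (W t) = y00 + integral {0..t} (\<lambda>t. p1 (W t))" using PW[OF bl(6) t] by (simp add: pc pA p\<Lambda>)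
    show "pk (W t) = ck t + integral {0..t} (\<lambda>s. (\<gamma>f (pM (W s)) - \<gamma>f cm0 * pk (W s)) / \<gamma> + bconv (\<lambda>t. pk (W t)) (\<lambda>s. - \<gamma>f (pM (W s)) / \<gamma>) s)"
      using PW[OF bl(3) t] by (simp add: pc pA p\<Lambda> rk_def lk_def)
    show "p2 (W t) + D u0 * pk (W t) = \<delta>f cm0 - z0_init / L +
        integral {0..t} (\<lambda>s. \<delta>f (pM (W s)) - \<delta>f cm0 * pk (W s) - ((p * p2 (W s) + q * p1 (W s)) - z0_init * pk (W s)) / L
           + bconv (\<lambda>t. pk (W t)) (\<lambda>s. - \<delta>f (pM (W s)) + (p * p2 (W s) + q * p1 (W s)) / L) s)"
      using PW[OF bP2 t] unfolding P2v unfolding P2_def zf_def .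
    show "pM (W t) - (p * p2 (W t) + q * p1 (W t)) *\<^sub>R cxL =
        cu02 + integral {0..t} (\<lambda>s. Bop (pm (W s)) - pk (W s) *\<^sub>R cu02 + bconv (\<lambda>t. pk (W t)) (\<lambda>s. - Bop (pm (W s))) s)"
      using PW[OF bPM t] unfolding PMv unfolding PM_def .
  qed
qed
end

subsection \<open>From the Volterra system back to the inverse problem\<close>

lemma primitive_onI_integral:
  fixes g :: "real \<Rightarrow> real"
  assumes g: "continuous_on {0..T} g" and F: "\<And>t. t \<in> {0..T} \<Longrightarrow> F t = c + integral {0..t} g"
  shows "primitive_on 0 T F g"
  unfolding primitive_on_def
proof (intro conjI ballI)
  show "integrable (leb 0 T) g" by (rule leb_continuous_integrable[OF g])
  fix t assume t: "t \<in> {0..T}"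
  have "0 \<in> {0..T}" using t by simp
  from F[OF this] have "F 0 = c" by simp
  thus "F t = F 0 + (LINT s|leb 0 t. g s)" using F[OF t] continuous_LINT[OF g t] by linarith
qed

lemma primitive_on_eq:
  assumes F: "primitive_on a b F g" and G: "primitive_on a b G h" and "F a = G a" "AE x in leb a b. g x = h x" and x: "x \<in> {a..b}"
  shows "F x = G x"
proof -
  have "(LINT s|leb a x. g s) = (LINT s|leb a x. h s)"
    by (rule leb_integral_cong_AE, rule AE_leb_sub[OF assms(4)]) (use x in auto)
  thus ?thesis using primitive_onD(2)[OF F, of x] primitive_onD(2)[OF G, of x] x assms(3) by simp
qed

lemma conv_linear:
  fixes h g :: "real \<Rightarrow> real"
  assumes k: "continuous_on {0..T} k" and h: "continuous_on {0..T} h" and g: "continuous_on {0..T} g" and t: "t \<in> {0..T}"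
  shows "conv k (\<lambda>s. a * h s + b * g s) t = a * conv k h t + b * conv k g t"
proof -
  have i: "integrable (leb 0 t) (\<lambda>s. k (t - s) * f s)" if "continuous_on {0..T} f" for f :: "real \<Rightarrow> real"
    by (rule leb_continuous_integrable[OF continuous_on_mult[OF continuous_reflect[OF k] continuous_on_subset[OF that]]]) (use t in auto)
  have "conv k (\<lambda>s. a * h s + b * g s) t = (LINT s|leb 0 t. a * (k (t - s) * h s) + b * (k (t - s) * g s))"
    unfolding conv_def by (simp add: algebra_simps)
  also have "\<dots> = a * conv k h t + b * conv k g t"
    unfolding conv_def using i[OF h] i[OF g] by simp
  finally show ?thesis .
qed

text \<open>Turns an equation for \<open>H - k * H\<close> into its time-integrated form, in which only \<open>h = H'\<close> is convolved.\<close>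

lemma minus_conv_primitive:
  assumes k: "continuous_on {0..T} k" and H: "primitive_on 0 T H h" and h: "continuous_on {0..T} h" and t: "t \<in> {0..T}"
  shows "H t - conv k H t = H 0 + integral {0..t} (\<lambda>s. h s - H 0 * k s - conv k h s)"
proof -
  have c: "continuous_on {0..T} (conv k h)" by (rule conv_continuous[OF k h])
  have i: "integrable (leb 0 t) f" if "continuous_on {0..T} f" for f :: "real \<Rightarrow> real"
    by (rule leb_continuous_integrable[OF continuous_on_subset[OF that]]) (use t in auto)
  have cc: "continuous_on {0..T} (\<lambda>s. h s - H 0 * k s - conv k h s)" by (intro continuous_intros h k c)
  have "conv k H t = H 0 * (LINT s|leb 0 t. k s) + (LINT s|leb 0 t. conv k h s)"
    unfolding conv_primitive[OF k H h c t] using i[OF k] i[OF c] by simp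
  moreover have "integral {0..t} (\<lambda>s. h s - H 0 * k s - conv k h s) = (LINT s|leb 0 t. h s) - H 0 * (LINT s|leb 0 t. k s) - (LINT s|leb 0 t. conv k h s)"
    unfolding continuous_LINT[OF cc t, symmetric] using i[OF k] i[OF c] i[OF h] by simp
  moreover have "H t = H 0 + (LINT s|leb 0 t. h s)" by (rule primitive_onD(2)[OF H]) (use t in auto)
  ultimately show ?thesis by linarith
qed

context semi_hilbert begin
lemma bcontinuous_of_bounded:
  fixes n :: "real \<Rightarrow> 'a::real_normed_vector"
  assumes E: "\<And>m. j m \<in> E" and d: "\<And>m n. j (m - n) = (\<lambda>x. j m x - j n x)" and b: "\<And>m. N (j m) \<le> K * norm m"
    and n: "continuous_on {a..b} n"
  shows "bcontinuous E N a b (\<lambda>t. j (n t))"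
  unfolding bcontinuous_def
proof (intro ballI conjI)
  fix t assume t: "t \<in> {a..b}"
  show "j (n t) \<in> E" by (rule E)
  have "((\<lambda>s. n s - n t) \<longlongrightarrow> n t - n t) (at t within {a..b})"
    using n t unfolding continuous_on_def by (intro tendsto_diff tendsto_const) auto
  hence l: "((\<lambda>s. K * norm (n s - n t)) \<longlongrightarrow> 0) (at t within {a..b})"
    by (intro tendsto_mult_right_zero tendsto_norm_zero) simp
  show "((\<lambda>s. N (\<lambda>x. j (n s) x - j (n t) x)) \<longlongrightarrow> 0) (at t within {a..b})"
  proof (rule Lim_null_comparison[OF _ l])
    show "\<forall>\<^sub>F s in at t within {a..b}. norm (N (\<lambda>x. j (n s) x - j (n t) x)) \<le> K * norm (n s - n t)"
      using b[of "n _ - n t"] N_nonneg[OF diff_mem[OF E E]] unfolding d by simp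
  qed
qed
end

context inverse_data begin
lemma X_AE_eq:
  assumes "e \<in> X L" "e' \<in> X L" "X_norm L (\<lambda>x. e x - e' x) = 0"
  shows "AE x in leb 0 L. e x = e' x"
  using AE_eq_zero_norm[OF pos(1) XX.diff_mem[OF assms(1,2)] assms(3)] by eventually_elim simp

end

text \<open>Reading the system backwards: undoing the time differentiation recovers the equations, because the
  prescribed initial values supply the right constants of integration.\<close>

locale Volterra_solution = inverse_data +
  fixes m M :: "real \<Rightarrow> real \<Rightarrow>\<^sub>C real" and k y2 y1 y0 :: "real \<Rightarrow> real"
  assumes mc: "continuous_on {0..T} m" and Mc: "continuous_on {0..T} M" and kc: "continuous_on {0..T} k"
    and y2c: "continuous_on {0..T} y2" and y1c: "continuous_on {0..T} y1" and y0c: "continuous_on {0..T} y0"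
    and m_eq: "\<And>t. t \<in> {0..T} \<Longrightarrow> m t = cm0 + integral {0..t} M"
    and y1_eq: "\<And>t. t \<in> {0..T} \<Longrightarrow> y1 t = y10 + integral {0..t} y2"
    and y0_eq: "\<And>t. t \<in> {0..T} \<Longrightarrow> y0 t = y00 + integral {0..t} y1"
    and k_eq: "\<And>t. t \<in> {0..T} \<Longrightarrow> k t = ck t + integral {0..t} (\<lambda>s. (\<gamma>f (M s) - \<gamma>f cm0 * k s) / \<gamma> + bconv k (\<lambda>s. - \<gamma>f (M s) / \<gamma>) s)"
    and y2_eq: "\<And>t. t \<in> {0..T} \<Longrightarrow> y2 t + D u0 * k t = \<delta>f cm0 - z0_init / L +
        integral {0..t} (\<lambda>s. \<delta>f (M s) - \<delta>f cm0 * k s - ((p * y2 s + q * y1 s) - z0_init * k s) / L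
           + bconv k (\<lambda>s. - \<delta>f (M s) + (p * y2 s + q * y1 s) / L) s)"
    and M_eq: "\<And>t. t \<in> {0..T} \<Longrightarrow> M t - (p * y2 t + q * y1 t) *\<^sub>R cxL =
        cu02 + integral {0..t} (\<lambda>s. Bop (m s) - k s *\<^sub>R cu02 + bconv k (\<lambda>s. - Bop (m s)) s)"
begin

lemma z0T: "0 \<in> {0..T}" using pos(2) by simp

definition "z0 t = p * y1 t + q * y0 t"
definition "z1 t = p * y2 t + q * y1 t"
definition "kI s = \<gamma>f (M s) - \<gamma>f cm0 * k s - conv k (\<lambda>s. \<gamma>f (M s)) s"
definition "yI s = (\<delta>f (M s) - \<delta>f cm0 * k s - conv k (\<lambda>s. \<delta>f (M s)) s) - (z1 s - z0_init * k s - conv k z1 s) / L"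
definition "Rt s = Bop (m s) - k s *\<^sub>R cu02 + bconv k (\<lambda>s. - Bop (m s)) s"
definition "k' t = 1 / \<gamma> * fd 4 t + 1 / \<gamma> * kI t"
definition "y3 t = - D u0 * k' t + 1 * yI t"
definition "z2 t = p * y3 t + q * y2 t"

lemma cont_of: "bounded_linear P \<Longrightarrow> continuous_on {0..T} (\<lambda>t. P (m t))" "bounded_linear P \<Longrightarrow> continuous_on {0..T} (\<lambda>t. P (M t))"
  using bounded_linear.continuous_on[OF _ mc] bounded_linear.continuous_on[OF _ Mc] by blast+

lemma z1c: "continuous_on {0..T} z1" and z0c: "continuous_on {0..T} z0"
  unfolding z1_def z0_def by (intro continuous_intros y0c y1c y2c)+

lemma kIc: "continuous_on {0..T} kI" and yIc: "continuous_on {0..T} yI" and Rtc: "continuous_on {0..T} Rt"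
proof -
  note c = cont_of(2)[OF \<gamma>f_bl] cont_of(2)[OF \<delta>f_bl] cont_of(1)[OF Bop_bounded_linear]
  show "continuous_on {0..T} kI" unfolding kI_def by (intro continuous_intros c kc conv_continuous)
  show "continuous_on {0..T} yI" unfolding yI_def by (intro continuous_intros c kc z1c conv_continuous) (use pos(1) in auto)
  show "continuous_on {0..T} Rt" unfolding Rt_def by (intro continuous_intros c kc bconv_continuous)
qed

lemma initial_values: "m 0 = cm0" "y1 0 = y10" "y0 0 = y00" "k 0 = k0" "y2 0 = ytt0" "z0 0 = z0_init" "z1 0 = z1_init"
    "M 0 = cu02 + z1_init *\<^sub>R cxL"
proof -
  show 1: "m 0 = cm0" "y1 0 = y10" "y0 0 = y00" using m_eq[OF z0T] y1_eq[OF z0T] y0_eq[OF z0T] by simp_all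
  show k: "k 0 = k0" using k_eq[OF z0T] unfolding k0_eq ck_def by simp
  show y2: "y2 0 = ytt0" using y2_eq[OF z0T] unfolding ytt0_eq k \<delta>f_cm0 by (simp add: algebra_simps)
  show "z0 0 = z0_init" "z1 0 = z1_init" unfolding z0_def z1_def 1 y2 y_init by simp_all
  hence "p * y2 0 + q * y1 0 = z1_init" unfolding z1_def by simp
  thus "M 0 = cu02 + z1_init *\<^sub>R cxL" using M_eq[OF z0T] by (simp add: algebra_simps)
qed

lemma m_functional:
  fixes P :: "(real \<Rightarrow>\<^sub>C real) \<Rightarrow> real"
  assumes P: "bounded_linear P"
  shows "primitive_on 0 T (\<lambda>t. P (m t)) (\<lambda>t. P (M t))"
proof (rule primitive_onI_integral[OF cont_of(2)[OF P]])
  fix t assume t: "t \<in> {0..T}"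
  have "continuous_on {0..t} M" by (rule continuous_on_subset[OF Mc]) (use t in auto)
  from bounded_linear_integral[OF P this] show "P (m t) = P cm0 + integral {0..t} (\<lambda>t. P (M t))"
    unfolding m_eq[OF t] by (simp add: linear_add[OF bounded_linear.linear[OF P]])
qed

lemma y_prim: "primitive_on 0 T y0 y1" "primitive_on 0 T y1 y2"
  by (rule primitive_onI_integral[OF y1c y0_eq], assumption, rule primitive_onI_integral[OF y2c y1_eq], assumption)

lemma z0_prim: "primitive_on 0 T z0 z1"
  unfolding z0_def z1_def by (intro primitive_on_linear y_prim)

lemma k_integral:
  assumes t: "t \<in> {0..T}"
  shows "k t = ck t + 1 / \<gamma> * integral {0..t} kI"
proof -
  have "integral {0..t} (\<lambda>s. (\<gamma>f (M s) - \<gamma>f cm0 * k s) / \<gamma> + bconv k (\<lambda>s. - \<gamma>f (M s) / \<gamma>) s) = integral {0..t} (\<lambda>s. 1 / \<gamma> * kI s)"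
  proof (rule Henstock_Kurzweil_Integration.integral_cong)
    fix s assume "s \<in> {0..t}"
    hence s: "s \<in> {0..T}" using t by auto
    have c: "continuous_on {0..T} (\<lambda>s. - \<gamma>f (M s) / \<gamma>)" by (intro continuous_intros cont_of \<gamma>f_bl) (use \<gamma>_nz' in auto)
    have "bconv k (\<lambda>s. - \<gamma>f (M s) / \<gamma>) s = - 1 / \<gamma> * conv k (\<lambda>s. \<gamma>f (M s)) s"
      unfolding bconv_real[OF kc c s] unfolding conv_def by simp
    thus "(\<gamma>f (M s) - \<gamma>f cm0 * k s) / \<gamma> + bconv k (\<lambda>s. - \<gamma>f (M s) / \<gamma>) s = 1 / \<gamma> * kI s"
      unfolding kI_def by (simp add: diff_divide_distrib)
  qed
  thus ?thesis using k_eq[OF t] by simp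
qed

lemma k_closed:
  assumes t: "t \<in> {0..T}"
  shows "\<gamma> * k t = fd 3 t + \<gamma>f (m t) - conv k (\<lambda>s. \<gamma>f (m s)) t"
proof -
  have "k t = (fd 3 t + \<gamma>f cm0 + integral {0..t} kI) / \<gamma>"
    using k_integral[OF t] by (simp add: ck_def add_divide_distrib)
  hence "\<gamma> * k t = fd 3 t + \<gamma>f cm0 + integral {0..t} kI" using \<gamma>_nz' by simp
  moreover have "\<gamma>f (m t) - conv k (\<lambda>s. \<gamma>f (m s)) t = \<gamma>f cm0 + integral {0..t} kI"
    using minus_conv_primitive[OF kc m_functional[OF \<gamma>f_bl] cont_of(2)[OF \<gamma>f_bl] t]
    unfolding initial_values(1) kI_def[abs_def] .
  ultimately show ?thesis by simp
qed

lemma y2_integral: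
  assumes t: "t \<in> {0..T}"
  shows "y2 t + D u0 * k t = \<delta>f cm0 - z0_init / L + integral {0..t} yI"
proof -
  have "integral {0..t} (\<lambda>s. \<delta>f (M s) - \<delta>f cm0 * k s - ((p * y2 s + q * y1 s) - z0_init * k s) / L
           + bconv k (\<lambda>s. - \<delta>f (M s) + (p * y2 s + q * y1 s) / L) s) = integral {0..t} yI"
  proof (rule Henstock_Kurzweil_Integration.integral_cong)
    fix s assume "s \<in> {0..t}"
    hence s: "s \<in> {0..T}" using t by auto
    have e: "(\<lambda>s. - \<delta>f (M s) + z1 s / L) = (\<lambda>s. (- 1) * \<delta>f (M s) + (1 / L) * z1 s)" by (simp add: fun_eq_iff)
    have c: "continuous_on {0..T} (\<lambda>s. (- 1) * \<delta>f (M s) + (1 / L) * z1 s)" by (intro continuous_intros cont_of \<delta>f_bl z1c) (use pos in auto)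
    have "bconv k (\<lambda>s. - \<delta>f (M s) + z1 s / L) s = (- 1) * conv k (\<lambda>s. \<delta>f (M s)) s + (1 / L) * conv k z1 s"
      unfolding e bconv_real[OF kc c s] by (rule conv_linear[OF kc cont_of(2)[OF \<delta>f_bl] z1c s])
    thus "\<delta>f (M s) - \<delta>f cm0 * k s - ((p * y2 s + q * y1 s) - z0_init * k s) / L
           + bconv k (\<lambda>s. - \<delta>f (M s) + (p * y2 s + q * y1 s) / L) s = yI s"
      unfolding yI_def z1_def[symmetric] by (simp add: diff_divide_distrib)
  qed
  thus ?thesis using y2_eq[OF t] by simp
qed

lemma boundary_closed:
  assumes t: "t \<in> {0..T}"
  shows "\<delta>f (m t) - conv k (\<lambda>s. \<delta>f (m s)) t = y2 t + k t * D u0 + 1 / L * (z0 t - conv k z0 t)"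
proof -
  let ?a = "\<lambda>s. \<delta>f (M s) - \<delta>f cm0 * k s - conv k (\<lambda>s. \<delta>f (M s)) s"
  let ?b = "\<lambda>s. z1 s - z0_init * k s - conv k z1 s"
  have 1: "\<delta>f (m t) - conv k (\<lambda>s. \<delta>f (m s)) t = \<delta>f cm0 + integral {0..t} ?a"
    using minus_conv_primitive[OF kc m_functional[OF \<delta>f_bl] cont_of(2)[OF \<delta>f_bl] t] unfolding initial_values(1) .
  have 2: "z0 t - conv k z0 t = z0_init + integral {0..t} ?b"
    using minus_conv_primitive[OF kc z0_prim z1c t] unfolding initial_values(6) .
  have c: "continuous_on {0..T} ?a" "continuous_on {0..T} ?b"
    by (intro continuous_intros kc conv_continuous cont_of \<delta>f_bl z1c)+
  have i: "?a integrable_on {0..t}" "?b integrable_on {0..t}"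
    by (rule integrable_continuous_real[OF continuous_on_subset[OF c(1)]], use t in simp)
       (rule integrable_continuous_real[OF continuous_on_subset[OF c(2)]], use t in simp)
  have "integral {0..t} yI = integral {0..t} ?a - integral {0..t} (\<lambda>s. 1 / L * ?b s)"
    unfolding yI_def[abs_def]
    using Henstock_Kurzweil_Integration.integral_diff[OF i(1) integrable_cmul[OF i(2), of "1 / L"]] by simp
  also have "integral {0..t} (\<lambda>s. 1 / L * ?b s) = 1 / L * integral {0..t} ?b" by (rule integral_mult_right)
  finally show ?thesis using y2_integral[OF t] unfolding 1 2 by (simp add: algebra_simps add_divide_distrib diff_divide_distrib)
qed

lemma k_prim: "primitive_on 0 T k k'"
proof -
  have I: "primitive_on 0 T (\<lambda>t. 0 + integral {0..t} kI) kI" by (rule primitive_onI_integral[OF kIc]) simp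
  have C: "primitive_on 0 T (\<lambda>t. \<gamma>f cm0 / \<gamma>) (\<lambda>t. 0)" by (rule primitive_on_DERIV) (auto intro!: derivative_eq_intros)
  have F: "primitive_on 0 T (fd 3) (fd 4)" using fd_prim[of 3] by simp
  have "primitive_on 0 T (\<lambda>t. 1 * (1 / \<gamma> * fd 3 t + 1 / \<gamma> * (0 + integral {0..t} kI)) + 1 * (\<gamma>f cm0 / \<gamma>))
     (\<lambda>t. 1 * (1 / \<gamma> * fd 4 t + 1 / \<gamma> * kI t) + 1 * 0)"
    by (intro primitive_on_linear F I C)
  thus ?thesis
    by (rule primitive_on_cong) (use pos(2) k_integral in \<open>auto simp: k'_def ck_def add_divide_distrib\<close>)
qed

lemma y2_prim: "primitive_on 0 T y2 y3"
proof -
  have I: "primitive_on 0 T (\<lambda>t. (\<delta>f cm0 - z0_init / L) + integral {0..t} yI) yI" by (rule primitive_onI_integral[OF yIc refl])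
  have "primitive_on 0 T (\<lambda>t. - D u0 * k t + 1 * ((\<delta>f cm0 - z0_init / L) + integral {0..t} yI)) y3"
    unfolding y3_def[abs_def] by (intro primitive_on_linear k_prim I)
  thus ?thesis
  proof (rule primitive_on_cong)
    fix t assume "0 \<le> t" "t \<le> T"
    thus "- D u0 * k t + 1 * ((\<delta>f cm0 - z0_init / L) + integral {0..t} yI) = y2 t" using y2_integral[of t] by simp
  qed (use pos(2) in auto)
qed

lemma k'_L2: "k' \<in> L2 0 T" and y3_L2: "y3 \<in> L2 0 T" and z2_L2: "z2 \<in> L2 0 T"
proof -
  have "fd 4 \<in> L2 0 T" by (rule sobolevD(2)[OF f]) simp
  thus 1: "k' \<in> L2 0 T" unfolding k'_def[abs_def] by (intro L2_linear continuous_L2[OF kIc])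
  thus 2: "y3 \<in> L2 0 T" unfolding y3_def[abs_def] by (intro L2_linear continuous_L2[OF yIc])
  thus "z2 \<in> L2 0 T" unfolding z2_def[abs_def] by (intro L2_linear continuous_L2[OF y2c])
qed

lemma z1_prim: "primitive_on 0 T z1 z2"
  unfolding z1_def z2_def by (intro primitive_on_linear y_prim y2_prim)

lemma k_sobolev: "k \<in> sobolev 1 0 T" "t \<in> {0..T} \<Longrightarrow> wderiv 0 T 0 k t = k t"
proof -
  define F where "F = (\<lambda>i::nat. if i = 0 then k else k')"
  have "AE t in leb 0 T. k t = F 0 t" "F 0 \<in> L2 0 T" "\<And>i. i < 1 \<Longrightarrow> primitive_on 0 T (F i) (F (Suc i))" "\<And>i. F i \<in> L2 0 T"
    using k_prim k'_L2 continuous_L2[OF kc] by (auto simp: F_def)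
  note S = sobolev_of_primitives[of 0 T k F 1, OF pos(2) this]
  show "k \<in> sobolev 1 0 T" by (rule S(1))
  show "t \<in> {0..T} \<Longrightarrow> wderiv 0 T 0 k t = k t" using S(3)[of 0 t] by (simp add: F_def)
qed

lemma y_sobolev: "y0 \<in> sobolev 3 0 T" "t \<in> {0..T} \<Longrightarrow> wderiv 0 T 1 y0 t = y1 t" "t \<in> {0..T} \<Longrightarrow> wderiv 0 T 2 y0 t = y2 t"
proof -
  define F where "F = (\<lambda>i::nat. if i = 0 then y0 else if i = 1 then y1 else if i = 2 then y2 else y3)"
  have pr: "primitive_on 0 T (F i) (F (Suc i))" if i: "i < 3" for i
  proof -
    consider "i = 0" | "i = 1" | "i = 2" using i by linarith
    thus ?thesis by cases (use y_prim y2_prim in \<open>simp_all add: F_def\<close>)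
  qed
  have ae: "AE t in leb 0 T. y0 t = F 0 t" by (simp add: F_def)
  have L: "F i \<in> L2 0 T" for i using continuous_L2[OF y0c] continuous_L2[OF y1c] continuous_L2[OF y2c] y3_L2 by (simp add: F_def)
  note S = sobolev_of_primitives[of 0 T y0 F 3, OF pos(2) ae L pr L]
  show "y0 \<in> sobolev 3 0 T" by (rule S(1))
  show "t \<in> {0..T} \<Longrightarrow> wderiv 0 T 1 y0 t = y1 t" "t \<in> {0..T} \<Longrightarrow> wderiv 0 T 2 y0 t = y2 t"
    using S(3)[of 1 t] S(3)[of 2 t] by (simp_all add: F_def)
qed

lemma z_wderiv: "AE t in leb 0 T. wderiv 0 T 2 (\<lambda>t. p * wderiv 0 T 1 y0 t + q * y0 t) t = z2 t"
proof -
  define F where "F = (\<lambda>i::nat. if i = 0 then z0 else if i = 1 then z1 else z2)"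
  have pr: "primitive_on 0 T (F i) (F (Suc i))" if i: "i < 2" for i
  proof -
    consider "i = 0" | "i = 1" using i by linarith
    thus ?thesis by cases (use z0_prim z1_prim in \<open>simp_all add: F_def\<close>)
  qed
  have ae: "AE t in leb 0 T. p * wderiv 0 T 1 y0 t + q * y0 t = F 0 t"
    using XX.AE_interval by eventually_elim (use y_sobolev(2) in \<open>simp add: F_def z0_def\<close>)
  have L: "F i \<in> L2 0 T" for i using continuous_L2[OF z0c] continuous_L2[OF z1c] z2_L2 by (simp add: F_def)
  have "has_weak_deriv 0 T 2 (\<lambda>t. p * wderiv 0 T 1 y0 t + q * y0 t) (F 2)"
    by (rule sobolev_of_primitives(2)[OF pos(2) ae L pr L]) auto
  thus ?thesis unfolding F_def by (intro wderiv_AE_eq) simp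
qed

text \<open>The derivative of \<open>M = v\<^sub>t - \<beta> v\<^sub>x\<^sub>x\<^sub>t\<close> is \<open>Rt\<close> plus \<open>z''\<close> times the element x/L. The second part is merely square
  integrable in time and is carried by a scalar factor, so that \<open>Rt\<close> stays continuous.\<close>

lemma M_functional:
  fixes P :: "(real \<Rightarrow>\<^sub>C real) \<Rightarrow> real"
  assumes P: "bounded_linear P"
  shows "primitive_on 0 T (\<lambda>t. P (M t) - z1 t * P cxL) (\<lambda>t. P (Rt t))"
proof (rule primitive_onI_integral[OF bounded_linear.continuous_on[OF P Rtc]])
  fix t assume t: "t \<in> {0..T}"
  note l = bounded_linear.linear[OF P]
  have c: "continuous_on {0..t} Rt" by (rule continuous_on_subset[OF Rtc]) (use t in auto)
  have "P (M t) - z1 t * P cxL = P (M t - z1 t *\<^sub>R cxL)" by (simp add: linear_diff[OF l] linear_scale[OF l])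
  also have "\<dots> = P (cu02 + integral {0..t} Rt)" using M_eq[OF t] unfolding z1_def Rt_def[abs_def] by simp
  also have "\<dots> = P cu02 + integral {0..t} (\<lambda>t. P (Rt t))"
    using bounded_linear_integral[OF P c] by (simp add: linear_add[OF l])
  finally show "P (M t) - z1 t * P cxL = P cu02 + integral {0..t} (\<lambda>t. P (Rt t))" .
qed

subsection \<open>Regularity in time\<close>

definition "v t = jX (m t)"
definition "V1 t = jX (M t)"
definition "V2 t = (\<lambda>x. 1 * jX (Rt t) x + z2 t * jX cxL x)"

lemma mem: "v t \<in> X L" "V1 t \<in> X L" "V2 t \<in> X L"
  unfolding v_def V1_def V2_def by (intro XX.lin_mem jX_X(1))+

lemma bcontinuous_jX: "continuous_on {0..T} n \<Longrightarrow> bcontinuous (X L) (X_norm L) 0 T (\<lambda>t. jX (n t))"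
  by (rule XX.bcontinuous_of_bounded[OF jX_X(1) jX_diff jX_bound])

lemma vc: "bcontinuous (X L) (X_norm L) 0 T v" and V1c: "bcontinuous (X L) (X_norm L) 0 T V1"
  unfolding v_def[abs_def] V1_def[abs_def] by (intro bcontinuous_jX mc Mc)+

lemma V2_bL2: "V2 \<in> bL2 (X L) (X_norm L) 0 T"
proof -
  have c: "bcontinuous (X L) (X_norm L) 0 T (\<lambda>t. jX (Rt t))" "bcontinuous (X L) (X_norm L) 0 T (\<lambda>t. jX cxL)"
    by (intro bcontinuous_jX Rtc continuous_on_const)+
  have bm: "bmeasurable (X L) (X_norm L) 0 T V2"
    unfolding V2_def[abs_def]
    by (rule XX.bmeasurable_linear[OF XX.bcontinuous_measurable[OF c(1) pos(2)] XX.bcontinuous_measurable[OF c(2) pos(2)]])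
       (use L2_measurable[OF z2_L2] in auto)
  let ?B = "\<lambda>t. 1 * X_norm L (jX (Rt t)) + X_norm L (jX cxL) * \<bar>z2 t\<bar>"
  have B: "X_norm L (V2 t) \<le> ?B t" for t
  proof -
    have "X_norm L (V2 t) \<le> X_norm L (\<lambda>x. 1 * jX (Rt t) x) + X_norm L (\<lambda>x. z2 t * jX cxL x)"
      unfolding V2_def by (rule XX.N_triangle) (intro XX.scale_mem jX_X(1))+
    thus ?thesis using XX.N_scale[OF jX_X(1)[of cxL], of "z2 t"] by (simp add: mult.commute)
  qed
  have "?B \<in> L2 0 T"
    by (intro L2_linear continuous_L2 XX.bcontinuous_N[OF c(1)] L2_abs z2_L2)
  hence i: "integrable (leb 0 T) (\<lambda>t. (?B t)\<^sup>2)" by (simp add: L2_def)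
  have "integrable (leb 0 T) (\<lambda>t. (X_norm L (V2 t))\<^sup>2)"
  proof (rule Bochner_Integration.integrable_bound[OF i])
    show "(\<lambda>t. (X_norm L (V2 t))\<^sup>2) \<in> borel_measurable (leb 0 T)"
      using XX.bmeasurable_N[OF bm] by measurable
    show "AE t in leb 0 T. norm ((X_norm L (V2 t))\<^sup>2) \<le> norm ((?B t)\<^sup>2)"
      by (rule AE_I2) (use power_mono[OF B XX.N_nonneg[OF mem(3)], of _ 2] in simp)
  qed
  thus ?thesis using bm by (simp add: bL2_def)
qed

text \<open>A bounded functional of \<open>jX m\<close> is a bounded linear functional of m, and those of m and M have the primitives
  found above.\<close>

lemma functional_weak_deriv:
  assumes l: "XX.bfunctional l C" and i: "i \<le> 2"
  shows "has_weak_deriv 0 T i (\<lambda>t. l (v t)) (\<lambda>t. l ((if i = 0 then v else if i = 1 then V1 else V2) t))"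
proof -
  define P where "P = (\<lambda>n. l (jX n))"
  have P: "bounded_linear P" unfolding P_def by (rule jX_functional[OF l])
  define F where "F = (\<lambda>i::nat. \<lambda>t. l ((if i = 0 then v else if i = 1 then V1 else V2) t))"
  have F2: "F 2 = (\<lambda>t. 1 * P (Rt t) + P cxL * z2 t)"
  proof
    fix t
    have "l (\<lambda>x. 1 * jX (Rt t) x + z2 t * jX cxL x) = 1 * l (jX (Rt t)) + z2 t * l (jX cxL)"
      by (rule XX.bfunctionalD(2)[OF l jX_X(1) jX_X(1)])
    thus "F 2 t = 1 * P (Rt t) + P cxL * z2 t" unfolding F_def V2_def P_def by (simp add: mult.commute)
  qed
  have p0: "primitive_on 0 T (F 0) (F 1)"
    using m_functional[OF P] by (simp add: F_def v_def V1_def P_def)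
  have "primitive_on 0 T (\<lambda>t. 1 * (P (M t) - z1 t * P cxL) + P cxL * z1 t) (F 2)"
    unfolding F2 by (intro primitive_on_linear M_functional[OF P] z1_prim)
  hence p1: "primitive_on 0 T (F 1) (F 2)" by (simp add: F_def V1_def P_def mult.commute)
  have pr: "primitive_on 0 T (F i) (F (Suc i))" if i: "i < 2" for i
  proof -
    consider "i = 0" | "i = 1" using i by linarith
    thus ?thesis by cases (use p0 p1 in \<open>simp_all add: numeral_2_eq_2\<close>)
  qed
  have L: "F i \<in> L2 0 T" if i: "i \<le> 2" for i
  proof -
    consider "i = 0" | "i = 1" | "i = 2" using i by linarith
    thus ?thesis
    proof cases
      case 3
      show ?thesis unfolding 3 F2 by (intro L2_linear continuous_L2 bounded_linear.continuous_on[OF P Rtc] z2_L2)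
    qed (use continuous_L2[OF primitive_on_continuous[OF p0]] continuous_L2[OF primitive_on_continuous[OF p1]] in auto)
  qed
  have ae: "AE t in leb 0 T. l (v t) = F 0 t" by (simp add: F_def)
  show ?thesis using sobolev_of_primitives(2)[OF pos(2) ae L pr L i] unfolding F_def by simp
qed

lemma bweak_derivs: "has_bweak_deriv (X L) (X_norm L) 0 T 0 v v" "has_bweak_deriv (X L) (X_norm L) 0 T 1 v V1"
    "has_bweak_deriv (X L) (X_norm L) 0 T 2 v V2"
proof -
  note cv = XX.bcontinuous_integrable[OF vc pos(2)] and cV1 = XX.bcontinuous_integrable[OF V1c pos(2)]
  show "has_bweak_deriv (X L) (X_norm L) 0 T 0 v v" by (rule XX.has_bweak_deriv_0[OF cv(3)])
  show "has_bweak_deriv (X L) (X_norm L) 0 T 1 v V1"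
    by (rule XX.bweak_derivI[OF cv(1,2) cV1(1,2)]) (use functional_weak_deriv[OF XX.bfunctional_ip, of _ 1] in simp)
  show "has_bweak_deriv (X L) (X_norm L) 0 T 2 v V2"
    by (rule XX.bweak_derivI[OF cv(1,2) XX.bL2_D[OF V2_bL2]]) (use functional_weak_deriv[OF XX.bfunctional_ip, of _ 2] in simp)
qed

lemma v_bsobolev: "v \<in> bsobolev 2 (X L) (X_norm L) 0 T"
proof -
  have "\<exists>w\<in>bL2 (X L) (X_norm L) 0 T. has_bweak_deriv (X L) (X_norm L) 0 T i v w" if i: "i \<le> 2" for i
  proof -
    consider "i = 0" | "i = 1" | "i = 2" using i by linarith
    thus ?thesis
      by cases (use bweak_derivs V2_bL2 XX.bcontinuous_integrable(3)[OF vc pos(2)] XX.bcontinuous_integrable(3)[OF V1c pos(2)] in blast)+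
  qed
  thus ?thesis using XX.bcontinuous_integrable(3)[OF vc pos(2)] by (simp add: bsobolev_def)
qed

lemma bwderiv_eq:
  assumes d: "has_bweak_deriv (X L) (X_norm L) 0 T n v w" and c: "bcontinuous (X L) (X_norm L) 0 T w" and t: "t \<in> {0..T}"
  shows "AE x in leb 0 L. w t x = bwderiv (X L) (X_norm L) 0 T n v t x"
proof -
  note b = XX.bwderiv_has_bweak_deriv[OF d] XX.bwderiv_has_bweak_deriv(2)[OF d c]
  have ae: "AE t in leb 0 T. X_norm L (\<lambda>x. w t x - bwderiv (X L) (X_norm L) 0 T n v t x) = 0"
    using XX.bweak_deriv_unique[OF d b(1)] by eventually_elim simp
  show ?thesis
    by (rule X_AE_eq[OF _ _ XX.bcontinuous_AE_eq[OF c b(3) ae pos(2) t]])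
       (use XX.bcontinuous_mem[OF c] XX.bcontinuous_mem[OF b(3)] t in auto)
qed

lemma initial_conditions:
  "AE x in leb 0 L. bwderiv (X L) (X_norm L) 0 T 0 v 0 x = w0 x"
  "AE x in leb 0 L. bwderiv (X L) (X_norm L) 0 T 1 v 0 x = w1 x"
proof -
  have "AE x in leb 0 L. v 0 x = w0 x" "AE x in leb 0 L. V1 0 x = w1 x"
    unfolding v_def V1_def initial_values by (rule X_AE_eq[OF jX_X(1) v0 jX_w0], rule X_AE_eq[OF jX_X(1) v1 jX_w1])
  thus "AE x in leb 0 L. bwderiv (X L) (X_norm L) 0 T 0 v 0 x = w0 x"
    "AE x in leb 0 L. bwderiv (X L) (X_norm L) 0 T 1 v 0 x = w1 x"
    using bwderiv_eq[OF bweak_derivs(1) vc z0T] bwderiv_eq[OF bweak_derivs(2) V1c z0T] by (eventually_elim, simp)+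
qed

subsection \<open>The equations\<close>

text \<open>The right-hand side is an integral in the space of continuous functions. Inner products are bounded
  functionals there, so they commute with it, and they identify Bochner integrals.\<close>

lemma memory_bintegral:
  assumes t: "t \<in> {0..T}"
  shows "has_bintegral (L2 0 L) (L2_norm 0 L) 0 t (\<lambda>s x. k (t - s) * wderiv 0 L 2 (v s) x) (ap (bconv k (\<lambda>s. Bop (m s)) t))"
proof (cases "t = 0")
  case True
  show ?thesis unfolding True
    by (rule L2sp.has_bintegralI[OF L2sp.has_bintegral_empty[OF order_refl] ap_L2]) (simp add: bconv_def L2_ip_def)
next
  case False
  hence t0: "0 < t" using t by simp
  define n where "n = (\<lambda>s. k (t - s) *\<^sub>R Bop (m s))"
  have n: "continuous_on {0..t} n"
    unfolding n_def by (rule bconv_integrable[OF kc cont_of(1)[OF Bop_bounded_linear]]) (use t in simp)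
  have bc: "bcontinuous (L2 0 L) (L2_norm 0 L) 0 t (\<lambda>s. ap (n s))"
    by (rule L2sp.bcontinuous_of_bounded[OF ap_L2 _ L2_norm_ap n]) (simp add: minus_bcontfun.rep_eq fun_eq_iff)
  have "has_bintegral (L2 0 L) (L2_norm 0 L) 0 t (\<lambda>s. ap (n s)) (ap (bconv k (\<lambda>s. Bop (m s)) t))"
  proof (rule L2sp.has_bintegralI[OF L2sp.bcontinuous_integrable(1,2)[OF bc t0] ap_L2])
    fix e assume e: "e \<in> L2 0 L"
    note P = L2_functional[OF e]
    have "(LINT s|leb 0 t. L2_ip 0 L (ap (n s)) e) = integral {0..t} (\<lambda>s. L2_ip 0 L (ap (n s)) e)"
      by (rule leb_eq_integral[OF leb_continuous_integrable[OF bounded_linear.continuous_on[OF P n]]])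
    also have "\<dots> = L2_ip 0 L (ap (integral {0..t} n)) e" by (rule bounded_linear_integral[OF P n, symmetric])
    finally show "(LINT s|leb 0 t. L2_ip 0 L (ap (n s)) e) = L2_ip 0 L (ap (bconv k (\<lambda>s. Bop (m s)) t)) e"
      unfolding bconv_def n_def .
  qed
  thus ?thesis
  proof (rule L2sp.has_bintegral_cong_AE, intro AE_I2 conjI)
    fix s
    show "(\<lambda>x. k (t - s) * wderiv 0 L 2 (v s) x) \<in> L2 0 L" by (rule L2sp.scale_mem[OF X_wderiv_L2[OF mem(1)]]) simp
    have "AE x in leb 0 L. ap (n s) x - k (t - s) * wderiv 0 L 2 (v s) x = 0"
      using XX.AE_interval by eventually_elim (simp add: n_def v_def Bop_apply)
    from L2_norm_cong_AE[OF this] show "L2_norm 0 L (\<lambda>x. ap (n s) x - k (t - s) * wderiv 0 L 2 (v s) x) = 0"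
      using L2sp.N_zero by simp
  qed
qed

lemma bconv_minus: "bconv k (\<lambda>s. - g s) t = - bconv k g t"
  by (simp add: bconv_def)

lemma equation_of_motion:
  "AE t in leb 0 T. \<exists>J.
     has_bintegral (L2 0 L) (L2_norm 0 L) 0 t (\<lambda>s x. k (t - s) * wderiv 0 L 2 (v s) x) J \<and>
     (AE x in leb 0 L.
        bwderiv (X L) (X_norm L) 0 T 2 v t x - wderiv 0 L 2 (v t) x - \<beta> * wderiv 0 L 2 (bwderiv (X L) (X_norm L) 0 T 2 v t) x
          + k t * wderiv 0 L 2 u0 x + J x
        = wderiv 0 T 2 (\<lambda>t. p * wderiv 0 T 1 y0 t + q * y0 t) t * x / L)"
  using XX.bwderiv_top(3)[OF bweak_derivs(3) V2_bL2] z_wderiv XX.AE_interval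
proof eventually_elim
  case (elim t)
  hence t: "t \<in> {0..T}" by simp
  let ?B = "bwderiv (X L) (X_norm L) 0 T 2 v t" and ?J = "ap (bconv k (\<lambda>s. Bop (m s)) t)"
  have B: "AE x in leb 0 L. V2 t x = ?B x" using elim(1) by (intro X_AE_eq) auto
  have w: "AE x in leb 0 L. wderiv 0 L i (V2 t) x = 1 * wderiv 0 L i (jX (Rt t)) x + z2 t * wderiv 0 L i (jX cxL) x" if "i \<le> 2" for i
    unfolding V2_def by (rule wderiv_linear_AE[OF X_D(1)[OF jX_X(1)] X_D(1)[OF jX_X(1)] that])
  have "AE x in leb 0 L. ?B x - wderiv 0 L 2 (v t) x - \<beta> * wderiv 0 L 2 ?B x + k t * u02 x + ?J x = z2 t * x / L"
    using B w[of 0, simplified] w[of 2, simplified] crep_AE[OF X_D(1)[OF mem(3)[of t]]] XX.AE_interval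
  proof eventually_elim
    case (elim x)
    hence x: "x \<in> {0..L}" by simp
    have "?B x - \<beta> * wderiv 0 L 2 ?B x = E (jX (Rt t)) x + z2 t * E (jX cxL) x"
      using elim(1-4) unfolding wderiv_cong_AE[OF B, symmetric] E_def by (simp add: algebra_simps)
    also have "\<dots> = ap (Rt t) x + z2 t * (x / L)" using jX_X(4)[OF x] ext_data(2)[OF x] by (simp add: xL_def)
    also have "ap (Rt t) x = wderiv 0 L 2 (v t) x - k t * u02 x - ?J x"
      unfolding Rt_def bconv_minus using ext_data(1)[OF x] Bop_apply[OF x, of "m t"]
      by (simp add: v_def plus_bcontfun.rep_eq minus_bcontfun.rep_eq)
    finally show ?case by (simp add: algebra_simps)
  qed
  thus ?case unfolding elim(2) using memory_bintegral[OF t] by blast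
qed

text \<open>The condition and its first time derivative hold at \<open>t = 0\<close> by the choice of the initial values of z and \<open>z'\<close>.
  Its second time derivative is the equation for k, since \<open>- \<Lambda>\<close> tests \<open>v - \<beta> v''\<close> with \<open>\<phi>'\<close>.\<close>

lemma overdetermination:
  assumes t: "t \<in> {0..T}"
  shows "\<Lambda> (v t) - z0 t * \<psi>L / L = fd 1 t"
proof -
  define P where "P = (\<lambda>n. L2_ip 0 L (ap n) \<phi>1)"
  have \<phi>1: "\<phi>1 \<in> L2 0 L" by (rule \<phi>_L2) simp
  have P: "bounded_linear P" unfolding P_def by (rule L2_functional[OF \<phi>1])
  have P\<Lambda>: "\<Lambda> (jX n) = - P n" for n
  proof -
    have "P n = L2_ip 0 L (E (jX n)) \<phi>1"
      unfolding P_def L2_ip_def by (rule Bochner_Integration.integral_cong) (auto simp: jX_X(4))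
    thus ?thesis using ell_\<phi>1[OF jX_X(1)[of n]] ell_E[OF jX_X(1)[of n] \<phi>1] by simp
  qed
  have Px: "P cxL = - \<psi>L / L" and Pu: "P cu02 = \<gamma>"
    unfolding xL_\<phi>1[symmetric] P_def \<gamma>_def L2_ip_def by (rule Bochner_Integration.integral_cong; auto simp: ext_data)+
  have PB: "P (Bop n) = \<gamma>f n" for n unfolding P_def \<gamma>f_def by (rule L2_ip_Bop[symmetric])
  have PR: "P (Rt s) = - fd 3 s" if s: "s \<in> {0..T}" for s
  proof -
    note l = bounded_linear.linear[OF P]
    have "P (bconv k (\<lambda>s. Bop (m s)) s) = conv k (\<lambda>s. \<gamma>f (m s)) s"
      using bounded_linear_bconv[OF P kc cont_of(1)[OF Bop_bounded_linear] s] bconv_real[OF kc cont_of(1)[OF \<gamma>f_bl] s]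
      unfolding PB by simp
    hence "P (Rt s) = \<gamma>f (m s) - k s * \<gamma> - conv k (\<lambda>s. \<gamma>f (m s)) s"
      unfolding Rt_def bconv_minus by (simp add: linear_add[OF l] linear_diff[OF l] linear_scale[OF l] linear_neg[OF l] PB Pu)
    thus ?thesis using k_closed[OF s] by (simp add: mult.commute)
  qed
  have fp: "primitive_on 0 T (fd 1) (fd 2)" "primitive_on 0 T (fd 2) (fd 3)"
    using fd_prim[of 1] fd_prim[of 2] by (simp_all add: numeral_2_eq_2 numeral_3_eq_3)
  have \<Lambda>0: "\<Lambda> (v 0) = \<Lambda> w0" "\<Lambda> (V1 0) = \<Lambda> w1"
    unfolding v_def V1_def initial_values
    by (rule XX.N_zero_bfunctional[OF \<Lambda>_bfunctional jX_X(1) v0 jX_w0], rule XX.N_zero_bfunctional[OF \<Lambda>_bfunctional jX_X(1) v1 jX_w1])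
  have eq1: "\<Lambda> (V1 s) - z1 s * \<psi>L / L = fd 2 s" if s: "s \<in> {0..T}" for s
  proof (rule primitive_on_eq[OF _ fp(2) _ _ s])
    have "primitive_on 0 T (\<lambda>t. (- 1) * (P (M t) - z1 t * P cxL) + 0 * z1 t) (\<lambda>t. (- 1) * P (Rt t) + 0 * z2 t)"
      by (intro primitive_on_linear M_functional P z1_prim)
    thus "primitive_on 0 T (\<lambda>s. \<Lambda> (V1 s) - z1 s * \<psi>L / L) (\<lambda>t. (- 1) * P (Rt t) + 0 * z2 t)"
      by (rule primitive_on_cong) (use pos(2) in \<open>auto simp: V1_def P\<Lambda> Px\<close>)
    show "AE t in leb 0 T. (- 1) * P (Rt t) + 0 * z2 t = fd 3 t" using XX.AE_interval by eventually_elim (simp add: PR)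
    show "\<Lambda> (V1 0) - z1 0 * \<psi>L / L = fd 2 0"
      unfolding \<Lambda>0 initial_values z1_init_def using pos(1) \<psi>L_eq(2) by (simp add: field_simps)
  qed
  show ?thesis
  proof (rule primitive_on_eq[OF _ fp(1) _ _ t])
    have "primitive_on 0 T (\<lambda>t. (- 1) * P (m t) + (- \<psi>L / L) * z0 t) (\<lambda>t. (- 1) * P (M t) + (- \<psi>L / L) * z1 t)"
      by (intro primitive_on_linear m_functional P z0_prim)
    thus "primitive_on 0 T (\<lambda>s. \<Lambda> (v s) - z0 s * \<psi>L / L) (\<lambda>t. (- 1) * P (M t) + (- \<psi>L / L) * z1 t)"
      by (rule primitive_on_cong) (use pos(2) in \<open>auto simp: v_def P\<Lambda>\<close>)
    show "AE t in leb 0 T. (- 1) * P (M t) + (- \<psi>L / L) * z1 t = fd 2 t"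
      using XX.AE_interval
    proof eventually_elim
      case (elim s)
      thus ?case using eq1[of s] by (simp add: V1_def P\<Lambda> mult.commute)
    qed
    show "\<Lambda> (v 0) - z0 0 * \<psi>L / L = fd 1 0"
      unfolding \<Lambda>0 initial_values z0_init_def using pos(1) \<psi>L_eq(2) by (simp add: field_simps)
  qed
qed

lemma solves_IP: "IP L T \<beta> p q \<phi> f u0 w0 w1 k0 ytt0 v k y0"
proof -
  have z: "p * wderiv 0 T 1 y0 t + q * y0 t = z0 t" if "t \<in> {0..T}" for t using y_sobolev(2)[OF that] by (simp add: z0_def)
  have bd: "AE t in leb 0 T. crep 0 L (v t) 0 = 0 \<and> crep 0 L (v t) L = 0" using X_D(2,3)[OF mem(1)] by simp
  have bc: "AE t in leb 0 T. wderiv 0 L 1 (v t) L - (LINT s|leb 0 t. k (t - s) * wderiv 0 L 1 (v s) L)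
      = wderiv 0 T 2 y0 t + k t * wderiv 0 L 1 u0 L
        + 1 / L * ((p * wderiv 0 T 1 y0 t + q * y0 t) - (LINT s|leb 0 t. k (t - s) * (p * wderiv 0 T 1 y0 s + q * y0 s)))"
    using XX.AE_interval
  proof eventually_elim
    case (elim t)
    hence t: "t \<in> {0..T}" by simp
    have "(LINT s|leb 0 t. k (t - s) * (p * wderiv 0 T 1 y0 s + q * y0 s)) = conv k z0 t"
      unfolding conv_def by (rule Bochner_Integration.integral_cong) (use z t in auto)
    thus ?case using boundary_closed[OF t] unfolding z[OF t] y_sobolev(3)[OF t] by (simp add: \<delta>f_def v_def conv_def)
  qed
  have od: "AE t in leb 0 T. (LINT x|leb 0 L. (\<phi> x - \<beta> * wderiv 0 L 2 \<phi> x) * (wderiv 0 L 1 (v t) x - (p * wderiv 0 T 1 y0 t + q * y0 t) / L)) = wderiv 0 T 1 f t"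
    using XX.AE_interval
  proof eventually_elim
    case (elim t)
    hence t: "t \<in> {0..T}" by simp
    show ?case unfolding z[OF t] overdetermination_functional[OF mem(1)] by (rule overdetermination[OF t])
  qed
  show ?thesis
    unfolding IP_def Let_def
    using v_bsobolev k_sobolev(1) y_sobolev(1) k_sobolev(2)[OF z0T] y_sobolev(3)[OF z0T] initial_values(4,5)
      equation_of_motion bd initial_conditions bc od by simp
qed
end

lemma (in inverse_data) IP_exists: "\<exists>v k y. IP L T \<beta> p q \<phi> f u0 w0 w1 k0 ytt0 v k y"
proof -
  obtain m M k y2 y1 y0 where S: "continuous_on {0..T} m" "continuous_on {0..T} M" "continuous_on {0..T} k"
      "continuous_on {0..T} y2" "continuous_on {0..T} y1" "continuous_on {0..T} y0"
    "\<And>t. t \<in> {0..T} \<Longrightarrow> m t = cm0 + integral {0..t} M"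
    "\<And>t. t \<in> {0..T} \<Longrightarrow> y1 t = y10 + integral {0..t} y2"
    "\<And>t. t \<in> {0..T} \<Longrightarrow> y0 t = y00 + integral {0..t} y1"
    "\<And>t. t \<in> {0..T} \<Longrightarrow> k t = ck t + integral {0..t} (\<lambda>s. (\<gamma>f (M s) - \<gamma>f cm0 * k s) / \<gamma> + bconv k (\<lambda>s. - \<gamma>f (M s) / \<gamma>) s)"
    "\<And>t. t \<in> {0..T} \<Longrightarrow> y2 t + D u0 * k t = \<delta>f cm0 - z0_init / L +
        integral {0..t} (\<lambda>s. \<delta>f (M s) - \<delta>f cm0 * k s - ((p * y2 s + q * y1 s) - z0_init * k s) / L
           + bconv k (\<lambda>s. - \<delta>f (M s) + (p * y2 s + q * y1 s) / L) s)"
    "\<And>t. t \<in> {0..T} \<Longrightarrow> M t - (p * y2 t + q * y1 t) *\<^sub>R cxL =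
        cu02 + integral {0..t} (\<lambda>s. Bop (m s) - k s *\<^sub>R cu02 + bconv k (\<lambda>s. - Bop (m s)) s)"
    using Volterra_system by blast
  interpret Volterra_solution L T \<beta> p q u0 u1 u2 \<phi> f m M k y2 y1 y0
    by unfold_locales (rule S; assumption)+
  show ?thesis using solves_IP by blast
qed

theorem theorem4p3:
  fixes L T \<beta> p q :: real
    and u0 u1 u2 w \<phi> f :: "real \<Rightarrow> real"
  assumes "L > 0" and "T > 0" and "\<beta> > 0" and "p > 0" and "q > 0"
    and i1: "u0 \<in> sobolev 4 0 L" "u1 \<in> sobolev 4 0 L" "\<phi> \<in> sobolev0 3 0 L"
    and i2: "u2 \<in> sobolev 2 0 L"
            "AE x in leb 0 L. u2 x - \<beta> * wderiv 0 L 2 u2 x = wderiv 0 L 2 u0 x"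
            "lift L u1 \<in> X L" "lift L u2 \<in> X L"
    and i3: "(LINT x|leb 0 L. wderiv 0 L 1 \<phi> x * wderiv 0 L 2 u0 x) \<noteq> 0"
    and i4: "f \<in> sobolev 4 0 T"
            "(LINT x|leb 0 L. (\<phi> x - \<beta> * wderiv 0 L 2 \<phi> x) * wderiv 0 L 1 u0 x) = crep 0 T f 0"
            "(LINT x|leb 0 L. (\<phi> x - \<beta> * wderiv 0 L 2 \<phi> x) * wderiv 0 L 1 u1 x) = wderiv 0 T 1 f 0"
            "(LINT x|leb 0 L. (\<phi> x - \<beta> * wderiv 0 L 2 \<phi> x) * wderiv 0 L 1 u2 x) = wderiv 0 T 2 f 0"
            "w \<in> sobolev 2 0 L"
            "AE x in leb 0 L. w x - \<beta> * wderiv 0 L 2 w x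
               = wderiv 0 L 3 u1 x - k_init L T \<phi> f u0 u1 * wderiv 0 L 3 u0 x"
            "(LINT x|leb 0 L. (\<phi> x - \<beta> * wderiv 0 L 2 \<phi> x) * w x) = wderiv 0 T 3 f 0"
    and i5: "\<psi> L \<beta> \<phi> L \<noteq> 0"
  defines "solution \<equiv> \<lambda>v k. \<exists>y.
             IP L T \<beta> p q \<phi> f u0 (lift L u1) (lift L u2)
                (k_init L T \<phi> f u0 u1) (ytt_init L T \<beta> \<phi> f u0 u1) v k y"
  shows "\<exists>v k. solution v k \<and>
           (\<forall>v' k'. solution v' k' \<longrightarrow>
              (AE t in leb 0 T. AE x in leb 0 L. v' t x = v t x) \<and>
              (AE t in leb 0 T. k' t = k t))"
proof -
  interpret inverse_data L T \<beta> p q u0 u1 u2 \<phi> f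
    by unfold_locales (rule assms)+
  obtain v k y where IP: "IP L T \<beta> p q \<phi> f u0 (lift L u1) (lift L u2) (k_init L T \<phi> f u0 u1) (ytt_init L T \<beta> \<phi> f u0 u1) v k y"
    using IP_exists by blast
  have sol: "solution v k" unfolding solution_def using IP by blast
  have uniq: "(AE t in leb 0 T. AE x in leb 0 L. v' t x = v t x) \<and> (AE t in leb 0 T. k' t = k t)" if sol': "solution v' k'" for v' k'
  proof -
    obtain y' where IP': "IP L T \<beta> p q \<phi> f u0 (lift L u1) (lift L u2) (k_init L T \<phi> f u0 u1) (ytt_init L T \<beta> \<phi> f u0 u1) v' k' y'"
      using sol' unfolding solution_def by blast
    show ?thesis using IP_unique[OF IP IP'] by blast
  qed
  show ?thesis using sol uniq by blast
qed

end
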